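(* Let $\mathfrak{A},\mathfrak{B}$ be $\mathbf{Gray}$-categories and let $F,G:\mathfrak{A}\to\mathfrak{B}$ be $\mathbf{Gray}$-functors. (1) There is a bijection $p\mapsto p'$ between the set of trinatural transformations $p:F\to G$ and the set of $3$-pseudofunctors $p':\mathfrak{A}\rightsquigarrow[\mathbf{2},\mathfrak{B}]$ satisfying $s_0p'=F$ and $t_0p'=G$. Moreover, this restricts to a bijection between semi-strict trinatural transformations and $\mathbf{Gray}$-functors. (2) Let $p,q:F\to G$ be trinatural transformations and let $p',q':\mathfrak{A}\rightsquigarrow[\mathbf{2},\mathfrak{B}]$ be the $3$-pseudofunctors corresponding to them under (1). There is a bijection between the set of trimodificational adjoint equivalences $\sigma:p\Rightarrow q$ and the set of $3$-pseudonatural transformations $\sigma':p'\Rightarrow q'$ satisfying $s_0.\sigma'=1_F$ and $t_0.\sigma'=1_G$.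
   Context: CONVENTIONS. A $\mathbf{Gray}$-category is a category enriched in $2$-categories with the (pseudo) Gray tensor product $\otimes$. We write $.$ (or juxtaposition) for composition and whiskering along objects, $\circ$ for composition of $2$-cells in hom-$2$-categories, $\cdot$ for vertical composition of $3$-cells; whiskering of a $3$-cell $\Gamma$ with a $2$-cell $\phi$ is written $\Gamma\circ\phi$ or $\phi\circ\Gamma$, and the name of a cell also denotes its identity. For $\alpha:f\Rightarrow f':X\to Y$ and $\beta:g\Rightarrow g':Y\to Z$ the interchanger is the invertible $3$-cell $\beta_\alpha:(g'.\alpha)\circ(\beta.f)\Rrightarrow(\beta.f')\circ(g.\alpha)$. TRINATURAL TRANSFORMATIONS. A trinatural transformation $p:F\to G$ between $\mathbf{Gray}$-functors consists of: $1$-cells $p_X:FX\to GX$; for each $f:X\to Y$ an adjoint equivalence $p_f\dashv p_f^*$ in $\mathfrak{B}(FX,GY)$ with $p_f:p_Y.Ff\Rightarrow Gf.p_X$; for each $\phi:f\Rightarrow g$ an invertible $3$-cell $p_\phi:p_g\circ(p_Y.F\phi)\Rrightarrow(G\phi.p_X)\circ p_f$; unitors: invertible $3$-cells $p^X:1_{p_X}\Rrightarrow p_{1_X}$; compositors: for $X\xrightarrow{f}Y\xrightarrow{g}Z$ invertible $3$-cells $p_{g,f}:(Gg.p_f)\circ(p_g.Ff)\Rrightarrow p_{gf}$. Axioms: local pseudonaturality: $p_{1_f}=1_{p_f}$; $p_{\psi\phi}=((G\psi.p_X)\circ p_\phi)\cdot(p_\psi\circ(p_Y.F\phi))$; $((G\Omega.p_X)\circ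 p_f)\cdot p_\phi=p_{\phi'}\cdot(p_g\circ(p_Y.F\Omega))$ for $\Omega:\phi\Rrightarrow\phi'$; right whiskering law for $\phi:f\Rightarrow f'$: $p_{g\phi}\cdot(p_{g,f'}\circ(p_Z.Fg.F\phi))=((Gg.G\phi.p_X)\circ p_{g,f})\cdot((Gg.p_\phi)\circ(p_g.Ff))\cdot((Gg.p_{f'})\circ(p_g)_{F\phi}^{-1})$; left whiskering law for $\psi:g\Rightarrow g'$: $p_{\psi f}\cdot(p_{g',f}\circ(p_Z.F\psi.Ff))=((G\psi.Gf.p_X)\circ p_{g,f})\cdot((G\psi)_{p_f}\circ(p_g.Ff))\cdot((Gg'.p_f)\circ(p_\psi.Ff))$; associativity: $p_{g,fe}\cdot((Gg.p_{f,e})\circ(p_g.Ff.Fe))=p_{gf,e}\cdot((Gg.Gf.p_e)\circ(p_{g,f}.Fe))$; unit laws: $p_{f,1_X}\cdot((Gf.p^X)\circ p_f)=1_{p_f}=p_{1_Y,f}\cdot(p_f\circ(p^Y.Ff))$. $p$ is semi-strict if all unitors and compositors are identities; this is understood to mean that the adjoint equivalence at $1_X$ is the identity and the one at $gf$ is the composite of those at $g$ and $f$. TRIMODIFICATIONS. A trimodification $\sigma:p\Rightarrow q$ consists of $2$-cells $\sigma_X:p_X\Rightarrow q_X$ and invertible $3$-cells $\sigma_f:(Gf.\sigma_X)\circ p_f\Rrightarrow q_f\circ(\sigma_Y.Ff)$ such that: (for $\phi:f\Rightarrow g$) $(q_\phi\circ(\sigma_Y.Ff))\cdot(q_g\circ(\sigma_Y)_{F\phi}^{-1})\cdot(\sigma_g\circ(p_Y.F\phi))=((G\phi.q_X)\circ\sigma_f)\cdot((G\phi)_{\sigma_X}\circ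 p_f)\cdot((Gg.\sigma_X)\circ p_\phi)$; $\sigma_{1_X}\cdot(\sigma_X\circ p^X)=q^X\circ\sigma_X$; $\sigma_{gf}\cdot((Gg.Gf.\sigma_X)\circ p_{g,f})=(q_{g,f}\circ(\sigma_Z.Fg.Ff))\cdot((Gg.q_f)\circ(\sigma_g.Ff))\cdot((Gg.\sigma_f)\circ(p_g.Ff))$. A perturbation $\Omega:\sigma\Rrightarrow\tau$ consists of $3$-cells $\Omega_X:\sigma_X\Rrightarrow\tau_X$ with $\tau_f\cdot((Gf.\Omega_X)\circ p_f)=(q_f\circ(\Omega_Y.Ff))\cdot\sigma_f$. A trimodificational adjoint equivalence $\sigma:p\Rightarrow q$ is an adjoint equivalence, with left adjoint $\sigma$, in the $2$-category of trinatural transformations $F\to G$, trimodifications and perturbations; equivalently, a trimodification $\sigma$ with a specified adjoint equivalence $\sigma_X\dashv\sigma_X^*$ for each $X$. $3$-PSEUDOFUNCTORS AND $3$-PSEUDONATURAL TRANSFORMATIONS. A $3$-pseudofunctor $H:\mathfrak{A}\rightsquigarrow\mathfrak{C}$ between $\mathbf{Gray}$-categories is a trihomomorphism whose actions $H_{X,Y}$ on homs are $2$-functors, whose unitors $\iota_X:1_{HX}\Rightarrow H1_X$ and compositors $\chi_{g,f}:Hg.Hf\Rightarrow H(gf)$ are invertible $2$-natural transformations ($\chi$ being $2$-natural between $2$-functors $\mathfrak{A}(Y,Z)\otimes\mathfrak{A}(X,Y)\to\mathfrak{C}(HX,HZ)$), and whose modifications $\gamma,\delta,\omega$ are identities, i.e.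 $\chi_{1_Y,f}\circ(\iota_Y.Hf)=1$, $\chi_{f,1_X}\circ(Hf.\iota_X)=1$, $\chi_{hg,f}\circ(\chi_{h,g}.Hf)=\chi_{h,gf}\circ(Hh.\chi_{g,f})$. A $3$-pseudonatural transformation $\theta:H\Rightarrow K$ is a trinatural transformation that is semi-strict (identity unitors and compositors) and locally strict (each $(f,\phi)\mapsto(\theta_f,\theta_\phi)$ is a $2$-natural isomorphism); that is, $1$-cells $\theta_X:HX\to KX$ and invertible $2$-cells $\theta_f:\theta_Y.Hf\Rightarrow Kf.\theta_X$, $2$-natural in $f\in\mathfrak{A}(X,Y)$, with $\theta_{1_X}\circ(\theta_X.\iota^H_X)=\iota^K_X.\theta_X$ and $\theta_{gf}\circ(\theta_Z.\chi^H_{g,f})=(\chi^K_{g,f}.\theta_X)\circ(Kg.\theta_f)\circ(\theta_g.Hf)$. PATH OBJECT. $[\mathbf{2},\mathfrak{B}]$ (also written $[\mathfrak{P}_1,\mathfrak{B}]$, with $\mathbf{2}=\mathfrak{P}_1$ the free-living $1$-cell) is the $\mathbf{Gray}$-category with: objects $(x,X_0,X_1)$ given by $1$-cells $x:X_0\to X_1$ of $\mathfrak{B}$; morphisms $(f\dashv f^*,f_0,f_1):(x,X_0,X_1)\to(y,Y_0,Y_1)$ consisting of $f_i:X_i\to Y_i$ and an adjoint equivalence $f\dashv f^*$ in $\mathfrak{B}(X_0,Y_1)$ with $f:y.f_0\Rightarrow f_1.x$; $2$-cells $(\phi,\phi_0,\phi_1)$ from it to $(g\dashv g^*,g_0,g_1)$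 consisting of $\phi_i:f_i\Rightarrow g_i$ and an invertible $3$-cell $\phi:g\circ(y.\phi_0)\Rrightarrow(\phi_1.x)\circ f$; $3$-cells $(\Gamma_0,\Gamma_1)$ to $(\psi,\psi_0,\psi_1)$ consisting of $\Gamma_i:\phi_i\Rrightarrow\psi_i$ with $\psi\cdot(g\circ(y.\Gamma_0))=((\Gamma_1.x)\circ f)\cdot\phi$. The composite of $f$ with $f':(y,Y_0,Y_1)\to(z,Z_0,Z_1)$ has left adjoint $(f_1'.f)\circ(f'.f_0)$ and the composite adjoint equivalence; the remaining structure is given by pasting in $\mathfrak{B}$ (using interchangers of $\mathfrak{B}$ where needed) and componentwise, as for semi-strict trinatural transformations, trimodifications and perturbations. The $\mathbf{Gray}$-functors $s_0,t_0:[\mathbf{2},\mathfrak{B}]\to\mathfrak{B}$ take the components with index $0$ and $1$ respectively. *)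

theory Defs
  imports Main "HOL-Library.FuncSet"
begin

section \<open>2-categories, 2-functors, adjoint equivalences\<close>

text \<open>
  Operations are only meaningful on the carriers and on composable arguments.
  Horizontal composition of 2-cells is written \<open>\<star>\<close>, vertical composition \<open>\<bullet>\<close>, and
  \<open>\<langle>f\<rangle>\<close> is the identity 2-cell of \<open>f\<close>; whiskering \<open>x\<close> with \<open>f\<close> is thus \<open>x \<star> \<langle>f\<rangle>\<close> or \<open>\<langle>f\<rangle> \<star> x\<close>.
\<close>

record ('a, 'b, 'c) twocat =
  ob :: "'a set"
  mor :: "'b set"
  cel :: "'c set"
  dm :: "'b \<Rightarrow> 'a"
  cd :: "'b \<Rightarrow> 'a"
  sr :: "'c \<Rightarrow> 'b"
  tg :: "'c \<Rightarrow> 'b"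
  idn :: "'a \<Rightarrow> 'b"
  idc :: "'b \<Rightarrow> 'c"  ("\<langle>_\<rangle>\<index>")
  cmp :: "'b \<Rightarrow> 'b \<Rightarrow> 'b"  (infixl "\<odot>\<index>" 70)
  hcmp :: "'c \<Rightarrow> 'c \<Rightarrow> 'c"  (infixl "\<star>\<index>" 70)
  vcmp :: "'c \<Rightarrow> 'c \<Rightarrow> 'c"  (infixl "\<bullet>\<index>" 65)

definition mors :: "('a, 'b, 'c, 'z) twocat_scheme \<Rightarrow> 'a \<Rightarrow> 'a \<Rightarrow> 'b set" where
  "mors C a b = {f \<in> mor C. dm C f = a \<and> cd C f = b}"

definition cels :: "('a, 'b, 'c, 'z) twocat_scheme \<Rightarrow> 'b \<Rightarrow> 'b \<Rightarrow> 'c set" where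
  "cels C f g = {x \<in> cel C. sr C x = f \<and> tg C x = g}"

locale two_category =
  fixes C :: "('a, 'b, 'c, 'z) twocat_scheme" (structure)
  assumes dm_cd: "f \<in> mor C \<Longrightarrow> dm C f \<in> ob C \<and> cd C f \<in> ob C"
    and sr_tg: "x \<in> cel C \<Longrightarrow> sr C x \<in> mor C \<and> tg C x \<in> mor C"
    and globular: "x \<in> cel C \<Longrightarrow> dm C (sr C x) = dm C (tg C x) \<and> cd C (sr C x) = cd C (tg C x)"
    and idn_in: "a \<in> ob C \<Longrightarrow> idn C a \<in> mors C a a"
    and cmp_in: "f \<in> mors C a b \<Longrightarrow> g \<in> mors C b c \<Longrightarrow> g \<odot> f \<in> mors C a c"
    and cmp_assoc: "f \<in> mors C a b \<Longrightarrow> g \<in> mors C b c \<Longrightarrow> h \<in> mors C c d \<Longrightarrow>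
      (h \<odot> g) \<odot> f = h \<odot> (g \<odot> f)"
    and cmp_idn: "f \<in> mors C a b \<Longrightarrow> f \<odot> idn C a = f \<and> idn C b \<odot> f = f"
    and idc_in: "f \<in> mor C \<Longrightarrow> \<langle>f\<rangle> \<in> cels C f f"
    and vcmp_in: "x \<in> cels C f g \<Longrightarrow> y \<in> cels C g h \<Longrightarrow> y \<bullet> x \<in> cels C f h"
    and vcmp_assoc: "x \<in> cels C f g \<Longrightarrow> y \<in> cels C g h \<Longrightarrow> z \<in> cels C h k \<Longrightarrow>
      (z \<bullet> y) \<bullet> x = z \<bullet> (y \<bullet> x)"
    and vcmp_idc: "x \<in> cels C f g \<Longrightarrow> x \<bullet> \<langle>f\<rangle> = x \<and> \<langle>g\<rangle> \<bullet> x = x"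
    and hcmp_in: "x \<in> cels C f f' \<Longrightarrow> y \<in> cels C g g' \<Longrightarrow> cd C f = dm C g \<Longrightarrow>
      y \<star> x \<in> cels C (g \<odot> f) (g' \<odot> f')"
    and hcmp_assoc: "x \<in> cels C f f' \<Longrightarrow> y \<in> cels C g g' \<Longrightarrow> z \<in> cels C h h' \<Longrightarrow>
      cd C f = dm C g \<Longrightarrow> cd C g = dm C h \<Longrightarrow> (z \<star> y) \<star> x = z \<star> (y \<star> x)"
    and hcmp_idn: "x \<in> cels C f g \<Longrightarrow>
      x \<star> \<langle>idn C (dm C f)\<rangle> = x \<and> \<langle>idn C (cd C f)\<rangle> \<star> x = x"
    and hcmp_idc: "f \<in> mors C a b \<Longrightarrow> g \<in> mors C b c \<Longrightarrow> \<langle>g\<rangle> \<star> \<langle>f\<rangle> = \<langle>g \<odot> f\<rangle>"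
    and interchange: "x \<in> cels C f f' \<Longrightarrow> x' \<in> cels C f' f'' \<Longrightarrow>
      y \<in> cels C g g' \<Longrightarrow> y' \<in> cels C g' g'' \<Longrightarrow> cd C f = dm C g \<Longrightarrow>
      (y' \<bullet> y) \<star> (x' \<bullet> x) = (y' \<star> x') \<bullet> (y \<star> x)"

locale two_functor =
  fixes C :: "('a, 'b, 'c, 'z) twocat_scheme" and D :: "('p, 'q, 'r, 'w) twocat_scheme"
    and m0 :: "'a \<Rightarrow> 'p" and m1 :: "'b \<Rightarrow> 'q" and m2 :: "'c \<Rightarrow> 'r"
  assumes m0_in: "a \<in> ob C \<Longrightarrow> m0 a \<in> ob D"
    and m1_in: "f \<in> mors C a b \<Longrightarrow> m1 f \<in> mors D (m0 a) (m0 b)"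
    and m2_in: "x \<in> cels C f g \<Longrightarrow> m2 x \<in> cels D (m1 f) (m1 g)"
    and m_idn: "a \<in> ob C \<Longrightarrow> m1 (idn C a) = idn D (m0 a)"
    and m_cmp: "f \<in> mors C a b \<Longrightarrow> g \<in> mors C b c \<Longrightarrow> m1 (g \<odot>\<^bsub>C\<^esub> f) = m1 g \<odot>\<^bsub>D\<^esub> m1 f"
    and m_idc: "f \<in> mor C \<Longrightarrow> m2 (idc C f) = idc D (m1 f)"
    and m_vcmp: "x \<in> cels C f g \<Longrightarrow> y \<in> cels C g h \<Longrightarrow> m2 (y \<bullet>\<^bsub>C\<^esub> x) = m2 y \<bullet>\<^bsub>D\<^esub> m2 x"
    and m_hcmp: "x \<in> cels C f f' \<Longrightarrow> y \<in> cels C g g' \<Longrightarrow> cd C f = dm C g \<Longrightarrow>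
      m2 (y \<star>\<^bsub>C\<^esub> x) = m2 y \<star>\<^bsub>D\<^esub> m2 x"

definition inverse_cells :: "('a, 'b, 'c, 'z) twocat_scheme \<Rightarrow> 'c \<Rightarrow> 'c \<Rightarrow> bool" where
  "inverse_cells C x y \<longleftrightarrow> y \<in> cels C (tg C x) (sr C x) \<and>
     y \<bullet>\<^bsub>C\<^esub> x = idc C (sr C x) \<and> x \<bullet>\<^bsub>C\<^esub> y = idc C (tg C x)"

text \<open>Invertible 2-cells, their inverses, and (strictly) invertible 1-cells.\<close>

definition icels :: "('a, 'b, 'c, 'z) twocat_scheme \<Rightarrow> 'b \<Rightarrow> 'b \<Rightarrow> 'c set" where
  "icels C f g = {x \<in> cels C f g. \<exists>y. inverse_cells C x y}"

definition cinv :: "('a, 'b, 'c, 'z) twocat_scheme \<Rightarrow> 'c \<Rightarrow> 'c" where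
  "cinv C x = (THE y. inverse_cells C x y)"

definition imors :: "('a, 'b, 'c, 'z) twocat_scheme \<Rightarrow> 'a \<Rightarrow> 'a \<Rightarrow> 'b set" where
  "imors C a b = {f \<in> mors C a b. \<exists>g \<in> mors C b a. g \<odot>\<^bsub>C\<^esub> f = idn C a \<and> f \<odot>\<^bsub>C\<^esub> g = idn C b}"

record ('b, 'c) adjeq =
  ladj :: 'b
  radj :: 'b
  aunit :: 'c
  acounit :: 'c

definition adjoint_equivalence ::
    "('a, 'b, 'c, 'z) twocat_scheme \<Rightarrow> 'a \<Rightarrow> 'a \<Rightarrow> ('b, 'c) adjeq \<Rightarrow> bool" where
  "adjoint_equivalence C a b e \<longleftrightarrow>
     ladj e \<in> mors C a b \<and> radj e \<in> mors C b a \<and>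
     aunit e \<in> icels C (idn C a) (radj e \<odot>\<^bsub>C\<^esub> ladj e) \<and>
     acounit e \<in> icels C (ladj e \<odot>\<^bsub>C\<^esub> radj e) (idn C b) \<and>
     (acounit e \<star>\<^bsub>C\<^esub> idc C (ladj e)) \<bullet>\<^bsub>C\<^esub> (idc C (ladj e) \<star>\<^bsub>C\<^esub> aunit e) = idc C (ladj e) \<and>
     (idc C (radj e) \<star>\<^bsub>C\<^esub> acounit e) \<bullet>\<^bsub>C\<^esub> (aunit e \<star>\<^bsub>C\<^esub> idc C (radj e)) = idc C (radj e)"

definition adj_id :: "('a, 'b, 'c, 'z) twocat_scheme \<Rightarrow> 'a \<Rightarrow> ('b, 'c) adjeq" where
  "adj_id C a = \<lparr>ladj = idn C a, radj = idn C a,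
     aunit = idc C (idn C a), acounit = idc C (idn C a)\<rparr>"

definition adj_comp ::
    "('a, 'b, 'c, 'z) twocat_scheme \<Rightarrow> ('b, 'c) adjeq \<Rightarrow> ('b, 'c) adjeq \<Rightarrow> ('b, 'c) adjeq" where
  "adj_comp C e' e =
    \<lparr>ladj = ladj e' \<odot>\<^bsub>C\<^esub> ladj e,
     radj = radj e \<odot>\<^bsub>C\<^esub> radj e',
     aunit = (idc C (radj e) \<star>\<^bsub>C\<^esub> aunit e' \<star>\<^bsub>C\<^esub> idc C (ladj e)) \<bullet>\<^bsub>C\<^esub> aunit e,
     acounit = acounit e' \<bullet>\<^bsub>C\<^esub> (idc C (ladj e') \<star>\<^bsub>C\<^esub> acounit e \<star>\<^bsub>C\<^esub> idc C (radj e'))\<rparr>"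

text \<open>Image of an adjoint equivalence under a 2-functor acting by \<open>m1\<close>, \<open>m2\<close>.\<close>

definition adj_map :: "('b \<Rightarrow> 'q) \<Rightarrow> ('c \<Rightarrow> 'r) \<Rightarrow> ('b, 'c) adjeq \<Rightarrow> ('q, 'r) adjeq" where
  "adj_map m1 m2 e = \<lparr>ladj = m1 (ladj e), radj = m1 (radj e),
     aunit = m2 (aunit e), acounit = m2 (acounit e)\<rparr>"


section \<open>Gray-categories and Gray-functors\<close>

text \<open>
  The hom-2-categories are stored as their disjoint union: the 1-, 2- and 3-cells of a
  Gray-category \<open>B\<close> are \<open>ob B\<close>, \<open>mor B\<close> and \<open>cel B\<close>, its objects are \<open>pt B\<close>, and
  \<open>s0\<close>, \<open>t0\<close> give the source and target object of a 1-cell. So \<open>\<odot>\<close>, \<open>\<star>\<close> are compositions along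
  1-cells, \<open>\<bullet>\<close> is composition along 2-cells, and \<open>\<langle>\<phi>\<rangle>\<close> is the identity 3-cell of the 2-cell \<open>\<phi>\<close>.
  Composition along objects is \<open>\<cdot>\<close> for 1-cells; \<open>\<rhd>\<close>, \<open>\<lhd>\<close> whisker 2-cells and \<open>\<unrhd>\<close>, \<open>\<unlhd>\<close> whisker
  3-cells by 1-cells. \<open>ich B \<beta> \<alpha>\<close> is the interchanger \<open>\<beta>\<^sub>\<alpha>\<close>.
\<close>

record ('a, 'b, 'c, 'o) gray = "('a, 'b, 'c) twocat" +
  pt :: "'o set"
  s0 :: "'a \<Rightarrow> 'o"
  t0 :: "'a \<Rightarrow> 'o"
  one :: "'o \<Rightarrow> 'a"
  comp1 :: "'a \<Rightarrow> 'a \<Rightarrow> 'a"  (infixl "\<cdot>\<index>" 80)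
  lw2 :: "'a \<Rightarrow> 'b \<Rightarrow> 'b"  (infix "\<rhd>\<index>" 75)
  rw2 :: "'b \<Rightarrow> 'a \<Rightarrow> 'b"  (infix "\<lhd>\<index>" 75)
  lw3 :: "'a \<Rightarrow> 'c \<Rightarrow> 'c"  (infix "\<unrhd>\<index>" 75)
  rw3 :: "'c \<Rightarrow> 'a \<Rightarrow> 'c"  (infix "\<unlhd>\<index>" 75)
  ich :: "'b \<Rightarrow> 'b \<Rightarrow> 'c"

definition hom :: "('a, 'b, 'c, 'o) gray \<Rightarrow> 'o \<Rightarrow> 'o \<Rightarrow> ('a, 'b, 'c) twocat" where
  "hom B X Y =
    \<lparr>ob = {f \<in> ob B. s0 B f = X \<and> t0 B f = Y},
     mor = {\<phi> \<in> mor B. s0 B (dm B \<phi>) = X \<and> t0 B (dm B \<phi>) = Y},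
     cel = {\<Gamma> \<in> cel B. s0 B (dm B (sr B \<Gamma>)) = X \<and> t0 B (dm B (sr B \<Gamma>)) = Y},
     dm = dm B, cd = cd B, sr = sr B, tg = tg B,
     idn = idn B, idc = idc B, cmp = cmp B, hcmp = hcmp B, vcmp = vcmp B\<rparr>"

abbreviation cells1 :: "('a, 'b, 'c, 'o) gray \<Rightarrow> 'o \<Rightarrow> 'o \<Rightarrow> 'a set" where
  "cells1 B X Y \<equiv> ob (hom B X Y)"

text \<open>
  Enrichment in 2-categories with the pseudo Gray tensor product, unravelled: a 2-functor on a
  Gray tensor product amounts to 2-functors in each variable separately together with
  invertible interchangers satisfying the laws below.
\<close>

locale gray_category =
  fixes B :: "('a, 'b, 'c, 'o) gray" (structure)
  assumes s0_t0: "f \<in> ob B \<Longrightarrow> s0 B f \<in> pt B \<and> t0 B f \<in> pt B"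
    and dm_ob: "\<phi> \<in> mor B \<Longrightarrow> dm B \<phi> \<in> ob B"
    and sr_mor: "\<Gamma> \<in> cel B \<Longrightarrow> sr B \<Gamma> \<in> mor B"
    and hom_two_category: "X \<in> pt B \<Longrightarrow> Y \<in> pt B \<Longrightarrow> two_category (hom B X Y)"
    and one_in: "X \<in> pt B \<Longrightarrow> one B X \<in> cells1 B X X"
    and lw_two_functor: "X \<in> pt B \<Longrightarrow> g \<in> cells1 B Y Z \<Longrightarrow>
      two_functor (hom B X Y) (hom B X Z) (\<lambda>f. g \<cdot> f) (\<lambda>\<phi>. g \<rhd> \<phi>) (\<lambda>\<Gamma>. g \<unrhd> \<Gamma>)"
    and rw_two_functor: "Z \<in> pt B \<Longrightarrow> f \<in> cells1 B X Y \<Longrightarrow>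
      two_functor (hom B Y Z) (hom B X Z) (\<lambda>g. g \<cdot> f) (\<lambda>\<psi>. \<psi> \<lhd> f) (\<lambda>\<Gamma>. \<Gamma> \<unlhd> f)"
    (* interchangers *)
    and ich_in: "\<alpha> \<in> mors (hom B X Y) f f' \<Longrightarrow> \<beta> \<in> mors (hom B Y Z) g g' \<Longrightarrow>
      ich B \<beta> \<alpha> \<in> icels (hom B X Z) ((g' \<rhd> \<alpha>) \<odot> (\<beta> \<lhd> f)) ((\<beta> \<lhd> f') \<odot> (g \<rhd> \<alpha>))"
    and ich_idn_left: "\<alpha> \<in> mors (hom B X Y) f f' \<Longrightarrow> g \<in> cells1 B Y Z \<Longrightarrow>
      ich B (idn B g) \<alpha> = \<langle>g \<rhd> \<alpha>\<rangle>"
    and ich_idn_right: "f \<in> cells1 B X Y \<Longrightarrow> \<beta> \<in> mors (hom B Y Z) g g' \<Longrightarrow>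
      ich B \<beta> (idn B f) = \<langle>\<beta> \<lhd> f\<rangle>"
    and ich_cmp_right: "\<alpha> \<in> mors (hom B X Y) f f' \<Longrightarrow> \<alpha>' \<in> mors (hom B X Y) f' f'' \<Longrightarrow>
      \<beta> \<in> mors (hom B Y Z) g g' \<Longrightarrow>
      ich B \<beta> (\<alpha>' \<odot> \<alpha>) = (ich B \<beta> \<alpha>' \<star> \<langle>g \<rhd> \<alpha>\<rangle>) \<bullet> (\<langle>g' \<rhd> \<alpha>'\<rangle> \<star> ich B \<beta> \<alpha>)"
    and ich_cmp_left: "\<alpha> \<in> mors (hom B X Y) f f' \<Longrightarrow>
      \<beta> \<in> mors (hom B Y Z) g g' \<Longrightarrow> \<beta>' \<in> mors (hom B Y Z) g' g'' \<Longrightarrow>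
      ich B (\<beta>' \<odot> \<beta>) \<alpha> = (\<langle>\<beta>' \<lhd> f'\<rangle> \<star> ich B \<beta> \<alpha>) \<bullet> (ich B \<beta>' \<alpha> \<star> \<langle>\<beta> \<lhd> f\<rangle>)"
    and ich_natural_right: "\<alpha> \<in> mors (hom B X Y) f f' \<Longrightarrow> \<Gamma> \<in> cels (hom B X Y) \<alpha> \<alpha>' \<Longrightarrow>
      \<beta> \<in> mors (hom B Y Z) g g' \<Longrightarrow>
      (\<langle>\<beta> \<lhd> f'\<rangle> \<star> (g \<unrhd> \<Gamma>)) \<bullet> ich B \<beta> \<alpha> = ich B \<beta> \<alpha>' \<bullet> ((g' \<unrhd> \<Gamma>) \<star> \<langle>\<beta> \<lhd> f\<rangle>)"
    and ich_natural_left: "\<alpha> \<in> mors (hom B X Y) f f' \<Longrightarrow>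
      \<beta> \<in> mors (hom B Y Z) g g' \<Longrightarrow> \<Gamma> \<in> cels (hom B Y Z) \<beta> \<beta>' \<Longrightarrow>
      ((\<Gamma> \<unlhd> f') \<star> \<langle>g \<rhd> \<alpha>\<rangle>) \<bullet> ich B \<beta> \<alpha> = ich B \<beta>' \<alpha> \<bullet> (\<langle>g' \<rhd> \<alpha>\<rangle> \<star> (\<Gamma> \<unlhd> f))"
    (* units *)
    and unit1: "f \<in> cells1 B X Y \<Longrightarrow> one B Y \<cdot> f = f \<and> f \<cdot> one B X = f"
    and unit2: "\<phi> \<in> mor (hom B X Y) \<Longrightarrow> one B Y \<rhd> \<phi> = \<phi> \<and> \<phi> \<lhd> one B X = \<phi>"
    and unit3: "\<Gamma> \<in> cel (hom B X Y) \<Longrightarrow> one B Y \<unrhd> \<Gamma> = \<Gamma> \<and> \<Gamma> \<unlhd> one B X = \<Gamma>"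
    (* associativity *)
    and assoc1: "f \<in> cells1 B W X \<Longrightarrow> g \<in> cells1 B X Y \<Longrightarrow> h \<in> cells1 B Y Z \<Longrightarrow>
      (h \<cdot> g) \<cdot> f = h \<cdot> (g \<cdot> f)"
    and assoc2_ll: "\<phi> \<in> mor (hom B W X) \<Longrightarrow> g \<in> cells1 B X Y \<Longrightarrow> h \<in> cells1 B Y Z \<Longrightarrow>
      (h \<cdot> g) \<rhd> \<phi> = h \<rhd> (g \<rhd> \<phi>)"
    and assoc2_lr: "f \<in> cells1 B W X \<Longrightarrow> \<phi> \<in> mor (hom B X Y) \<Longrightarrow> h \<in> cells1 B Y Z \<Longrightarrow>
      (h \<rhd> \<phi>) \<lhd> f = h \<rhd> (\<phi> \<lhd> f)"
    and assoc2_rr: "f \<in> cells1 B W X \<Longrightarrow> g \<in> cells1 B X Y \<Longrightarrow> \<phi> \<in> mor (hom B Y Z) \<Longrightarrow>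
      (\<phi> \<lhd> g) \<lhd> f = \<phi> \<lhd> (g \<cdot> f)"
    and assoc3_ll: "\<Gamma> \<in> cel (hom B W X) \<Longrightarrow> g \<in> cells1 B X Y \<Longrightarrow> h \<in> cells1 B Y Z \<Longrightarrow>
      (h \<cdot> g) \<unrhd> \<Gamma> = h \<unrhd> (g \<unrhd> \<Gamma>)"
    and assoc3_lr: "f \<in> cells1 B W X \<Longrightarrow> \<Gamma> \<in> cel (hom B X Y) \<Longrightarrow> h \<in> cells1 B Y Z \<Longrightarrow>
      (h \<unrhd> \<Gamma>) \<unlhd> f = h \<unrhd> (\<Gamma> \<unlhd> f)"
    and assoc3_rr: "f \<in> cells1 B W X \<Longrightarrow> g \<in> cells1 B X Y \<Longrightarrow> \<Gamma> \<in> cel (hom B Y Z) \<Longrightarrow>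
      (\<Gamma> \<unlhd> g) \<unlhd> f = \<Gamma> \<unlhd> (g \<cdot> f)"
    and ich_assoc_left: "\<alpha> \<in> mor (hom B W X) \<Longrightarrow> \<beta> \<in> mor (hom B X Y) \<Longrightarrow> h \<in> cells1 B Y Z \<Longrightarrow>
      ich B (h \<rhd> \<beta>) \<alpha> = h \<unrhd> ich B \<beta> \<alpha>"
    and ich_assoc_middle: "\<alpha> \<in> mor (hom B W X) \<Longrightarrow> g \<in> cells1 B X Y \<Longrightarrow> \<beta> \<in> mor (hom B Y Z) \<Longrightarrow>
      ich B (\<beta> \<lhd> g) \<alpha> = ich B \<beta> (g \<rhd> \<alpha>)"
    and ich_assoc_right: "f \<in> cells1 B W X \<Longrightarrow> \<alpha> \<in> mor (hom B X Y) \<Longrightarrow> \<beta> \<in> mor (hom B Y Z) \<Longrightarrow>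
      ich B \<beta> (\<alpha> \<lhd> f) = ich B \<beta> \<alpha> \<unlhd> f"

text \<open>
  Here and below, structure maps are extensional (\<open>undefined\<close> outside their domain), so that
  equality of records is equality of the functors or transformations they represent.
\<close>

record ('o, 'a, 'b, 'c, 'p, 'd, 'e, 'g) gmap =
  map0 :: "'o \<Rightarrow> 'p"
  map1 :: "'a \<Rightarrow> 'd"
  map2 :: "'b \<Rightarrow> 'e"
  map3 :: "'c \<Rightarrow> 'g"

locale gray_functor =
  fixes A :: "('a, 'b, 'c, 'o) gray" and B :: "('d, 'e, 'g, 'p) gray"
    and F :: "('o, 'a, 'b, 'c, 'p, 'd, 'e, 'g) gmap"
  assumes extensional: "map0 F \<in> extensional (pt A)" "map1 F \<in> extensional (ob A)"
      "map2 F \<in> extensional (mor A)" "map3 F \<in> extensional (cel A)"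
    and map0_in: "X \<in> pt A \<Longrightarrow> map0 F X \<in> pt B"
    and local_two_functor: "X \<in> pt A \<Longrightarrow> Y \<in> pt A \<Longrightarrow>
      two_functor (hom A X Y) (hom B (map0 F X) (map0 F Y)) (map1 F) (map2 F) (map3 F)"
    and map_one: "X \<in> pt A \<Longrightarrow> map1 F (one A X) = one B (map0 F X)"
    and map_comp1: "f \<in> cells1 A X Y \<Longrightarrow> g \<in> cells1 A Y Z \<Longrightarrow>
      map1 F (g \<cdot>\<^bsub>A\<^esub> f) = map1 F g \<cdot>\<^bsub>B\<^esub> map1 F f"
    and map_lw2: "\<phi> \<in> mor (hom A X Y) \<Longrightarrow> g \<in> cells1 A Y Z \<Longrightarrow>
      map2 F (g \<rhd>\<^bsub>A\<^esub> \<phi>) = map1 F g \<rhd>\<^bsub>B\<^esub> map2 F \<phi>"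
    and map_rw2: "f \<in> cells1 A X Y \<Longrightarrow> \<psi> \<in> mor (hom A Y Z) \<Longrightarrow>
      map2 F (\<psi> \<lhd>\<^bsub>A\<^esub> f) = map2 F \<psi> \<lhd>\<^bsub>B\<^esub> map1 F f"
    and map_lw3: "\<Gamma> \<in> cel (hom A X Y) \<Longrightarrow> g \<in> cells1 A Y Z \<Longrightarrow>
      map3 F (g \<unrhd>\<^bsub>A\<^esub> \<Gamma>) = map1 F g \<unrhd>\<^bsub>B\<^esub> map3 F \<Gamma>"
    and map_rw3: "f \<in> cells1 A X Y \<Longrightarrow> \<Gamma> \<in> cel (hom A Y Z) \<Longrightarrow>
      map3 F (\<Gamma> \<unlhd>\<^bsub>A\<^esub> f) = map3 F \<Gamma> \<unlhd>\<^bsub>B\<^esub> map1 F f"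
    and map_ich: "\<phi> \<in> mor (hom A X Y) \<Longrightarrow> \<psi> \<in> mor (hom A Y Z) \<Longrightarrow>
      map3 F (ich A \<psi> \<phi>) = ich B (map2 F \<psi>) (map2 F \<phi>)"


section \<open>Trinatural transformations\<close>

definition comps :: "('a, 'b, 'c, 'o) gray \<Rightarrow> ('a \<times> 'a) set" where
  "comps A = {(g, f). g \<in> ob A \<and> f \<in> ob A \<and> s0 A g = t0 A f}"

text \<open>\<open>tn0 p X\<close> is \<open>p\<^sub>X\<close>, \<open>tn1 p f\<close> the adjoint equivalence \<open>p\<^sub>f \<stileturn> p\<^sub>f\<^sup>*\<close>, \<open>tn2 p \<phi>\<close> is \<open>p\<^sub>\<phi>\<close>,
  \<open>tnu p X\<close> the unitor and \<open>tnc p (g, f)\<close> the compositor.\<close>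

record ('o, 'a, 'b, 'd, 'e, 'g) trinat =
  tn0 :: "'o \<Rightarrow> 'd"
  tn1 :: "'a \<Rightarrow> ('e, 'g) adjeq"
  tn2 :: "'b \<Rightarrow> 'g"
  tnu :: "'o \<Rightarrow> 'g"
  tnc :: "'a \<times> 'a \<Rightarrow> 'g"

abbreviation tnl :: "('o, 'a, 'b, 'd, 'e, 'g) trinat \<Rightarrow> 'a \<Rightarrow> 'e" where
  "tnl p f \<equiv> ladj (tn1 p f)"

locale trinatural =
  fixes A :: "('a, 'b, 'c, 'o) gray" and B :: "('d, 'e, 'g, 'p) gray" (structure)
    and F G :: "('o, 'a, 'b, 'c, 'p, 'd, 'e, 'g) gmap"
    and p :: "('o, 'a, 'b, 'd, 'e, 'g) trinat"
  assumes extensional: "tn0 p \<in> extensional (pt A)" "tn1 p \<in> extensional (ob A)"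
      "tn2 p \<in> extensional (mor A)" "tnu p \<in> extensional (pt A)" "tnc p \<in> extensional (comps A)"
    and tn0_in: "X \<in> pt A \<Longrightarrow> tn0 p X \<in> cells1 B (map0 F X) (map0 G X)"
    and tn1_in: "f \<in> cells1 A X Y \<Longrightarrow>
      adjoint_equivalence (hom B (map0 F X) (map0 G Y))
        (tn0 p Y \<cdot> map1 F f) (map1 G f \<cdot> tn0 p X) (tn1 p f)"
    and tn2_in: "\<phi> \<in> mors (hom A X Y) f g \<Longrightarrow>
      tn2 p \<phi> \<in> icels B (tnl p g \<odot> (tn0 p Y \<rhd> map2 F \<phi>)) ((map2 G \<phi> \<lhd> tn0 p X) \<odot> tnl p f)"
    and tnu_in: "X \<in> pt A \<Longrightarrow> tnu p X \<in> icels B (idn B (tn0 p X)) (tnl p (one A X))"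
    and tnc_in: "f \<in> cells1 A X Y \<Longrightarrow> g \<in> cells1 A Y Z \<Longrightarrow>
      tnc p (g, f) \<in> icels B ((map1 G g \<rhd> tnl p f) \<odot> (tnl p g \<lhd> map1 F f)) (tnl p (g \<cdot>\<^bsub>A\<^esub> f))"
    and local_id: "f \<in> ob A \<Longrightarrow> tn2 p (idn A f) = \<langle>tnl p f\<rangle>"
    and local_cmp: "\<phi> \<in> mors (hom A X Y) f g \<Longrightarrow> \<psi> \<in> mors (hom A X Y) g h \<Longrightarrow>
      tn2 p (\<psi> \<odot>\<^bsub>A\<^esub> \<phi>) =
        (\<langle>map2 G \<psi> \<lhd> tn0 p X\<rangle> \<star> tn2 p \<phi>) \<bullet> (tn2 p \<psi> \<star> \<langle>tn0 p Y \<rhd> map2 F \<phi>\<rangle>)"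
    and local_natural: "\<phi> \<in> mors (hom A X Y) f g \<Longrightarrow> \<Omega> \<in> cels (hom A X Y) \<phi> \<phi>' \<Longrightarrow>
      ((map3 G \<Omega> \<unlhd> tn0 p X) \<star> \<langle>tnl p f\<rangle>) \<bullet> tn2 p \<phi> =
        tn2 p \<phi>' \<bullet> (\<langle>tnl p g\<rangle> \<star> (tn0 p Y \<unrhd> map3 F \<Omega>))"
    and right_whiskering: "\<phi> \<in> mors (hom A X Y) f f' \<Longrightarrow> g \<in> cells1 A Y Z \<Longrightarrow>
      tn2 p (g \<rhd>\<^bsub>A\<^esub> \<phi>) \<bullet> (tnc p (g, f') \<star> \<langle>(tn0 p Z \<cdot> map1 F g) \<rhd> map2 F \<phi>\<rangle>) =
        (\<langle>(map1 G g \<rhd> map2 G \<phi>) \<lhd> tn0 p X\<rangle> \<star> tnc p (g, f))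
        \<bullet> ((map1 G g \<unrhd> tn2 p \<phi>) \<star> \<langle>tnl p g \<lhd> map1 F f\<rangle>)
        \<bullet> (\<langle>map1 G g \<rhd> tnl p f'\<rangle> \<star> cinv B (ich B (tnl p g) (map2 F \<phi>)))"
    and left_whiskering: "f \<in> cells1 A X Y \<Longrightarrow> \<psi> \<in> mors (hom A Y Z) g g' \<Longrightarrow>
      tn2 p (\<psi> \<lhd>\<^bsub>A\<^esub> f) \<bullet> (tnc p (g', f) \<star> \<langle>tn0 p Z \<rhd> (map2 F \<psi> \<lhd> map1 F f)\<rangle>) =
        (\<langle>map2 G \<psi> \<lhd> (map1 G f \<cdot> tn0 p X)\<rangle> \<star> tnc p (g, f))
        \<bullet> (ich B (map2 G \<psi>) (tnl p f) \<star> \<langle>tnl p g \<lhd> map1 F f\<rangle>)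
        \<bullet> (\<langle>map1 G g' \<rhd> tnl p f\<rangle> \<star> (tn2 p \<psi> \<unlhd> map1 F f))"
    and associativity: "e \<in> cells1 A W X \<Longrightarrow> f \<in> cells1 A X Y \<Longrightarrow> g \<in> cells1 A Y Z \<Longrightarrow>
      tnc p (g, f \<cdot>\<^bsub>A\<^esub> e) \<bullet> ((map1 G g \<unrhd> tnc p (f, e)) \<star> \<langle>tnl p g \<lhd> (map1 F f \<cdot> map1 F e)\<rangle>) =
        tnc p (g \<cdot>\<^bsub>A\<^esub> f, e) \<bullet> (\<langle>(map1 G g \<cdot> map1 G f) \<rhd> tnl p e\<rangle> \<star> (tnc p (g, f) \<unlhd> map1 F e))"
    and unit_right: "f \<in> cells1 A X Y \<Longrightarrow>
      tnc p (f, one A X) \<bullet> ((map1 G f \<unrhd> tnu p X) \<star> \<langle>tnl p f\<rangle>) = \<langle>tnl p f\<rangle>"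
    and unit_left: "f \<in> cells1 A X Y \<Longrightarrow>
      tnc p (one A Y, f) \<bullet> (\<langle>tnl p f\<rangle> \<star> (tnu p Y \<unlhd> map1 F f)) = \<langle>tnl p f\<rangle>"

definition semi_strict :: "('a, 'b, 'c, 'o) gray \<Rightarrow> ('d, 'e, 'g, 'p) gray \<Rightarrow>
    ('o, 'a, 'b, 'c, 'p, 'd, 'e, 'g) gmap \<Rightarrow> ('o, 'a, 'b, 'c, 'p, 'd, 'e, 'g) gmap \<Rightarrow>
    ('o, 'a, 'b, 'd, 'e, 'g) trinat \<Rightarrow> bool" where
  "semi_strict A B F G p \<longleftrightarrow>
    (\<forall>X \<in> pt A. tn1 p (one A X) = adj_id B (tn0 p X) \<and> tnu p X = idc B (idn B (tn0 p X))) \<and>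
    (\<forall>(g, f) \<in> comps A.
      tn1 p (g \<cdot>\<^bsub>A\<^esub> f) =
        adj_comp B (adj_map (lw2 B (map1 G g)) (lw3 B (map1 G g)) (tn1 p f))
                   (adj_map (\<lambda>\<phi>. rw2 B \<phi> (map1 F f)) (\<lambda>\<Gamma>. rw3 B \<Gamma> (map1 F f)) (tn1 p g)) \<and>
      tnc p (g, f) = idc B ((map1 G g \<rhd>\<^bsub>B\<^esub> tnl p f) \<odot>\<^bsub>B\<^esub> (tnl p g \<lhd>\<^bsub>B\<^esub> map1 F f)))"


section \<open>Trimodifications and perturbations\<close>

record ('o, 'a, 'b, 'd, 'e, 'g) trimod =
  tm_src :: "('o, 'a, 'b, 'd, 'e, 'g) trinat"
  tm_tgt :: "('o, 'a, 'b, 'd, 'e, 'g) trinat"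
  tm0 :: "'o \<Rightarrow> 'e"
  tm1 :: "'a \<Rightarrow> 'g"

locale trimodification =
  fixes A :: "('a, 'b, 'c, 'o) gray" and B :: "('d, 'e, 'g, 'p) gray" (structure)
    and F G :: "('o, 'a, 'b, 'c, 'p, 'd, 'e, 'g) gmap"
    and p q :: "('o, 'a, 'b, 'd, 'e, 'g) trinat"
    and \<sigma> :: "('o, 'a, 'b, 'd, 'e, 'g) trimod"
  assumes src_tgt: "tm_src \<sigma> = p" "tm_tgt \<sigma> = q" "trinatural A B F G p" "trinatural A B F G q"
    and extensional: "tm0 \<sigma> \<in> extensional (pt A)" "tm1 \<sigma> \<in> extensional (ob A)"
    and tm0_in: "X \<in> pt A \<Longrightarrow> tm0 \<sigma> X \<in> mors B (tn0 p X) (tn0 q X)"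
    and tm1_in: "f \<in> cells1 A X Y \<Longrightarrow>
      tm1 \<sigma> f \<in> icels B ((map1 G f \<rhd> tm0 \<sigma> X) \<odot> tnl p f) (tnl q f \<odot> (tm0 \<sigma> Y \<lhd> map1 F f))"
    and natural: "\<phi> \<in> mors (hom A X Y) f g \<Longrightarrow>
      (tn2 q \<phi> \<star> \<langle>tm0 \<sigma> Y \<lhd> map1 F f\<rangle>)
        \<bullet> (\<langle>tnl q g\<rangle> \<star> cinv B (ich B (tm0 \<sigma> Y) (map2 F \<phi>)))
        \<bullet> (tm1 \<sigma> g \<star> \<langle>tn0 p Y \<rhd> map2 F \<phi>\<rangle>) =
      (\<langle>map2 G \<phi> \<lhd> tn0 q X\<rangle> \<star> tm1 \<sigma> f)
        \<bullet> (ich B (map2 G \<phi>) (tm0 \<sigma> X) \<star> \<langle>tnl p f\<rangle>)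
        \<bullet> (\<langle>map1 G g \<rhd> tm0 \<sigma> X\<rangle> \<star> tn2 p \<phi>)"
    and unit: "X \<in> pt A \<Longrightarrow>
      tm1 \<sigma> (one A X) \<bullet> (\<langle>tm0 \<sigma> X\<rangle> \<star> tnu p X) = tnu q X \<star> \<langle>tm0 \<sigma> X\<rangle>"
    and composition: "f \<in> cells1 A X Y \<Longrightarrow> g \<in> cells1 A Y Z \<Longrightarrow>
      tm1 \<sigma> (g \<cdot>\<^bsub>A\<^esub> f) \<bullet> (\<langle>(map1 G g \<cdot> map1 G f) \<rhd> tm0 \<sigma> X\<rangle> \<star> tnc p (g, f)) =
        (tnc q (g, f) \<star> \<langle>tm0 \<sigma> Z \<lhd> (map1 F g \<cdot> map1 F f)\<rangle>)
        \<bullet> (\<langle>map1 G g \<rhd> tnl q f\<rangle> \<star> (tm1 \<sigma> g \<unlhd> map1 F f))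
        \<bullet> ((map1 G g \<unrhd> tm1 \<sigma> f) \<star> \<langle>tnl p g \<lhd> map1 F f\<rangle>)"

record ('o, 'a, 'b, 'd, 'e, 'g) pert =
  pb_src :: "('o, 'a, 'b, 'd, 'e, 'g) trimod"
  pb_tgt :: "('o, 'a, 'b, 'd, 'e, 'g) trimod"
  pb0 :: "'o \<Rightarrow> 'g"

locale perturbation =
  fixes A :: "('a, 'b, 'c, 'o) gray" and B :: "('d, 'e, 'g, 'p) gray" (structure)
    and F G :: "('o, 'a, 'b, 'c, 'p, 'd, 'e, 'g) gmap"
    and p q :: "('o, 'a, 'b, 'd, 'e, 'g) trinat"
    and \<sigma> \<tau> :: "('o, 'a, 'b, 'd, 'e, 'g) trimod"
    and \<Omega> :: "('o, 'a, 'b, 'd, 'e, 'g) pert"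
  assumes src_tgt: "pb_src \<Omega> = \<sigma>" "pb_tgt \<Omega> = \<tau>"
      "trimodification A B F G p q \<sigma>" "trimodification A B F G p q \<tau>"
    and extensional: "pb0 \<Omega> \<in> extensional (pt A)"
    and pb0_in: "X \<in> pt A \<Longrightarrow> pb0 \<Omega> X \<in> cels B (tm0 \<sigma> X) (tm0 \<tau> X)"
    and natural: "f \<in> cells1 A X Y \<Longrightarrow>
      tm1 \<tau> f \<bullet> ((map1 G f \<unrhd> pb0 \<Omega> X) \<star> \<langle>tnl p f\<rangle>) =
        (\<langle>tnl q f\<rangle> \<star> (pb0 \<Omega> Y \<unlhd> map1 F f)) \<bullet> tm1 \<sigma> f"

definition tm_id :: "('a, 'b, 'c, 'o) gray \<Rightarrow> ('d, 'e, 'g, 'p) gray \<Rightarrow>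
    ('o, 'a, 'b, 'd, 'e, 'g) trinat \<Rightarrow> ('o, 'a, 'b, 'd, 'e, 'g) trimod" where
  "tm_id A B p = \<lparr>tm_src = p, tm_tgt = p,
     tm0 = \<lambda>X\<in>pt A. idn B (tn0 p X), tm1 = \<lambda>f\<in>ob A. idc B (tnl p f)\<rparr>"

definition tm_comp :: "('a, 'b, 'c, 'o) gray \<Rightarrow> ('d, 'e, 'g, 'p) gray \<Rightarrow>
    ('o, 'a, 'b, 'c, 'p, 'd, 'e, 'g) gmap \<Rightarrow> ('o, 'a, 'b, 'c, 'p, 'd, 'e, 'g) gmap \<Rightarrow>
    ('o, 'a, 'b, 'd, 'e, 'g) trimod \<Rightarrow> ('o, 'a, 'b, 'd, 'e, 'g) trimod \<Rightarrow>
    ('o, 'a, 'b, 'd, 'e, 'g) trimod" where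
  "tm_comp A B F G \<tau> \<sigma> = \<lparr>tm_src = tm_src \<sigma>, tm_tgt = tm_tgt \<tau>,
     tm0 = \<lambda>X\<in>pt A. tm0 \<tau> X \<odot>\<^bsub>B\<^esub> tm0 \<sigma> X,
     tm1 = \<lambda>f\<in>ob A. (tm1 \<tau> f \<star>\<^bsub>B\<^esub> idc B (tm0 \<sigma> (t0 A f) \<lhd>\<^bsub>B\<^esub> map1 F f))
                \<bullet>\<^bsub>B\<^esub> (idc B (map1 G f \<rhd>\<^bsub>B\<^esub> tm0 \<tau> (s0 A f)) \<star>\<^bsub>B\<^esub> tm1 \<sigma> f)\<rparr>"

text \<open>The 2-category of trinatural transformations \<open>F \<rightarrow> G\<close>, trimodifications and perturbations.\<close>

definition trinat_twocat :: "('a, 'b, 'c, 'o) gray \<Rightarrow> ('d, 'e, 'g, 'p) gray \<Rightarrow>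
    ('o, 'a, 'b, 'c, 'p, 'd, 'e, 'g) gmap \<Rightarrow> ('o, 'a, 'b, 'c, 'p, 'd, 'e, 'g) gmap \<Rightarrow>
    (('o, 'a, 'b, 'd, 'e, 'g) trinat, ('o, 'a, 'b, 'd, 'e, 'g) trimod,
     ('o, 'a, 'b, 'd, 'e, 'g) pert) twocat" where
  "trinat_twocat A B F G =
    \<lparr>ob = {p. trinatural A B F G p},
     mor = {\<sigma>. \<exists>p q. trimodification A B F G p q \<sigma>},
     cel = {\<Omega>. \<exists>p q \<sigma> \<tau>. perturbation A B F G p q \<sigma> \<tau> \<Omega>},
     dm = tm_src, cd = tm_tgt, sr = pb_src, tg = pb_tgt,
     idn = tm_id A B,
     idc = (\<lambda>\<sigma>. \<lparr>pb_src = \<sigma>, pb_tgt = \<sigma>, pb0 = \<lambda>X\<in>pt A. idc B (tm0 \<sigma> X)\<rparr>),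
     cmp = tm_comp A B F G,
     hcmp = (\<lambda>\<Omega>' \<Omega>. \<lparr>pb_src = tm_comp A B F G (pb_src \<Omega>') (pb_src \<Omega>),
                      pb_tgt = tm_comp A B F G (pb_tgt \<Omega>') (pb_tgt \<Omega>),
                      pb0 = \<lambda>X\<in>pt A. pb0 \<Omega>' X \<star>\<^bsub>B\<^esub> pb0 \<Omega> X\<rparr>),
     vcmp = (\<lambda>\<Omega>' \<Omega>. \<lparr>pb_src = pb_src \<Omega>, pb_tgt = pb_tgt \<Omega>',
                      pb0 = \<lambda>X\<in>pt A. pb0 \<Omega>' X \<bullet>\<^bsub>B\<^esub> pb0 \<Omega> X\<rparr>)\<rparr>"

abbreviation trimod_adjoint_equivalence :: "('a, 'b, 'c, 'o) gray \<Rightarrow> ('d, 'e, 'g, 'p) gray \<Rightarrow>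
    ('o, 'a, 'b, 'c, 'p, 'd, 'e, 'g) gmap \<Rightarrow> ('o, 'a, 'b, 'c, 'p, 'd, 'e, 'g) gmap \<Rightarrow>
    ('o, 'a, 'b, 'd, 'e, 'g) trinat \<Rightarrow> ('o, 'a, 'b, 'd, 'e, 'g) trinat \<Rightarrow>
    (('o, 'a, 'b, 'd, 'e, 'g) trimod, ('o, 'a, 'b, 'd, 'e, 'g) pert) adjeq \<Rightarrow> bool" where
  "trimod_adjoint_equivalence A B F G \<equiv> adjoint_equivalence (trinat_twocat A B F G)"


section \<open>3-pseudofunctors and 3-pseudonatural transformations\<close>

record ('o, 'a, 'b, 'c, 'p, 'd, 'e, 'g) pmap = "('o, 'a, 'b, 'c, 'p, 'd, 'e, 'g) gmap" +
  iota :: "'o \<Rightarrow> 'e"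
  chi :: "'a \<times> 'a \<Rightarrow> 'e"

text \<open>
  2-naturality of \<open>\<chi>\<close> between 2-functors on \<open>\<AA>(Y,Z) \<otimes> \<AA>(X,Y)\<close> is stated on the generating
  1-cells \<open>(\<psi>, f)\<close>, \<open>(g, \<phi>)\<close> and the generating 2-cells (3-cells in either variable and
  interchangers) of the Gray tensor product.
\<close>

locale pseudofunctor3 =
  fixes A :: "('a, 'b, 'c, 'o) gray" and C :: "('d, 'e, 'g, 'p) gray" (structure)
    and H :: "('o, 'a, 'b, 'c, 'p, 'd, 'e, 'g) pmap"
  assumes extensional: "map0 H \<in> extensional (pt A)" "map1 H \<in> extensional (ob A)"
      "map2 H \<in> extensional (mor A)" "map3 H \<in> extensional (cel A)"
      "iota H \<in> extensional (pt A)" "chi H \<in> extensional (comps A)"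
    and map0_in: "X \<in> pt A \<Longrightarrow> map0 H X \<in> pt C"
    and local_two_functor: "X \<in> pt A \<Longrightarrow> Y \<in> pt A \<Longrightarrow>
      two_functor (hom A X Y) (hom C (map0 H X) (map0 H Y)) (map1 H) (map2 H) (map3 H)"
    and iota_in: "X \<in> pt A \<Longrightarrow> iota H X \<in> imors C (one C (map0 H X)) (map1 H (one A X))"
    and chi_in: "f \<in> cells1 A X Y \<Longrightarrow> g \<in> cells1 A Y Z \<Longrightarrow>
      chi H (g, f) \<in> imors C (map1 H g \<cdot> map1 H f) (map1 H (g \<cdot>\<^bsub>A\<^esub> f))"
    and chi_natural2_left: "f \<in> cells1 A X Y \<Longrightarrow> \<psi> \<in> mors (hom A Y Z) g g' \<Longrightarrow>
      chi H (g', f) \<odot> (map2 H \<psi> \<lhd> map1 H f) = map2 H (\<psi> \<lhd>\<^bsub>A\<^esub> f) \<odot> chi H (g, f)"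
    and chi_natural2_right: "\<phi> \<in> mors (hom A X Y) f f' \<Longrightarrow> g \<in> cells1 A Y Z \<Longrightarrow>
      chi H (g, f') \<odot> (map1 H g \<rhd> map2 H \<phi>) = map2 H (g \<rhd>\<^bsub>A\<^esub> \<phi>) \<odot> chi H (g, f)"
    and chi_natural3_left: "f \<in> cells1 A X Y \<Longrightarrow>
      \<psi> \<in> mors (hom A Y Z) g g' \<Longrightarrow> \<Gamma> \<in> cels (hom A Y Z) \<psi> \<psi>' \<Longrightarrow>
      \<langle>chi H (g', f)\<rangle> \<star> (map3 H \<Gamma> \<unlhd> map1 H f) = map3 H (\<Gamma> \<unlhd>\<^bsub>A\<^esub> f) \<star> \<langle>chi H (g, f)\<rangle>"
    and chi_natural3_right: "\<phi> \<in> mors (hom A X Y) f f' \<Longrightarrow> \<Gamma> \<in> cels (hom A X Y) \<phi> \<phi>' \<Longrightarrow>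
      g \<in> cells1 A Y Z \<Longrightarrow>
      \<langle>chi H (g, f')\<rangle> \<star> (map1 H g \<unrhd> map3 H \<Gamma>) = map3 H (g \<unrhd>\<^bsub>A\<^esub> \<Gamma>) \<star> \<langle>chi H (g, f)\<rangle>"
    and chi_natural3_ich: "\<phi> \<in> mors (hom A X Y) f f' \<Longrightarrow> \<psi> \<in> mors (hom A Y Z) g g' \<Longrightarrow>
      \<langle>chi H (g', f')\<rangle> \<star> ich C (map2 H \<psi>) (map2 H \<phi>) = map3 H (ich A \<psi> \<phi>) \<star> \<langle>chi H (g, f)\<rangle>"
    and unit_left: "f \<in> cells1 A X Y \<Longrightarrow>
      chi H (one A Y, f) \<odot> (iota H Y \<lhd> map1 H f) = idn C (map1 H f)"
    and unit_right: "f \<in> cells1 A X Y \<Longrightarrow>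
      chi H (f, one A X) \<odot> (map1 H f \<rhd> iota H X) = idn C (map1 H f)"
    and associativity: "f \<in> cells1 A W X \<Longrightarrow> g \<in> cells1 A X Y \<Longrightarrow> h \<in> cells1 A Y Z \<Longrightarrow>
      chi H (h \<cdot>\<^bsub>A\<^esub> g, f) \<odot> (chi H (h, g) \<lhd> map1 H f) =
        chi H (h, g \<cdot>\<^bsub>A\<^esub> f) \<odot> (map1 H h \<rhd> chi H (g, f))"

text \<open>A Gray-functor as a 3-pseudofunctor, with identity unitors and compositors.\<close>

definition strict_pmap :: "('a, 'b, 'c, 'o) gray \<Rightarrow> ('d, 'e, 'g, 'p) gray \<Rightarrow>
    ('o, 'a, 'b, 'c, 'p, 'd, 'e, 'g) gmap \<Rightarrow> ('o, 'a, 'b, 'c, 'p, 'd, 'e, 'g) pmap" where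
  "strict_pmap A C F = \<lparr>map0 = map0 F, map1 = map1 F, map2 = map2 F, map3 = map3 F,
     iota = \<lambda>X\<in>pt A. idn C (one C (map0 F X)),
     chi = \<lambda>(g, f)\<in>comps A. idn C (map1 F g \<cdot>\<^bsub>C\<^esub> map1 F f)\<rparr>"

text \<open>The composite \<open>KH\<close> of a 3-pseudofunctor \<open>H\<close> on \<open>A\<close> with a Gray-functor \<open>K\<close>; strictness of
  \<open>K\<close> makes \<open>K\<iota>\<close> and \<open>K\<chi>\<close> its unitors and compositors.\<close>

definition post_comp :: "('a, 'b, 'c, 'o) gray \<Rightarrow> ('p, 'd, 'e, 'g, 'q, 'x, 'y, 'z) gmap \<Rightarrow>
    ('o, 'a, 'b, 'c, 'p, 'd, 'e, 'g) pmap \<Rightarrow> ('o, 'a, 'b, 'c, 'q, 'x, 'y, 'z) pmap" where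
  "post_comp A K H =
    \<lparr>map0 = compose (pt A) (map0 K) (map0 H), map1 = compose (ob A) (map1 K) (map1 H),
     map2 = compose (mor A) (map2 K) (map2 H), map3 = compose (cel A) (map3 K) (map3 H),
     iota = compose (pt A) (map2 K) (iota H), chi = compose (comps A) (map2 K) (chi H)\<rparr>"

record ('o, 'a, 'd, 'e) psnat =
  ps0 :: "'o \<Rightarrow> 'd"
  ps1 :: "'a \<Rightarrow> 'e"

locale pseudonatural3 =
  fixes A :: "('a, 'b, 'c, 'o) gray" and C :: "('d, 'e, 'g, 'p) gray" (structure)
    and H K :: "('o, 'a, 'b, 'c, 'p, 'd, 'e, 'g) pmap"
    and \<theta> :: "('o, 'a, 'd, 'e) psnat"
  assumes extensional: "ps0 \<theta> \<in> extensional (pt A)" "ps1 \<theta> \<in> extensional (ob A)"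
    and ps0_in: "X \<in> pt A \<Longrightarrow> ps0 \<theta> X \<in> cells1 C (map0 H X) (map0 K X)"
    and ps1_in: "f \<in> cells1 A X Y \<Longrightarrow>
      ps1 \<theta> f \<in> imors C (ps0 \<theta> Y \<cdot> map1 H f) (map1 K f \<cdot> ps0 \<theta> X)"
    and natural2: "\<phi> \<in> mors (hom A X Y) f f' \<Longrightarrow>
      ps1 \<theta> f' \<odot> (ps0 \<theta> Y \<rhd> map2 H \<phi>) = (map2 K \<phi> \<lhd> ps0 \<theta> X) \<odot> ps1 \<theta> f"
    and natural3: "\<phi> \<in> mors (hom A X Y) f f' \<Longrightarrow> \<Gamma> \<in> cels (hom A X Y) \<phi> \<phi>' \<Longrightarrow>
      \<langle>ps1 \<theta> f'\<rangle> \<star> (ps0 \<theta> Y \<unrhd> map3 H \<Gamma>) = (map3 K \<Gamma> \<unlhd> ps0 \<theta> X) \<star> \<langle>ps1 \<theta> f\<rangle>"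
    and unit: "X \<in> pt A \<Longrightarrow>
      ps1 \<theta> (one A X) \<odot> (ps0 \<theta> X \<rhd> iota H X) = iota K X \<lhd> ps0 \<theta> X"
    and composition: "f \<in> cells1 A X Y \<Longrightarrow> g \<in> cells1 A Y Z \<Longrightarrow>
      ps1 \<theta> (g \<cdot>\<^bsub>A\<^esub> f) \<odot> (ps0 \<theta> Z \<rhd> chi H (g, f)) =
        (chi K (g, f) \<lhd> ps0 \<theta> X) \<odot> (map1 K g \<rhd> ps1 \<theta> f) \<odot> (ps1 \<theta> g \<lhd> map1 H f)"

definition psnat_id :: "('a, 'b, 'c, 'o) gray \<Rightarrow> ('d, 'e, 'g, 'p) gray \<Rightarrow>
    ('o, 'a, 'b, 'c, 'p, 'd, 'e, 'g) gmap \<Rightarrow> ('o, 'a, 'd, 'e) psnat" where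
  "psnat_id A C F = \<lparr>ps0 = \<lambda>X\<in>pt A. one C (map0 F X), ps1 = \<lambda>f\<in>ob A. idn C (map1 F f)\<rparr>"

text \<open>The whiskering \<open>K.\<theta>\<close> with a Gray-functor \<open>K\<close>.\<close>

definition post_whisker :: "('a, 'b, 'c, 'o) gray \<Rightarrow> ('p, 'd, 'e, 'g, 'q, 'x, 'y, 'z) gmap \<Rightarrow>
    ('o, 'a, 'd, 'e) psnat \<Rightarrow> ('o, 'a, 'x, 'y) psnat" where
  "post_whisker A K \<theta> =
    \<lparr>ps0 = compose (pt A) (map1 K) (ps0 \<theta>), ps1 = compose (ob A) (map2 K) (ps1 \<theta>)\<rparr>"


section \<open>The path object\<close>

text \<open>The objects of \<open>[2, B]\<close> are the 1-cells \<open>x\<close> of \<open>B\<close>. Its 1-, 2- and 3-cells carry their source and target.\<close>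

record ('d, 'e, 'g) path1 =
  p1_src :: 'd
  p1_tgt :: 'd
  p1_eq :: "('e, 'g) adjeq"
  p1_0 :: 'd
  p1_1 :: 'd

record ('d, 'e, 'g) path2 =
  p2_src :: "('d, 'e, 'g) path1"
  p2_tgt :: "('d, 'e, 'g) path1"
  p2_cell :: 'g
  p2_0 :: 'e
  p2_1 :: 'e

record ('d, 'e, 'g) path3 =
  p3_src :: "('d, 'e, 'g) path2"
  p3_tgt :: "('d, 'e, 'g) path2"
  p3_0 :: 'g
  p3_1 :: 'g

abbreviation p1_l :: "('d, 'e, 'g) path1 \<Rightarrow> 'e" where
  "p1_l u \<equiv> ladj (p1_eq u)"

context
  fixes B :: "('d, 'e, 'g, 'p) gray" (structure)
begin

definition path_cells1 :: "('d, 'e, 'g) path1 set" where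
  "path_cells1 = {u. p1_src u \<in> ob B \<and> p1_tgt u \<in> ob B \<and>
     p1_0 u \<in> cells1 B (s0 B (p1_src u)) (s0 B (p1_tgt u)) \<and>
     p1_1 u \<in> cells1 B (t0 B (p1_src u)) (t0 B (p1_tgt u)) \<and>
     adjoint_equivalence (hom B (s0 B (p1_src u)) (t0 B (p1_tgt u)))
       (p1_tgt u \<cdot> p1_0 u) (p1_1 u \<cdot> p1_src u) (p1_eq u)}"

definition path_cells2 :: "('d, 'e, 'g) path2 set" where
  "path_cells2 = {\<phi>. p2_src \<phi> \<in> path_cells1 \<and> p2_tgt \<phi> \<in> path_cells1 \<and>
     p1_src (p2_src \<phi>) = p1_src (p2_tgt \<phi>) \<and> p1_tgt (p2_src \<phi>) = p1_tgt (p2_tgt \<phi>) \<and>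
     p2_0 \<phi> \<in> mors B (p1_0 (p2_src \<phi>)) (p1_0 (p2_tgt \<phi>)) \<and>
     p2_1 \<phi> \<in> mors B (p1_1 (p2_src \<phi>)) (p1_1 (p2_tgt \<phi>)) \<and>
     p2_cell \<phi> \<in> icels B (p1_l (p2_tgt \<phi>) \<odot> (p1_tgt (p2_src \<phi>) \<rhd> p2_0 \<phi>))
                        ((p2_1 \<phi> \<lhd> p1_src (p2_src \<phi>)) \<odot> p1_l (p2_src \<phi>))}"

definition path_cells3 :: "('d, 'e, 'g) path3 set" where
  "path_cells3 = {\<Gamma>. p3_src \<Gamma> \<in> path_cells2 \<and> p3_tgt \<Gamma> \<in> path_cells2 \<and>
     p2_src (p3_src \<Gamma>) = p2_src (p3_tgt \<Gamma>) \<and> p2_tgt (p3_src \<Gamma>) = p2_tgt (p3_tgt \<Gamma>) \<and>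
     p3_0 \<Gamma> \<in> cels B (p2_0 (p3_src \<Gamma>)) (p2_0 (p3_tgt \<Gamma>)) \<and>
     p3_1 \<Gamma> \<in> cels B (p2_1 (p3_src \<Gamma>)) (p2_1 (p3_tgt \<Gamma>)) \<and>
     p2_cell (p3_tgt \<Gamma>)
         \<bullet> (\<langle>p1_l (p2_tgt (p3_src \<Gamma>))\<rangle> \<star> (p1_tgt (p2_src (p3_src \<Gamma>)) \<unrhd> p3_0 \<Gamma>)) =
       ((p3_1 \<Gamma> \<unlhd> p1_src (p2_src (p3_src \<Gamma>))) \<star> \<langle>p1_l (p2_src (p3_src \<Gamma>))\<rangle>)
         \<bullet> p2_cell (p3_src \<Gamma>)}"

definition path_one :: "'d \<Rightarrow> ('d, 'e, 'g) path1" where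
  "path_one x = \<lparr>p1_src = x, p1_tgt = x, p1_eq = adj_id B x,
     p1_0 = one B (s0 B x), p1_1 = one B (t0 B x)\<rparr>"

definition path_comp1 :: "('d, 'e, 'g) path1 \<Rightarrow> ('d, 'e, 'g) path1 \<Rightarrow> ('d, 'e, 'g) path1" where
  "path_comp1 v u = \<lparr>p1_src = p1_src u, p1_tgt = p1_tgt v,
     p1_eq = adj_comp B
       (adj_map (\<lambda>\<phi>. p1_1 v \<rhd> \<phi>) (\<lambda>\<Gamma>. p1_1 v \<unrhd> \<Gamma>) (p1_eq u))
       (adj_map (\<lambda>\<phi>. \<phi> \<lhd> p1_0 u) (\<lambda>\<Gamma>. \<Gamma> \<unlhd> p1_0 u) (p1_eq v)),
     p1_0 = p1_0 v \<cdot> p1_0 u, p1_1 = p1_1 v \<cdot> p1_1 u\<rparr>"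

definition path_idn :: "('d, 'e, 'g) path1 \<Rightarrow> ('d, 'e, 'g) path2" where
  "path_idn u = \<lparr>p2_src = u, p2_tgt = u, p2_cell = \<langle>p1_l u\<rangle>,
     p2_0 = idn B (p1_0 u), p2_1 = idn B (p1_1 u)\<rparr>"

definition path_cmp :: "('d, 'e, 'g) path2 \<Rightarrow> ('d, 'e, 'g) path2 \<Rightarrow> ('d, 'e, 'g) path2" where
  "path_cmp \<psi> \<phi> = \<lparr>p2_src = p2_src \<phi>, p2_tgt = p2_tgt \<psi>,
     p2_cell = (\<langle>p2_1 \<psi> \<lhd> p1_src (p2_src \<phi>)\<rangle> \<star> p2_cell \<phi>)
               \<bullet> (p2_cell \<psi> \<star> \<langle>p1_tgt (p2_src \<phi>) \<rhd> p2_0 \<phi>\<rangle>),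
     p2_0 = p2_0 \<psi> \<odot> p2_0 \<phi>, p2_1 = p2_1 \<psi> \<odot> p2_1 \<phi>\<rparr>"

text \<open>
  Whiskering \<open>\<phi> : u \<Rightarrow> u'\<close> by \<open>v\<close> on the left uses the inverse interchanger of \<open>v\<close> and \<open>\<phi>\<^sub>0\<close>;
  whiskering \<open>\<psi> : v \<Rightarrow> v'\<close> by \<open>u\<close> on the right uses the interchanger of \<open>\<psi>\<^sub>1\<close> and \<open>u\<close>,
  as in the two whiskering laws of a semi-strict trinatural transformation.
\<close>

definition path_lw2 :: "('d, 'e, 'g) path1 \<Rightarrow> ('d, 'e, 'g) path2 \<Rightarrow> ('d, 'e, 'g) path2" where
  "path_lw2 v \<phi> = \<lparr>p2_src = path_comp1 v (p2_src \<phi>), p2_tgt = path_comp1 v (p2_tgt \<phi>),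
     p2_cell = ((p1_1 v \<unrhd> p2_cell \<phi>) \<star> \<langle>p1_l v \<lhd> p1_0 (p2_src \<phi>)\<rangle>)
               \<bullet> (\<langle>p1_1 v \<rhd> p1_l (p2_tgt \<phi>)\<rangle> \<star> cinv B (ich B (p1_l v) (p2_0 \<phi>))),
     p2_0 = p1_0 v \<rhd> p2_0 \<phi>, p2_1 = p1_1 v \<rhd> p2_1 \<phi>\<rparr>"

definition path_rw2 :: "('d, 'e, 'g) path2 \<Rightarrow> ('d, 'e, 'g) path1 \<Rightarrow> ('d, 'e, 'g) path2" where
  "path_rw2 \<psi> u = \<lparr>p2_src = path_comp1 (p2_src \<psi>) u, p2_tgt = path_comp1 (p2_tgt \<psi>) u,
     p2_cell = (ich B (p2_1 \<psi>) (p1_l u) \<star> \<langle>p1_l (p2_src \<psi>) \<lhd> p1_0 u\<rangle>)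
               \<bullet> (\<langle>p1_1 (p2_tgt \<psi>) \<rhd> p1_l u\<rangle> \<star> (p2_cell \<psi> \<unlhd> p1_0 u)),
     p2_0 = p2_0 \<psi> \<lhd> p1_0 u, p2_1 = p2_1 \<psi> \<lhd> p1_1 u\<rparr>"

definition path :: "(('d, 'e, 'g) path1, ('d, 'e, 'g) path2, ('d, 'e, 'g) path3, 'd) gray" where
  "path =
    \<lparr>ob = path_cells1, mor = path_cells2, cel = path_cells3,
     dm = p2_src, cd = p2_tgt, sr = p3_src, tg = p3_tgt,
     idn = path_idn,
     idc = (\<lambda>\<phi>. \<lparr>p3_src = \<phi>, p3_tgt = \<phi>, p3_0 = \<langle>p2_0 \<phi>\<rangle>, p3_1 = \<langle>p2_1 \<phi>\<rangle>\<rparr>),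
     cmp = path_cmp,
     hcmp = (\<lambda>\<Delta> \<Gamma>. \<lparr>p3_src = path_cmp (p3_src \<Delta>) (p3_src \<Gamma>),
                    p3_tgt = path_cmp (p3_tgt \<Delta>) (p3_tgt \<Gamma>),
                    p3_0 = p3_0 \<Delta> \<star> p3_0 \<Gamma>, p3_1 = p3_1 \<Delta> \<star> p3_1 \<Gamma>\<rparr>),
     vcmp = (\<lambda>\<Delta> \<Gamma>. \<lparr>p3_src = p3_src \<Gamma>, p3_tgt = p3_tgt \<Delta>,
                    p3_0 = p3_0 \<Delta> \<bullet> p3_0 \<Gamma>, p3_1 = p3_1 \<Delta> \<bullet> p3_1 \<Gamma>\<rparr>),
     pt = ob B, s0 = p1_src, t0 = p1_tgt,
     one = path_one, comp1 = path_comp1, lw2 = path_lw2, rw2 = path_rw2,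
     lw3 = (\<lambda>v \<Gamma>. \<lparr>p3_src = path_lw2 v (p3_src \<Gamma>), p3_tgt = path_lw2 v (p3_tgt \<Gamma>),
                   p3_0 = p1_0 v \<unrhd> p3_0 \<Gamma>, p3_1 = p1_1 v \<unrhd> p3_1 \<Gamma>\<rparr>),
     rw3 = (\<lambda>\<Gamma> u. \<lparr>p3_src = path_rw2 (p3_src \<Gamma>) u, p3_tgt = path_rw2 (p3_tgt \<Gamma>) u,
                   p3_0 = p3_0 \<Gamma> \<unlhd> p1_0 u, p3_1 = p3_1 \<Gamma> \<unlhd> p1_1 u\<rparr>),
     ich = (\<lambda>\<psi> \<phi>. \<lparr>p3_src = path_cmp (path_lw2 (p2_tgt \<psi>) \<phi>) (path_rw2 \<psi> (p2_src \<phi>)),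
                   p3_tgt = path_cmp (path_rw2 \<psi> (p2_tgt \<phi>)) (path_lw2 (p2_src \<psi>) \<phi>),
                   p3_0 = ich B (p2_0 \<psi>) (p2_0 \<phi>), p3_1 = ich B (p2_1 \<psi>) (p2_1 \<phi>)\<rparr>)\<rparr>"

definition path_s0 ::
    "('d, ('d, 'e, 'g) path1, ('d, 'e, 'g) path2, ('d, 'e, 'g) path3, 'p, 'd, 'e, 'g) gmap" where
  "path_s0 = \<lparr>map0 = restrict (s0 B) (ob B), map1 = restrict p1_0 path_cells1,
     map2 = restrict p2_0 path_cells2, map3 = restrict p3_0 path_cells3\<rparr>"

definition path_t0 ::
    "('d, ('d, 'e, 'g) path1, ('d, 'e, 'g) path2, ('d, 'e, 'g) path3, 'p, 'd, 'e, 'g) gmap" where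
  "path_t0 = \<lparr>map0 = restrict (t0 B) (ob B), map1 = restrict p1_1 path_cells1,
     map2 = restrict p2_1 path_cells2, map3 = restrict p3_1 path_cells3\<rparr>"

end


section \<open>The correspondences\<close>

text \<open>\<open>trinat_to_path A B F G p\<close> is \<open>p'\<close>. A 2-cell of the path object with identity components
  from \<open>p'g.p'f\<close> to \<open>p'(gf)\<close> is a 3-cell from \<open>p\<^sub>g\<^sub>f\<close> to \<open>(Gg.p\<^sub>f) \<circ> (p\<^sub>g.Ff)\<close>, which is why the
  unitors and compositors of \<open>p\<close> enter through their inverses.\<close>

context
  fixes A :: "('a, 'b, 'c, 'o) gray" and B :: "('d, 'e, 'g, 'p) gray"
    and F G :: "('o, 'a, 'b, 'c, 'p, 'd, 'e, 'g) gmap"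
begin

definition path1_of :: "('o, 'a, 'b, 'd, 'e, 'g) trinat \<Rightarrow> 'a \<Rightarrow> ('d, 'e, 'g) path1" where
  "path1_of p f = \<lparr>p1_src = tn0 p (s0 A f), p1_tgt = tn0 p (t0 A f), p1_eq = tn1 p f,
     p1_0 = map1 F f, p1_1 = map1 G f\<rparr>"

definition path2_of :: "('o, 'a, 'b, 'd, 'e, 'g) trinat \<Rightarrow> 'b \<Rightarrow> ('d, 'e, 'g) path2" where
  "path2_of p \<phi> = \<lparr>p2_src = path1_of p (dm A \<phi>), p2_tgt = path1_of p (cd A \<phi>),
     p2_cell = tn2 p \<phi>, p2_0 = map2 F \<phi>, p2_1 = map2 G \<phi>\<rparr>"

definition path3_of :: "('o, 'a, 'b, 'd, 'e, 'g) trinat \<Rightarrow> 'c \<Rightarrow> ('d, 'e, 'g) path3" where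
  "path3_of p \<Gamma> = \<lparr>p3_src = path2_of p (sr A \<Gamma>), p3_tgt = path2_of p (tg A \<Gamma>),
     p3_0 = map3 F \<Gamma>, p3_1 = map3 G \<Gamma>\<rparr>"

definition trinat_to_path :: "('o, 'a, 'b, 'd, 'e, 'g) trinat \<Rightarrow>
    ('o, 'a, 'b, 'c, 'd, ('d, 'e, 'g) path1, ('d, 'e, 'g) path2, ('d, 'e, 'g) path3) pmap" where
  "trinat_to_path p =
    \<lparr>map0 = \<lambda>X\<in>pt A. tn0 p X, map1 = \<lambda>f\<in>ob A. path1_of p f,
     map2 = \<lambda>\<phi>\<in>mor A. path2_of p \<phi>, map3 = \<lambda>\<Gamma>\<in>cel A. path3_of p \<Gamma>,
     iota = \<lambda>X\<in>pt A. \<lparr>p2_src = path_one B (tn0 p X), p2_tgt = path1_of p (one A X),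
       p2_cell = cinv B (tnu p X),
       p2_0 = idn B (one B (map0 F X)), p2_1 = idn B (one B (map0 G X))\<rparr>,
     chi = \<lambda>(g, f)\<in>comps A. \<lparr>p2_src = path_comp1 B (path1_of p g) (path1_of p f),
       p2_tgt = path1_of p (g \<cdot>\<^bsub>A\<^esub> f),
       p2_cell = cinv B (tnc p (g, f)),
       p2_0 = idn B (map1 F g \<cdot>\<^bsub>B\<^esub> map1 F f), p2_1 = idn B (map1 G g \<cdot>\<^bsub>B\<^esub> map1 G f)\<rparr>\<rparr>"

text \<open>
  A 1-cell \<open>p\<^sub>X \<rightarrow> q\<^sub>X\<close> of the path object over identities is an adjoint equivalence whose
  left adjoint goes from \<open>q\<^sub>X\<close> to \<open>p\<^sub>X\<close>. So \<open>\<sigma> \<stileturn> \<sigma>\<^sup>*\<close> with unit \<open>\<eta>\<close> and counit \<open>\<epsilon>\<close> is sent to the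
  transformation with components \<open>\<sigma>\<^sup>*\<^sub>X \<stileturn> \<sigma>\<^sub>X\<close>, with unit \<open>\<epsilon>\<^sub>X\<close> inverse and counit \<open>\<eta>\<^sub>X\<close> inverse,
  and \<open>\<sigma>\<^sup>*\<^sub>f\<close>.
\<close>

definition adj_to_path0 ::
    "('o, 'a, 'b, 'd, 'e, 'g) trinat \<Rightarrow> ('o, 'a, 'b, 'd, 'e, 'g) trinat \<Rightarrow>
     (('o, 'a, 'b, 'd, 'e, 'g) trimod, ('o, 'a, 'b, 'd, 'e, 'g) pert) adjeq \<Rightarrow>
     'o \<Rightarrow> ('d, 'e, 'g) path1" where
  "adj_to_path0 p q e X = \<lparr>p1_src = tn0 p X, p1_tgt = tn0 q X,
     p1_eq = \<lparr>ladj = tm0 (radj e) X, radj = tm0 (ladj e) X,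
       aunit = cinv B (pb0 (acounit e) X), acounit = cinv B (pb0 (aunit e) X)\<rparr>,
     p1_0 = one B (map0 F X), p1_1 = one B (map0 G X)\<rparr>"

definition adj_to_path ::
    "('o, 'a, 'b, 'd, 'e, 'g) trinat \<Rightarrow> ('o, 'a, 'b, 'd, 'e, 'g) trinat \<Rightarrow>
     (('o, 'a, 'b, 'd, 'e, 'g) trimod, ('o, 'a, 'b, 'd, 'e, 'g) pert) adjeq \<Rightarrow>
     ('o, 'a, ('d, 'e, 'g) path1, ('d, 'e, 'g) path2) psnat" where
  "adj_to_path p q e =
    \<lparr>ps0 = \<lambda>X\<in>pt A. adj_to_path0 p q e X,
     ps1 = \<lambda>f\<in>ob A.
       \<lparr>p2_src = path_comp1 B (adj_to_path0 p q e (t0 A f)) (path1_of p f),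
        p2_tgt = path_comp1 B (path1_of q f) (adj_to_path0 p q e (s0 A f)),
        p2_cell = tm1 (radj e) f, p2_0 = idn B (map1 F f), p2_1 = idn B (map1 G f)\<rparr>\<rparr>"

text \<open>The 3-pseudofunctors \<open>H\<close> from \<open>A\<close> to the path object of \<open>B\<close> with \<open>s\<^sub>0H = F\<close> and \<open>t\<^sub>0H = G\<close>.\<close>

definition path_pseudofunctors where
  "path_pseudofunctors = {H. pseudofunctor3 A (path B) H \<and>
     post_comp A (path_s0 B) H = strict_pmap A B F \<and>
     post_comp A (path_t0 B) H = strict_pmap A B G}"

text \<open>The 3-pseudonatural transformations \<open>\<theta> : H \<Rightarrow> K\<close> with \<open>s\<^sub>0.\<theta> = 1\<^sub>F\<close> and \<open>t\<^sub>0.\<theta> = 1\<^sub>G\<close>.\<close>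

definition path_pseudonaturals where
  "path_pseudonaturals H K = {\<theta>. pseudonatural3 A (path B) H K \<theta> \<and>
     post_whisker A (path_s0 B) \<theta> = psnat_id A B F \<and>
     post_whisker A (path_t0 B) \<theta> = psnat_id A B G}"

end

end

theory Submission
  imports Defs
begin

text \<open>
  A cell of the path object over given cells of \<open>B\<close> is the same as a component of a trinatural
  transformation, so the first part is a law-by-law translation: once unitors and compositors are
  moved to the other side by inverting them, each law of \<open>p\<close> is the equation between the 3-cells
  in the corresponding law of \<open>p'\<close>. In the same way a 3-pseudonatural transformation
  \<open>p' \<Rightarrow> q'\<close> over identities is a trimodification \<open>s : q \<Rightarrow> p\<close> together with adjoint equivalences
  extending its 2-cells. It remains to see that \<open>s\<close> is the right adjoint of a unique adjoint
  equivalence with these components. The unit forces the 3-cells of the left adjoint \<open>t\<close> to be the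
  mates of the inverses of those of \<open>s\<close>. The laws of a trimodification are equations between
  pastings of squares, hence transport along invertible perturbations; so the composite of \<open>s\<close> and
  \<open>t\<close> satisfies them because the identity does. As \<open>s\<close> satisfies them too and whiskering with an
  equivalence is faithful, they can be cancelled to give the laws of \<open>t\<close>.
\<close>

text \<open>Cells of the path object are records over \<open>B\<close>, so all calculation takes
  place in \<open>B\<close>. An equation of 2-cells there splits into equal boundaries, equal
  components at both ends, and one equation between 3-cells of \<open>B\<close>. An equation of
  3-cells involves only boundaries and end components, and the latter agree because \<open>F\<close>
  and \<open>G\<close> are Gray-functors. The left adjoint \<open>t\<close> shapes the second half:
  its laws are the last thing to be known, yet it has to be composed with \<open>s\<close> and
  related to the identity before that. Hence typing is kept apart from laws. The locales
  \<open>pretrinatural\<close> and \<open>pretrimodification\<close> hold well-typed data, and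
  translation, pasting and transport are proved for such data one law at a time. Plain inverses do
  not suffice for the 3-cells of \<open>t\<close>: the inverse of \<open>tm1 s f\<close> still has
  the 2-cells of \<open>s\<close> in its boundary, and only the units and counits exchange them for
  their right adjoints. This is why mates appear.\<close>

definition invertible :: "('a, 'b, 'c, 'z) twocat_scheme \<Rightarrow> 'c \<Rightarrow> bool" where
  "invertible C x \<longleftrightarrow> x \<in> cel C \<and> (\<exists>y. inverse_cells C x y)"

text \<open>Membership in \<open>icels\<close> bundles invertibility with a source and a target.
  Splitting them makes invertibility a condition that simplification rules can carry separately from
  boundary equations.\<close>

lemma icels_iff: "x \<in> icels C f g \<longleftrightarrow> invertible C x \<and> sr C x = f \<and> tg C x = g"
  by (auto simp: icels_def cels_def invertible_def)

section \<open>2-categories\<close>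

text \<open>The axioms are restated with source and target as functions of a cell, so that the
  simplifier discharges the typing conditions.\<close>

context two_category
begin

text \<open>The ends of a target are rewritten to those of the source, which fixes
  \<open>dm C (sr C x)\<close> and \<open>cd C (sr C x)\<close> as normal forms for the ends of a
  2-cell.\<close>

lemma mor_simps [simp]:
  "f \<in> mor C \<Longrightarrow> dm C f \<in> ob C" "f \<in> mor C \<Longrightarrow> cd C f \<in> ob C"
  "x \<in> cel C \<Longrightarrow> sr C x \<in> mor C" "x \<in> cel C \<Longrightarrow> tg C x \<in> mor C"
  "x \<in> cel C \<Longrightarrow> dm C (tg C x) = dm C (sr C x)" "x \<in> cel C \<Longrightarrow> cd C (tg C x) = cd C (sr C x)"
  using dm_cd sr_tg globular by auto

lemma idn_simps [simp]:
  assumes "a \<in> ob C"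
  shows "idn C a \<in> mor C" "dm C (idn C a) = a" "cd C (idn C a) = a"
  using idn_in[OF assms] by (auto simp: mors_def)

lemma cmp_simps [simp]:
  assumes "f \<in> mor C" "g \<in> mor C" "cd C f = dm C g"
  shows "g \<odot> f \<in> mor C" "dm C (g \<odot> f) = dm C f" "cd C (g \<odot> f) = cd C g"
  using cmp_in[of f "dm C f" "cd C f" g "cd C g"] assms by (auto simp: mors_def)

lemma cmp_assoc_simp [simp]:
  assumes "f \<in> mor C" "g \<in> mor C" "h \<in> mor C" "cd C f = dm C g" "cd C g = dm C h"
  shows "h \<odot> g \<odot> f = h \<odot> (g \<odot> f)"
  using cmp_assoc[of f "dm C f" "cd C f" g "cd C g" h "cd C h"] assms by (auto simp: mors_def)

lemma cmp_idn_simps [simp]: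
  "f \<in> mor C \<Longrightarrow> dm C f = a \<Longrightarrow> f \<odot> idn C a = f"
  "f \<in> mor C \<Longrightarrow> cd C f = a \<Longrightarrow> idn C a \<odot> f = f"
  using cmp_idn[of f "dm C f" "cd C f"] by (auto simp: mors_def)

lemma idc_simps [simp]:
  assumes "f \<in> mor C"
  shows "\<langle>f\<rangle> \<in> cel C" "sr C \<langle>f\<rangle> = f" "tg C \<langle>f\<rangle> = f"
  using idc_in[OF assms] by (auto simp: cels_def)

lemma vcmp_simps [simp]:
  assumes "x \<in> cel C" "y \<in> cel C" "tg C x = sr C y"
  shows "y \<bullet> x \<in> cel C" "sr C (y \<bullet> x) = sr C x" "tg C (y \<bullet> x) = tg C y"
  using vcmp_in[of x "sr C x" "tg C x" y "tg C y"] assms by (auto simp: cels_def)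

lemma vcmp_assoc_simp [simp]:
  assumes "x \<in> cel C" "y \<in> cel C" "z \<in> cel C" "tg C x = sr C y" "tg C y = sr C z"
  shows "z \<bullet> y \<bullet> x = z \<bullet> (y \<bullet> x)"
  using vcmp_assoc[of x "sr C x" "tg C x" y "tg C y" z "tg C z"] assms by (auto simp: cels_def)

lemma vcmp_idc_simps [simp]:
  "x \<in> cel C \<Longrightarrow> sr C x = f \<Longrightarrow> x \<bullet> \<langle>f\<rangle> = x"
  "x \<in> cel C \<Longrightarrow> tg C x = f \<Longrightarrow> \<langle>f\<rangle> \<bullet> x = x"
  using vcmp_idc[of x "sr C x" "tg C x"] by (auto simp: cels_def)

lemma hcmp_simps [simp]:
  assumes "x \<in> cel C" "y \<in> cel C" "cd C (sr C x) = dm C (sr C y)"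
  shows "y \<star> x \<in> cel C" "sr C (y \<star> x) = sr C y \<odot> sr C x" "tg C (y \<star> x) = tg C y \<odot> tg C x"
  using hcmp_in[of x "sr C x" "tg C x" y "sr C y" "tg C y"] assms by (auto simp: cels_def)

lemma hcmp_assoc_simp [simp]:
  assumes "x \<in> cel C" "y \<in> cel C" "z \<in> cel C"
    "cd C (sr C x) = dm C (sr C y)" "cd C (sr C y) = dm C (sr C z)"
  shows "z \<star> y \<star> x = z \<star> (y \<star> x)"
  using hcmp_assoc[of x "sr C x" "tg C x" y "sr C y" "tg C y" z "sr C z" "tg C z"] assms
  by (auto simp: cels_def)

lemma hcmp_idn_simps [simp]:
  "x \<in> cel C \<Longrightarrow> dm C (sr C x) = a \<Longrightarrow> x \<star> \<langle>idn C a\<rangle> = x"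
  "x \<in> cel C \<Longrightarrow> cd C (sr C x) = a \<Longrightarrow> \<langle>idn C a\<rangle> \<star> x = x"
  using hcmp_idn[of x "sr C x" "tg C x"] by (auto simp: cels_def)

lemma hcmp_idc_simp [simp]:
  assumes "f \<in> mor C" "g \<in> mor C" "cd C f = dm C g"
  shows "\<langle>g\<rangle> \<star> \<langle>f\<rangle> = \<langle>g \<odot> f\<rangle>"
  using hcmp_idc[of f "dm C f" "cd C f" g "cd C g"] assms by (auto simp: mors_def)

text \<open>After association to the right, two neighbouring identity cells need not form a subterm.
  This rule merges them in front of a further factor, so repeated left whiskering collapses to one
  identity cell.\<close>

lemma hcmp_idc_left [simp]:
  assumes "f \<in> mor C" "g \<in> mor C" "cd C f = dm C g" "x \<in> cel C" "cd C (sr C x) = dm C f"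
  shows "\<langle>g\<rangle> \<star> (\<langle>f\<rangle> \<star> x) = \<langle>g \<odot> f\<rangle> \<star> x"
  using hcmp_assoc_simp[of x "\<langle>f\<rangle>" "\<langle>g\<rangle>"] assms by (simp del: hcmp_assoc_simp)

lemma interchange_simp:
  assumes "x \<in> cel C" "x' \<in> cel C" "y \<in> cel C" "y' \<in> cel C" "tg C x = sr C x'" "tg C y = sr C y'"
    "cd C (sr C x) = dm C (sr C y)"
  shows "(y' \<bullet> y) \<star> (x' \<bullet> x) = (y' \<star> x') \<bullet> (y \<star> x)"
  using interchange[of x "sr C x" "tg C x" x' "tg C x'" y "sr C y" "tg C y" y' "tg C y'"] assms
  by (auto simp: cels_def)

text \<open>With an identity as one factor, interchange has a preferred direction. Distributing
  whiskerings brings every pasting into the form of a vertical composite of whiskered cells.\<close>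

lemma whisker_vcmp [simp]:
  assumes "x \<in> cel C" "x' \<in> cel C" "tg C x = sr C x'" "g \<in> mor C"
  shows "cd C (sr C x) = dm C g \<Longrightarrow> \<langle>g\<rangle> \<star> (x' \<bullet> x) = (\<langle>g\<rangle> \<star> x') \<bullet> (\<langle>g\<rangle> \<star> x)"
    and "cd C g = dm C (sr C x) \<Longrightarrow> (x' \<bullet> x) \<star> \<langle>g\<rangle> = (x' \<star> \<langle>g\<rangle>) \<bullet> (x \<star> \<langle>g\<rangle>)"
  using interchange_simp[of x x' "\<langle>g\<rangle>" "\<langle>g\<rangle>"] interchange_simp[of "\<langle>g\<rangle>" "\<langle>g\<rangle>" x x'] assms
  by auto

text \<open>Either order of performing two side-by-side cells gives their horizontal composite.
  Equating the two orders is the exchange behind all later slides.\<close>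

lemma hcmp_slide:
  assumes "x \<in> cel C" "y \<in> cel C" "cd C (sr C x) = dm C (sr C y)"
  shows "(y \<star> \<langle>tg C x\<rangle>) \<bullet> (\<langle>sr C y\<rangle> \<star> x) = y \<star> x"
    and "(\<langle>tg C y\<rangle> \<star> x) \<bullet> (y \<star> \<langle>sr C x\<rangle>) = y \<star> x"
  using interchange_simp[of x "\<langle>tg C x\<rangle>" "\<langle>sr C y\<rangle>" y] interchange_simp[of "\<langle>sr C x\<rangle>" x y "\<langle>tg C y\<rangle>"]
    assms by auto

text \<open>Composites are kept associated to the right, where the two sides of a two-factor
  equation are no longer subterms once \<open>z\<close> follows. This applies such an equation at
  the head of a longer composite.\<close>

lemma vcmp_prefix:
  assumes "y \<bullet> x = y' \<bullet> x'" "x \<in> cel C" "y \<in> cel C" "tg C x = sr C y"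
    "x' \<in> cel C" "y' \<in> cel C" "tg C x' = sr C y'" "z \<in> cel C" "tg C z = sr C x" "sr C x' = sr C x"
  shows "y \<bullet> (x \<bullet> z) = y' \<bullet> (x' \<bullet> z)"
proof -
  have "y \<bullet> (x \<bullet> z) = (y \<bullet> x) \<bullet> z" using assms(2-) by simp
  also have "\<dots> = (y' \<bullet> x') \<bullet> z" by (simp only: assms(1))
  also have "\<dots> = y' \<bullet> (x' \<bullet> z)" using assms(2-) by simp
  finally show ?thesis .
qed

subsection \<open>Invertible cells\<close>

lemma inverse_cells_unique:
  assumes "x \<in> cel C" "inverse_cells C x y" "inverse_cells C x z"
  shows "y = z"
proof -
  have y: "y \<in> cel C" "sr C y = tg C x" "tg C y = sr C x" "y \<bullet> x = \<langle>sr C x\<rangle>"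
    and z: "z \<in> cel C" "sr C z = tg C x" "tg C z = sr C x" "x \<bullet> z = \<langle>tg C x\<rangle>"
    using assms by (auto simp: inverse_cells_def cels_def)
  have "y = y \<bullet> (x \<bullet> z)" using y z assms(1) by simp
  also have "\<dots> = (y \<bullet> x) \<bullet> z" using y(1-3) z(1-3) assms(1) by simp
  also have "\<dots> = z" using y z assms(1) by simp
  finally show ?thesis .
qed

lemma cinv_eqI:
  assumes "x \<in> cel C" "inverse_cells C x y"
  shows "cinv C x = y"
  unfolding cinv_def using assms inverse_cells_unique by blast

lemma iso_cel [simp]: "invertible C x \<Longrightarrow> x \<in> cel C"
  by (simp add: invertible_def)

lemma inverse_cells_cinv: "invertible C x \<Longrightarrow> inverse_cells C x (cinv C x)"
  using cinv_eqI by (metis invertible_def)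

lemma cinv_simps [simp]:
  assumes "invertible C x"
  shows "cinv C x \<in> cel C" "sr C (cinv C x) = tg C x" "tg C (cinv C x) = sr C x"
    "cinv C x \<bullet> x = \<langle>sr C x\<rangle>" "x \<bullet> cinv C x = \<langle>tg C x\<rangle>"
  using inverse_cells_cinv[OF assms] by (auto simp: inverse_cells_def cels_def)

lemma cinv_cancel [simp]:
  assumes "invertible C x" "z \<in> cel C"
  shows "tg C z = sr C x \<Longrightarrow> cinv C x \<bullet> (x \<bullet> z) = z"
    and "tg C z = tg C x \<Longrightarrow> x \<bullet> (cinv C x \<bullet> z) = z"
proof -
  assume "tg C z = sr C x"
  then have "cinv C x \<bullet> (x \<bullet> z) = (cinv C x \<bullet> x) \<bullet> z"
    using assms by (simp del: cinv_simps(4))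
  then show "cinv C x \<bullet> (x \<bullet> z) = z" using assms \<open>tg C z = sr C x\<close> by simp
next
  assume "tg C z = tg C x"
  then have "x \<bullet> (cinv C x \<bullet> z) = (x \<bullet> cinv C x) \<bullet> z"
    using assms by (simp del: cinv_simps(5))
  then show "x \<bullet> (cinv C x \<bullet> z) = z" using assms \<open>tg C z = tg C x\<close> by simp
qed

lemma isoI:
  assumes "x \<in> cel C" "y \<in> cel C" "sr C y = tg C x" "tg C y = sr C x"
    "y \<bullet> x = \<langle>sr C x\<rangle>" "x \<bullet> y = \<langle>tg C x\<rangle>"
  shows "invertible C x" "cinv C x = y"
proof -
  have "inverse_cells C x y" using assms by (auto simp: inverse_cells_def cels_def)
  then show "invertible C x" "cinv C x = y" using assms(1) cinv_eqI by (auto simp: invertible_def)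
qed

lemma iso_cinv [simp]:
  assumes "invertible C x"
  shows "invertible C (cinv C x)" "cinv C (cinv C x) = x"
  using isoI[of "cinv C x" x] assms by auto

lemma iso_idc [simp]:
  assumes "f \<in> mor C"
  shows "invertible C \<langle>f\<rangle>" "cinv C \<langle>f\<rangle> = \<langle>f\<rangle>"
  using isoI[of "\<langle>f\<rangle>" "\<langle>f\<rangle>"] assms by auto

lemma iso_vcmp [simp]:
  assumes "invertible C x" "invertible C y" "tg C x = sr C y"
  shows "invertible C (y \<bullet> x)" "cinv C (y \<bullet> x) = cinv C x \<bullet> cinv C y"
  using isoI[of "y \<bullet> x" "cinv C x \<bullet> cinv C y"] assms by auto

lemma iso_hcmp [simp]:
  assumes "invertible C x" "invertible C y" "cd C (sr C x) = dm C (sr C y)"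
  shows "invertible C (y \<star> x)" "cinv C (y \<star> x) = cinv C y \<star> cinv C x"
proof -
  have "cinv C y \<star> cinv C x \<bullet> y \<star> x = \<langle>sr C (y \<star> x)\<rangle>"
    using interchange_simp[of x "cinv C x" y "cinv C y"] assms by simp
  moreover have "y \<star> x \<bullet> cinv C y \<star> cinv C x = \<langle>tg C (y \<star> x)\<rangle>"
    using interchange_simp[of "cinv C x" x "cinv C y" y] assms by simp
  ultimately show "invertible C (y \<star> x)" "cinv C (y \<star> x) = cinv C y \<star> cinv C x"
    using isoI[of "y \<star> x" "cinv C y \<star> cinv C x"] assms by auto
qed

lemma iso_cancel_left:
  assumes "invertible C x" "y \<in> cel C" "z \<in> cel C" "tg C y = sr C x" "tg C z = sr C x"
  shows "x \<bullet> y = x \<bullet> z \<longleftrightarrow> y = z"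
  using assms by (metis cinv_cancel(1))

lemma iso_cancel_right:
  assumes "invertible C x" "y \<in> cel C" "z \<in> cel C" "sr C y = tg C x" "sr C z = tg C x"
  shows "y \<bullet> x = z \<bullet> x \<longleftrightarrow> y = z"
proof
  assume "y \<bullet> x = z \<bullet> x"
  then have "(y \<bullet> x) \<bullet> cinv C x = (z \<bullet> x) \<bullet> cinv C x" by simp
  then show "y = z" using assms by simp
qed simp

text \<open>Multiplying by both inverses carries \<open>x\<close> and \<open>y\<close> across the
  equation. Unitors and compositors enter the path object inverted, so this is the passage between a
  law and its translation.\<close>

lemma conjugate_iff:
  assumes "invertible C x" "invertible C y" "l \<in> cel C" "r \<in> cel C"
    "sr C r = tg C x" "sr C l = sr C x" "tg C l = sr C y" "tg C r = tg C y"
  shows "r \<bullet> x = y \<bullet> l \<longleftrightarrow> l \<bullet> cinv C x = cinv C y \<bullet> r"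
proof
  assume "r \<bullet> x = y \<bullet> l"
  then have "cinv C y \<bullet> ((r \<bullet> x) \<bullet> cinv C x) = cinv C y \<bullet> ((y \<bullet> l) \<bullet> cinv C x)" by simp
  then show "l \<bullet> cinv C x = cinv C y \<bullet> r" using assms by simp
next
  assume "l \<bullet> cinv C x = cinv C y \<bullet> r"
  then have "y \<bullet> ((l \<bullet> cinv C x) \<bullet> x) = y \<bullet> ((cinv C y \<bullet> r) \<bullet> x)" by simp
  then show "r \<bullet> x = y \<bullet> l" using assms by simp
qed

subsection \<open>Squares\<close>

text \<open>A square fills the two routes \<open>a\<close> after \<open>P\<close> and
  \<open>Q\<close> after \<open>b\<close>. For a trimodification, \<open>a\<close> and
  \<open>b\<close> come from its own 2-cells, \<open>P\<close> and \<open>Q\<close> from the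
  transformations it connects.\<close>

definition square :: "'b \<Rightarrow> 'b \<Rightarrow> 'b \<Rightarrow> 'b \<Rightarrow> 'c set" where
  "square a P Q b = {s \<in> cel C. a \<in> mor C \<and> P \<in> mor C \<and> Q \<in> mor C \<and> b \<in> mor C \<and>
     cd C P = dm C a \<and> cd C b = dm C Q \<and> dm C b = dm C P \<and> cd C Q = cd C a \<and>
     sr C s = a \<odot> P \<and> tg C s = Q \<odot> b}"

definition hpaste :: "'b \<Rightarrow> 'b \<Rightarrow> 'c \<Rightarrow> 'c \<Rightarrow> 'c" where
  "hpaste Q P' s s' = (\<langle>Q\<rangle> \<star> s') \<bullet> (s \<star> \<langle>P'\<rangle>)"

text \<open>The two squares share the side \<open>Q\<close>, whereas \<open>hpaste\<close> glues
  along \<open>b\<close>. Composing trimodifications is \<open>vpaste\<close>; the boundary pastings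
  inside the law of one trimodification are \<open>hpaste\<close>.\<close>

definition vpaste :: "'b \<Rightarrow> 'b \<Rightarrow> 'c \<Rightarrow> 'c \<Rightarrow> 'c" where
  "vpaste a' b t s = (t \<star> \<langle>b\<rangle>) \<bullet> (\<langle>a'\<rangle> \<star> s)"

lemma squareD:
  assumes "s \<in> square a P Q b"
  shows "s \<in> cel C" "a \<in> mor C" "P \<in> mor C" "Q \<in> mor C" "b \<in> mor C"
     "cd C P = dm C a" "cd C b = dm C Q" "dm C b = dm C P" "cd C Q = cd C a"
     "sr C s = a \<odot> P" "tg C s = Q \<odot> b"
  using assms by (auto simp: square_def)

lemma hpaste_square:
  assumes "s \<in> square a P Q b" "s' \<in> square b P' Q' c"
  shows "hpaste Q P' s s' \<in> square a (P \<odot> P') (Q \<odot> Q') c"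
  using squareD[OF assms(1)] squareD[OF assms(2)] by (simp add: square_def hpaste_def)

lemma vpaste_square:
  assumes "s \<in> square a P Q b" "t \<in> square a' Q R b'"
  shows "vpaste a' b t s \<in> square (a' \<odot> a) P R (b' \<odot> b)"
  using squareD[OF assms(1)] squareD[OF assms(2)] by (simp add: square_def vpaste_def)

lemma hpaste_iso:
  assumes "s \<in> square a P Q b" "s' \<in> square b P' Q' c" "invertible C s" "invertible C s'"
  shows "invertible C (hpaste Q P' s s')"
  using squareD[OF assms(1)] squareD[OF assms(2)] assms by (simp add: hpaste_def)

lemma vpaste_iso:
  assumes "s \<in> square a P Q b" "t \<in> square a' Q R b'" "invertible C s" "invertible C t"
  shows "invertible C (vpaste a' b t s)"
  using squareD[OF assms(1)] squareD[OF assms(2)] assms by (simp add: vpaste_def)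

text \<open>Only \<open>t\<close> and \<open>s'\<close> occur in different orders on the two sides,
  and they act on disjoint factors, so one slide suffices. This is the interchange law of the double
  category of squares.\<close>

lemma hpaste_vpaste:
  assumes "s \<in> square a P Q b" "s' \<in> square b P' Q' c"
    "t \<in> square a' Q R b'" "t' \<in> square b' Q' R' c'"
  shows "vpaste a' c (hpaste R Q' t t') (hpaste Q P' s s') =
    hpaste R P' (vpaste a' b t s) (vpaste b' c t' s')"
proof -
  note sq = squareD[OF assms(1)] squareD[OF assms(2)] squareD[OF assms(3)] squareD[OF assms(4)]
  have "(t \<star> \<langle>Q' \<odot> c\<rangle>) \<bullet> (\<langle>a' \<odot> Q\<rangle> \<star> s') = (\<langle>R \<odot> b'\<rangle> \<star> s') \<bullet> (t \<star> \<langle>b \<odot> P'\<rangle>)"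
    using hcmp_slide[of s' t] sq by simp
  then have "(t \<star> \<langle>Q' \<odot> c\<rangle>) \<bullet> ((\<langle>a' \<odot> Q\<rangle> \<star> s') \<bullet> (\<langle>a'\<rangle> \<star> (s \<star> \<langle>P'\<rangle>))) =
      (\<langle>R \<odot> b'\<rangle> \<star> s') \<bullet> ((t \<star> \<langle>b \<odot> P'\<rangle>) \<bullet> (\<langle>a'\<rangle> \<star> (s \<star> \<langle>P'\<rangle>)))"
    by (rule vcmp_prefix) (use sq in simp_all)
  then show ?thesis using sq by (simp add: hpaste_def vpaste_def)
qed

end

section \<open>Gray-categories\<close>

lemma hom_simps [simp]:
  "ob (hom B X Y) = {f \<in> ob B. s0 B f = X \<and> t0 B f = Y}"
  "mor (hom B X Y) = {\<phi> \<in> mor B. s0 B (dm B \<phi>) = X \<and> t0 B (dm B \<phi>) = Y}"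
  "cel (hom B X Y) = {\<Gamma> \<in> cel B. s0 B (dm B (sr B \<Gamma>)) = X \<and> t0 B (dm B (sr B \<Gamma>)) = Y}"
  "dm (hom B X Y) = dm B" "cd (hom B X Y) = cd B" "sr (hom B X Y) = sr B" "tg (hom B X Y) = tg B"
  "idn (hom B X Y) = idn B" "idc (hom B X Y) = idc B" "cmp (hom B X Y) = cmp B"
  "hcmp (hom B X Y) = hcmp B" "vcmp (hom B X Y) = vcmp B"
  by (simp_all add: hom_def)

lemma mors_hom_iff:
  "\<phi> \<in> mors (hom B X Y) f g \<longleftrightarrow> \<phi> \<in> mor B \<and> dm B \<phi> = f \<and> cd B \<phi> = g \<and> s0 B f = X \<and> t0 B f = Y"
  by (auto simp: mors_def)

lemma cels_hom_iff:
  "\<Gamma> \<in> cels (hom B X Y) \<phi> \<psi> \<longleftrightarrow>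
    \<Gamma> \<in> cel B \<and> sr B \<Gamma> = \<phi> \<and> tg B \<Gamma> = \<psi> \<and> s0 B (dm B \<phi>) = X \<and> t0 B (dm B \<phi>) = Y"
  by (auto simp: cels_def)

context gray_category
begin

lemma ends_simps [simp]:
  "f \<in> ob B \<Longrightarrow> s0 B f \<in> pt B" "f \<in> ob B \<Longrightarrow> t0 B f \<in> pt B"
  using s0_t0 by auto

lemma hom_ends_two_category: "f \<in> ob B \<Longrightarrow> two_category (hom B (s0 B f) (t0 B f))"
  by (simp add: hom_two_category)

lemma cd_ends:
  assumes "\<phi> \<in> mor B"
  shows "cd B \<phi> \<in> ob B" "s0 B (cd B \<phi>) = s0 B (dm B \<phi>)" "t0 B (cd B \<phi>) = t0 B (dm B \<phi>)"
  using two_category.dm_cd[OF hom_ends_two_category[OF dm_ob[OF assms]], of \<phi>] assms by auto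

lemma tg_ends:
  assumes "\<Gamma> \<in> cel B"
  shows "tg B \<Gamma> \<in> mor B" "dm B (tg B \<Gamma>) = dm B (sr B \<Gamma>)" "cd B (tg B \<Gamma>) = cd B (sr B \<Gamma>)"
proof -
  have H: "two_category (hom B (s0 B (dm B (sr B \<Gamma>))) (t0 B (dm B (sr B \<Gamma>))))"
    using assms by (intro hom_ends_two_category dm_ob sr_mor)
  show "tg B \<Gamma> \<in> mor B" using two_category.sr_tg[OF H, of \<Gamma>] assms by simp
  show "dm B (tg B \<Gamma>) = dm B (sr B \<Gamma>)" "cd B (tg B \<Gamma>) = cd B (sr B \<Gamma>)"
    using two_category.globular[OF H, of \<Gamma>] assms by simp_all
qed

lemma composable_ends:
  "\<phi> \<in> mor B \<Longrightarrow> \<psi> \<in> mor B \<Longrightarrow> cd B \<phi> = dm B \<psi> \<Longrightarrow> s0 B (dm B \<psi>) = s0 B (dm B \<phi>)"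
  "\<phi> \<in> mor B \<Longrightarrow> \<psi> \<in> mor B \<Longrightarrow> cd B \<phi> = dm B \<psi> \<Longrightarrow> t0 B (dm B \<psi>) = t0 B (dm B \<phi>)"
  using cd_ends(2,3) by metis+

text \<open>Boundaries preserve end objects, so any composable configuration lies in a single hom.
  The disjoint union of the homs is therefore itself a 2-category, and one calculus serves all of
  them.\<close>

lemma two_category_total: "two_category B"
proof
  fix f assume "f \<in> mor B"
  then show "dm B f \<in> ob B \<and> cd B f \<in> ob B" using dm_ob cd_ends by auto
next
  fix x assume "x \<in> cel B"
  then show "sr B x \<in> mor B \<and> tg B x \<in> mor B"
    and "dm B (sr B x) = dm B (tg B x) \<and> cd B (sr B x) = cd B (tg B x)"
    using sr_mor tg_ends by auto
next
  fix a assume a: "a \<in> ob B"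
  show "idn B a \<in> mors B a a"
    using two_category.idn_in[OF hom_ends_two_category[OF a], of a] a by (auto simp: mors_def)
next
  fix f a b g c assume *: "f \<in> mors B a b" "g \<in> mors B b c"
  then have a: "a \<in> ob B" "s0 B b = s0 B a" "t0 B b = t0 B a"
    using dm_ob cd_ends by (auto simp: mors_def)
  show "g \<odot> f \<in> mors B a c"
    using two_category.cmp_in[OF hom_ends_two_category[OF a(1)], of f a b g c] * a
    by (auto simp: mors_def)
next
  fix f a b g c h d assume *: "f \<in> mors B a b" "g \<in> mors B b c" "h \<in> mors B c d"
  then have a: "a \<in> ob B" "s0 B b = s0 B a" "t0 B b = t0 B a" "s0 B c = s0 B a" "t0 B c = t0 B a"
    using dm_ob cd_ends by (auto simp: mors_def)
  show "h \<odot> g \<odot> f = h \<odot> (g \<odot> f)"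
    using two_category.cmp_assoc[OF hom_ends_two_category[OF a(1)], of f a b g c h d] * a
    by (auto simp: mors_def)
next
  fix f a b assume *: "f \<in> mors B a b"
  then have a: "a \<in> ob B" using dm_ob by (auto simp: mors_def)
  show "f \<odot> idn B a = f \<and> idn B b \<odot> f = f"
    using two_category.cmp_idn[OF hom_ends_two_category[OF a(1)], of f a b] * a
    by (auto simp: mors_def)
next
  fix f assume *: "f \<in> mor B"
  then have a: "dm B f \<in> ob B" using dm_ob by auto
  show "\<langle>f\<rangle> \<in> cels B f f"
    using two_category.idc_in[OF hom_ends_two_category[OF a(1)], of f] *
    by (auto simp: cels_def)
next
  fix x f g y h assume *: "x \<in> cels B f g" "y \<in> cels B g h"
  then have a: "dm B f \<in> ob B" "dm B g = dm B f"
    using dm_ob sr_mor tg_ends by (auto simp: cels_def)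
  show "y \<bullet> x \<in> cels B f h"
    using two_category.vcmp_in[OF hom_ends_two_category[OF a(1)], of x f g y h] * a
    by (auto simp: cels_def)
next
  fix x f g y h z k assume *: "x \<in> cels B f g" "y \<in> cels B g h" "z \<in> cels B h k"
  then have a: "dm B f \<in> ob B" "dm B g = dm B f" "dm B h = dm B f"
    using dm_ob sr_mor tg_ends by (auto simp: cels_def)
  show "z \<bullet> y \<bullet> x = z \<bullet> (y \<bullet> x)"
    using two_category.vcmp_assoc[OF hom_ends_two_category[OF a(1)], of x f g y h z k] * a
    by (auto simp: cels_def)
next
  fix x f g assume *: "x \<in> cels B f g"
  then have a: "dm B f \<in> ob B"
    using dm_ob sr_mor by (auto simp: cels_def)
  show "x \<bullet> \<langle>f\<rangle> = x \<and> \<langle>g\<rangle> \<bullet> x = x"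
    using two_category.vcmp_idc[OF hom_ends_two_category[OF a(1)], of x f g] * a
    by (auto simp: cels_def)
  show "x \<star> \<langle>idn B (dm B f)\<rangle> = x \<and> \<langle>idn B (cd B f)\<rangle> \<star> x = x"
    using two_category.hcmp_idn[OF hom_ends_two_category[OF a(1)], of x f g] * a
    by (auto simp: cels_def)
next
  fix x f f' y g g' assume *: "x \<in> cels B f f'" "y \<in> cels B g g'" "cd B f = dm B g"
  then have a: "dm B f \<in> ob B" "s0 B (dm B g) = s0 B (dm B f)" "t0 B (dm B g) = t0 B (dm B f)"
    using dm_ob sr_mor cd_ends by (auto simp: cels_def simp flip: \<open>cd B f = dm B g\<close>)
  show "y \<star> x \<in> cels B (g \<odot> f) (g' \<odot> f')"
    using two_category.hcmp_in[OF hom_ends_two_category[OF a(1)], of x f f' y g g'] * a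
    by (auto simp: cels_def)
next
  fix x f f' y g g' z h h'
  assume *: "x \<in> cels B f f'" "y \<in> cels B g g'" "z \<in> cels B h h'" "cd B f = dm B g" "cd B g = dm B h"
  then have a: "dm B f \<in> ob B" "s0 B (dm B g) = s0 B (dm B f)" "t0 B (dm B g) = t0 B (dm B f)"
    "s0 B (dm B h) = s0 B (dm B f)" "t0 B (dm B h) = t0 B (dm B f)"
    using dm_ob sr_mor composable_ends[of f g] composable_ends[of g h] by (auto simp: cels_def)
  show "z \<star> y \<star> x = z \<star> (y \<star> x)"
    using two_category.hcmp_assoc[OF hom_ends_two_category[OF a(1)], of x f f' y g g' z h h'] * a
    by (auto simp: cels_def)
next
  fix f a b g c assume *: "f \<in> mors B a b" "g \<in> mors B b c"
  then have a: "a \<in> ob B" "s0 B b = s0 B a" "t0 B b = t0 B a"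
    using dm_ob cd_ends by (auto simp: mors_def)
  show "\<langle>g\<rangle> \<star> \<langle>f\<rangle> = \<langle>g \<odot> f\<rangle>"
    using two_category.hcmp_idc[OF hom_ends_two_category[OF a(1)], of f a b g c] * a
    by (auto simp: mors_def)
next
  fix x f f' x' f'' y g g' y' g''
  assume *: "x \<in> cels B f f'" "x' \<in> cels B f' f''" "y \<in> cels B g g'" "y' \<in> cels B g' g''"
    "cd B f = dm B g"
  then have a: "dm B f \<in> ob B" "s0 B (dm B g) = s0 B (dm B f)" "t0 B (dm B g) = t0 B (dm B f)"
    "dm B f' = dm B f" "dm B g' = dm B g"
    using dm_ob sr_mor tg_ends composable_ends[of f g] by (auto simp: cels_def)
  show "(y' \<bullet> y) \<star> (x' \<bullet> x) = y' \<star> x' \<bullet> y \<star> x"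
    using two_category.interchange[OF hom_ends_two_category[OF a(1)], of x f f' x' f'' y g g' y' g'']
      * a
    by (auto simp: cels_def)
qed

end

sublocale gray_category \<subseteq> two_category B
  by (rule two_category_total)

context gray_category
begin

declare cd_ends(2,3) [simp]

lemma one_simps [simp]:
  assumes "X \<in> pt B"
  shows "one B X \<in> ob B" "s0 B (one B X) = X" "t0 B (one B X) = X"
  using one_in[OF assms] by auto

lemma comp1_simps [simp]:
  assumes "g \<in> ob B" "f \<in> ob B" "s0 B g = t0 B f"
  shows "g \<cdot> f \<in> ob B" "s0 B (g \<cdot> f) = s0 B f" "t0 B (g \<cdot> f) = t0 B g"
  using two_functor.m0_in[OF lw_two_functor[of "s0 B f" g "t0 B f" "t0 B g"], of f] assms by auto

lemma lw2_simps [simp]: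
  assumes "g \<in> ob B" "\<phi> \<in> mor B" "s0 B g = t0 B (dm B \<phi>)"
  shows "g \<rhd> \<phi> \<in> mor B" "dm B (g \<rhd> \<phi>) = g \<cdot> dm B \<phi>" "cd B (g \<rhd> \<phi>) = g \<cdot> cd B \<phi>"
  using two_functor.m1_in[OF lw_two_functor[of "s0 B (dm B \<phi>)" g "s0 B g" "t0 B g"],
      of \<phi> "dm B \<phi>" "cd B \<phi>"] assms
  by (auto simp: mors_hom_iff)

lemma rw2_simps [simp]:
  assumes "f \<in> ob B" "\<phi> \<in> mor B" "s0 B (dm B \<phi>) = t0 B f"
  shows "\<phi> \<lhd> f \<in> mor B" "dm B (\<phi> \<lhd> f) = dm B \<phi> \<cdot> f" "cd B (\<phi> \<lhd> f) = cd B \<phi> \<cdot> f"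
  using two_functor.m1_in[OF rw_two_functor[of "t0 B (dm B \<phi>)" f "s0 B f" "t0 B f"],
      of \<phi> "dm B \<phi>" "cd B \<phi>"] assms
  by (auto simp: mors_hom_iff)

lemma lw3_simps [simp]:
  assumes "g \<in> ob B" "\<Gamma> \<in> cel B" "s0 B g = t0 B (dm B (sr B \<Gamma>))"
  shows "g \<unrhd> \<Gamma> \<in> cel B" "sr B (g \<unrhd> \<Gamma>) = g \<rhd> sr B \<Gamma>" "tg B (g \<unrhd> \<Gamma>) = g \<rhd> tg B \<Gamma>"
  using two_functor.m2_in[OF lw_two_functor[of "s0 B (dm B (sr B \<Gamma>))" g "s0 B g" "t0 B g"],
      of \<Gamma> "sr B \<Gamma>" "tg B \<Gamma>"] assms
  by (auto simp: cels_hom_iff)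

lemma rw3_simps [simp]:
  assumes "f \<in> ob B" "\<Gamma> \<in> cel B" "s0 B (dm B (sr B \<Gamma>)) = t0 B f"
  shows "\<Gamma> \<unlhd> f \<in> cel B" "sr B (\<Gamma> \<unlhd> f) = sr B \<Gamma> \<lhd> f" "tg B (\<Gamma> \<unlhd> f) = tg B \<Gamma> \<lhd> f"
  using two_functor.m2_in[OF rw_two_functor[of "t0 B (dm B (sr B \<Gamma>))" f "s0 B f" "t0 B f"],
      of \<Gamma> "sr B \<Gamma>" "tg B \<Gamma>"] assms
  by (auto simp: cels_hom_iff)

lemma lw_functor_simps [simp]:
  "g \<in> ob B \<Longrightarrow> f \<in> ob B \<Longrightarrow> s0 B g = t0 B f \<Longrightarrow> g \<rhd> idn B f = idn B (g \<cdot> f)"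
  "g \<in> ob B \<Longrightarrow> \<phi> \<in> mor B \<Longrightarrow> \<psi> \<in> mor B \<Longrightarrow> cd B \<phi> = dm B \<psi> \<Longrightarrow> s0 B g = t0 B (dm B \<phi>) \<Longrightarrow>
    g \<rhd> (\<psi> \<odot> \<phi>) = (g \<rhd> \<psi>) \<odot> (g \<rhd> \<phi>)"
  "g \<in> ob B \<Longrightarrow> \<phi> \<in> mor B \<Longrightarrow> s0 B g = t0 B (dm B \<phi>) \<Longrightarrow> g \<unrhd> \<langle>\<phi>\<rangle> = \<langle>g \<rhd> \<phi>\<rangle>"
  "g \<in> ob B \<Longrightarrow> x \<in> cel B \<Longrightarrow> y \<in> cel B \<Longrightarrow> tg B x = sr B y \<Longrightarrow> s0 B g = t0 B (dm B (sr B x)) \<Longrightarrow>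
    g \<unrhd> (y \<bullet> x) = (g \<unrhd> y) \<bullet> (g \<unrhd> x)"
  "g \<in> ob B \<Longrightarrow> x \<in> cel B \<Longrightarrow> y \<in> cel B \<Longrightarrow> cd B (sr B x) = dm B (sr B y) \<Longrightarrow>
    s0 B g = t0 B (dm B (sr B x)) \<Longrightarrow> g \<unrhd> (y \<star> x) = (g \<unrhd> y) \<star> (g \<unrhd> x)"
proof -
  assume g: "g \<in> ob B"
  note L = lw_two_functor[of _ g "s0 B g" "t0 B g"]
  show "g \<rhd> idn B f = idn B (g \<cdot> f)" if "f \<in> ob B" "s0 B g = t0 B f"
    using two_functor.m_idn[OF L[of "s0 B f"], of f] that g by auto
  show "g \<rhd> (\<psi> \<odot> \<phi>) = (g \<rhd> \<psi>) \<odot> (g \<rhd> \<phi>)"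
    if "\<phi> \<in> mor B" "\<psi> \<in> mor B" "cd B \<phi> = dm B \<psi>" "s0 B g = t0 B (dm B \<phi>)"
    using two_functor.m_cmp[OF L[of "s0 B (dm B \<phi>)"], of \<phi> "dm B \<phi>" "cd B \<phi>" \<psi> "cd B \<psi>"] that g
      composable_ends[OF that(1-3)] by (auto simp: mors_hom_iff)
  show "g \<unrhd> \<langle>\<phi>\<rangle> = \<langle>g \<rhd> \<phi>\<rangle>" if "\<phi> \<in> mor B" "s0 B g = t0 B (dm B \<phi>)"
    using two_functor.m_idc[OF L[of "s0 B (dm B \<phi>)"], of \<phi>] that g by auto
  show "g \<unrhd> (y \<bullet> x) = (g \<unrhd> y) \<bullet> (g \<unrhd> x)"
    if "x \<in> cel B" "y \<in> cel B" "tg B x = sr B y" "s0 B g = t0 B (dm B (sr B x))"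
    using two_functor.m_vcmp[OF L[of "s0 B (dm B (sr B x))"], of x "sr B x" "tg B x" y "tg B y"] that g
      tg_ends(2)[OF that(1)] by (auto simp: cels_hom_iff)
  show "g \<unrhd> (y \<star> x) = (g \<unrhd> y) \<star> (g \<unrhd> x)"
    if "x \<in> cel B" "y \<in> cel B" "cd B (sr B x) = dm B (sr B y)" "s0 B g = t0 B (dm B (sr B x))"
    using two_functor.m_hcmp[OF L[of "s0 B (dm B (sr B x))"], of x "sr B x" "tg B x" y "sr B y" "tg B y"]
      that g composable_ends[OF sr_mor[OF that(1)] sr_mor[OF that(2)] that(3)]
    by (auto simp: cels_hom_iff)
qed

lemma rw_functor_simps [simp]:
  "f \<in> ob B \<Longrightarrow> g \<in> ob B \<Longrightarrow> s0 B g = t0 B f \<Longrightarrow> idn B g \<lhd> f = idn B (g \<cdot> f)"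
  "f \<in> ob B \<Longrightarrow> \<phi> \<in> mor B \<Longrightarrow> \<psi> \<in> mor B \<Longrightarrow> cd B \<phi> = dm B \<psi> \<Longrightarrow> s0 B (dm B \<phi>) = t0 B f \<Longrightarrow>
    (\<psi> \<odot> \<phi>) \<lhd> f = (\<psi> \<lhd> f) \<odot> (\<phi> \<lhd> f)"
  "f \<in> ob B \<Longrightarrow> \<phi> \<in> mor B \<Longrightarrow> s0 B (dm B \<phi>) = t0 B f \<Longrightarrow> \<langle>\<phi>\<rangle> \<unlhd> f = \<langle>\<phi> \<lhd> f\<rangle>"
  "f \<in> ob B \<Longrightarrow> x \<in> cel B \<Longrightarrow> y \<in> cel B \<Longrightarrow> tg B x = sr B y \<Longrightarrow> s0 B (dm B (sr B x)) = t0 B f \<Longrightarrow>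
    (y \<bullet> x) \<unlhd> f = (y \<unlhd> f) \<bullet> (x \<unlhd> f)"
  "f \<in> ob B \<Longrightarrow> x \<in> cel B \<Longrightarrow> y \<in> cel B \<Longrightarrow> cd B (sr B x) = dm B (sr B y) \<Longrightarrow>
    s0 B (dm B (sr B x)) = t0 B f \<Longrightarrow> (y \<star> x) \<unlhd> f = (y \<unlhd> f) \<star> (x \<unlhd> f)"
proof -
  assume f: "f \<in> ob B"
  note L = rw_two_functor[of _ f "s0 B f" "t0 B f"]
  show "idn B g \<lhd> f = idn B (g \<cdot> f)" if "g \<in> ob B" "s0 B g = t0 B f"
    using two_functor.m_idn[OF L[of "t0 B g"], of g] that f by auto
  show "(\<psi> \<odot> \<phi>) \<lhd> f = (\<psi> \<lhd> f) \<odot> (\<phi> \<lhd> f)"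
    if "\<phi> \<in> mor B" "\<psi> \<in> mor B" "cd B \<phi> = dm B \<psi>" "s0 B (dm B \<phi>) = t0 B f"
    using two_functor.m_cmp[OF L[of "t0 B (dm B \<phi>)"], of \<phi> "dm B \<phi>" "cd B \<phi>" \<psi> "cd B \<psi>"] that f
      composable_ends[OF that(1-3)] by (auto simp: mors_hom_iff)
  show "\<langle>\<phi>\<rangle> \<unlhd> f = \<langle>\<phi> \<lhd> f\<rangle>" if "\<phi> \<in> mor B" "s0 B (dm B \<phi>) = t0 B f"
    using two_functor.m_idc[OF L[of "t0 B (dm B \<phi>)"], of \<phi>] that f by auto
  show "(y \<bullet> x) \<unlhd> f = (y \<unlhd> f) \<bullet> (x \<unlhd> f)"
    if "x \<in> cel B" "y \<in> cel B" "tg B x = sr B y" "s0 B (dm B (sr B x)) = t0 B f"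
    using two_functor.m_vcmp[OF L[of "t0 B (dm B (sr B x))"], of x "sr B x" "tg B x" y "tg B y"] that f
      tg_ends(2)[OF that(1)] by (auto simp: cels_hom_iff)
  show "(y \<star> x) \<unlhd> f = (y \<unlhd> f) \<star> (x \<unlhd> f)"
    if "x \<in> cel B" "y \<in> cel B" "cd B (sr B x) = dm B (sr B y)" "s0 B (dm B (sr B x)) = t0 B f"
    using two_functor.m_hcmp[OF L[of "t0 B (dm B (sr B x))"], of x "sr B x" "tg B x" y "sr B y" "tg B y"]
      that f composable_ends[OF sr_mor[OF that(1)] sr_mor[OF that(2)] that(3)]
    by (auto simp: cels_hom_iff)
qed

lemma lw3_iso [simp]:
  assumes "g \<in> ob B" "invertible B \<Gamma>" "s0 B g = t0 B (dm B (sr B \<Gamma>))"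
  shows "invertible B (g \<unrhd> \<Gamma>)" "cinv B (g \<unrhd> \<Gamma>) = g \<unrhd> cinv B \<Gamma>"
  using isoI[of "g \<unrhd> \<Gamma>" "g \<unrhd> cinv B \<Gamma>"] assms by (auto simp flip: lw_functor_simps(4))

lemma rw3_iso [simp]:
  assumes "f \<in> ob B" "invertible B \<Gamma>" "s0 B (dm B (sr B \<Gamma>)) = t0 B f"
  shows "invertible B (\<Gamma> \<unlhd> f)" "cinv B (\<Gamma> \<unlhd> f) = cinv B \<Gamma> \<unlhd> f"
  using isoI[of "\<Gamma> \<unlhd> f" "cinv B \<Gamma> \<unlhd> f"] assms by (auto simp flip: rw_functor_simps(4))

lemma unit_simps [simp]:
  "f \<in> ob B \<Longrightarrow> t0 B f = Y \<Longrightarrow> one B Y \<cdot> f = f" "f \<in> ob B \<Longrightarrow> s0 B f = X \<Longrightarrow> f \<cdot> one B X = f"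
  "\<phi> \<in> mor B \<Longrightarrow> t0 B (dm B \<phi>) = Y \<Longrightarrow> one B Y \<rhd> \<phi> = \<phi>"
  "\<phi> \<in> mor B \<Longrightarrow> s0 B (dm B \<phi>) = X \<Longrightarrow> \<phi> \<lhd> one B X = \<phi>"
  "\<Gamma> \<in> cel B \<Longrightarrow> t0 B (dm B (sr B \<Gamma>)) = Y \<Longrightarrow> one B Y \<unrhd> \<Gamma> = \<Gamma>"
  "\<Gamma> \<in> cel B \<Longrightarrow> s0 B (dm B (sr B \<Gamma>)) = X \<Longrightarrow> \<Gamma> \<unlhd> one B X = \<Gamma>"
  subgoal using unit1[of f "s0 B f" Y] by auto
  subgoal using unit1[of f X "t0 B f"] by auto
  subgoal using unit2[of \<phi> "s0 B (dm B \<phi>)" Y] by auto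
  subgoal using unit2[of \<phi> X "t0 B (dm B \<phi>)"] by auto
  subgoal using unit3[of \<Gamma> "s0 B (dm B (sr B \<Gamma>))" Y] by auto
  subgoal using unit3[of \<Gamma> X "t0 B (dm B (sr B \<Gamma>))"] by auto
  done

lemma comp1_assoc_simp [simp]:
  "f \<in> ob B \<Longrightarrow> g \<in> ob B \<Longrightarrow> h \<in> ob B \<Longrightarrow> s0 B g = t0 B f \<Longrightarrow> s0 B h = t0 B g \<Longrightarrow>
    (h \<cdot> g) \<cdot> f = h \<cdot> (g \<cdot> f)"
  using assoc1[of f "s0 B f" "t0 B f" g "t0 B g" h "t0 B h"] by auto

lemma whisker_assoc_simps [simp]:
  "\<phi> \<in> mor B \<Longrightarrow> g \<in> ob B \<Longrightarrow> h \<in> ob B \<Longrightarrow> s0 B g = t0 B (dm B \<phi>) \<Longrightarrow> s0 B h = t0 B g \<Longrightarrow>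
    (h \<cdot> g) \<rhd> \<phi> = h \<rhd> (g \<rhd> \<phi>)"
  "f \<in> ob B \<Longrightarrow> \<phi> \<in> mor B \<Longrightarrow> h \<in> ob B \<Longrightarrow> s0 B (dm B \<phi>) = t0 B f \<Longrightarrow> s0 B h = t0 B (dm B \<phi>) \<Longrightarrow>
    (h \<rhd> \<phi>) \<lhd> f = h \<rhd> (\<phi> \<lhd> f)"
  "f \<in> ob B \<Longrightarrow> g \<in> ob B \<Longrightarrow> \<phi> \<in> mor B \<Longrightarrow> s0 B g = t0 B f \<Longrightarrow> s0 B (dm B \<phi>) = t0 B g \<Longrightarrow>
    (\<phi> \<lhd> g) \<lhd> f = \<phi> \<lhd> (g \<cdot> f)"
  "\<Gamma> \<in> cel B \<Longrightarrow> g \<in> ob B \<Longrightarrow> h \<in> ob B \<Longrightarrow> s0 B g = t0 B (dm B (sr B \<Gamma>)) \<Longrightarrow> s0 B h = t0 B g \<Longrightarrow>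
    (h \<cdot> g) \<unrhd> \<Gamma> = h \<unrhd> (g \<unrhd> \<Gamma>)"
  "f \<in> ob B \<Longrightarrow> \<Gamma> \<in> cel B \<Longrightarrow> h \<in> ob B \<Longrightarrow> s0 B (dm B (sr B \<Gamma>)) = t0 B f \<Longrightarrow>
    s0 B h = t0 B (dm B (sr B \<Gamma>)) \<Longrightarrow> (h \<unrhd> \<Gamma>) \<unlhd> f = h \<unrhd> (\<Gamma> \<unlhd> f)"
  "f \<in> ob B \<Longrightarrow> g \<in> ob B \<Longrightarrow> \<Gamma> \<in> cel B \<Longrightarrow> s0 B g = t0 B f \<Longrightarrow> s0 B (dm B (sr B \<Gamma>)) = t0 B g \<Longrightarrow>
    (\<Gamma> \<unlhd> g) \<unlhd> f = \<Gamma> \<unlhd> (g \<cdot> f)"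
  subgoal using assoc2_ll[of \<phi> "s0 B (dm B \<phi>)" "t0 B (dm B \<phi>)" g "t0 B g" h "t0 B h"] by auto
  subgoal using assoc2_lr[of f "s0 B f" "t0 B f" \<phi> "t0 B (dm B \<phi>)" h "t0 B h"] by auto
  subgoal using assoc2_rr[of f "s0 B f" "t0 B f" g "t0 B g" \<phi> "t0 B (dm B \<phi>)"] by auto
  subgoal using assoc3_ll[of \<Gamma> "s0 B (dm B (sr B \<Gamma>))" "t0 B (dm B (sr B \<Gamma>))" g "t0 B g" h "t0 B h"] by auto
  subgoal using assoc3_lr[of f "s0 B f" "t0 B f" \<Gamma> "t0 B (dm B (sr B \<Gamma>))" h "t0 B h"] by auto
  subgoal using assoc3_rr[of f "s0 B f" "t0 B f" g "t0 B g" \<Gamma> "t0 B (dm B (sr B \<Gamma>))"] by auto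
  done

lemma ich_simps [simp]:
  assumes "\<alpha> \<in> mor B" "\<beta> \<in> mor B" "s0 B (dm B \<beta>) = t0 B (dm B \<alpha>)"
  shows "invertible B (ich B \<beta> \<alpha>)"
    "sr B (ich B \<beta> \<alpha>) = (cd B \<beta> \<rhd> \<alpha>) \<odot> (\<beta> \<lhd> dm B \<alpha>)"
    "tg B (ich B \<beta> \<alpha>) = (\<beta> \<lhd> cd B \<alpha>) \<odot> (dm B \<beta> \<rhd> \<alpha>)"
proof -
  have i: "ich B \<beta> \<alpha> \<in> icels (hom B (s0 B (dm B \<alpha>)) (t0 B (dm B \<beta>)))
      ((cd B \<beta> \<rhd> \<alpha>) \<odot> (\<beta> \<lhd> dm B \<alpha>)) ((\<beta> \<lhd> cd B \<alpha>) \<odot> (dm B \<beta> \<rhd> \<alpha>))"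
    by (rule ich_in) (simp_all add: mors_hom_iff assms)
  have *: "invertible B x \<and> sr B x = f \<and> tg B x = g" if "x \<in> icels (hom B X Z) f g" for x X Z f g
    using that by (auto simp: icels_def cels_hom_iff invertible_def inverse_cells_def) (auto simp: cels_def)
  show "invertible B (ich B \<beta> \<alpha>)"
    "sr B (ich B \<beta> \<alpha>) = (cd B \<beta> \<rhd> \<alpha>) \<odot> (\<beta> \<lhd> dm B \<alpha>)"
    "tg B (ich B \<beta> \<alpha>) = (\<beta> \<lhd> cd B \<alpha>) \<odot> (dm B \<beta> \<rhd> \<alpha>)"
    using *[OF i] by blast+
qed

lemma ich_idn_simps [simp]:
  "\<alpha> \<in> mor B \<Longrightarrow> g \<in> ob B \<Longrightarrow> s0 B g = t0 B (dm B \<alpha>) \<Longrightarrow> ich B (idn B g) \<alpha> = \<langle>g \<rhd> \<alpha>\<rangle>"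
  "f \<in> ob B \<Longrightarrow> \<beta> \<in> mor B \<Longrightarrow> s0 B (dm B \<beta>) = t0 B f \<Longrightarrow> ich B \<beta> (idn B f) = \<langle>\<beta> \<lhd> f\<rangle>"
  using ich_idn_left[of \<alpha> "s0 B (dm B \<alpha>)" "t0 B (dm B \<alpha>)" "dm B \<alpha>" "cd B \<alpha>" g "t0 B g"]
    ich_idn_right[of f "s0 B f" "t0 B f" \<beta> "t0 B (dm B \<beta>)" "dm B \<beta>" "cd B \<beta>"]
  by (auto simp: mors_hom_iff)

lemma ich_assoc_simps [simp]:
  "\<alpha> \<in> mor B \<Longrightarrow> \<beta> \<in> mor B \<Longrightarrow> h \<in> ob B \<Longrightarrow> s0 B (dm B \<beta>) = t0 B (dm B \<alpha>) \<Longrightarrow>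
    s0 B h = t0 B (dm B \<beta>) \<Longrightarrow> ich B (h \<rhd> \<beta>) \<alpha> = h \<unrhd> ich B \<beta> \<alpha>"
  "\<alpha> \<in> mor B \<Longrightarrow> g \<in> ob B \<Longrightarrow> \<beta> \<in> mor B \<Longrightarrow> s0 B g = t0 B (dm B \<alpha>) \<Longrightarrow>
    s0 B (dm B \<beta>) = t0 B g \<Longrightarrow> ich B (\<beta> \<lhd> g) \<alpha> = ich B \<beta> (g \<rhd> \<alpha>)"
  "f \<in> ob B \<Longrightarrow> \<alpha> \<in> mor B \<Longrightarrow> \<beta> \<in> mor B \<Longrightarrow> s0 B (dm B \<alpha>) = t0 B f \<Longrightarrow>
    s0 B (dm B \<beta>) = t0 B (dm B \<alpha>) \<Longrightarrow> ich B \<beta> (\<alpha> \<lhd> f) = ich B \<beta> \<alpha> \<unlhd> f"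
  subgoal using ich_assoc_left[of \<alpha> "s0 B (dm B \<alpha>)" "t0 B (dm B \<alpha>)" \<beta> "t0 B (dm B \<beta>)" h "t0 B h"] by auto
  subgoal using ich_assoc_middle[of \<alpha> "s0 B (dm B \<alpha>)" "t0 B (dm B \<alpha>)" g "t0 B g" \<beta> "t0 B (dm B \<beta>)"] by auto
  subgoal using ich_assoc_right[of f "s0 B f" "t0 B f" \<alpha> "t0 B (dm B \<alpha>)" \<beta> "t0 B (dm B \<beta>)"] by auto
  done

lemma iso_hom_iff: "invertible (hom B X Y) x \<longleftrightarrow> invertible B x \<and> s0 B (dm B (sr B x)) = X \<and> t0 B (dm B (sr B x)) = Y"
  by (auto simp: invertible_def inverse_cells_def cels_hom_iff) (auto simp: cels_def)

end

context two_category
begin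

lemma iso_cancel_leftD:
  assumes "x \<bullet> y = x \<bullet> z" "invertible C x" "y \<in> cel C" "z \<in> cel C" "tg C y = sr C x" "tg C z = sr C x"
  shows "y = z"
  using iso_cancel_left[of x y z] assms by blast

lemma iso_cancel_rightD:
  assumes "y \<bullet> x = z \<bullet> x" "invertible C x" "y \<in> cel C" "z \<in> cel C" "sr C y = tg C x" "sr C z = tg C x"
  shows "y = z"
  using iso_cancel_right[of x y z] assms by blast

subsection \<open>Adjoint equivalences\<close>

lemma adjoint_equivalence_iff:
  "adjoint_equivalence C a b e \<longleftrightarrow>
     ladj e \<in> mor C \<and> dm C (ladj e) = a \<and> cd C (ladj e) = b \<and>
     radj e \<in> mor C \<and> dm C (radj e) = b \<and> cd C (radj e) = a \<and>
     invertible C (aunit e) \<and> sr C (aunit e) = idn C a \<and> tg C (aunit e) = radj e \<odot> ladj e \<and>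
     invertible C (acounit e) \<and> sr C (acounit e) = ladj e \<odot> radj e \<and> tg C (acounit e) = idn C b \<and>
     (acounit e \<star> \<langle>ladj e\<rangle>) \<bullet> (\<langle>ladj e\<rangle> \<star> aunit e) = \<langle>ladj e\<rangle> \<and>
     (\<langle>radj e\<rangle> \<star> acounit e) \<bullet> (aunit e \<star> \<langle>radj e\<rangle>) = \<langle>radj e\<rangle>"
  by (auto simp: adjoint_equivalence_def icels_iff mors_def)

lemma adjoint_equivalenceD:
  assumes "adjoint_equivalence C a b e"
  shows "ladj e \<in> mor C" "dm C (ladj e) = a" "cd C (ladj e) = b"
    "radj e \<in> mor C" "dm C (radj e) = b" "cd C (radj e) = a"
    "invertible C (aunit e)" "sr C (aunit e) = idn C a" "tg C (aunit e) = radj e \<odot> ladj e"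
    "invertible C (acounit e)" "sr C (acounit e) = ladj e \<odot> radj e" "tg C (acounit e) = idn C b"
    "(acounit e \<star> \<langle>ladj e\<rangle>) \<bullet> (\<langle>ladj e\<rangle> \<star> aunit e) = \<langle>ladj e\<rangle>"
    "(\<langle>radj e\<rangle> \<star> acounit e) \<bullet> (aunit e \<star> \<langle>radj e\<rangle>) = \<langle>radj e\<rangle>"
    "a \<in> ob C" "b \<in> ob C"
  using assms mor_simps(1,2)[of "ladj e"] unfolding adjoint_equivalence_iff by auto

lemma adj_id_equivalence: "a \<in> ob C \<Longrightarrow> adjoint_equivalence C a a (adj_id C a)"
  by (simp add: adjoint_equivalence_iff adj_id_def)

text \<open>In each triangle composite the counit of \<open>e\<close> meets the unit of
  \<open>e'\<close>. Once these two have been exchanged, the composite falls apart into a triangle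
  of \<open>e\<close> followed by a triangle of \<open>e'\<close>.\<close>

lemma adj_comp_equivalence:
  assumes "adjoint_equivalence C a b e" "adjoint_equivalence C b c e'"
  shows "adjoint_equivalence C a c (adj_comp C e' e)"
proof -
  note e = adjoint_equivalenceD[OF assms(1)] and e' = adjoint_equivalenceD[OF assms(2)]
  let ?l = "ladj e" and ?r = "radj e" and ?\<eta> = "aunit e" and ?\<epsilon> = "acounit e"
  let ?l' = "ladj e'" and ?r' = "radj e'" and ?\<eta>' = "aunit e'" and ?\<epsilon>' = "acounit e'"
  note s = e(1-12,15,16) e'(1-12,15,16)
  \<comment> \<open>The exchange: both orders equal \<open>?\<eta>' \<bullet> ?\<epsilon>\<close> up
    to whiskering, because the counit ends and the unit begins at an identity 1-cell.\<close>
  have 1: "(\<langle>?l'\<rangle> \<star> (?\<epsilon> \<star> \<langle>?r' \<odot> (?l' \<odot> ?l)\<rangle>)) \<bullet> (\<langle>?l' \<odot> (?l \<odot> ?r)\<rangle> \<star> (?\<eta>' \<star> \<langle>?l\<rangle>)) =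
      (\<langle>?l'\<rangle> \<star> (?\<eta>' \<star> \<langle>?l\<rangle>)) \<bullet> (\<langle>?l'\<rangle> \<star> (?\<epsilon> \<star> \<langle>?l\<rangle>))"
  proof -
    have "(?\<epsilon> \<star> \<langle>?r' \<odot> ?l'\<rangle>) \<bullet> (\<langle>?l \<odot> ?r\<rangle> \<star> ?\<eta>') = ?\<eta>' \<bullet> ?\<epsilon>"
      using hcmp_slide[of ?\<eta>' ?\<epsilon>] s by simp
    then have "\<langle>?l'\<rangle> \<star> (((?\<epsilon> \<star> \<langle>?r' \<odot> ?l'\<rangle>) \<bullet> (\<langle>?l \<odot> ?r\<rangle> \<star> ?\<eta>')) \<star> \<langle>?l\<rangle>) =
      \<langle>?l'\<rangle> \<star> ((?\<eta>' \<bullet> ?\<epsilon>) \<star> \<langle>?l\<rangle>)" by simp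
    then show ?thesis using s by simp
  qed
  have 2: "(\<langle>?r \<odot> (?r' \<odot> ?l')\<rangle> \<star> (?\<epsilon> \<star> \<langle>?r'\<rangle>)) \<bullet> (\<langle>?r\<rangle> \<star> (?\<eta>' \<star> \<langle>?l \<odot> (?r \<odot> ?r')\<rangle>)) =
      (\<langle>?r\<rangle> \<star> (?\<eta>' \<star> \<langle>?r'\<rangle>)) \<bullet> (\<langle>?r\<rangle> \<star> (?\<epsilon> \<star> \<langle>?r'\<rangle>))"
  proof -
    have "(\<langle>?r' \<odot> ?l'\<rangle> \<star> ?\<epsilon>) \<bullet> (?\<eta>' \<star> \<langle>?l \<odot> ?r\<rangle>) = ?\<eta>' \<bullet> ?\<epsilon>"
      using hcmp_slide[of ?\<epsilon> ?\<eta>'] s by simp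
    then have "\<langle>?r\<rangle> \<star> (((\<langle>?r' \<odot> ?l'\<rangle> \<star> ?\<epsilon>) \<bullet> (?\<eta>' \<star> \<langle>?l \<odot> ?r\<rangle>)) \<star> \<langle>?r'\<rangle>) =
      \<langle>?r\<rangle> \<star> ((?\<eta>' \<bullet> ?\<epsilon>) \<star> \<langle>?r'\<rangle>)" by simp
    then show ?thesis using s by simp
  qed
  have t1: "(\<langle>?l'\<rangle> \<star> (?\<epsilon> \<star> \<langle>?l\<rangle>)) \<bullet> (\<langle>?l' \<odot> ?l\<rangle> \<star> ?\<eta>) = \<langle>?l' \<odot> ?l\<rangle>"
  proof -
    have "\<langle>?l'\<rangle> \<star> ((?\<epsilon> \<star> \<langle>?l\<rangle>) \<bullet> (\<langle>?l\<rangle> \<star> ?\<eta>)) = \<langle>?l' \<odot> ?l\<rangle>" unfolding e(13) using s by simp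
    then show ?thesis using s by simp
  qed
  have t1': "(?\<epsilon>' \<star> \<langle>?l' \<odot> ?l\<rangle>) \<bullet> (\<langle>?l'\<rangle> \<star> (?\<eta>' \<star> \<langle>?l\<rangle>)) = \<langle>?l' \<odot> ?l\<rangle>"
  proof -
    have "((?\<epsilon>' \<star> \<langle>?l'\<rangle>) \<bullet> (\<langle>?l'\<rangle> \<star> ?\<eta>')) \<star> \<langle>?l\<rangle> = \<langle>?l' \<odot> ?l\<rangle>" unfolding e'(13) using s by simp
    then show ?thesis using s by simp
  qed
  have t2: "(\<langle>?r\<rangle> \<star> (?\<epsilon> \<star> \<langle>?r'\<rangle>)) \<bullet> (?\<eta> \<star> \<langle>?r \<odot> ?r'\<rangle>) = \<langle>?r \<odot> ?r'\<rangle>"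
  proof -
    have "((\<langle>?r\<rangle> \<star> ?\<epsilon>) \<bullet> (?\<eta> \<star> \<langle>?r\<rangle>)) \<star> \<langle>?r'\<rangle> = \<langle>?r \<odot> ?r'\<rangle>" unfolding e(14) using s by simp
    then show ?thesis using s by simp
  qed
  have t2': "(\<langle>?r \<odot> ?r'\<rangle> \<star> ?\<epsilon>') \<bullet> (\<langle>?r\<rangle> \<star> (?\<eta>' \<star> \<langle>?r'\<rangle>)) = \<langle>?r \<odot> ?r'\<rangle>"
  proof -
    have "\<langle>?r\<rangle> \<star> ((\<langle>?r'\<rangle> \<star> ?\<epsilon>') \<bullet> (?\<eta>' \<star> \<langle>?r'\<rangle>)) = \<langle>?r \<odot> ?r'\<rangle>" unfolding e'(14) using s by simp
    then show ?thesis using s by simp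
  qed
  have "(?\<epsilon>' \<star> \<langle>?l' \<odot> ?l\<rangle>) \<bullet> ((\<langle>?l'\<rangle> \<star> (?\<epsilon> \<star> \<langle>?r' \<odot> (?l' \<odot> ?l)\<rangle>)) \<bullet>
      ((\<langle>?l' \<odot> (?l \<odot> ?r)\<rangle> \<star> (?\<eta>' \<star> \<langle>?l\<rangle>)) \<bullet> (\<langle>?l' \<odot> ?l\<rangle> \<star> ?\<eta>))) = \<langle>?l' \<odot> ?l\<rangle>"
  proof -
    have "(\<langle>?l'\<rangle> \<star> (?\<epsilon> \<star> \<langle>?r' \<odot> (?l' \<odot> ?l)\<rangle>)) \<bullet>
        ((\<langle>?l' \<odot> (?l \<odot> ?r)\<rangle> \<star> (?\<eta>' \<star> \<langle>?l\<rangle>)) \<bullet> (\<langle>?l' \<odot> ?l\<rangle> \<star> ?\<eta>)) =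
        (\<langle>?l'\<rangle> \<star> (?\<eta>' \<star> \<langle>?l\<rangle>)) \<bullet> ((\<langle>?l'\<rangle> \<star> (?\<epsilon> \<star> \<langle>?l\<rangle>)) \<bullet> (\<langle>?l' \<odot> ?l\<rangle> \<star> ?\<eta>))"
      by (rule vcmp_prefix[OF 1]) (use s in simp_all)
    then show ?thesis using s t1 t1' by simp
  qed
  moreover have "(\<langle>?r \<odot> ?r'\<rangle> \<star> ?\<epsilon>') \<bullet> ((\<langle>?r \<odot> (?r' \<odot> ?l')\<rangle> \<star> (?\<epsilon> \<star> \<langle>?r'\<rangle>)) \<bullet>
      ((\<langle>?r\<rangle> \<star> (?\<eta>' \<star> \<langle>?l \<odot> (?r \<odot> ?r')\<rangle>)) \<bullet> (?\<eta> \<star> \<langle>?r \<odot> ?r'\<rangle>))) = \<langle>?r \<odot> ?r'\<rangle>"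
  proof -
    have "(\<langle>?r \<odot> (?r' \<odot> ?l')\<rangle> \<star> (?\<epsilon> \<star> \<langle>?r'\<rangle>)) \<bullet>
        ((\<langle>?r\<rangle> \<star> (?\<eta>' \<star> \<langle>?l \<odot> (?r \<odot> ?r')\<rangle>)) \<bullet> (?\<eta> \<star> \<langle>?r \<odot> ?r'\<rangle>)) =
        (\<langle>?r\<rangle> \<star> (?\<eta>' \<star> \<langle>?r'\<rangle>)) \<bullet> ((\<langle>?r\<rangle> \<star> (?\<epsilon> \<star> \<langle>?r'\<rangle>)) \<bullet> (?\<eta> \<star> \<langle>?r \<odot> ?r'\<rangle>))"
      by (rule vcmp_prefix[OF 2]) (use s in simp_all)
    then show ?thesis using s t2 t2' by simp
  qed
  ultimately show ?thesis
    using s by (simp add: adjoint_equivalence_iff adj_comp_def)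
qed

definition adj_opp :: "('b, 'c) adjeq \<Rightarrow> ('b, 'c) adjeq" where
  "adj_opp e = \<lparr>ladj = radj e, radj = ladj e,
     aunit = cinv C (acounit e), acounit = cinv C (aunit e)\<rparr>"

text \<open>Inverting a triangle identity reverses its two factors, which turns the first triangle
  identity into the second one of the reversed data and conversely.\<close>

lemma adj_opp_equivalence:
  assumes "adjoint_equivalence C a b e"
  shows "adjoint_equivalence C b a (adj_opp e)"
proof -
  note e = adjoint_equivalenceD[OF assms]
  have "cinv C ((acounit e \<star> \<langle>ladj e\<rangle>) \<bullet> (\<langle>ladj e\<rangle> \<star> aunit e)) = \<langle>ladj e\<rangle>"
    "cinv C ((\<langle>radj e\<rangle> \<star> acounit e) \<bullet> (aunit e \<star> \<langle>radj e\<rangle>)) = \<langle>radj e\<rangle>"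
    unfolding e(13,14) using e(1-12) by simp_all
  then show ?thesis using e(1-12,15,16) by (simp add: adjoint_equivalence_iff adj_opp_def)
qed

lemma adj_opp_opp:
  "adjoint_equivalence C a b e \<Longrightarrow> adj_opp (adj_opp e) = e"
  using adjoint_equivalenceD[of a b e] by (simp add: adj_opp_def)

text \<open>Whiskering with an equivalence is full: \<open>z\<close> is carried along the right
  adjoint and conjugated with the unit, giving a cell \<open>f\<close> to \<open>g\<close> through
  \<open>radj e \<odot> ladj e\<close>.\<close>

lemma equivalence_whisker_surj:
  assumes e: "adjoint_equivalence C a b e"
    and f: "f \<in> mor C" "g \<in> mor C" "cd C f = a" "cd C g = a"
    and z: "z \<in> cel C" "sr C z = ladj e \<odot> f" "tg C z = ladj e \<odot> g"
  obtains x where "x \<in> cel C" "sr C x = f" "tg C x = g" "\<langle>ladj e\<rangle> \<star> x = z" "invertible C z \<Longrightarrow> invertible C x"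
proof -
  note e' = adjoint_equivalenceD[OF e]
  let ?l = "ladj e" and ?r = "radj e" and ?\<eta> = "aunit e" and ?\<epsilon> = "acounit e"
  define x where "x = (cinv C ?\<eta> \<star> \<langle>g\<rangle>) \<bullet> ((\<langle>?r\<rangle> \<star> z) \<bullet> (?\<eta> \<star> \<langle>f\<rangle>))"
  note s = e'(1-12,15,16) f z
  have dg: "dm C g = dm C f" using z s by (metis mor_simps(5) cmp_simps(2))
  \<comment> \<open>The triangle identity trades the inverse unit for the counit, and the counit can
    slide past \<open>z\<close>.\<close>
  have inv: "\<langle>?l\<rangle> \<star> cinv C ?\<eta> = ?\<epsilon> \<star> \<langle>?l\<rangle>"
  proof -
    have "((?\<epsilon> \<star> \<langle>?l\<rangle>) \<bullet> (\<langle>?l\<rangle> \<star> ?\<eta>)) \<bullet> cinv C (\<langle>?l\<rangle> \<star> ?\<eta>) = cinv C (\<langle>?l\<rangle> \<star> ?\<eta>)"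
      unfolding e'(13) using s by simp
    moreover have "(\<langle>?l\<rangle> \<star> ?\<eta>) \<bullet> cinv C (\<langle>?l\<rangle> \<star> ?\<eta>) = \<langle>tg C (\<langle>?l\<rangle> \<star> ?\<eta>)\<rangle>"
      using s by (intro cinv_simps) simp
    ultimately show ?thesis using s by simp
  qed
  have x: "x \<in> cel C" "sr C x = f" "tg C x = g" unfolding x_def using s dg by simp_all
  have slide: "(?\<epsilon> \<star> \<langle>?l \<odot> g\<rangle>) \<bullet> (\<langle>?l \<odot> ?r\<rangle> \<star> z) = z \<bullet> (?\<epsilon> \<star> \<langle>?l \<odot> f\<rangle>)"
    using hcmp_slide[of z ?\<epsilon>] s by simp
  have tri: "(?\<epsilon> \<star> \<langle>?l \<odot> f\<rangle>) \<bullet> (\<langle>?l\<rangle> \<star> (?\<eta> \<star> \<langle>f\<rangle>)) = \<langle>?l \<odot> f\<rangle>"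
  proof -
    have "((?\<epsilon> \<star> \<langle>?l\<rangle>) \<bullet> (\<langle>?l\<rangle> \<star> ?\<eta>)) \<star> \<langle>f\<rangle> = \<langle>?l \<odot> f\<rangle>" unfolding e'(13) using s by simp
    then show ?thesis using s by simp
  qed
  have "\<langle>?l\<rangle> \<star> x = (\<langle>?l\<rangle> \<star> (cinv C ?\<eta> \<star> \<langle>g\<rangle>)) \<bullet> ((\<langle>?l \<odot> ?r\<rangle> \<star> z) \<bullet> (\<langle>?l\<rangle> \<star> (?\<eta> \<star> \<langle>f\<rangle>)))"
    unfolding x_def using s dg by simp
  also have "\<langle>?l\<rangle> \<star> (cinv C ?\<eta> \<star> \<langle>g\<rangle>) = ?\<epsilon> \<star> \<langle>?l \<odot> g\<rangle>"
  proof -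
    have "\<langle>?l\<rangle> \<star> (cinv C ?\<eta> \<star> \<langle>g\<rangle>) = (\<langle>?l\<rangle> \<star> cinv C ?\<eta>) \<star> \<langle>g\<rangle>" using s by simp
    then show ?thesis unfolding inv using s by simp
  qed
  also have "(?\<epsilon> \<star> \<langle>?l \<odot> g\<rangle>) \<bullet> ((\<langle>?l \<odot> ?r\<rangle> \<star> z) \<bullet> (\<langle>?l\<rangle> \<star> (?\<eta> \<star> \<langle>f\<rangle>))) =
      z \<bullet> ((?\<epsilon> \<star> \<langle>?l \<odot> f\<rangle>) \<bullet> (\<langle>?l\<rangle> \<star> (?\<eta> \<star> \<langle>f\<rangle>)))"
    by (rule vcmp_prefix[OF slide]) (use s dg in simp_all)
  also have "\<dots> = z" unfolding tri using s by simp
  finally have "\<langle>?l\<rangle> \<star> x = z" .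
  moreover have "invertible C x" if "invertible C z"
    unfolding x_def using s dg that by simp
  ultimately show thesis using x that by blast
qed

text \<open>Whiskering once more with the right adjoint gives equality under
  \<open>radj e \<odot> ladj e\<close>; naturality of the invertible unit then removes that
  factor.\<close>

lemma equivalence_whisker_inj:
  assumes e: "adjoint_equivalence C a b e"
    and x: "x \<in> cel C" "cd C (sr C x) = a" and y: "y \<in> cel C" "sr C y = sr C x" "tg C y = tg C x"
    and eq: "\<langle>ladj e\<rangle> \<star> x = \<langle>ladj e\<rangle> \<star> y"
  shows "x = y"
proof -
  note e' = adjoint_equivalenceD[OF e]
  let ?r = "radj e" and ?\<eta> = "aunit e"
  have slide: "(?\<eta> \<star> \<langle>tg C u\<rangle>) \<bullet> u = (\<langle>?r \<odot> ladj e\<rangle> \<star> u) \<bullet> (?\<eta> \<star> \<langle>sr C u\<rangle>)"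
    if "u \<in> cel C" "cd C (sr C u) = a" for u
    using hcmp_slide[of u ?\<eta>] that e' by simp
  have "\<langle>?r \<odot> ladj e\<rangle> \<star> x = \<langle>?r \<odot> ladj e\<rangle> \<star> y"
  proof -
    have "\<langle>?r\<rangle> \<star> (\<langle>ladj e\<rangle> \<star> x) = \<langle>?r\<rangle> \<star> (\<langle>ladj e\<rangle> \<star> y)" using eq by simp
    then show ?thesis using e'(1-12) x y by simp
  qed
  then have "(?\<eta> \<star> \<langle>tg C x\<rangle>) \<bullet> x = (?\<eta> \<star> \<langle>tg C x\<rangle>) \<bullet> y"
    using slide[of x] slide[of y] x y by simp
  then show ?thesis
    by (rule iso_cancel_leftD) (use e'(1-12,15,16) x y in simp_all)
qed

subsection \<open>Cylinders between squares\<close>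

text \<open>The three laws of a trimodification have the form \<open>cyl\<close>, the law of a perturbation has the
  form \<open>cocyl\<close>, where the squares are pastings of components and interchangers.\<close>

definition cyl :: "'b \<Rightarrow> 'b \<Rightarrow> 'c \<Rightarrow> 'c \<Rightarrow> 'c \<Rightarrow> 'c \<Rightarrow> bool" where
  "cyl a b \<alpha> \<beta> s s' \<longleftrightarrow> (\<beta> \<star> \<langle>b\<rangle>) \<bullet> s = s' \<bullet> (\<langle>a\<rangle> \<star> \<alpha>)"

definition cocyl :: "'b \<Rightarrow> 'b \<Rightarrow> 'c \<Rightarrow> 'c \<Rightarrow> 'c \<Rightarrow> 'c \<Rightarrow> bool" where
  "cocyl P Q \<omega> \<omega>' s s' \<longleftrightarrow> s' \<bullet> (\<omega> \<star> \<langle>P\<rangle>) = (\<langle>Q\<rangle> \<star> \<omega>') \<bullet> s"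

text \<open>Naming the four corners keeps the typing equations oriented, so that the simplifier terminates.\<close>

lemma square_cornersD:
  assumes "s \<in> square a P Q b" "dm C a = X" "cd C a = Z" "dm C b = W" "cd C b = Y"
  shows "s \<in> cel C" "a \<in> mor C" "P \<in> mor C" "Q \<in> mor C" "b \<in> mor C"
     "dm C P = W" "cd C P = X" "dm C Q = Y" "cd C Q = Z" "dm C a = X" "cd C a = Z" "dm C b = W" "cd C b = Y"
     "sr C s = a \<odot> P" "tg C s = Q \<odot> b"
  using assms by (auto simp: square_def)

lemma square_corners_vpaste:
  assumes "s \<in> square a P Q b" "t \<in> square a' Q R b'"
  obtains W X Y Z Y' Z' where "dm C a = X" "cd C a = Z" "dm C b = W" "cd C b = Y"
    "dm C a' = Z" "cd C a' = Z'" "dm C b' = Y" "cd C b' = Y'"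
  using squareD[OF assms(1)] squareD[OF assms(2)] that by metis

lemma square_corners_hpaste:
  assumes "s \<in> square a P Q b" "t \<in> square b R S c"
  obtains W X Y Z W' Y' where "dm C a = X" "cd C a = Z" "dm C b = W" "cd C b = Y"
    "dm C c = W'" "cd C c = Y'"
  using that by metis

text \<open>The law for \<open>t\<close> and \<open>t'\<close> brings both sides of the pasted law
  to a common shape: an outer factor made of \<open>t'\<close>, after the whiskering with
  \<open>a'\<close> of the respective side of the law for \<open>s\<close> and \<open>s'\<close>.
  Pasting reads this forwards, cancellation backwards.\<close>

lemma cyl_vpaste_expand:
  assumes s: "s \<in> square a P Q b" "s' \<in> square a P' Q' b"
    and t: "t \<in> square a' Q R b'" "t' \<in> square a' Q' R' b'"
    and cells: "\<alpha> \<in> cels C P P'" "\<beta> \<in> cels C Q Q'" "\<gamma> \<in> cels C R R'"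
    and ct: "cyl a' b' \<beta> \<gamma> t t'"
  shows "(\<gamma> \<star> \<langle>b' \<odot> b\<rangle>) \<bullet> vpaste a' b t s = (t' \<star> \<langle>b\<rangle>) \<bullet> (\<langle>a'\<rangle> \<star> ((\<beta> \<star> \<langle>b\<rangle>) \<bullet> s))"
    and "vpaste a' b t' s' \<bullet> (\<langle>a' \<odot> a\<rangle> \<star> \<alpha>) = (t' \<star> \<langle>b\<rangle>) \<bullet> (\<langle>a'\<rangle> \<star> (s' \<bullet> (\<langle>a\<rangle> \<star> \<alpha>)))"
proof -
  have c: "\<alpha> \<in> cel C" "sr C \<alpha> = P" "tg C \<alpha> = P'" "\<beta> \<in> cel C" "sr C \<beta> = Q" "tg C \<beta> = Q'"
    "\<gamma> \<in> cel C" "sr C \<gamma> = R" "tg C \<gamma> = R'"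
    using cells by (auto simp: cels_def)
  obtain W X Y Z Y' Z' where k: "dm C a = X" "cd C a = Z" "dm C b = W" "cd C b = Y"
    and k': "dm C a' = Z" "cd C a' = Z'" "dm C b' = Y" "cd C b' = Y'"
    using square_corners_vpaste[OF s(1) t(1)] .
  note sq = square_cornersD[OF s(1) k] square_cornersD[OF s(2) k]
    square_cornersD[OF t(1) k'] square_cornersD[OF t(2) k'] c
  have "((\<gamma> \<star> \<langle>b'\<rangle>) \<bullet> t) \<star> \<langle>b\<rangle> = (t' \<bullet> (\<langle>a'\<rangle> \<star> \<beta>)) \<star> \<langle>b\<rangle>"
    using ct by (simp add: cyl_def)
  then have 1: "(\<gamma> \<star> \<langle>b' \<odot> b\<rangle>) \<bullet> (t \<star> \<langle>b\<rangle>) = (t' \<star> \<langle>b\<rangle>) \<bullet> (\<langle>a'\<rangle> \<star> (\<beta> \<star> \<langle>b\<rangle>))"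
    using sq by simp
  have "(\<gamma> \<star> \<langle>b' \<odot> b\<rangle>) \<bullet> ((t \<star> \<langle>b\<rangle>) \<bullet> (\<langle>a'\<rangle> \<star> s)) =
      (t' \<star> \<langle>b\<rangle>) \<bullet> ((\<langle>a'\<rangle> \<star> (\<beta> \<star> \<langle>b\<rangle>)) \<bullet> (\<langle>a'\<rangle> \<star> s))"
    by (rule vcmp_prefix[OF 1]) (use sq in simp_all)
  then show "(\<gamma> \<star> \<langle>b' \<odot> b\<rangle>) \<bullet> vpaste a' b t s = (t' \<star> \<langle>b\<rangle>) \<bullet> (\<langle>a'\<rangle> \<star> ((\<beta> \<star> \<langle>b\<rangle>) \<bullet> s))"
    using sq by (simp add: vpaste_def)
  show "vpaste a' b t' s' \<bullet> (\<langle>a' \<odot> a\<rangle> \<star> \<alpha>) = (t' \<star> \<langle>b\<rangle>) \<bullet> (\<langle>a'\<rangle> \<star> (s' \<bullet> (\<langle>a\<rangle> \<star> \<alpha>)))"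
    using sq by (simp add: vpaste_def)
qed

lemma cyl_vpaste:
  assumes s: "s \<in> square a P Q b" "s' \<in> square a P' Q' b"
    and t: "t \<in> square a' Q R b'" "t' \<in> square a' Q' R' b'"
    and cells: "\<alpha> \<in> cels C P P'" "\<beta> \<in> cels C Q Q'" "\<gamma> \<in> cels C R R'"
    and c: "cyl a b \<alpha> \<beta> s s'" "cyl a' b' \<beta> \<gamma> t t'"
  shows "cyl (a' \<odot> a) (b' \<odot> b) \<alpha> \<gamma> (vpaste a' b t s) (vpaste a' b t' s')"
  using cyl_vpaste_expand[OF s t cells c(2)] c(1) by (simp add: cyl_def)

text \<open>In the common shape the outer factor is invertible with \<open>t'\<close>, and the
  remaining whiskering with \<open>a'\<close> is faithful because \<open>a'\<close> is the left
  adjoint of an adjoint equivalence.\<close>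

lemma cyl_vpaste_cancel:
  assumes s: "s \<in> square a P Q b" "s' \<in> square a P' Q' b"
    and t: "t \<in> square a' Q R b'" "t' \<in> square a' Q' R' b'" "invertible C t'"
    and cells: "\<alpha> \<in> cels C P P'" "\<beta> \<in> cels C Q Q'" "\<gamma> \<in> cels C R R'"
    and e: "adjoint_equivalence C x y e" "ladj e = a'"
    and c: "cyl a' b' \<beta> \<gamma> t t'" "cyl (a' \<odot> a) (b' \<odot> b) \<alpha> \<gamma> (vpaste a' b t s) (vpaste a' b t' s')"
  shows "cyl a b \<alpha> \<beta> s s'"
proof -
  have sc: "\<alpha> \<in> cel C" "sr C \<alpha> = P" "tg C \<alpha> = P'" "\<beta> \<in> cel C" "sr C \<beta> = Q" "tg C \<beta> = Q'"
    using cells by (auto simp: cels_def)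
  obtain W X Y Z Y' Z' where k: "dm C a = X" "cd C a = Z" "dm C b = W" "cd C b = Y"
    and k': "dm C a' = Z" "cd C a' = Z'" "dm C b' = Y" "cd C b' = Y'"
    using square_corners_vpaste[OF s(1) t(1)] .
  note sq = square_cornersD[OF s(1) k] square_cornersD[OF s(2) k]
    square_cornersD[OF t(1) k'] square_cornersD[OF t(2) k'] sc
  have "(t' \<star> \<langle>b\<rangle>) \<bullet> (\<langle>a'\<rangle> \<star> ((\<beta> \<star> \<langle>b\<rangle>) \<bullet> s)) = (t' \<star> \<langle>b\<rangle>) \<bullet> (\<langle>a'\<rangle> \<star> (s' \<bullet> (\<langle>a\<rangle> \<star> \<alpha>)))"
    using cyl_vpaste_expand[OF s t(1,2) cells c(1)] c(2) by (simp add: cyl_def)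
  then have "\<langle>a'\<rangle> \<star> ((\<beta> \<star> \<langle>b\<rangle>) \<bullet> s) = \<langle>a'\<rangle> \<star> (s' \<bullet> (\<langle>a\<rangle> \<star> \<alpha>))"
    by (rule iso_cancel_leftD) (simp_all add: sq t(3))
  then have eq: "\<langle>ladj e\<rangle> \<star> ((\<beta> \<star> \<langle>b\<rangle>) \<bullet> s) = \<langle>ladj e\<rangle> \<star> (s' \<bullet> (\<langle>a\<rangle> \<star> \<alpha>))"
    by (simp only: e(2))
  have "x = Z" using adjoint_equivalenceD(2)[OF e(1)] e(2) k'(1) by simp
  then have "(\<beta> \<star> \<langle>b\<rangle>) \<bullet> s = s' \<bullet> (\<langle>a\<rangle> \<star> \<alpha>)"
    by (intro equivalence_whisker_inj[OF e(1) _ _ _ _ _ eq]) (simp_all add: sq)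
  then show ?thesis by (simp add: cyl_def)
qed

text \<open>A change \<omega> of the first side passes through one square and becomes \<omega>' on
  the common side, then through the other and becomes \<omega>''.\<close>

lemma cocyl_hpaste:
  assumes s: "s \<in> square a P Q b" "s' \<in> square a' P Q b'"
    and t: "t \<in> square b R S c" "t' \<in> square b' R S c'"
    and cells: "\<omega> \<in> cels C a a'" "\<omega>' \<in> cels C b b'" "\<omega>'' \<in> cels C c c'"
    and c: "cocyl P Q \<omega> \<omega>' s s'" "cocyl R S \<omega>' \<omega>'' t t'"
  shows "cocyl (P \<odot> R) (Q \<odot> S) \<omega> \<omega>'' (hpaste Q R s t) (hpaste Q R s' t')"
proof -
  have sc: "\<omega> \<in> cel C" "sr C \<omega> = a" "tg C \<omega> = a'" "\<omega>' \<in> cel C" "sr C \<omega>' = b" "tg C \<omega>' = b'"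
    "\<omega>'' \<in> cel C" "sr C \<omega>'' = c" "tg C \<omega>'' = c'"
    using cells by (auto simp: cels_def)
  obtain W X Y Z W' Y' where k: "dm C a = X" "cd C a = Z" "dm C b = W" "cd C b = Y"
    and k': "dm C c = W'" "cd C c = Y'"
    using square_corners_hpaste[OF s(1) t(1)] .
  have l: "dm C a' = X" "cd C a' = Z" "dm C b' = W" "cd C b' = Y" "dm C c' = W'" "cd C c' = Y'"
    using sc k k' mor_simps(5,6) by metis+
  note sq = square_cornersD[OF s(1) k] square_cornersD[OF s(2) l(1-4)]
    square_cornersD[OF t(1) k(3,4) k'] square_cornersD[OF t(2) l(3-6)] sc
  have "(s' \<bullet> (\<omega> \<star> \<langle>P\<rangle>)) \<star> \<langle>R\<rangle> = ((\<langle>Q\<rangle> \<star> \<omega>') \<bullet> s) \<star> \<langle>R\<rangle>"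
    using c by (simp add: cocyl_def)
  then have 1: "(s' \<star> \<langle>R\<rangle>) \<bullet> (\<omega> \<star> \<langle>P \<odot> R\<rangle>) = (\<langle>Q\<rangle> \<star> (\<omega>' \<star> \<langle>R\<rangle>)) \<bullet> (s \<star> \<langle>R\<rangle>)" using sq by simp
  have "\<langle>Q\<rangle> \<star> (t' \<bullet> (\<omega>' \<star> \<langle>R\<rangle>)) = \<langle>Q\<rangle> \<star> ((\<langle>S\<rangle> \<star> \<omega>'') \<bullet> t)"
    using c by (simp add: cocyl_def)
  then have 2: "(\<langle>Q\<rangle> \<star> t') \<bullet> (\<langle>Q\<rangle> \<star> (\<omega>' \<star> \<langle>R\<rangle>)) = (\<langle>Q \<odot> S\<rangle> \<star> \<omega>'') \<bullet> (\<langle>Q\<rangle> \<star> t)" using sq by simp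
  have "hpaste Q R s' t' \<bullet> (\<omega> \<star> \<langle>P \<odot> R\<rangle>) = (\<langle>Q\<rangle> \<star> t') \<bullet> ((s' \<star> \<langle>R\<rangle>) \<bullet> (\<omega> \<star> \<langle>P \<odot> R\<rangle>))"
    using sq by (simp add: hpaste_def)
  also have "\<dots> = (\<langle>Q\<rangle> \<star> t') \<bullet> ((\<langle>Q\<rangle> \<star> (\<omega>' \<star> \<langle>R\<rangle>)) \<bullet> (s \<star> \<langle>R\<rangle>))" by (simp only: 1)
  also have "\<dots> = (\<langle>Q \<odot> S\<rangle> \<star> \<omega>'') \<bullet> ((\<langle>Q\<rangle> \<star> t) \<bullet> (s \<star> \<langle>R\<rangle>))"
    by (rule vcmp_prefix[OF 2]) (use sq in simp_all)
  finally show ?thesis by (simp add: cocyl_def hpaste_def)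
qed

text \<open>Precomposed with \<omega> whiskered by \<open>P1\<close>, each side of the new law can
  be pushed back to the old one: the two cocylinder laws replace \<open>t1\<close> and
  \<open>t2\<close> by \<open>s1\<close> and \<open>s2\<close>, and slides move the changes past
  \<alpha> and \<beta>. The invertible \<omega> is cancelled at the end.\<close>

lemma cyl_transport:
  assumes s: "s1 \<in> square a P1 Q1 b" "s2 \<in> square a P2 Q2 b"
    and t: "t1 \<in> square a' P1 Q1 b'" "t2 \<in> square a' P2 Q2 b'"
    and cells: "\<alpha> \<in> cels C P1 P2" "\<beta> \<in> cels C Q1 Q2" "\<omega> \<in> cels C a a'" "invertible C \<omega>" "\<omega>' \<in> cels C b b'"
    and c: "cyl a b \<alpha> \<beta> s1 s2" "cocyl P1 Q1 \<omega> \<omega>' s1 t1" "cocyl P2 Q2 \<omega> \<omega>' s2 t2"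
  shows "cyl a' b' \<alpha> \<beta> t1 t2"
proof -
  have sc: "\<alpha> \<in> cel C" "sr C \<alpha> = P1" "tg C \<alpha> = P2" "\<beta> \<in> cel C" "sr C \<beta> = Q1" "tg C \<beta> = Q2"
    "\<omega> \<in> cel C" "sr C \<omega> = a" "tg C \<omega> = a'" "\<omega>' \<in> cel C" "sr C \<omega>' = b" "tg C \<omega>' = b'"
    using cells by (auto simp: cels_def)
  obtain W X Y Z where k: "dm C a = X" "cd C a = Z" "dm C b = W" "cd C b = Y"
    by blast
  have l: "dm C a' = X" "cd C a' = Z" "dm C b' = W" "cd C b' = Y"
    using sc k mor_simps(5,6) by metis+
  note sq = square_cornersD[OF s(1) k] square_cornersD[OF s(2) k]
    square_cornersD[OF t(1) l] square_cornersD[OF t(2) l] sc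
  have 1: "(\<beta> \<star> \<langle>b'\<rangle>) \<bullet> (\<langle>Q1\<rangle> \<star> \<omega>') = (\<langle>Q2\<rangle> \<star> \<omega>') \<bullet> (\<beta> \<star> \<langle>b\<rangle>)"
    using hcmp_slide[of \<omega>' \<beta>] sq by simp
  have 2: "(\<omega> \<star> \<langle>P2\<rangle>) \<bullet> (\<langle>a\<rangle> \<star> \<alpha>) = (\<langle>a'\<rangle> \<star> \<alpha>) \<bullet> (\<omega> \<star> \<langle>P1\<rangle>)"
    using hcmp_slide[of \<alpha> \<omega>] sq by simp
  have "((\<beta> \<star> \<langle>b'\<rangle>) \<bullet> t1) \<bullet> (\<omega> \<star> \<langle>P1\<rangle>) = (\<beta> \<star> \<langle>b'\<rangle>) \<bullet> (t1 \<bullet> (\<omega> \<star> \<langle>P1\<rangle>))"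
    using sq by simp
  also have "\<dots> = (\<beta> \<star> \<langle>b'\<rangle>) \<bullet> ((\<langle>Q1\<rangle> \<star> \<omega>') \<bullet> s1)" using c by (simp add: cocyl_def)
  also have "\<dots> = (\<langle>Q2\<rangle> \<star> \<omega>') \<bullet> ((\<beta> \<star> \<langle>b\<rangle>) \<bullet> s1)"
    by (rule vcmp_prefix[OF 1]) (use sq in simp_all)
  also have "\<dots> = (\<langle>Q2\<rangle> \<star> \<omega>') \<bullet> (s2 \<bullet> (\<langle>a\<rangle> \<star> \<alpha>))" using c by (simp add: cyl_def)
  also have "\<dots> = t2 \<bullet> ((\<omega> \<star> \<langle>P2\<rangle>) \<bullet> (\<langle>a\<rangle> \<star> \<alpha>))"
    by (rule vcmp_prefix) (use sq c in \<open>simp_all add: cocyl_def\<close>)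
  also have "\<dots> = (t2 \<bullet> (\<langle>a'\<rangle> \<star> \<alpha>)) \<bullet> (\<omega> \<star> \<langle>P1\<rangle>)" using sq by (simp add: 2)
  finally have "(\<beta> \<star> \<langle>b'\<rangle>) \<bullet> t1 = t2 \<bullet> (\<langle>a'\<rangle> \<star> \<alpha>)"
    by (rule iso_cancel_rightD) (simp_all add: sq cells)
  then show ?thesis by (simp add: cyl_def)
qed

end

text \<open>The end objects of \<open>a\<close> alone decide in which hom an adjoint equivalence
  lives, since all its cells share them.\<close>

lemma (in gray_category) adjoint_equivalence_hom_iff:
  "adjoint_equivalence (hom B X Y) a b e \<longleftrightarrow> adjoint_equivalence B a b e \<and> s0 B a = X \<and> t0 B a = Y"
proof
  assume *: "adjoint_equivalence (hom B X Y) a b e"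
  then have "s0 B a = X" "t0 B a = Y"
    by (auto simp: adjoint_equivalence_def mors_hom_iff)
  with * show "adjoint_equivalence B a b e \<and> s0 B a = X \<and> t0 B a = Y"
    by (auto simp: adjoint_equivalence_def icels_iff iso_hom_iff mors_def)
next
  assume *: "adjoint_equivalence B a b e \<and> s0 B a = X \<and> t0 B a = Y"
  then have e: "adjoint_equivalence B a b e" and a: "s0 B a = X" "t0 B a = Y" by auto
  note e' = adjoint_equivalenceD[OF e]
  have b: "s0 B b = X" "t0 B b = Y" using cd_ends[OF e'(1)] e' a by simp_all
  show "adjoint_equivalence (hom B X Y) a b e"
    using e a b e'
    by (simp add: adjoint_equivalence_def icels_iff iso_hom_iff mors_def)
qed

section \<open>Cells of the path object\<close>

context gray_category
begin

lemma adj_map_lw: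
  assumes "adjoint_equivalence B a b e" "g \<in> ob B" "s0 B g = t0 B a"
  shows "adjoint_equivalence B (g \<cdot> a) (g \<cdot> b) (adj_map (lw2 B g) (lw3 B g) e)"
proof -
  note e = adjoint_equivalenceD[OF assms(1)]
  note c = cd_ends[OF e(1)] e(1-12,15,16) assms(2,3)
  have "g \<unrhd> ((acounit e \<star> \<langle>ladj e\<rangle>) \<bullet> (\<langle>ladj e\<rangle> \<star> aunit e)) = g \<unrhd> \<langle>ladj e\<rangle>"
    "g \<unrhd> ((\<langle>radj e\<rangle> \<star> acounit e) \<bullet> (aunit e \<star> \<langle>radj e\<rangle>)) = g \<unrhd> \<langle>radj e\<rangle>"
    using e by simp_all
  then show ?thesis using c by (simp add: adjoint_equivalence_iff adj_map_def)
qed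

lemma adj_map_rw:
  assumes "adjoint_equivalence B a b e" "f \<in> ob B" "s0 B a = t0 B f"
  shows "adjoint_equivalence B (a \<cdot> f) (b \<cdot> f) (adj_map (\<lambda>\<phi>. \<phi> \<lhd> f) (\<lambda>\<Gamma>. \<Gamma> \<unlhd> f) e)"
proof -
  note e = adjoint_equivalenceD[OF assms(1)]
  note c = cd_ends[OF e(1)] e(1-12,15,16) assms(2,3)
  have "((acounit e \<star> \<langle>ladj e\<rangle>) \<bullet> (\<langle>ladj e\<rangle> \<star> aunit e)) \<unlhd> f = \<langle>ladj e\<rangle> \<unlhd> f"
    "((\<langle>radj e\<rangle> \<star> acounit e) \<bullet> (aunit e \<star> \<langle>radj e\<rangle>)) \<unlhd> f = \<langle>radj e\<rangle> \<unlhd> f"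
    using e by simp_all
  then show ?thesis using c by (simp add: adjoint_equivalence_iff adj_map_def)
qed

lemma path_cells1_iff:
  "u \<in> path_cells1 B \<longleftrightarrow> p1_src u \<in> ob B \<and> p1_tgt u \<in> ob B \<and>
     p1_0 u \<in> ob B \<and> s0 B (p1_0 u) = s0 B (p1_src u) \<and> t0 B (p1_0 u) = s0 B (p1_tgt u) \<and>
     p1_1 u \<in> ob B \<and> s0 B (p1_1 u) = t0 B (p1_src u) \<and> t0 B (p1_1 u) = t0 B (p1_tgt u) \<and>
     adjoint_equivalence B (p1_tgt u \<cdot> p1_0 u) (p1_1 u \<cdot> p1_src u) (p1_eq u)"
  by (auto simp: path_cells1_def adjoint_equivalence_hom_iff)

lemma path_cells1_equivalence:
  "u \<in> path_cells1 B \<Longrightarrow>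
    adjoint_equivalence B (p1_tgt u \<cdot> p1_0 u) (p1_1 u \<cdot> p1_src u) (p1_eq u)"
  by (simp only: path_cells1_iff)

lemma path_cells1_simps [simp]:
  assumes "u \<in> path_cells1 B"
  shows "p1_src u \<in> ob B" "p1_tgt u \<in> ob B" "p1_0 u \<in> ob B" "p1_1 u \<in> ob B"
    "s0 B (p1_0 u) = s0 B (p1_src u)" "t0 B (p1_0 u) = s0 B (p1_tgt u)"
    "s0 B (p1_1 u) = t0 B (p1_src u)" "t0 B (p1_1 u) = t0 B (p1_tgt u)"
    "p1_l u \<in> mor B" "dm B (p1_l u) = p1_tgt u \<cdot> p1_0 u" "cd B (p1_l u) = p1_1 u \<cdot> p1_src u"
  subgoal using assms path_cells1_iff by blast
  subgoal using assms path_cells1_iff by blast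
  subgoal using assms path_cells1_iff by blast
  subgoal using assms path_cells1_iff by blast
  subgoal using assms path_cells1_iff by blast
  subgoal using assms path_cells1_iff by blast
  subgoal using assms path_cells1_iff by blast
  subgoal using assms path_cells1_iff by blast
  subgoal using adjoint_equivalenceD(1)[OF path_cells1_equivalence[OF assms]] .
  subgoal using adjoint_equivalenceD(2)[OF path_cells1_equivalence[OF assms]] .
  subgoal using adjoint_equivalenceD(3)[OF path_cells1_equivalence[OF assms]] .
  done

lemma path_one_in [simp]: "x \<in> ob B \<Longrightarrow> path_one B x \<in> path_cells1 B"
  using adj_id_equivalence[of x] by (simp add: path_one_def path_cells1_iff)

lemma path_one_simps [simp]:
  "p1_src (path_one B x) = x" "p1_tgt (path_one B x) = x" "p1_eq (path_one B x) = adj_id B x"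
  "p1_0 (path_one B x) = one B (s0 B x)" "p1_1 (path_one B x) = one B (t0 B x)"
  by (simp_all add: path_one_def)

lemma path_comp1_simps [simp]:
  "p1_src (path_comp1 B v u) = p1_src u" "p1_tgt (path_comp1 B v u) = p1_tgt v"
  "p1_0 (path_comp1 B v u) = p1_0 v \<cdot> p1_0 u" "p1_1 (path_comp1 B v u) = p1_1 v \<cdot> p1_1 u"
  "p1_l (path_comp1 B v u) = (p1_1 v \<rhd> p1_l u) \<odot> (p1_l v \<lhd> p1_0 u)"
  by (simp_all add: path_comp1_def adj_comp_def adj_map_def)

lemma path_comp1_in [simp]:
  assumes u: "u \<in> path_cells1 B" and v: "v \<in> path_cells1 B" and uv: "p1_src v = p1_tgt u"
  shows "path_comp1 B v u \<in> path_cells1 B"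
proof -
  have "adjoint_equivalence B (p1_1 v \<cdot> (p1_tgt u \<cdot> p1_0 u)) (p1_1 v \<cdot> (p1_1 u \<cdot> p1_src u))
      (adj_map (lw2 B (p1_1 v)) (lw3 B (p1_1 v)) (p1_eq u))"
    by (rule adj_map_lw[OF path_cells1_equivalence[OF u]]) (use assms in simp_all)
  moreover have "adjoint_equivalence B ((p1_tgt v \<cdot> p1_0 v) \<cdot> p1_0 u) ((p1_1 v \<cdot> p1_src v) \<cdot> p1_0 u)
      (adj_map (\<lambda>\<phi>. \<phi> \<lhd> p1_0 u) (\<lambda>\<Gamma>. \<Gamma> \<unlhd> p1_0 u) (p1_eq v))"
    by (rule adj_map_rw[OF path_cells1_equivalence[OF v]]) (use assms in simp_all)
  ultimately show ?thesis
    using adj_comp_equivalence[of "p1_tgt v \<cdot> (p1_0 v \<cdot> p1_0 u)" "p1_1 v \<cdot> (p1_tgt u \<cdot> p1_0 u)"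
      "adj_map (\<lambda>\<phi>. \<phi> \<lhd> p1_0 u) (\<lambda>\<Gamma>. \<Gamma> \<unlhd> p1_0 u) (p1_eq v)" "p1_1 v \<cdot> (p1_1 u \<cdot> p1_src u)"
      "adj_map (lw2 B (p1_1 v)) (lw3 B (p1_1 v)) (p1_eq u)"] assms
    unfolding path_cells1_iff[of "path_comp1 B v u"] by (simp add: path_comp1_def)
qed

text \<open>Equality of 1-cells of the path object compares right adjoints, units and counits too,
  so composition of adjoint equivalences has to be strictly associative. All the whiskerings
  involved have the same normal form.\<close>

lemma path_comp1_assoc [simp]:
  assumes u: "u \<in> path_cells1 B" and v: "v \<in> path_cells1 B" and w: "w \<in> path_cells1 B"
    and uv: "p1_src v = p1_tgt u" "p1_src w = p1_tgt v"
  shows "path_comp1 B (path_comp1 B w v) u = path_comp1 B w (path_comp1 B v u)"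
  using assms adjoint_equivalenceD(4-12)[OF path_cells1_equivalence[OF u]]
    adjoint_equivalenceD(4-12)[OF path_cells1_equivalence[OF v]]
    adjoint_equivalenceD(4-12)[OF path_cells1_equivalence[OF w]]
  by (simp add: path_comp1_def adj_comp_def adj_map_def)

lemma path_comp1_one [simp]:
  assumes u: "u \<in> path_cells1 B"
  shows "p1_tgt u = y \<Longrightarrow> path_comp1 B (path_one B y) u = u"
    and "p1_src u = x \<Longrightarrow> path_comp1 B u (path_one B x) = u"
  using assms adjoint_equivalenceD(4-12)[OF path_cells1_equivalence[OF u]]
  by (auto simp: path_comp1_def path_one_def adj_comp_def adj_map_def adj_id_def)

lemma path_cells2_iff:
  "\<phi> \<in> path_cells2 B \<longleftrightarrow> p2_src \<phi> \<in> path_cells1 B \<and> p2_tgt \<phi> \<in> path_cells1 B \<and>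
     p1_src (p2_tgt \<phi>) = p1_src (p2_src \<phi>) \<and> p1_tgt (p2_tgt \<phi>) = p1_tgt (p2_src \<phi>) \<and>
     p2_0 \<phi> \<in> mor B \<and> dm B (p2_0 \<phi>) = p1_0 (p2_src \<phi>) \<and> cd B (p2_0 \<phi>) = p1_0 (p2_tgt \<phi>) \<and>
     p2_1 \<phi> \<in> mor B \<and> dm B (p2_1 \<phi>) = p1_1 (p2_src \<phi>) \<and> cd B (p2_1 \<phi>) = p1_1 (p2_tgt \<phi>) \<and>
     invertible B (p2_cell \<phi>) \<and>
     sr B (p2_cell \<phi>) = p1_l (p2_tgt \<phi>) \<odot> (p1_tgt (p2_src \<phi>) \<rhd> p2_0 \<phi>) \<and>
     tg B (p2_cell \<phi>) = (p2_1 \<phi> \<lhd> p1_src (p2_src \<phi>)) \<odot> p1_l (p2_src \<phi>)"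
  by (auto simp: path_cells2_def icels_iff mors_def)

lemma path_cells2_simps [simp]:
  assumes "\<phi> \<in> path_cells2 B"
  shows "p2_src \<phi> \<in> path_cells1 B" "p2_tgt \<phi> \<in> path_cells1 B"
     "p1_src (p2_tgt \<phi>) = p1_src (p2_src \<phi>)" "p1_tgt (p2_tgt \<phi>) = p1_tgt (p2_src \<phi>)"
     "p2_0 \<phi> \<in> mor B" "dm B (p2_0 \<phi>) = p1_0 (p2_src \<phi>)" "cd B (p2_0 \<phi>) = p1_0 (p2_tgt \<phi>)"
     "p2_1 \<phi> \<in> mor B" "dm B (p2_1 \<phi>) = p1_1 (p2_src \<phi>)" "cd B (p2_1 \<phi>) = p1_1 (p2_tgt \<phi>)"
     "invertible B (p2_cell \<phi>)"
     "sr B (p2_cell \<phi>) = p1_l (p2_tgt \<phi>) \<odot> (p1_tgt (p2_src \<phi>) \<rhd> p2_0 \<phi>)"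
     "tg B (p2_cell \<phi>) = (p2_1 \<phi> \<lhd> p1_src (p2_src \<phi>)) \<odot> p1_l (p2_src \<phi>)"
  using assms unfolding path_cells2_iff by auto

lemma path_idn_simps [simp]:
  "p2_src (path_idn B u) = u" "p2_tgt (path_idn B u) = u" "p2_cell (path_idn B u) = \<langle>p1_l u\<rangle>"
  "p2_0 (path_idn B u) = idn B (p1_0 u)" "p2_1 (path_idn B u) = idn B (p1_1 u)"
  by (simp_all add: path_idn_def)

lemma path_cmp_simps [simp]:
  "p2_src (path_cmp B \<psi> \<phi>) = p2_src \<phi>" "p2_tgt (path_cmp B \<psi> \<phi>) = p2_tgt \<psi>"
  "p2_0 (path_cmp B \<psi> \<phi>) = p2_0 \<psi> \<odot> p2_0 \<phi>" "p2_1 (path_cmp B \<psi> \<phi>) = p2_1 \<psi> \<odot> p2_1 \<phi>"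
  by (simp_all add: path_cmp_def)

lemma p2_cell_path_cmp:
  "p2_cell (path_cmp B \<psi> \<phi>) = (\<langle>p2_1 \<psi> \<lhd> p1_src (p2_src \<phi>)\<rangle> \<star> p2_cell \<phi>)
               \<bullet> (p2_cell \<psi> \<star> \<langle>p1_tgt (p2_src \<phi>) \<rhd> p2_0 \<phi>\<rangle>)"
  by (simp add: path_cmp_def)

lemma path_cmp_assoc [simp]:
  assumes "\<phi> \<in> path_cells2 B" "\<psi> \<in> path_cells2 B" "\<chi> \<in> path_cells2 B"
    "p2_src \<psi> = p2_tgt \<phi>" "p2_src \<chi> = p2_tgt \<psi>"
  shows "path_cmp B (path_cmp B \<chi> \<psi>) \<phi> = path_cmp B \<chi> (path_cmp B \<psi> \<phi>)"
  using assms by (simp add: path_cmp_def)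

lemma path_cmp_idn [simp]:
  assumes "\<phi> \<in> path_cells2 B"
  shows "p2_src \<phi> = u \<Longrightarrow> path_cmp B \<phi> (path_idn B u) = \<phi>"
    and "p2_tgt \<phi> = v \<Longrightarrow> path_cmp B (path_idn B v) \<phi> = \<phi>"
  using assms by (auto simp: path_cmp_def path_idn_def)

lemma path_lw2_simps [simp]:
  "p2_src (path_lw2 B v \<phi>) = path_comp1 B v (p2_src \<phi>)"
  "p2_tgt (path_lw2 B v \<phi>) = path_comp1 B v (p2_tgt \<phi>)"
  "p2_0 (path_lw2 B v \<phi>) = p1_0 v \<rhd> p2_0 \<phi>" "p2_1 (path_lw2 B v \<phi>) = p1_1 v \<rhd> p2_1 \<phi>"
  by (simp_all add: path_lw2_def)

lemma p2_cell_path_lw2: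
  "p2_cell (path_lw2 B v \<phi>) = ((p1_1 v \<unrhd> p2_cell \<phi>) \<star> \<langle>p1_l v \<lhd> p1_0 (p2_src \<phi>)\<rangle>)
     \<bullet> (\<langle>p1_1 v \<rhd> p1_l (p2_tgt \<phi>)\<rangle> \<star> cinv B (ich B (p1_l v) (p2_0 \<phi>)))"
  by (simp add: path_lw2_def)

lemma path_rw2_simps [simp]:
  "p2_src (path_rw2 B \<psi> u) = path_comp1 B (p2_src \<psi>) u"
  "p2_tgt (path_rw2 B \<psi> u) = path_comp1 B (p2_tgt \<psi>) u"
  "p2_0 (path_rw2 B \<psi> u) = p2_0 \<psi> \<lhd> p1_0 u" "p2_1 (path_rw2 B \<psi> u) = p2_1 \<psi> \<lhd> p1_1 u"
  by (simp_all add: path_rw2_def)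

lemma p2_cell_path_rw2:
  "p2_cell (path_rw2 B \<psi> u) = (ich B (p2_1 \<psi>) (p1_l u) \<star> \<langle>p1_l (p2_src \<psi>) \<lhd> p1_0 u\<rangle>)
     \<bullet> (\<langle>p1_1 (p2_tgt \<psi>) \<rhd> p1_l u\<rangle> \<star> (p2_cell \<psi> \<unlhd> p1_0 u))"
  by (simp add: path_rw2_def)

lemma path_lw2_in [simp]:
  assumes "v \<in> path_cells1 B" "\<phi> \<in> path_cells2 B" "p1_src v = p1_tgt (p2_src \<phi>)"
  shows "path_lw2 B v \<phi> \<in> path_cells2 B"
  using assms by (simp add: path_cells2_iff[of "path_lw2 B v \<phi>"] p2_cell_path_lw2)

lemma path_rw2_in [simp]:
  assumes "u \<in> path_cells1 B" "\<psi> \<in> path_cells2 B" "p1_src (p2_src \<psi>) = p1_tgt u"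
  shows "path_rw2 B \<psi> u \<in> path_cells2 B"
  using assms by (simp add: path_cells2_iff[of "path_rw2 B \<psi> u"] p2_cell_path_rw2)

lemma path_simps [simp]:
  "ob (path B) = path_cells1 B" "mor (path B) = path_cells2 B" "cel (path B) = path_cells3 B"
  "dm (path B) = p2_src" "cd (path B) = p2_tgt" "sr (path B) = p3_src" "tg (path B) = p3_tgt"
  "idn (path B) = path_idn B" "cmp (path B) = path_cmp B"
  "pt (path B) = ob B" "s0 (path B) = p1_src" "t0 (path B) = p1_tgt" "one (path B) = path_one B"
  "comp1 (path B) = path_comp1 B" "lw2 (path B) = path_lw2 B" "rw2 (path B) = path_rw2 B"
  by (simp_all add: path_def)

lemma path_cells3_iff:
  "\<Gamma> \<in> path_cells3 B \<longleftrightarrow> p3_src \<Gamma> \<in> path_cells2 B \<and> p3_tgt \<Gamma> \<in> path_cells2 B \<and>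
     p2_src (p3_tgt \<Gamma>) = p2_src (p3_src \<Gamma>) \<and> p2_tgt (p3_tgt \<Gamma>) = p2_tgt (p3_src \<Gamma>) \<and>
     p3_0 \<Gamma> \<in> cel B \<and> sr B (p3_0 \<Gamma>) = p2_0 (p3_src \<Gamma>) \<and> tg B (p3_0 \<Gamma>) = p2_0 (p3_tgt \<Gamma>) \<and>
     p3_1 \<Gamma> \<in> cel B \<and> sr B (p3_1 \<Gamma>) = p2_1 (p3_src \<Gamma>) \<and> tg B (p3_1 \<Gamma>) = p2_1 (p3_tgt \<Gamma>) \<and>
     p2_cell (p3_tgt \<Gamma>)
         \<bullet> (\<langle>p1_l (p2_tgt (p3_src \<Gamma>))\<rangle> \<star> (p1_tgt (p2_src (p3_src \<Gamma>)) \<unrhd> p3_0 \<Gamma>)) =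
       ((p3_1 \<Gamma> \<unlhd> p1_src (p2_src (p3_src \<Gamma>))) \<star> \<langle>p1_l (p2_src (p3_src \<Gamma>))\<rangle>)
         \<bullet> p2_cell (p3_src \<Gamma>)"
  by (auto simp: path_cells3_def cels_def)

text \<open>Over identity components the remaining datum of a 2-cell is an invertible 3-cell, and
  inverting it gives a strict inverse. All unitors, compositors and 2-cells of transformations over
  identities are of this kind.\<close>

lemma path_inverse:
  assumes \<phi>: "\<phi> \<in> path_cells2 B"
    and id: "p2_0 \<phi> = idn B a" "p2_1 \<phi> = idn B b" "a \<in> ob B" "b \<in> ob B"
  shows "\<phi> \<in> imors (path B) (p2_src \<phi>) (p2_tgt \<phi>)"
proof -
  define \<psi> where "\<psi> = \<lparr>p2_src = p2_tgt \<phi>, p2_tgt = p2_src \<phi>, p2_cell = cinv B (p2_cell \<phi>),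
    p2_0 = idn B a, p2_1 = idn B b\<rparr>"
  have ab: "p1_0 (p2_src \<phi>) = a" "p1_0 (p2_tgt \<phi>) = a" "p1_1 (p2_src \<phi>) = b" "p1_1 (p2_tgt \<phi>) = b"
    using path_cells2_simps(6,7,9,10)[OF \<phi>] id by simp_all
  have ends: "s0 B a = s0 B (p1_src (p2_src \<phi>))" "t0 B a = s0 B (p1_tgt (p2_src \<phi>))"
    "s0 B b = t0 B (p1_src (p2_src \<phi>))" "t0 B b = t0 B (p1_tgt (p2_src \<phi>))"
    using path_cells1_simps(5-8)[OF path_cells2_simps(1)[OF \<phi>]] by (simp_all add: ab)
  have \<psi>: "\<psi> \<in> path_cells2 B"
    unfolding path_cells2_iff[of \<psi>] using \<phi> id(3,4) by (simp add: \<psi>_def id(1,2) ab ends)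
  have "path_cmp B \<psi> \<phi> = path_idn B (p2_src \<phi>)" "path_cmp B \<phi> \<psi> = path_idn B (p2_tgt \<phi>)"
    using \<phi> id(3,4) by (simp_all add: path_cmp_def path_idn_def \<psi>_def id(1,2) ab ends)
  moreover have "p2_src \<psi> = p2_tgt \<phi>" "p2_tgt \<psi> = p2_src \<phi>" by (simp_all add: \<psi>_def)
  ultimately show ?thesis using \<phi> \<psi> by (auto simp: imors_def mors_def)
qed

end

lemma (in two_category) cinv_eq_iff:
  assumes "invertible C x" "invertible C y"
  shows "cinv C x = cinv C y \<longleftrightarrow> x = y"
  using assms iso_cinv(2) by metis

lemma ladj_adj_id [simp]: "ladj (adj_id C a) = idn C a"
  by (simp add: adj_id_def)

section \<open>Trinatural transformations in the path object\<close>

locale gray_functor_between = A: gray_category A + B: gray_category B + gray_functor A B F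
  for A :: "('a, 'b, 'c, 'o) gray" and B :: "('d, 'e, 'g, 'p) gray" (structure) and F
begin

lemma map1_simps [simp]:
  assumes "f \<in> ob A"
  shows "map1 F f \<in> ob B" "s0 B (map1 F f) = map0 F (s0 A f)" "t0 B (map1 F f) = map0 F (t0 A f)"
  using two_functor.m0_in[OF local_two_functor[of "s0 A f" "t0 A f"], of f] assms by auto

lemma map2_simps [simp]:
  assumes "\<phi> \<in> mor A"
  shows "map2 F \<phi> \<in> mor B" "dm B (map2 F \<phi>) = map1 F (dm A \<phi>)" "cd B (map2 F \<phi>) = map1 F (cd A \<phi>)"
  using two_functor.m1_in[OF local_two_functor[of "s0 A (dm A \<phi>)" "t0 A (dm A \<phi>)"],
      of \<phi> "dm A \<phi>" "cd A \<phi>"] assms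
  by (auto simp: mors_hom_iff)

lemma map3_simps [simp]:
  assumes "\<Gamma> \<in> cel A"
  shows "map3 F \<Gamma> \<in> cel B" "sr B (map3 F \<Gamma>) = map2 F (sr A \<Gamma>)" "tg B (map3 F \<Gamma>) = map2 F (tg A \<Gamma>)"
  using two_functor.m2_in[OF local_two_functor[of "s0 A (dm A (sr A \<Gamma>))" "t0 A (dm A (sr A \<Gamma>))"],
      of \<Gamma> "sr A \<Gamma>" "tg A \<Gamma>"] assms
  by (auto simp: cels_hom_iff)

lemma map0_in_simp [simp]: "X \<in> pt A \<Longrightarrow> map0 F X \<in> pt B"
  by (rule map0_in)

lemma map1_one_simp [simp]: "X \<in> pt A \<Longrightarrow> map1 F (one A X) = one B (map0 F X)"
  by (rule map_one)

lemma map1_comp1_simp [simp]: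
  "f \<in> ob A \<Longrightarrow> g \<in> ob A \<Longrightarrow> s0 A g = t0 A f \<Longrightarrow> map1 F (g \<cdot>\<^bsub>A\<^esub> f) = map1 F g \<cdot> map1 F f"
  using map_comp1[of f "s0 A f" "t0 A f" g "t0 A g"] by auto

lemma local_functor_simps [simp]:
  "f \<in> ob A \<Longrightarrow> map2 F (idn A f) = idn B (map1 F f)"
  "\<phi> \<in> mor A \<Longrightarrow> \<psi> \<in> mor A \<Longrightarrow> dm A \<psi> = cd A \<phi> \<Longrightarrow> map2 F (\<psi> \<odot>\<^bsub>A\<^esub> \<phi>) = map2 F \<psi> \<odot> map2 F \<phi>"
  "\<phi> \<in> mor A \<Longrightarrow> map3 F (idc A \<phi>) = \<langle>map2 F \<phi>\<rangle>"
  "x \<in> cel A \<Longrightarrow> y \<in> cel A \<Longrightarrow> sr A y = tg A x \<Longrightarrow> map3 F (y \<bullet>\<^bsub>A\<^esub> x) = map3 F y \<bullet> map3 F x"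
  "x \<in> cel A \<Longrightarrow> y \<in> cel A \<Longrightarrow> dm A (sr A y) = cd A (sr A x) \<Longrightarrow>
    map3 F (y \<star>\<^bsub>A\<^esub> x) = map3 F y \<star> map3 F x"
  subgoal
    using two_functor.m_idn[OF local_two_functor[of "s0 A f" "t0 A f"], of f] by auto
  subgoal
    using two_functor.m_cmp[OF local_two_functor[of "s0 A (dm A \<phi>)" "t0 A (dm A \<phi>)"],
      of \<phi> "dm A \<phi>" "cd A \<phi>" \<psi> "cd A \<psi>"]
    by (auto simp: mors_hom_iff)
  subgoal
    using two_functor.m_idc[OF local_two_functor[of "s0 A (dm A \<phi>)" "t0 A (dm A \<phi>)"], of \<phi>] by auto
  subgoal
    using two_functor.m_vcmp[OF local_two_functor[of "s0 A (dm A (sr A x))" "t0 A (dm A (sr A x))"],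
      of x "sr A x" "tg A x" y "tg A y"]
    by (auto simp: cels_hom_iff)
  subgoal
    using two_functor.m_hcmp[OF local_two_functor[of "s0 A (dm A (sr A x))" "t0 A (dm A (sr A x))"],
      of x "sr A x" "tg A x" y "sr A y" "tg A y"]
    by (auto simp: cels_hom_iff)
  done

lemma whisker_functor_simps [simp]:
  "\<phi> \<in> mor A \<Longrightarrow> g \<in> ob A \<Longrightarrow> s0 A g = t0 A (dm A \<phi>) \<Longrightarrow> map2 F (g \<rhd>\<^bsub>A\<^esub> \<phi>) = map1 F g \<rhd> map2 F \<phi>"
  "\<psi> \<in> mor A \<Longrightarrow> f \<in> ob A \<Longrightarrow> s0 A (dm A \<psi>) = t0 A f \<Longrightarrow> map2 F (\<psi> \<lhd>\<^bsub>A\<^esub> f) = map2 F \<psi> \<lhd> map1 F f"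
  "\<Gamma> \<in> cel A \<Longrightarrow> g \<in> ob A \<Longrightarrow> s0 A g = t0 A (dm A (sr A \<Gamma>)) \<Longrightarrow> map3 F (g \<unrhd>\<^bsub>A\<^esub> \<Gamma>) = map1 F g \<unrhd> map3 F \<Gamma>"
  "\<Gamma> \<in> cel A \<Longrightarrow> f \<in> ob A \<Longrightarrow> s0 A (dm A (sr A \<Gamma>)) = t0 A f \<Longrightarrow> map3 F (\<Gamma> \<unlhd>\<^bsub>A\<^esub> f) = map3 F \<Gamma> \<unlhd> map1 F f"
  "\<phi> \<in> mor A \<Longrightarrow> \<psi> \<in> mor A \<Longrightarrow> s0 A (dm A \<psi>) = t0 A (dm A \<phi>) \<Longrightarrow>
    map3 F (ich A \<psi> \<phi>) = ich B (map2 F \<psi>) (map2 F \<phi>)"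
  subgoal using map_lw2[of \<phi> "s0 A (dm A \<phi>)" "t0 A (dm A \<phi>)" g "t0 A g"] by auto
  subgoal using map_rw2[of f "s0 A f" "t0 A f" \<psi> "t0 A (dm A \<psi>)"] by auto
  subgoal using map_lw3[of \<Gamma> "s0 A (dm A (sr A \<Gamma>))" "t0 A (dm A (sr A \<Gamma>))" g "t0 A g"] by auto
  subgoal using map_rw3[of f "s0 A f" "t0 A f" \<Gamma> "t0 A (dm A (sr A \<Gamma>))"] by auto
  subgoal using map_ich[of \<phi> "s0 A (dm A \<phi>)" "t0 A (dm A \<phi>)" \<psi> "t0 A (dm A \<psi>)"] by auto
  done

end

locale gray_functors = F: gray_functor_between A B F + G: gray_functor_between A B G
  for A :: "('a, 'b, 'c, 'o) gray" and B :: "('d, 'e, 'g, 'p) gray" (structure) and F G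

text \<open>Well-typed data without equations. The assignment to \<open>H\<close> makes sense
  already here, so each law of \<open>p\<close> can be shown equivalent to one law of
  \<open>H\<close>, and both directions of the correspondence use the same equivalences.\<close>

locale pretrinatural = gray_functors A B F G
  for A :: "('a, 'b, 'c, 'o) gray" and B :: "('d, 'e, 'g, 'p) gray" (structure) and F G +
  fixes p :: "('o, 'a, 'b, 'd, 'e, 'g) trinat"
  assumes extensional: "tn0 p \<in> extensional (pt A)" "tn1 p \<in> extensional (ob A)"
      "tn2 p \<in> extensional (mor A)" "tnu p \<in> extensional (pt A)" "tnc p \<in> extensional (comps A)"
    and tn0_simps [simp]: "X \<in> pt A \<Longrightarrow> tn0 p X \<in> ob B" "X \<in> pt A \<Longrightarrow> s0 B (tn0 p X) = map0 F X"
      "X \<in> pt A \<Longrightarrow> t0 B (tn0 p X) = map0 G X"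
    and tn1_equivalence: "f \<in> ob A \<Longrightarrow> adjoint_equivalence B
        (tn0 p (t0 A f) \<cdot> map1 F f) (map1 G f \<cdot> tn0 p (s0 A f)) (tn1 p f)"
    and tn2_simps [simp]: "\<phi> \<in> mor A \<Longrightarrow> invertible B (tn2 p \<phi>)"
      "\<phi> \<in> mor A \<Longrightarrow> sr B (tn2 p \<phi>) = tnl p (cd A \<phi>) \<odot> (tn0 p (t0 A (dm A \<phi>)) \<rhd> map2 F \<phi>)"
      "\<phi> \<in> mor A \<Longrightarrow> tg B (tn2 p \<phi>) = (map2 G \<phi> \<lhd> tn0 p (s0 A (dm A \<phi>))) \<odot> tnl p (dm A \<phi>)"
    and tnu_simps [simp]: "X \<in> pt A \<Longrightarrow> invertible B (tnu p X)"
      "X \<in> pt A \<Longrightarrow> sr B (tnu p X) = idn B (tn0 p X)" "X \<in> pt A \<Longrightarrow> tg B (tnu p X) = tnl p (one A X)"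
    and tnc_simps [simp]: "f \<in> ob A \<Longrightarrow> g \<in> ob A \<Longrightarrow> s0 A g = t0 A f \<Longrightarrow> invertible B (tnc p (g, f))"
      "f \<in> ob A \<Longrightarrow> g \<in> ob A \<Longrightarrow> s0 A g = t0 A f \<Longrightarrow>
        sr B (tnc p (g, f)) = (map1 G g \<rhd> tnl p f) \<odot> (tnl p g \<lhd> map1 F f)"
      "f \<in> ob A \<Longrightarrow> g \<in> ob A \<Longrightarrow> s0 A g = t0 A f \<Longrightarrow> tg B (tnc p (g, f)) = tnl p (g \<cdot>\<^bsub>A\<^esub> f)"
begin

lemma tnl_simps [simp]:
  assumes "f \<in> ob A"
  shows "tnl p f \<in> mor B" "dm B (tnl p f) = tn0 p (t0 A f) \<cdot> map1 F f"
    "cd B (tnl p f) = map1 G f \<cdot> tn0 p (s0 A f)"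
  by (fact F.B.adjoint_equivalenceD(1)[OF tn1_equivalence[OF assms]],
      fact F.B.adjoint_equivalenceD(2)[OF tn1_equivalence[OF assms]],
      fact F.B.adjoint_equivalenceD(3)[OF tn1_equivalence[OF assms]])

abbreviation "P1 \<equiv> path1_of A F G p"
abbreviation "P2 \<equiv> path2_of A F G p"
abbreviation "P3 \<equiv> path3_of A F G p"
abbreviation "H \<equiv> trinat_to_path A B F G p"

lemma path1_of_simps [simp]:
  "p1_src (P1 f) = tn0 p (s0 A f)" "p1_tgt (P1 f) = tn0 p (t0 A f)" "p1_eq (P1 f) = tn1 p f"
  "p1_0 (P1 f) = map1 F f" "p1_1 (P1 f) = map1 G f"
  by (simp_all add: path1_of_def)

lemma path1_of_in [simp]: "f \<in> ob A \<Longrightarrow> P1 f \<in> path_cells1 B"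
  by (simp add: F.B.path_cells1_iff tn1_equivalence)

lemma path2_of_simps [simp]:
  "p2_src (P2 \<phi>) = P1 (dm A \<phi>)" "p2_tgt (P2 \<phi>) = P1 (cd A \<phi>)" "p2_cell (P2 \<phi>) = tn2 p \<phi>"
  "p2_0 (P2 \<phi>) = map2 F \<phi>" "p2_1 (P2 \<phi>) = map2 G \<phi>"
  by (simp_all add: path2_of_def)

lemma path2_of_in [simp]: "\<phi> \<in> mor A \<Longrightarrow> P2 \<phi> \<in> path_cells2 B"
  by (simp add: F.B.path_cells2_iff)

lemma path3_of_simps [simp]:
  "p3_src (P3 \<Gamma>) = P2 (sr A \<Gamma>)" "p3_tgt (P3 \<Gamma>) = P2 (tg A \<Gamma>)" "p3_0 (P3 \<Gamma>) = map3 F \<Gamma>"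
  "p3_1 (P3 \<Gamma>) = map3 G \<Gamma>"
  by (simp_all add: path3_of_def)

lemma trinat_to_path_simps [simp]:
  "X \<in> pt A \<Longrightarrow> map0 H X = tn0 p X" "f \<in> ob A \<Longrightarrow> map1 H f = P1 f"
  "\<phi> \<in> mor A \<Longrightarrow> map2 H \<phi> = P2 \<phi>" "\<Gamma> \<in> cel A \<Longrightarrow> map3 H \<Gamma> = P3 \<Gamma>"
  by (simp_all add: trinat_to_path_def)

lemma iota_simps [simp]:
  assumes "X \<in> pt A"
  shows "p2_src (iota H X) = path_one B (tn0 p X)" "p2_tgt (iota H X) = P1 (one A X)"
    "p2_cell (iota H X) = cinv B (tnu p X)"
    "p2_0 (iota H X) = idn B (one B (map0 F X))" "p2_1 (iota H X) = idn B (one B (map0 G X))"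
  using assms by (simp_all add: trinat_to_path_def)

lemma chi_simps [simp]:
  assumes "f \<in> ob A" "g \<in> ob A" "s0 A g = t0 A f"
  shows "p2_src (chi H (g, f)) = path_comp1 B (P1 g) (P1 f)" "p2_tgt (chi H (g, f)) = P1 (g \<cdot>\<^bsub>A\<^esub> f)"
    "p2_cell (chi H (g, f)) = cinv B (tnc p (g, f))"
    "p2_0 (chi H (g, f)) = idn B (map1 F g \<cdot> map1 F f)"
    "p2_1 (chi H (g, f)) = idn B (map1 G g \<cdot> map1 G f)"
  using assms by (simp_all add: trinat_to_path_def comps_def)

lemma iota_in [simp]: "X \<in> pt A \<Longrightarrow> iota H X \<in> path_cells2 B"
  by (simp add: F.B.path_cells2_iff)

lemma chi_in [simp]:
  "f \<in> ob A \<Longrightarrow> g \<in> ob A \<Longrightarrow> s0 A g = t0 A f \<Longrightarrow> chi H (g, f) \<in> path_cells2 B"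
  by (simp add: F.B.path_cells2_iff)

lemma iota_invertible:
  assumes "X \<in> pt A"
  shows "iota H X \<in> imors (path B) (path_one B (tn0 p X)) (P1 (one A X))"
  using F.B.path_inverse[of "iota H X" "one B (map0 F X)" "one B (map0 G X)"] assms by simp

lemma chi_invertible:
  assumes "f \<in> ob A" "g \<in> ob A" "s0 A g = t0 A f"
  shows "chi H (g, f) \<in> imors (path B) (path_comp1 B (P1 g) (P1 f)) (P1 (g \<cdot>\<^bsub>A\<^esub> f))"
  using F.B.path_inverse[of "chi H (g, f)" "map1 F g \<cdot> map1 F f" "map1 G g \<cdot> map1 G f"] assms by simp

lemma local_id_iff:
  "f \<in> ob A \<Longrightarrow> P2 (idn A f) = path_idn B (P1 f) \<longleftrightarrow> tn2 p (idn A f) = \<langle>tnl p f\<rangle>"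
  by (simp add: path2_of_def path_idn_def)

lemma local_cmp_iff:
  assumes "\<phi> \<in> mor A" "\<psi> \<in> mor A" "dm A \<psi> = cd A \<phi>"
  shows "P2 (\<psi> \<odot>\<^bsub>A\<^esub> \<phi>) = path_cmp B (P2 \<psi>) (P2 \<phi>) \<longleftrightarrow>
    tn2 p (\<psi> \<odot>\<^bsub>A\<^esub> \<phi>) = (\<langle>map2 G \<psi> \<lhd> tn0 p (s0 A (dm A \<phi>))\<rangle> \<star> tn2 p \<phi>)
      \<bullet> (tn2 p \<psi> \<star> \<langle>tn0 p (t0 A (dm A \<phi>)) \<rhd> map2 F \<phi>\<rangle>)"
  using assms by (simp add: path2_of_def path_cmp_def)

lemma local_natural_iff:
  assumes "\<Gamma> \<in> cel A"
  shows "P3 \<Gamma> \<in> path_cells3 B \<longleftrightarrow>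
    ((map3 G \<Gamma> \<unlhd> tn0 p (s0 A (dm A (sr A \<Gamma>)))) \<star> \<langle>tnl p (dm A (sr A \<Gamma>))\<rangle>) \<bullet> tn2 p (sr A \<Gamma>) =
    tn2 p (tg A \<Gamma>) \<bullet> (\<langle>tnl p (cd A (sr A \<Gamma>))\<rangle> \<star> (tn0 p (t0 A (dm A (sr A \<Gamma>))) \<unrhd> map3 F \<Gamma>))"
  using assms by (auto simp: F.B.path_cells3_iff)

text \<open>The last two factors of the law, with the inverse interchanger, are by construction the
  3-cell of \<open>path_lw2\<close>. It remains to move the two compositors, which occur inverted in
  \<open>chi\<close>, to the other sides.\<close>

lemma right_whiskering_iff:
  assumes "\<phi> \<in> mor A" "g \<in> ob A" "s0 A g = t0 A (dm A \<phi>)"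
  shows "path_cmp B (chi H (g, cd A \<phi>)) (path_lw2 B (P1 g) (P2 \<phi>)) =
      path_cmp B (P2 (g \<rhd>\<^bsub>A\<^esub> \<phi>)) (chi H (g, dm A \<phi>)) \<longleftrightarrow>
    tn2 p (g \<rhd>\<^bsub>A\<^esub> \<phi>) \<bullet> (tnc p (g, cd A \<phi>) \<star> \<langle>(tn0 p (t0 A g) \<cdot> map1 F g) \<rhd> map2 F \<phi>\<rangle>) =
        (\<langle>(map1 G g \<rhd> map2 G \<phi>) \<lhd> tn0 p (s0 A (dm A \<phi>))\<rangle> \<star> tnc p (g, dm A \<phi>))
        \<bullet> ((map1 G g \<unrhd> tn2 p \<phi>) \<star> \<langle>tnl p g \<lhd> map1 F (dm A \<phi>)\<rangle>)
        \<bullet> (\<langle>map1 G g \<rhd> tnl p (cd A \<phi>)\<rangle> \<star> cinv B (ich B (tnl p g) (map2 F \<phi>)))"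
    (is "?l \<longleftrightarrow> ?r")
proof -
  let ?L = "p2_cell (path_lw2 B (P1 g) (P2 \<phi>))"
  let ?x = "tnc p (g, cd A \<phi>) \<star> \<langle>(tn0 p (t0 A g) \<cdot> map1 F g) \<rhd> map2 F \<phi>\<rangle>"
  let ?y = "\<langle>(map1 G g \<rhd> map2 G \<phi>) \<lhd> tn0 p (s0 A (dm A \<phi>))\<rangle> \<star> tnc p (g, dm A \<phi>)"
  have "?l \<longleftrightarrow> ?L \<bullet> cinv B ?x = cinv B ?y \<bullet> tn2 p (g \<rhd>\<^bsub>A\<^esub> \<phi>)"
    using assms by (simp add: path_cmp_def F.B.p2_cell_path_lw2)
  also have "\<dots> \<longleftrightarrow> tn2 p (g \<rhd>\<^bsub>A\<^esub> \<phi>) \<bullet> ?x = ?y \<bullet> ?L"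
    by (rule F.B.conjugate_iff[symmetric]) (use assms in \<open>simp_all add: F.B.p2_cell_path_lw2\<close>)
  also have "\<dots> \<longleftrightarrow> ?r"
    using assms by (simp add: F.B.p2_cell_path_lw2)
  finally show ?thesis .
qed

text \<open>As for right whiskering, with \<open>path_rw2\<close> supplying the interchanger, this
  time not inverted.\<close>

lemma left_whiskering_iff:
  assumes "f \<in> ob A" "\<psi> \<in> mor A" "s0 A (dm A \<psi>) = t0 A f"
  shows "path_cmp B (chi H (cd A \<psi>, f)) (path_rw2 B (P2 \<psi>) (P1 f)) =
      path_cmp B (P2 (\<psi> \<lhd>\<^bsub>A\<^esub> f)) (chi H (dm A \<psi>, f)) \<longleftrightarrow>
    tn2 p (\<psi> \<lhd>\<^bsub>A\<^esub> f) \<bullet> (tnc p (cd A \<psi>, f) \<star> \<langle>tn0 p (t0 A (dm A \<psi>)) \<rhd> (map2 F \<psi> \<lhd> map1 F f)\<rangle>) =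
        (\<langle>map2 G \<psi> \<lhd> (map1 G f \<cdot> tn0 p (s0 A f))\<rangle> \<star> tnc p (dm A \<psi>, f))
        \<bullet> (ich B (map2 G \<psi>) (tnl p f) \<star> \<langle>tnl p (dm A \<psi>) \<lhd> map1 F f\<rangle>)
        \<bullet> (\<langle>map1 G (cd A \<psi>) \<rhd> tnl p f\<rangle> \<star> (tn2 p \<psi> \<unlhd> map1 F f))"
    (is "?l \<longleftrightarrow> ?r")
proof -
  let ?L = "p2_cell (path_rw2 B (P2 \<psi>) (P1 f))"
  let ?x = "tnc p (cd A \<psi>, f) \<star> \<langle>tn0 p (t0 A (dm A \<psi>)) \<rhd> (map2 F \<psi> \<lhd> map1 F f)\<rangle>"
  let ?y = "\<langle>map2 G \<psi> \<lhd> (map1 G f \<cdot> tn0 p (s0 A f))\<rangle> \<star> tnc p (dm A \<psi>, f)"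
  have "?l \<longleftrightarrow> ?L \<bullet> cinv B ?x = cinv B ?y \<bullet> tn2 p (\<psi> \<lhd>\<^bsub>A\<^esub> f)"
    using assms by (simp add: path_cmp_def F.B.p2_cell_path_rw2)
  also have "\<dots> \<longleftrightarrow> tn2 p (\<psi> \<lhd>\<^bsub>A\<^esub> f) \<bullet> ?x = ?y \<bullet> ?L"
    by (rule F.B.conjugate_iff[symmetric]) (use assms in \<open>simp_all add: F.B.p2_cell_path_rw2\<close>)
  also have "\<dots> \<longleftrightarrow> ?r"
    using assms by (simp add: F.B.p2_cell_path_rw2)
  finally show ?thesis .
qed

text \<open>Both whiskerings take interchangers at identity 2-cells, where they are identities. The
  equation in the path object is then the law with both sides inverted; the unit laws behave
  alike.\<close>

lemma associativity_iff:
  assumes "e \<in> ob A" "f \<in> ob A" "g \<in> ob A" "s0 A f = t0 A e" "s0 A g = t0 A f"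
  shows "path_cmp B (chi H (g \<cdot>\<^bsub>A\<^esub> f, e)) (path_rw2 B (chi H (g, f)) (P1 e)) =
      path_cmp B (chi H (g, f \<cdot>\<^bsub>A\<^esub> e)) (path_lw2 B (P1 g) (chi H (f, e))) \<longleftrightarrow>
    tnc p (g, f \<cdot>\<^bsub>A\<^esub> e) \<bullet> ((map1 G g \<unrhd> tnc p (f, e)) \<star> \<langle>tnl p g \<lhd> (map1 F f \<cdot> map1 F e)\<rangle>) =
        tnc p (g \<cdot>\<^bsub>A\<^esub> f, e) \<bullet> (\<langle>(map1 G g \<cdot> map1 G f) \<rhd> tnl p e\<rangle> \<star> (tnc p (g, f) \<unlhd> map1 F e))"
    (is "?l \<longleftrightarrow> ?x = ?y")
proof -
  have "?l \<longleftrightarrow> cinv B ?y = cinv B ?x"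
    using assms by (simp add: path_cmp_def F.B.p2_cell_path_rw2 F.B.p2_cell_path_lw2)
  also have "\<dots> \<longleftrightarrow> ?x = ?y"
    by (subst F.B.cinv_eq_iff) (use assms in auto)
  finally show ?thesis .
qed

lemma unit_right_iff:
  assumes "f \<in> ob A"
  shows "path_cmp B (chi H (f, one A (s0 A f))) (path_lw2 B (P1 f) (iota H (s0 A f))) = path_idn B (P1 f)
    \<longleftrightarrow> tnc p (f, one A (s0 A f)) \<bullet> ((map1 G f \<unrhd> tnu p (s0 A f)) \<star> \<langle>tnl p f\<rangle>) = \<langle>tnl p f\<rangle>"
    (is "?l \<longleftrightarrow> ?x = ?y")
proof -
  have "?l \<longleftrightarrow> cinv B ?x = cinv B ?y"
    using assms by (simp add: path_cmp_def path_idn_def F.B.p2_cell_path_lw2)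
  also have "\<dots> \<longleftrightarrow> ?x = ?y"
    by (subst F.B.cinv_eq_iff) (use assms in auto)
  finally show ?thesis .
qed

lemma unit_left_iff:
  assumes "f \<in> ob A"
  shows "path_cmp B (chi H (one A (t0 A f), f)) (path_rw2 B (iota H (t0 A f)) (P1 f)) = path_idn B (P1 f)
    \<longleftrightarrow> tnc p (one A (t0 A f), f) \<bullet> (\<langle>tnl p f\<rangle> \<star> (tnu p (t0 A f) \<unlhd> map1 F f)) = \<langle>tnl p f\<rangle>"
    (is "?l \<longleftrightarrow> ?x = ?y")
proof -
  have "?l \<longleftrightarrow> cinv B ?x = cinv B ?y"
    using assms by (simp add: path_cmp_def path_idn_def F.B.p2_cell_path_rw2)
  also have "\<dots> \<longleftrightarrow> ?x = ?y"
    by (subst F.B.cinv_eq_iff) (use assms in auto)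
  finally show ?thesis .
qed

end

context gray_functors
begin

lemma pretrinatural_of_trinatural:
  assumes "trinatural A B F G p"
  shows "pretrinatural A B F G p"
proof -
  interpret t: trinatural A B F G p by fact
  show ?thesis
  proof
    show "tn0 p \<in> extensional (pt A)" "tn1 p \<in> extensional (ob A)" "tn2 p \<in> extensional (mor A)"
      "tnu p \<in> extensional (pt A)" "tnc p \<in> extensional (comps A)"
      by (fact t.extensional)+
  next
    fix X assume "X \<in> pt A"
    then show "tn0 p X \<in> ob B" "s0 B (tn0 p X) = map0 F X" "t0 B (tn0 p X) = map0 G X"
      and "invertible B (tnu p X)" "sr B (tnu p X) = idn B (tn0 p X)" "tg B (tnu p X) = tnl p (one A X)"
      using t.tn0_in[of X] t.tnu_in[of X] by (auto simp: icels_iff)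
  next
    fix f assume "f \<in> ob A"
    then show "adjoint_equivalence B (tn0 p (t0 A f) \<cdot> map1 F f) (map1 G f \<cdot> tn0 p (s0 A f)) (tn1 p f)"
      using t.tn1_in[of f "s0 A f" "t0 A f"] by (simp add: F.B.adjoint_equivalence_hom_iff)
  next
    fix \<phi> assume "\<phi> \<in> mor A"
    then show "invertible B (tn2 p \<phi>)"
      "sr B (tn2 p \<phi>) = tnl p (cd A \<phi>) \<odot> (tn0 p (t0 A (dm A \<phi>)) \<rhd> map2 F \<phi>)"
      "tg B (tn2 p \<phi>) = (map2 G \<phi> \<lhd> tn0 p (s0 A (dm A \<phi>))) \<odot> tnl p (dm A \<phi>)"
      using t.tn2_in[of \<phi> "s0 A (dm A \<phi>)" "t0 A (dm A \<phi>)" "dm A \<phi>" "cd A \<phi>"]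
      by (auto simp: icels_iff mors_hom_iff)
  next
    fix f g assume "f \<in> ob A" "g \<in> ob A" "s0 A g = t0 A f"
    then show "invertible B (tnc p (g, f))"
      "sr B (tnc p (g, f)) = (map1 G g \<rhd> tnl p f) \<odot> (tnl p g \<lhd> map1 F f)"
      "tg B (tnc p (g, f)) = tnl p (g \<cdot>\<^bsub>A\<^esub> f)"
      using t.tnc_in[of f "s0 A f" "t0 A f" g "t0 A g"] by (auto simp: icels_iff)
  qed
qed

end

section \<open>Trinatural transformations versus 3-pseudofunctors into the path object\<close>

context pretrinatural
begin

lemma path_ops:
  "idc (path B) \<phi> = \<lparr>p3_src = \<phi>, p3_tgt = \<phi>, p3_0 = \<langle>p2_0 \<phi>\<rangle>, p3_1 = \<langle>p2_1 \<phi>\<rangle>\<rparr>"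
  "hcmp (path B) \<Delta> \<Gamma> = \<lparr>p3_src = path_cmp B (p3_src \<Delta>) (p3_src \<Gamma>),
     p3_tgt = path_cmp B (p3_tgt \<Delta>) (p3_tgt \<Gamma>),
     p3_0 = p3_0 \<Delta> \<star> p3_0 \<Gamma>, p3_1 = p3_1 \<Delta> \<star> p3_1 \<Gamma>\<rparr>"
  "vcmp (path B) \<Delta> \<Gamma> = \<lparr>p3_src = p3_src \<Gamma>, p3_tgt = p3_tgt \<Delta>,
     p3_0 = p3_0 \<Delta> \<bullet> p3_0 \<Gamma>, p3_1 = p3_1 \<Delta> \<bullet> p3_1 \<Gamma>\<rparr>"
  "lw3 (path B) v \<Gamma> = \<lparr>p3_src = path_lw2 B v (p3_src \<Gamma>), p3_tgt = path_lw2 B v (p3_tgt \<Gamma>),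
     p3_0 = p1_0 v \<unrhd> p3_0 \<Gamma>, p3_1 = p1_1 v \<unrhd> p3_1 \<Gamma>\<rparr>"
  "rw3 (path B) \<Gamma> u = \<lparr>p3_src = path_rw2 B (p3_src \<Gamma>) u, p3_tgt = path_rw2 B (p3_tgt \<Gamma>) u,
     p3_0 = p3_0 \<Gamma> \<unlhd> p1_0 u, p3_1 = p3_1 \<Gamma> \<unlhd> p1_1 u\<rparr>"
  "ich (path B) \<psi> \<phi> = \<lparr>p3_src = path_cmp B (path_lw2 B (p2_tgt \<psi>) \<phi>) (path_rw2 B \<psi> (p2_src \<phi>)),
     p3_tgt = path_cmp B (path_rw2 B \<psi> (p2_tgt \<phi>)) (path_lw2 B (p2_src \<psi>) \<phi>),
     p3_0 = ich B (p2_0 \<psi>) (p2_0 \<phi>), p3_1 = ich B (p2_1 \<psi>) (p2_1 \<phi>)\<rparr>"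
  by (simp_all add: path_def)

text \<open>A 3-cell of the path object is determined by its boundary and its two components. The
  components agree because \<open>F\<close> and \<open>G\<close> preserve all structure, so every
  axiom on 3-cells follows from the 2-cell laws applied to source and target.\<close>

lemma pseudofunctor3_of_trinatural:
  assumes "trinatural A B F G p"
  shows "pseudofunctor3 A (path B) H"
proof -
  interpret t: trinatural A B F G p by fact
  have id: "P2 (idn A f) = path_idn B (P1 f)" if "f \<in> ob A" for f
    using that by (simp add: local_id_iff t.local_id)
  have cmp: "P2 (\<psi> \<odot>\<^bsub>A\<^esub> \<phi>) = path_cmp B (P2 \<psi>) (P2 \<phi>)"
    if "\<phi> \<in> mor A" "\<psi> \<in> mor A" "dm A \<psi> = cd A \<phi>" for \<phi> \<psi>
    using that t.local_cmp[of \<phi> "s0 A (dm A \<phi>)" "t0 A (dm A \<phi>)" "dm A \<phi>" "cd A \<phi>" \<psi> "cd A \<psi>"]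
    by (simp add: local_cmp_iff mors_hom_iff)
  have P3: "P3 \<Gamma> \<in> path_cells3 B" if "\<Gamma> \<in> cel A" for \<Gamma>
    using that t.local_natural[of "sr A \<Gamma>" "s0 A (dm A (sr A \<Gamma>))" "t0 A (dm A (sr A \<Gamma>))"
        "dm A (sr A \<Gamma>)" "cd A (sr A \<Gamma>)" \<Gamma> "tg A \<Gamma>"]
    by (simp add: local_natural_iff mors_hom_iff cels_hom_iff)
  have right: "path_cmp B (chi H (g, cd A \<phi>)) (path_lw2 B (P1 g) (P2 \<phi>)) =
      path_cmp B (P2 (g \<rhd>\<^bsub>A\<^esub> \<phi>)) (chi H (g, dm A \<phi>))"
    if "\<phi> \<in> mor A" "g \<in> ob A" "s0 A g = t0 A (dm A \<phi>)" for \<phi> g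
    unfolding right_whiskering_iff[OF that]
    using that t.right_whiskering[of \<phi> "s0 A (dm A \<phi>)" "t0 A (dm A \<phi>)" "dm A \<phi>" "cd A \<phi>" g "t0 A g"]
    by (simp only: mors_hom_iff hom_simps mem_Collect_eq simp_thms)
  have left: "path_cmp B (chi H (cd A \<psi>, f)) (path_rw2 B (P2 \<psi>) (P1 f)) =
      path_cmp B (P2 (\<psi> \<lhd>\<^bsub>A\<^esub> f)) (chi H (dm A \<psi>, f))"
    if "f \<in> ob A" "\<psi> \<in> mor A" "s0 A (dm A \<psi>) = t0 A f" for \<psi> f
    unfolding left_whiskering_iff[OF that]
    using that t.left_whiskering[of f "s0 A f" "t0 A f" \<psi> "t0 A (dm A \<psi>)" "dm A \<psi>" "cd A \<psi>"]
    by (simp only: mors_hom_iff hom_simps mem_Collect_eq simp_thms)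
  show ?thesis
  proof (rule pseudofunctor3.intro)
    show "map0 H \<in> extensional (pt A)" "map1 H \<in> extensional (ob A)"
      "map2 H \<in> extensional (mor A)" "map3 H \<in> extensional (cel A)"
      "iota H \<in> extensional (pt A)" "chi H \<in> extensional (comps A)"
      by (simp_all add: trinat_to_path_def)
  next
    fix X assume "X \<in> pt A"
    then show "map0 H X \<in> pt (path B)"
      and "iota H X \<in> imors (path B) (one (path B) (map0 H X)) (map1 H (one A X))"
      using iota_invertible by simp_all
  next
    fix X Y assume XY: "X \<in> pt A" "Y \<in> pt A"
    show "two_functor (hom A X Y) (hom (path B) (map0 H X) (map0 H Y)) (map1 H) (map2 H) (map3 H)"
    proof
      fix a assume "a \<in> ob (hom A X Y)"
      then show "map1 H a \<in> ob (hom (path B) (map0 H X) (map0 H Y))"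
        and "map2 H (idn (hom A X Y) a) = idn (hom (path B) (map0 H X) (map0 H Y)) (map1 H a)"
        by (auto simp: id)
    next
      fix f a b assume "f \<in> mors (hom A X Y) a b"
      then show "map2 H f \<in> mors (hom (path B) (map0 H X) (map0 H Y)) (map1 H a) (map1 H b)"
        by (auto simp: mors_hom_iff)
    next
      fix x f g assume "x \<in> cels (hom A X Y) f g"
      then show "map3 H x \<in> cels (hom (path B) (map0 H X) (map0 H Y)) (map2 H f) (map2 H g)"
        by (auto simp: cels_hom_iff P3)
    next
      fix f a b g c assume "f \<in> mors (hom A X Y) a b" "g \<in> mors (hom A X Y) b c"
      then show "map2 H (g \<odot>\<^bsub>hom A X Y\<^esub> f) = map2 H g \<odot>\<^bsub>hom (path B) (map0 H X) (map0 H Y)\<^esub> map2 H f"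
        by (auto simp: mors_hom_iff cmp)
    next
      fix f assume "f \<in> mor (hom A X Y)"
      then show "map3 H (idc (hom A X Y) f) = idc (hom (path B) (map0 H X) (map0 H Y)) (map2 H f)"
        by (auto simp: path_ops path3_of_def)
    next
      fix x f g y h assume "x \<in> cels (hom A X Y) f g" "y \<in> cels (hom A X Y) g h"
      then show "map3 H (y \<bullet>\<^bsub>hom A X Y\<^esub> x) = map3 H y \<bullet>\<^bsub>hom (path B) (map0 H X) (map0 H Y)\<^esub> map3 H x"
        by (auto simp: cels_hom_iff path_ops path3_of_def)
    next
      fix x f f' y g g'
      assume "x \<in> cels (hom A X Y) f f'" "y \<in> cels (hom A X Y) g g'"
        "cd (hom A X Y) f = dm (hom A X Y) g"
      then show "map3 H (y \<star>\<^bsub>hom A X Y\<^esub> x) = map3 H y \<star>\<^bsub>hom (path B) (map0 H X) (map0 H Y)\<^esub> map3 H x"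
        by (auto simp: cels_hom_iff path_ops path3_of_def cmp)
    qed
  next
    fix f X Y g Z assume "f \<in> cells1 A X Y" "g \<in> cells1 A Y Z"
    then show "chi H (g, f) \<in> imors (path B) (map1 H g \<cdot>\<^bsub>path B\<^esub> map1 H f) (map1 H (g \<cdot>\<^bsub>A\<^esub> f))"
      using chi_invertible[of f g] by simp
  next
    fix f X Y \<psi> Z g g' assume *: "f \<in> cells1 A X Y" "\<psi> \<in> mors (hom A Y Z) g g'"
    then show l: "chi H (g', f) \<odot>\<^bsub>path B\<^esub> (map2 H \<psi> \<lhd>\<^bsub>path B\<^esub> map1 H f) =
        map2 H (\<psi> \<lhd>\<^bsub>A\<^esub> f) \<odot>\<^bsub>path B\<^esub> chi H (g, f)"
      using left[of f \<psi>] by (auto simp: mors_hom_iff)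
    fix \<Gamma> \<psi>' assume "\<Gamma> \<in> cels (hom A Y Z) \<psi> \<psi>'"
    with * show "idc (path B) (chi H (g', f)) \<star>\<^bsub>path B\<^esub> (map3 H \<Gamma> \<unlhd>\<^bsub>path B\<^esub> map1 H f) =
        map3 H (\<Gamma> \<unlhd>\<^bsub>A\<^esub> f) \<star>\<^bsub>path B\<^esub> idc (path B) (chi H (g, f))"
      using left[of f \<psi>] left[of f \<psi>'] by (auto simp: mors_hom_iff cels_hom_iff path_ops)
  next
    fix \<phi> X Y f f' g Z assume *: "\<phi> \<in> mors (hom A X Y) f f'" "g \<in> cells1 A Y Z"
    then show "chi H (g, f') \<odot>\<^bsub>path B\<^esub> (map1 H g \<rhd>\<^bsub>path B\<^esub> map2 H \<phi>) =
        map2 H (g \<rhd>\<^bsub>A\<^esub> \<phi>) \<odot>\<^bsub>path B\<^esub> chi H (g, f)"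
      using right[of \<phi> g] by (auto simp: mors_hom_iff)
  next
    fix \<phi> X Y f f' \<Gamma> \<phi>' g Z
    assume *: "\<phi> \<in> mors (hom A X Y) f f'" "\<Gamma> \<in> cels (hom A X Y) \<phi> \<phi>'" "g \<in> cells1 A Y Z"
    then show "idc (path B) (chi H (g, f')) \<star>\<^bsub>path B\<^esub> (map1 H g \<unrhd>\<^bsub>path B\<^esub> map3 H \<Gamma>) =
        map3 H (g \<unrhd>\<^bsub>A\<^esub> \<Gamma>) \<star>\<^bsub>path B\<^esub> idc (path B) (chi H (g, f))"
      using right[of \<phi> g] right[of \<phi>' g] by (auto simp: mors_hom_iff cels_hom_iff path_ops)
  next
    fix \<phi> X Y f f' \<psi> Z g g'
    assume *: "\<phi> \<in> mors (hom A X Y) f f'" "\<psi> \<in> mors (hom A Y Z) g g'"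
    then have m: "\<phi> \<in> mor A" "\<psi> \<in> mor A" "s0 A (dm A \<psi>) = t0 A (dm A \<phi>)" 
      "f = dm A \<phi>" "f' = cd A \<phi>" "g = dm A \<psi>" "g' = cd A \<psi>" by (auto simp: mors_hom_iff)
    \<comment> \<open>Each end of an interchanger is a composite of a left and a right whiskering,
      and \<open>chi\<close> is moved past one after the other. The other end, in
      \<open>tgt\<close>, has the two whiskerings in the opposite order.\<close>
    have src: "path_cmp B (chi H (cd A \<psi>, cd A \<phi>))
        (path_cmp B (path_lw2 B (P1 (cd A \<psi>)) (P2 \<phi>)) (path_rw2 B (P2 \<psi>) (P1 (dm A \<phi>)))) =
      path_cmp B (P2 ((cd A \<psi> \<rhd>\<^bsub>A\<^esub> \<phi>) \<odot>\<^bsub>A\<^esub> (\<psi> \<lhd>\<^bsub>A\<^esub> dm A \<phi>))) (chi H (dm A \<psi>, dm A \<phi>))" (is "?l = ?r")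
    proof -
      have "?l = path_cmp B (path_cmp B (chi H (cd A \<psi>, cd A \<phi>)) (path_lw2 B (P1 (cd A \<psi>)) (P2 \<phi>)))
          (path_rw2 B (P2 \<psi>) (P1 (dm A \<phi>)))"
        using m by simp
      also have "\<dots> = path_cmp B (P2 (cd A \<psi> \<rhd>\<^bsub>A\<^esub> \<phi>))
          (path_cmp B (chi H (cd A \<psi>, dm A \<phi>)) (path_rw2 B (P2 \<psi>) (P1 (dm A \<phi>))))"
        using m by (simp add: right del: F.B.path_cmp_assoc) (simp add: m)
      also have "\<dots> = ?r" using m by (simp add: left cmp)
      finally show ?thesis .
    qed
    have tgt: "path_cmp B (chi H (cd A \<psi>, cd A \<phi>))
        (path_cmp B (path_rw2 B (P2 \<psi>) (P1 (cd A \<phi>))) (path_lw2 B (P1 (dm A \<psi>)) (P2 \<phi>))) =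
      path_cmp B (P2 ((\<psi> \<lhd>\<^bsub>A\<^esub> cd A \<phi>) \<odot>\<^bsub>A\<^esub> (dm A \<psi> \<rhd>\<^bsub>A\<^esub> \<phi>))) (chi H (dm A \<psi>, dm A \<phi>))" (is "?l = ?r")
    proof -
      have "?l = path_cmp B (path_cmp B (chi H (cd A \<psi>, cd A \<phi>)) (path_rw2 B (P2 \<psi>) (P1 (cd A \<phi>))))
          (path_lw2 B (P1 (dm A \<psi>)) (P2 \<phi>))"
        using m by simp
      also have "\<dots> = path_cmp B (P2 (\<psi> \<lhd>\<^bsub>A\<^esub> cd A \<phi>))
          (path_cmp B (chi H (dm A \<psi>, cd A \<phi>)) (path_lw2 B (P1 (dm A \<psi>)) (P2 \<phi>)))"
        using m by (simp add: left del: F.B.path_cmp_assoc) (simp add: m)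
      also have "\<dots> = ?r" using m by (simp add: right cmp)
      finally show ?thesis .
    qed
    show "idc (path B) (chi H (g', f')) \<star>\<^bsub>path B\<^esub> ich (path B) (map2 H \<psi>) (map2 H \<phi>) =
        map3 H (ich A \<psi> \<phi>) \<star>\<^bsub>path B\<^esub> idc (path B) (chi H (g, f))"
      using m src tgt by (simp add: path_ops)
  next
    fix f X Y assume "f \<in> cells1 A X Y"
    then show "chi H (one A Y, f) \<odot>\<^bsub>path B\<^esub> (iota H Y \<lhd>\<^bsub>path B\<^esub> map1 H f) = idn (path B) (map1 H f)"
      and "chi H (f, one A X) \<odot>\<^bsub>path B\<^esub> (map1 H f \<rhd>\<^bsub>path B\<^esub> iota H X) = idn (path B) (map1 H f)"
      using unit_left_iff[of f] unit_right_iff[of f] t.unit_left[of f X Y] t.unit_right[of f X Y] by auto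
  next
    fix f W X g Y h Z assume "f \<in> cells1 A W X" "g \<in> cells1 A X Y" "h \<in> cells1 A Y Z"
    then show "chi H (h \<cdot>\<^bsub>A\<^esub> g, f) \<odot>\<^bsub>path B\<^esub> (chi H (h, g) \<lhd>\<^bsub>path B\<^esub> map1 H f) =
       chi H (h, g \<cdot>\<^bsub>A\<^esub> f) \<odot>\<^bsub>path B\<^esub> (map1 H h \<rhd>\<^bsub>path B\<^esub> chi H (g, f))"
      using associativity_iff[of f g h] t.associativity[of f W X g Y h Z] by auto
  qed
qed

lemma trinatural_of_pseudofunctor3:
  assumes "pseudofunctor3 A (path B) H"
  shows "trinatural A B F G p"
proof -
  interpret t: pseudofunctor3 A "path B" H by fact
  show ?thesis
  proof
    show "tn0 p \<in> extensional (pt A)" "tn1 p \<in> extensional (ob A)" "tn2 p \<in> extensional (mor A)"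
      "tnu p \<in> extensional (pt A)" "tnc p \<in> extensional (comps A)"
      by (fact extensional)+
  next
    fix X assume "X \<in> pt A"
    then show "tn0 p X \<in> cells1 B (map0 F X) (map0 G X)"
      and "tnu p X \<in> icels B (idn B (tn0 p X)) (tnl p (one A X))"
      by (auto simp: icels_iff)
  next
    fix f X Y assume "f \<in> cells1 A X Y"
    then have f: "f \<in> ob A" "s0 A f = X" "t0 A f = Y" by auto
    show "adjoint_equivalence (hom B (map0 F X) (map0 G Y))
        (tn0 p Y \<cdot> map1 F f) (map1 G f \<cdot> tn0 p X) (tn1 p f)"
      unfolding f(2,3)[symmetric] F.B.adjoint_equivalence_hom_iff
      using tn1_equivalence[OF f(1)] f(1) by simp
    show "tnc p (f, one A X) \<bullet> ((map1 G f \<unrhd> tnu p X) \<star> \<langle>tnl p f\<rangle>) = \<langle>tnl p f\<rangle>"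
      using unit_right_iff[OF f(1)] t.unit_right[of f X Y] f by simp
    show "tnc p (one A Y, f) \<bullet> (\<langle>tnl p f\<rangle> \<star> (tnu p Y \<unlhd> map1 F f)) = \<langle>tnl p f\<rangle>"
      using unit_left_iff[OF f(1)] t.unit_left[of f X Y] f by simp
  next
    fix \<phi> X Y f g assume "\<phi> \<in> mors (hom A X Y) f g"
    then show "tn2 p \<phi> \<in> icels B (tnl p g \<odot> (tn0 p Y \<rhd> map2 F \<phi>)) ((map2 G \<phi> \<lhd> tn0 p X) \<odot> tnl p f)"
      by (auto simp: icels_iff mors_hom_iff)
  next
    fix f X Y g Z assume "f \<in> cells1 A X Y" "g \<in> cells1 A Y Z"
    then show "tnc p (g, f) \<in> icels B ((map1 G g \<rhd> tnl p f) \<odot> (tnl p g \<lhd> map1 F f)) (tnl p (g \<cdot>\<^bsub>A\<^esub> f))"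
      by (auto simp: icels_iff)
  next
    fix f assume "f \<in> ob A"
    then show "tn2 p (idn A f) = \<langle>tnl p f\<rangle>"
      using two_functor.m_idn[OF t.local_two_functor[of "s0 A f" "t0 A f"], of f] local_id_iff[of f]
      by auto
  next
    fix \<phi> X Y f g \<psi> h assume *: "\<phi> \<in> mors (hom A X Y) f g" "\<psi> \<in> mors (hom A X Y) g h"
    then have "X \<in> pt A" "Y \<in> pt A" by (auto simp: mors_hom_iff)
    from two_functor.m_cmp[OF t.local_two_functor[OF this], OF *] local_cmp_iff[of \<phi> \<psi>] *
    show "tn2 p (\<psi> \<odot>\<^bsub>A\<^esub> \<phi>) =
        (\<langle>map2 G \<psi> \<lhd> tn0 p X\<rangle> \<star> tn2 p \<phi>) \<bullet> (tn2 p \<psi> \<star> \<langle>tn0 p Y \<rhd> map2 F \<phi>\<rangle>)"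
      by (auto simp: mors_hom_iff)
  next
    fix \<phi> X Y f g \<Omega> \<phi>' assume *: "\<phi> \<in> mors (hom A X Y) f g" "\<Omega> \<in> cels (hom A X Y) \<phi> \<phi>'"
    then have m: "X \<in> pt A" "Y \<in> pt A" "\<Omega> \<in> cel A" "\<phi> = sr A \<Omega>" "\<phi>' = tg A \<Omega>"
      "f = dm A (sr A \<Omega>)" "g = cd A (sr A \<Omega>)" "X = s0 A (dm A (sr A \<Omega>))" "Y = t0 A (dm A (sr A \<Omega>))"
      by (auto simp: mors_hom_iff cels_hom_iff)
    \<comment> \<open>Naturality in 3-cells is no separate axiom of a 3-pseudofunctor. It is
      contained in the typing of \<open>map3\<close>, because a 3-cell of the path object satisfies
      this equation by definition.\<close>
    have "P3 \<Omega> \<in> path_cells3 B"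
      using two_functor.m2_in[OF t.local_two_functor[OF m(1,2)], OF *(2)] m(3)
      by (simp add: cels_hom_iff)
    then show "((map3 G \<Omega> \<unlhd> tn0 p X) \<star> \<langle>tnl p f\<rangle>) \<bullet> tn2 p \<phi> =
        tn2 p \<phi>' \<bullet> (\<langle>tnl p g\<rangle> \<star> (tn0 p Y \<unrhd> map3 F \<Omega>))"
      unfolding local_natural_iff[OF m(3)] m(4-9) .
  next
    fix \<phi> X Y f f' g Z assume *: "\<phi> \<in> mors (hom A X Y) f f'" "g \<in> cells1 A Y Z"
    then have m: "\<phi> \<in> mor A" "g \<in> ob A" "s0 A g = t0 A (dm A \<phi>)" "f = dm A \<phi>" "f' = cd A \<phi>"
      "X = s0 A (dm A \<phi>)" "Z = t0 A g" by (auto simp: mors_hom_iff)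
    show "tn2 p (g \<rhd>\<^bsub>A\<^esub> \<phi>) \<bullet> (tnc p (g, f') \<star> \<langle>(tn0 p Z \<cdot> map1 F g) \<rhd> map2 F \<phi>\<rangle>) =
        (\<langle>(map1 G g \<rhd> map2 G \<phi>) \<lhd> tn0 p X\<rangle> \<star> tnc p (g, f))
        \<bullet> ((map1 G g \<unrhd> tn2 p \<phi>) \<star> \<langle>tnl p g \<lhd> map1 F f\<rangle>)
        \<bullet> (\<langle>map1 G g \<rhd> tnl p f'\<rangle> \<star> cinv B (ich B (tnl p g) (map2 F \<phi>)))"
      unfolding m(4-7) right_whiskering_iff[OF m(1-3), symmetric]
      using t.chi_natural2_right[OF *] m by simp
  next
    fix f X Y \<psi> Z g g' assume *: "f \<in> cells1 A X Y" "\<psi> \<in> mors (hom A Y Z) g g'"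
    then have m: "f \<in> ob A" "\<psi> \<in> mor A" "s0 A (dm A \<psi>) = t0 A f" "g = dm A \<psi>" "g' = cd A \<psi>"
      "X = s0 A f" "Z = t0 A (dm A \<psi>)" by (auto simp: mors_hom_iff)
    show "tn2 p (\<psi> \<lhd>\<^bsub>A\<^esub> f) \<bullet> (tnc p (g', f) \<star> \<langle>tn0 p Z \<rhd> (map2 F \<psi> \<lhd> map1 F f)\<rangle>) =
        (\<langle>map2 G \<psi> \<lhd> (map1 G f \<cdot> tn0 p X)\<rangle> \<star> tnc p (g, f))
        \<bullet> (ich B (map2 G \<psi>) (tnl p f) \<star> \<langle>tnl p g \<lhd> map1 F f\<rangle>)
        \<bullet> (\<langle>map1 G g' \<rhd> tnl p f\<rangle> \<star> (tn2 p \<psi> \<unlhd> map1 F f))"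
      unfolding m(4-7) left_whiskering_iff[OF m(1-3), symmetric]
      using t.chi_natural2_left[OF *] m by simp
  next
    fix e W X f Y g Z assume "e \<in> cells1 A W X" "f \<in> cells1 A X Y" "g \<in> cells1 A Y Z"
    then show "tnc p (g, f \<cdot>\<^bsub>A\<^esub> e) \<bullet> ((map1 G g \<unrhd> tnc p (f, e)) \<star> \<langle>tnl p g \<lhd> (map1 F f \<cdot> map1 F e)\<rangle>) =
        tnc p (g \<cdot>\<^bsub>A\<^esub> f, e) \<bullet> (\<langle>(map1 G g \<cdot> map1 G f) \<rhd> tnl p e\<rangle> \<star> (tnc p (g, f) \<unlhd> map1 F e))"
      using associativity_iff[of e f g] t.associativity[of e W X f Y g Z] by auto
  qed
qed

text \<open>The hypothesis enters because the projections are restricted to genuine cells. For the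
  lower cells membership follows from typing, for 3-cells it is the naturality law.\<close>

lemma post_comp_path_ends:
  assumes "\<And>\<Gamma>. \<Gamma> \<in> cel A \<Longrightarrow> P3 \<Gamma> \<in> path_cells3 B"
  shows "post_comp A (path_s0 B) H = strict_pmap A B F" "post_comp A (path_t0 B) H = strict_pmap A B G"
  unfolding post_comp_def strict_pmap_def
  by (auto simp: path_s0_def path_t0_def comps_def compose_def fun_eq_iff assms
      extensional_arb[OF F.extensional(1)] extensional_arb[OF F.extensional(2)]
      extensional_arb[OF F.extensional(3)] extensional_arb[OF F.extensional(4)]
      extensional_arb[OF G.extensional(1)] extensional_arb[OF G.extensional(2)]
      extensional_arb[OF G.extensional(3)] extensional_arb[OF G.extensional(4)])

text \<open>An identity 2-cell has equal source and target, so this condition also forces equality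
  of the 1-cells, hence of the whole adjoint equivalences at units and composites, as
  semi-strictness demands.\<close>

lemma semi_strict_cells_iff:
  "semi_strict A B F G p \<longleftrightarrow>
    (\<forall>X\<in>pt A. iota H X = path_idn B (path_one B (tn0 p X))) \<and>
    (\<forall>(g, f)\<in>comps A. chi H (g, f) = path_idn B (path_comp1 B (P1 g) (P1 f)))"
proof -
  have iota: "iota H X = path_idn B (path_one B (tn0 p X)) \<longleftrightarrow>
      tn1 p (one A X) = adj_id B (tn0 p X) \<and> tnu p X = idc B (idn B (tn0 p X))" if X: "X \<in> pt A" for X
  proof -
    have "iota H X = path_idn B (path_one B (tn0 p X)) \<longleftrightarrow>
        P1 (one A X) = path_one B (tn0 p X) \<and> cinv B (tnu p X) = \<langle>idn B (tn0 p X)\<rangle>"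
      using X by (auto simp: path_idn_def trinat_to_path_def)
    also have "cinv B (tnu p X) = \<langle>idn B (tn0 p X)\<rangle> \<longleftrightarrow> tnu p X = \<langle>idn B (tn0 p X)\<rangle>"
      using F.B.cinv_eq_iff[of "tnu p X" "\<langle>idn B (tn0 p X)\<rangle>"] X by simp
    also have "P1 (one A X) = path_one B (tn0 p X) \<longleftrightarrow> tn1 p (one A X) = adj_id B (tn0 p X)"
      using X by (auto simp: path1_of_def path_one_def)
    finally show ?thesis .
  qed
  have chi: "chi H (g, f) = path_idn B (path_comp1 B (P1 g) (P1 f)) \<longleftrightarrow>
      tn1 p (g \<cdot>\<^bsub>A\<^esub> f) =
        adj_comp B (adj_map (lw2 B (map1 G g)) (lw3 B (map1 G g)) (tn1 p f))
                   (adj_map (\<lambda>\<phi>. rw2 B \<phi> (map1 F f)) (\<lambda>\<Gamma>. rw3 B \<Gamma> (map1 F f)) (tn1 p g)) \<and>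
      tnc p (g, f) = idc B ((map1 G g \<rhd> tnl p f) \<odot> (tnl p g \<lhd> map1 F f))"
    if gf: "(g, f) \<in> comps A" for g f
  proof -
    have gf': "f \<in> ob A" "g \<in> ob A" "s0 A g = t0 A f" using gf by (auto simp: comps_def)
    let ?i = "\<langle>(map1 G g \<rhd> tnl p f) \<odot> (tnl p g \<lhd> map1 F f)\<rangle>"
    have "chi H (g, f) = path_idn B (path_comp1 B (P1 g) (P1 f)) \<longleftrightarrow>
        P1 (g \<cdot>\<^bsub>A\<^esub> f) = path_comp1 B (P1 g) (P1 f) \<and> cinv B (tnc p (g, f)) = ?i"
      using gf gf' by (auto simp: path_idn_def trinat_to_path_def)
    also have "cinv B (tnc p (g, f)) = ?i \<longleftrightarrow> tnc p (g, f) = ?i"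
      using F.B.cinv_eq_iff[of "tnc p (g, f)" ?i] gf' by simp
    also have "P1 (g \<cdot>\<^bsub>A\<^esub> f) = path_comp1 B (P1 g) (P1 f) \<longleftrightarrow> tn1 p (g \<cdot>\<^bsub>A\<^esub> f) =
        adj_comp B (adj_map (lw2 B (map1 G g)) (lw3 B (map1 G g)) (tn1 p f))
                   (adj_map (\<lambda>\<phi>. rw2 B \<phi> (map1 F f)) (\<lambda>\<Gamma>. rw3 B \<Gamma> (map1 F f)) (tn1 p g))"
      using gf' by (auto simp: path1_of_def path_comp1_def)
    finally show ?thesis .
  qed
  show ?thesis unfolding semi_strict_def using iota chi by blast
qed

text \<open>If unitors and compositors are identities, forgetting them leaves a Gray-functor:
  equality of their ends gives preservation of units and composites of 1-cells, and naturality of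
  \<open>chi\<close> gives preservation of whiskerings.\<close>

lemma semi_strict_iff:
  assumes "trinatural A B F G p"
  shows "semi_strict A B F G p \<longleftrightarrow> (\<exists>P. gray_functor A (path B) P \<and> H = strict_pmap A (path B) P)"
proof
  assume "\<exists>P. gray_functor A (path B) P \<and> H = strict_pmap A (path B) P"
  then obtain P where P: "H = strict_pmap A (path B) P" by blast
  have m: "map0 P = map0 H" "map1 P = map1 H" unfolding P by (simp_all add: strict_pmap_def)
  have "iota H X = path_idn B (path_one B (tn0 p X))" if "X \<in> pt A" for X
    by (subst P) (use that in \<open>simp add: strict_pmap_def m\<close>)
  moreover have "chi H (g, f) = path_idn B (path_comp1 B (P1 g) (P1 f))" if "(g, f) \<in> comps A" for g f
  proof -
    have "chi H (g, f) = path_idn B (path_comp1 B (map1 P g) (map1 P f))"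
      by (subst P) (use that in \<open>simp add: strict_pmap_def\<close>)
    then show ?thesis using that by (simp add: m comps_def)
  qed
  ultimately show "semi_strict A B F G p" unfolding semi_strict_cells_iff by blast
next
  assume "semi_strict A B F G p"
  then have *: "\<forall>X\<in>pt A. iota H X = path_idn B (path_one B (tn0 p X))"
    "\<forall>(g, f)\<in>comps A. chi H (g, f) = path_idn B (path_comp1 B (P1 g) (P1 f))"
    unfolding semi_strict_cells_iff by blast+
  have iota: "iota H X = path_idn B (path_one B (tn0 p X))" if "X \<in> pt A" for X
    using *(1) that by blast
  have chi: "chi H (g, f) = path_idn B (path_comp1 B (P1 g) (P1 f))"
    if "g \<in> ob A" "f \<in> ob A" "s0 A g = t0 A f" for g f
    using *(2) that unfolding comps_def by blast
  interpret t: pseudofunctor3 A "path B" H by (rule pseudofunctor3_of_trinatural[OF assms])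
  have P1_one: "P1 (one A X) = path_one B (tn0 p X)" if "X \<in> pt A" for X
    using iota_simps(2)[OF that] by (simp add: iota that)
  have comp: "P1 (g \<cdot>\<^bsub>A\<^esub> f) = path_comp1 B (P1 g) (P1 f)" if "g \<in> ob A" "f \<in> ob A" "s0 A g = t0 A f" for g f
    using chi_simps(2)[of f g] that by (simp add: chi)
  \<comment> \<open>With identities for \<open>chi\<close>, its naturality square reduces to this
    equation.\<close>
  have lw: "P2 (g \<rhd>\<^bsub>A\<^esub> \<phi>) = path_lw2 B (P1 g) (P2 \<phi>)" if "\<phi> \<in> mor A" "g \<in> ob A" "s0 A g = t0 A (dm A \<phi>)" for g \<phi>
    using t.chi_natural2_right[of \<phi> "s0 A (dm A \<phi>)" "t0 A (dm A \<phi>)" "dm A \<phi>" "cd A \<phi>" g "t0 A g"] that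
    by (simp add: mors_hom_iff chi comp)
  have rw: "P2 (\<psi> \<lhd>\<^bsub>A\<^esub> f) = path_rw2 B (P2 \<psi>) (P1 f)" if "f \<in> ob A" "\<psi> \<in> mor A" "s0 A (dm A \<psi>) = t0 A f" for f \<psi>
    using t.chi_natural2_left[of f "s0 A f" "t0 A f" \<psi> "t0 A (dm A \<psi>)" "dm A \<psi>" "cd A \<psi>"] that
    by (simp add: mors_hom_iff chi comp)
  have cmp: "P2 (\<psi> \<odot>\<^bsub>A\<^esub> \<phi>) = path_cmp B (P2 \<psi>) (P2 \<phi>)"
    if "\<phi> \<in> mor A" "\<psi> \<in> mor A" "dm A \<psi> = cd A \<phi>" for \<phi> \<psi>
    using two_functor.m_cmp[OF t.local_two_functor[of "s0 A (dm A \<phi>)" "t0 A (dm A \<phi>)"],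
        of \<phi> "dm A \<phi>" "cd A \<phi>" \<psi> "cd A \<psi>"] that
    by (simp add: mors_hom_iff)
  define P where "P = \<lparr>map0 = map0 H, map1 = map1 H, map2 = map2 H, map3 = map3 H\<rparr>"
  have "gray_functor A (path B) P"
  proof (rule gray_functor.intro)
    show "map0 P \<in> extensional (pt A)" "map1 P \<in> extensional (ob A)"
      "map2 P \<in> extensional (mor A)" "map3 P \<in> extensional (cel A)"
      using t.extensional by (simp_all add: P_def)
  next
    fix X assume "X \<in> pt A"
    then show "map0 P X \<in> pt (path B)" and "map1 P (one A X) = one (path B) (map0 P X)"
      by (simp_all add: P_def P1_one)
  next
    fix X Y assume "X \<in> pt A" "Y \<in> pt A"
    then show "two_functor (hom A X Y) (hom (path B) (map0 P X) (map0 P Y)) (map1 P) (map2 P) (map3 P)"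
      using t.local_two_functor by (simp add: P_def)
  next
    fix f X Y g Z assume "f \<in> cells1 A X Y" "g \<in> cells1 A Y Z"
    then show "map1 P (g \<cdot>\<^bsub>A\<^esub> f) = map1 P g \<cdot>\<^bsub>path B\<^esub> map1 P f"
      by (auto simp: P_def comp)
  next
    fix \<phi> X Y g Z assume "\<phi> \<in> mor (hom A X Y)" "g \<in> cells1 A Y Z"
    then show "map2 P (g \<rhd>\<^bsub>A\<^esub> \<phi>) = map1 P g \<rhd>\<^bsub>path B\<^esub> map2 P \<phi>"
      by (auto simp: P_def lw)
  next
    fix f X Y \<psi> Z assume "f \<in> cells1 A X Y" "\<psi> \<in> mor (hom A Y Z)"
    then show "map2 P (\<psi> \<lhd>\<^bsub>A\<^esub> f) = map2 P \<psi> \<lhd>\<^bsub>path B\<^esub> map1 P f"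
      by (auto simp: P_def rw)
  next
    fix \<Gamma> X Y g Z assume "\<Gamma> \<in> cel (hom A X Y)" "g \<in> cells1 A Y Z"
    then show "map3 P (g \<unrhd>\<^bsub>A\<^esub> \<Gamma>) = map1 P g \<unrhd>\<^bsub>path B\<^esub> map3 P \<Gamma>"
      by (auto simp: P_def path_ops path3_of_def lw)
  next
    fix f X Y \<Gamma> Z assume "f \<in> cells1 A X Y" "\<Gamma> \<in> cel (hom A Y Z)"
    then show "map3 P (\<Gamma> \<unlhd>\<^bsub>A\<^esub> f) = map3 P \<Gamma> \<unlhd>\<^bsub>path B\<^esub> map1 P f"
      by (auto simp: P_def path_ops path3_of_def rw)
  next
    fix \<phi> X Y \<psi> Z assume "\<phi> \<in> mor (hom A X Y)" "\<psi> \<in> mor (hom A Y Z)"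
    then have m: "\<phi> \<in> mor A" "\<psi> \<in> mor A" "s0 A (dm A \<psi>) = t0 A (dm A \<phi>)" by auto
    have "P3 (ich A \<psi> \<phi>) = ich (path B) (P2 \<psi>) (P2 \<phi>)"
      using m by (simp add: path_ops path3_of_def lw rw cmp)
    then show "map3 P (ich A \<psi> \<phi>) = ich (path B) (map2 P \<psi>) (map2 P \<phi>)"
      using m by (simp add: P_def)
  qed
  moreover have "H = strict_pmap A (path B) P"
  proof -
    have "iota H = (\<lambda>X\<in>pt A. path_idn B (path_one B (map0 H X)))"
      by (rule extensionalityI[of _ "pt A"]) (simp_all add: t.extensional iota del: iota_simps)
    moreover have "chi H = (\<lambda>(g, f)\<in>comps A. path_idn B (path_comp1 B (map1 H g) (map1 H f)))"
      by (rule extensionalityI[of _ "comps A"])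
        (use t.extensional in \<open>simp_all split: prod.split, auto simp: comps_def chi\<close>)
    ultimately show ?thesis by (simp add: strict_pmap_def P_def)
  qed
  ultimately show "\<exists>P. gray_functor A (path B) P \<and> H = strict_pmap A (path B) P" by blast
qed

end

section \<open>The bijections for trinatural and semi-strict trinatural transformations\<close>

context gray_functors
begin

text \<open>Each component of \<open>p\<close> can be read off a field of its image; unitors and
  compositors are recovered by inverting once more.\<close>

lemma trinat_to_path_inj:
  assumes "pretrinatural A B F G p" "pretrinatural A B F G q"
    and eq: "trinat_to_path A B F G p = trinat_to_path A B F G q"
  shows "p = q"
proof -
  interpret p: pretrinatural A B F G p by fact
  interpret q: pretrinatural A B F G q by fact
  have "tn0 p X = tn0 q X" if "X \<in> pt A" for X
    using p.trinat_to_path_simps(1)[OF that] q.trinat_to_path_simps(1)[OF that] eq by simp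
  moreover have "tn1 p f = tn1 q f" if "f \<in> ob A" for f
    using p.trinat_to_path_simps(2)[OF that] q.trinat_to_path_simps(2)[OF that] eq
    by (metis p.path1_of_simps(3) q.path1_of_simps(3))
  moreover have "tn2 p \<phi> = tn2 q \<phi>" if "\<phi> \<in> mor A" for \<phi>
    using p.trinat_to_path_simps(3)[OF that] q.trinat_to_path_simps(3)[OF that] eq
    by (metis p.path2_of_simps(3) q.path2_of_simps(3))
  moreover have "tnu p X = tnu q X" if "X \<in> pt A" for X
    using p.iota_simps(3)[OF that] q.iota_simps(3)[OF that] eq p.tnu_simps(1)[OF that] q.tnu_simps(1)[OF that]
    by (metis F.B.iso_cinv(2))
  moreover have "tnc p x = tnc q x" if "x \<in> comps A" for x
  proof -
    obtain g f where x: "x = (g, f)" "f \<in> ob A" "g \<in> ob A" "s0 A g = t0 A f"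
      using \<open>x \<in> comps A\<close> by (auto simp: comps_def)
    show ?thesis
      using p.chi_simps(3)[OF x(2-4)] q.chi_simps(3)[OF x(2-4)] eq
        p.tnc_simps(1)[OF x(2-4)] q.tnc_simps(1)[OF x(2-4)] x(1)
      by (metis F.B.iso_cinv(2))
  qed
  ultimately show "p = q"
    by (intro trinat.equality) (auto intro!: extensionalityI[OF p.extensional(1) q.extensional(1)]
      extensionalityI[OF p.extensional(2) q.extensional(2)]
      extensionalityI[OF p.extensional(3) q.extensional(3)]
      extensionalityI[OF p.extensional(4) q.extensional(4)]
      extensionalityI[OF p.extensional(5) q.extensional(5)])
qed

text \<open>The conditions on the two ends determine every field of the cells in the image of
  \<open>K\<close> except the adjoint equivalences and 3-cells, and these make up \<open>p\<close>.
  Only typing is established; the laws come from the equivalences already proved.\<close>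

lemma trinat_to_path_surj:
  assumes "K \<in> path_pseudofunctors A B F G"
  obtains p where "pretrinatural A B F G p" "trinat_to_path A B F G p = K"
proof -
  interpret t: pseudofunctor3 A "path B" K using assms by (simp add: path_pseudofunctors_def)
  have s: "post_comp A (path_s0 B) K = strict_pmap A B F" and t: "post_comp A (path_t0 B) K = strict_pmap A B G"
    using assms by (auto simp: path_pseudofunctors_def)
  have K0: "map0 K X \<in> ob B" if "X \<in> pt A" for X using t.map0_in[OF that] by simp
  \<comment> \<open>The end conditions are equations of records. They are projected to a field and
    evaluated at a cell; since the end functors are restricted, the cell must be known to lie in the
    path object.\<close>
  have K0': "s0 B (map0 K X) = map0 F X" "t0 B (map0 K X) = map0 G X" if "X \<in> pt A" for X
    using fun_cong[OF arg_cong[OF s, of map0], of X] fun_cong[OF arg_cong[OF t, of map0], of X] that K0[OF that]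
    by (simp_all add: post_comp_def strict_pmap_def compose_eq path_s0_def path_t0_def)
  have K1: "map1 K f \<in> path_cells1 B" "p1_src (map1 K f) = map0 K (s0 A f)" "p1_tgt (map1 K f) = map0 K (t0 A f)"
    if "f \<in> ob A" for f
    using two_functor.m0_in[OF t.local_two_functor[of "s0 A f" "t0 A f"], of f] that by auto
  have K1': "p1_0 (map1 K f) = map1 F f" "p1_1 (map1 K f) = map1 G f" if "f \<in> ob A" for f
    using fun_cong[OF arg_cong[OF s, of map1], of f] fun_cong[OF arg_cong[OF t, of map1], of f] that K1[OF that]
    by (simp_all add: post_comp_def strict_pmap_def compose_eq path_s0_def path_t0_def)
  have K2: "map2 K \<phi> \<in> path_cells2 B" "p2_src (map2 K \<phi>) = map1 K (dm A \<phi>)" "p2_tgt (map2 K \<phi>) = map1 K (cd A \<phi>)"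
    if "\<phi> \<in> mor A" for \<phi>
    using two_functor.m1_in[OF t.local_two_functor[of "s0 A (dm A \<phi>)" "t0 A (dm A \<phi>)"], of \<phi> "dm A \<phi>" "cd A \<phi>"] that
    by (auto simp: mors_hom_iff)
  have K2': "p2_0 (map2 K \<phi>) = map2 F \<phi>" "p2_1 (map2 K \<phi>) = map2 G \<phi>" if "\<phi> \<in> mor A" for \<phi>
    using fun_cong[OF arg_cong[OF s, of map2], of \<phi>] fun_cong[OF arg_cong[OF t, of map2], of \<phi>] that K2[OF that]
    by (simp_all add: post_comp_def strict_pmap_def compose_eq path_s0_def path_t0_def)
  have K3: "map3 K \<Gamma> \<in> path_cells3 B" "p3_src (map3 K \<Gamma>) = map2 K (sr A \<Gamma>)" "p3_tgt (map3 K \<Gamma>) = map2 K (tg A \<Gamma>)"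
    if "\<Gamma> \<in> cel A" for \<Gamma>
    using two_functor.m2_in[OF t.local_two_functor[of "s0 A (dm A (sr A \<Gamma>))" "t0 A (dm A (sr A \<Gamma>))"],
      of \<Gamma> "sr A \<Gamma>" "tg A \<Gamma>"] that
    by (auto simp: cels_hom_iff)
  have K3': "p3_0 (map3 K \<Gamma>) = map3 F \<Gamma>" "p3_1 (map3 K \<Gamma>) = map3 G \<Gamma>" if "\<Gamma> \<in> cel A" for \<Gamma>
    using fun_cong[OF arg_cong[OF s, of map3], of \<Gamma>] fun_cong[OF arg_cong[OF t, of map3], of \<Gamma>] that K3[OF that]
    by (simp_all add: post_comp_def strict_pmap_def compose_eq path_s0_def path_t0_def)
  have i: "iota K X \<in> path_cells2 B" "p2_src (iota K X) = path_one B (map0 K X)"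
    "p2_tgt (iota K X) = map1 K (one A X)" if "X \<in> pt A" for X
    using t.iota_in[OF that] by (auto simp: imors_def mors_def)
  have i': "p2_0 (iota K X) = idn B (one B (map0 F X))" "p2_1 (iota K X) = idn B (one B (map0 G X))"
    if "X \<in> pt A" for X
    using fun_cong[OF arg_cong[OF s, of iota], of X] fun_cong[OF arg_cong[OF t, of iota], of X] that i[OF that]
    by (simp_all add: post_comp_def strict_pmap_def compose_eq path_s0_def path_t0_def)
  have c: "chi K (g, f) \<in> path_cells2 B" "p2_src (chi K (g, f)) = path_comp1 B (map1 K g) (map1 K f)"
    "p2_tgt (chi K (g, f)) = map1 K (g \<cdot>\<^bsub>A\<^esub> f)" if "f \<in> ob A" "g \<in> ob A" "s0 A g = t0 A f" for f g
    using t.chi_in[of f "s0 A f" "t0 A f" g "t0 A g"] that by (auto simp: imors_def mors_def)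
  have c': "p2_0 (chi K (g, f)) = idn B (map1 F g \<cdot> map1 F f)" "p2_1 (chi K (g, f)) = idn B (map1 G g \<cdot> map1 G f)"
    if "f \<in> ob A" "g \<in> ob A" "s0 A g = t0 A f" for f g
    using fun_cong[OF arg_cong[OF s, of chi], of "(g, f)"] fun_cong[OF arg_cong[OF t, of chi], of "(g, f)"] that c[OF that]
    by (simp_all add: post_comp_def strict_pmap_def compose_eq path_s0_def path_t0_def comps_def)
  \<comment> \<open>Unitors and compositors are inverted because their direction in \<open>K\<close>
    is opposite to that in a trinatural transformation.\<close>
  define p where "p = \<lparr>tn0 = map0 K, tn1 = \<lambda>f\<in>ob A. p1_eq (map1 K f), tn2 = \<lambda>\<phi>\<in>mor A. p2_cell (map2 K \<phi>),
    tnu = \<lambda>X\<in>pt A. cinv B (p2_cell (iota K X)), tnc = \<lambda>x\<in>comps A. cinv B (p2_cell (chi K x))\<rparr>"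
  have "pretrinatural A B F G p"
  proof
    show "tn0 p \<in> extensional (pt A)" "tn1 p \<in> extensional (ob A)" "tn2 p \<in> extensional (mor A)"
      "tnu p \<in> extensional (pt A)" "tnc p \<in> extensional (comps A)"
      using t.extensional(1) by (simp_all add: p_def)
  next
    fix X assume X: "X \<in> pt A"
    then show "tn0 p X \<in> ob B" "s0 B (tn0 p X) = map0 F X" "t0 B (tn0 p X) = map0 G X"
      by (simp_all add: p_def K0 K0')
    show "invertible B (tnu p X)" "sr B (tnu p X) = idn B (tn0 p X)" "tg B (tnu p X) = tnl p (one A X)"
      using X F.B.path_cells2_simps(11-13)[OF i(1)[OF X]] K0[OF X] F.B.path_cells1_simps[OF K1(1), of "one A X"]
      by (simp_all add: p_def i i' K0' K1 K1')
  next
    fix f assume f: "f \<in> ob A"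
    then show "adjoint_equivalence B (tn0 p (t0 A f) \<cdot> map1 F f) (map1 G f \<cdot> tn0 p (s0 A f)) (tn1 p f)"
      using F.B.path_cells1_equivalence[OF K1(1)[OF f]] by (simp add: p_def K1 K1')
  next
    fix \<phi> assume \<phi>: "\<phi> \<in> mor A"
    then show "invertible B (tn2 p \<phi>)"
      "sr B (tn2 p \<phi>) = tnl p (cd A \<phi>) \<odot> (tn0 p (t0 A (dm A \<phi>)) \<rhd> map2 F \<phi>)"
      "tg B (tn2 p \<phi>) = (map2 G \<phi> \<lhd> tn0 p (s0 A (dm A \<phi>))) \<odot> tnl p (dm A \<phi>)"
      using F.B.path_cells2_simps(11-13)[OF K2(1)[OF \<phi>]] by (simp_all add: p_def K1 K2 K2')
  next
    fix f g assume fg: "f \<in> ob A" "g \<in> ob A" "s0 A g = t0 A f"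
    then show "invertible B (tnc p (g, f))"
      "sr B (tnc p (g, f)) = (map1 G g \<rhd> tnl p f) \<odot> (tnl p g \<lhd> map1 F f)"
      "tg B (tnc p (g, f)) = tnl p (g \<cdot>\<^bsub>A\<^esub> f)"
      using F.B.path_cells2_simps(11-13)[OF c(1)[OF fg]] K0[of "s0 A f"] K0[of "t0 A g"]
        F.B.path_cells1_simps[OF K1(1)[OF fg(1)]] F.B.path_cells1_simps[OF K1(1)[OF fg(2)]]
        F.B.path_cells1_simps[OF K1(1), of "g \<cdot>\<^bsub>A\<^esub> f"]
      by (simp_all add: p_def c c' K0' K1 K1' comps_def)
  qed
  then interpret p: pretrinatural A B F G p .
  have "trinat_to_path A B F G p = K"
  proof (rule pmap.equality)
    show "map0 p.H = map0 K"
      by (rule extensionalityI[of _ "pt A"]) (simp_all add: t.extensional trinat_to_path_def p_def)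
    have P1: "p.P1 f = map1 K f" if "f \<in> ob A" for f
      using that by (intro path1.equality) (simp_all add: K1 K1', simp_all add: p_def)
    show "map1 p.H = map1 K"
      by (rule extensionalityI[of _ "ob A"]) (simp_all add: t.extensional P1, simp add: trinat_to_path_def)
    have P2: "p.P2 \<phi> = map2 K \<phi>" if "\<phi> \<in> mor A" for \<phi>
      using that by (intro path2.equality) (simp_all add: K2 K2' P1, simp_all add: p_def)
    show "map2 p.H = map2 K"
      by (rule extensionalityI[of _ "mor A"]) (simp_all add: t.extensional P2, simp add: trinat_to_path_def)
    have P3: "p.P3 \<Gamma> = map3 K \<Gamma>" if "\<Gamma> \<in> cel A" for \<Gamma>
      using that by (intro path3.equality) (simp_all add: K3 K3' P2)
    show "map3 p.H = map3 K"
      by (rule extensionalityI[of _ "cel A"]) (simp_all add: t.extensional P3, simp add: trinat_to_path_def)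
    have "iota p.H X = iota K X" if "X \<in> pt A" for X
      using that F.B.path_cells2_simps(11)[OF i(1)[OF that]]
      by (intro path2.equality) (simp_all add: i i' P1, simp_all add: p_def i)
    then show "iota p.H = iota K"
      by (intro extensionalityI[of _ "pt A"]) (simp_all add: t.extensional, simp add: trinat_to_path_def)
    have "chi p.H x = chi K x" if "x \<in> comps A" for x
    proof -
      obtain g f where x: "x = (g, f)" "f \<in> ob A" "g \<in> ob A" "s0 A g = t0 A f"
        using \<open>x \<in> comps A\<close> by (auto simp: comps_def)
      then show ?thesis
        using \<open>x \<in> comps A\<close> F.B.path_cells2_simps(11)[OF c(1)[OF x(2-4)]]
        by (intro path2.equality) (simp_all add: c c' P1, simp_all add: p_def c)
    qed
    then show "chi p.H = chi K"
      by (intro extensionalityI[of _ "comps A"]) (simp_all add: t.extensional, simp add: trinat_to_path_def)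
  qed simp
  with \<open>pretrinatural A B F G p\<close> show thesis using that by blast
qed

lemma trinat_to_path_bij:
  "bij_betw (trinat_to_path A B F G) {p. trinatural A B F G p} (path_pseudofunctors A B F G)"
proof (rule bij_betw_imageI)
  show "inj_on (trinat_to_path A B F G) {p. trinatural A B F G p}"
    using trinat_to_path_inj pretrinatural_of_trinatural by (auto intro: inj_onI)
  have "trinat_to_path A B F G p \<in> path_pseudofunctors A B F G" if "trinatural A B F G p" for p
  proof -
    interpret p: pretrinatural A B F G p by (rule pretrinatural_of_trinatural[OF that])
    interpret t: trinatural A B F G p by fact
    have "p.P3 \<Gamma> \<in> path_cells3 B" if "\<Gamma> \<in> cel A" for \<Gamma>
      using that t.local_natural[of "sr A \<Gamma>" "s0 A (dm A (sr A \<Gamma>))" "t0 A (dm A (sr A \<Gamma>))"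
          "dm A (sr A \<Gamma>)" "cd A (sr A \<Gamma>)" \<Gamma> "tg A \<Gamma>"]
      by (simp add: p.local_natural_iff mors_hom_iff cels_hom_iff)
    then show ?thesis
      using p.pseudofunctor3_of_trinatural[OF that] p.post_comp_path_ends by (simp add: path_pseudofunctors_def)
  qed
  moreover have "K \<in> trinat_to_path A B F G ` {p. trinatural A B F G p}"
    if "K \<in> path_pseudofunctors A B F G" for K
  proof -
    obtain p where p: "pretrinatural A B F G p" "trinat_to_path A B F G p = K"
      using trinat_to_path_surj[OF \<open>K \<in> path_pseudofunctors A B F G\<close>] .
    then have "trinatural A B F G p"
      using pretrinatural.trinatural_of_pseudofunctor3[OF p(1)] that by (simp add: path_pseudofunctors_def)
    then show ?thesis using p by blast
  qed
  ultimately show "trinat_to_path A B F G ` {p. trinatural A B F G p} = path_pseudofunctors A B F G" by blast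
qed

lemma trinat_to_path_semi_strict_bij:
  "bij_betw (trinat_to_path A B F G)
     {p. trinatural A B F G p \<and> semi_strict A B F G p}
     {H \<in> path_pseudofunctors A B F G. \<exists>P. gray_functor A (path B) P \<and> H = strict_pmap A (path B) P}"
proof (rule bij_betw_subset[OF trinat_to_path_bij])
  show "{p. trinatural A B F G p \<and> semi_strict A B F G p} \<subseteq> {p. trinatural A B F G p}" by blast
  have iff: "semi_strict A B F G p \<longleftrightarrow>
      (\<exists>P. gray_functor A (path B) P \<and> trinat_to_path A B F G p = strict_pmap A (path B) P)"
    if "trinatural A B F G p" for p
    using pretrinatural.semi_strict_iff[OF pretrinatural_of_trinatural[OF that] that] .
  show "trinat_to_path A B F G ` {p. trinatural A B F G p \<and> semi_strict A B F G p} =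
     {H \<in> path_pseudofunctors A B F G. \<exists>P. gray_functor A (path B) P \<and> H = strict_pmap A (path B) P}"
    (is "?L = ?R")
  proof
    show "?L \<subseteq> ?R" using iff bij_betw_imp_surj_on[OF trinat_to_path_bij] by blast
    show "?R \<subseteq> ?L"
    proof
      fix K assume K: "K \<in> ?R"
      then obtain p where p: "trinatural A B F G p" "K = trinat_to_path A B F G p"
        using bij_betw_imp_surj_on[OF trinat_to_path_bij] by blast
      then have "semi_strict A B F G p" using iff[of p] K by auto
      then show "K \<in> ?L" using p by blast
    qed
  qed
qed

end

section \<open>Mates\<close>

context two_category
begin


text \<open>Both cells become the identity when followed by the invertible counit whiskered with
  \<open>ladj e\<close>, so they are equal. This lets an inverse counit be exchanged for a
  unit.\<close>

lemma triangle_inverse: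
  assumes "adjoint_equivalence C a b e"
  shows "cinv C (acounit e) \<star> \<langle>ladj e\<rangle> = \<langle>ladj e\<rangle> \<star> aunit e"
proof -
  note e = adjoint_equivalenceD[OF assms]
  have "(acounit e \<star> \<langle>ladj e\<rangle>) \<bullet> (\<langle>ladj e\<rangle> \<star> aunit e) =
      (acounit e \<star> \<langle>ladj e\<rangle>) \<bullet> (cinv C (acounit e) \<star> \<langle>ladj e\<rangle>)"
    unfolding e(13) using e(1-12,15,16) by (simp flip: whisker_vcmp(2))
  then show ?thesis
    by (rule iso_cancel_leftD[symmetric]) (use e(1-12,15,16) in simp_all)
qed

context
  fixes a b a' b' e e' p q s
  assumes e: "adjoint_equivalence C a b e" and e': "adjoint_equivalence C a' b' e'"
    and p: "p \<in> mor C" "dm C p = b'" "cd C p = b" and q: "q \<in> mor C" "dm C q = a'" "cd C q = a"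
    and s: "invertible C s" "sr C s = ladj e \<odot> q" "tg C s = p \<odot> ladj e'"
begin

text \<open>The cell \<open>t\<close> is the mate of the inverse of \<open>s\<close>; it is pinned down by the counits alone.\<close>

lemma mate_exists:
  obtains t where "invertible C t" "sr C t = radj e \<odot> p" "tg C t = q \<odot> radj e'"
    "(s \<star> \<langle>radj e'\<rangle>) \<bullet> (\<langle>ladj e\<rangle> \<star> t) = (\<langle>p\<rangle> \<star> cinv C (acounit e')) \<bullet> (acounit e \<star> \<langle>p\<rangle>)"
proof -
  note E = adjoint_equivalenceD(1-12,15,16)[OF e] adjoint_equivalenceD(1-12,15,16)[OF e'] p q s
  \<comment> \<open>The value that the required equation forces on \<open>t\<close> whiskered with
    \<open>ladj e\<close>. Fullness of the whiskering then produces \<open>t\<close>.\<close>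
  let ?z = "cinv C (s \<star> \<langle>radj e'\<rangle>) \<bullet> ((\<langle>p\<rangle> \<star> cinv C (acounit e')) \<bullet> (acounit e \<star> \<langle>p\<rangle>))"
  have z: "invertible C ?z" "sr C ?z = ladj e \<odot> (radj e \<odot> p)" "tg C ?z = ladj e \<odot> (q \<odot> radj e')"
    using E by simp_all
  have m: "radj e \<odot> p \<in> mor C" "q \<odot> radj e' \<in> mor C" "cd C (radj e \<odot> p) = a" "cd C (q \<odot> radj e') = a"
    using E by simp_all
  obtain t where t: "t \<in> cel C" "sr C t = radj e \<odot> p" "tg C t = q \<odot> radj e'" "\<langle>ladj e\<rangle> \<star> t = ?z"
    "invertible C t"
    using equivalence_whisker_surj[OF e m iso_cel[OF z(1)] z(2,3)] z(1) by metis
  have "(s \<star> \<langle>radj e'\<rangle>) \<bullet> (\<langle>ladj e\<rangle> \<star> t) = (\<langle>p\<rangle> \<star> cinv C (acounit e')) \<bullet> (acounit e \<star> \<langle>p\<rangle>)"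
    unfolding t(4) by (rule cinv_cancel(2)) (use E in simp_all)
  with t that show thesis by blast
qed

text \<open>The factor made of \<open>s\<close> is invertible and whiskering with
  \<open>ladj e\<close> is faithful, so equality of the pastings with \<open>s\<close> already gives
  equality of the cells.\<close>

lemma mate_unique:
  assumes t: "t \<in> cel C" "sr C t = radj e \<odot> p" "tg C t = q \<odot> radj e'"
    and t': "t' \<in> cel C" "sr C t' = radj e \<odot> p" "tg C t' = q \<odot> radj e'"
    and eq: "(s \<star> \<langle>radj e'\<rangle>) \<bullet> (\<langle>ladj e\<rangle> \<star> t) = (s \<star> \<langle>radj e'\<rangle>) \<bullet> (\<langle>ladj e\<rangle> \<star> t')"
  shows "t = t'"
proof -
  note E = adjoint_equivalenceD(1-12,15,16)[OF e] adjoint_equivalenceD(1-12,15,16)[OF e'] p q s t t'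
  have "\<langle>ladj e\<rangle> \<star> t = \<langle>ladj e\<rangle> \<star> t'"
    by (rule iso_cancel_leftD[OF eq]) (use E in simp_all)
  then show ?thesis
    by (intro equivalence_whisker_inj[OF e, of t t']) (use E in simp_all)
qed

text \<open>The mate is defined through counits, but an adjoint equivalence of trimodifications also
  needs compatibility with units. Both sides are compared after whiskering with
  \<open>ladj e\<close> and pasting \<open>s\<close>: the counit equation applies, the counit of
  \<open>e\<close> slides past \<open>s\<close>, and the triangle for \<open>e\<close> removes
  it.\<close>

lemma mate_unit:
  assumes t: "t \<in> cel C" "sr C t = radj e \<odot> p" "tg C t = q \<odot> radj e'"
    and eq: "(s \<star> \<langle>radj e'\<rangle>) \<bullet> (\<langle>ladj e\<rangle> \<star> t) = (\<langle>p\<rangle> \<star> cinv C (acounit e')) \<bullet> (acounit e \<star> \<langle>p\<rangle>)"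
  shows "((t \<star> \<langle>ladj e'\<rangle>) \<bullet> (\<langle>radj e\<rangle> \<star> s)) \<bullet> (aunit e \<star> \<langle>q\<rangle>) = \<langle>q\<rangle> \<star> aunit e'"
proof -
  note E = adjoint_equivalenceD(1-12,15,16)[OF e] adjoint_equivalenceD(1-12,15,16)[OF e'] p q s t
  let ?L = "ladj e" and ?R = "radj e" and ?L' = "ladj e'" and ?R' = "radj e'"
  have 1: "(s \<star> \<langle>?R' \<odot> ?L'\<rangle>) \<bullet> (\<langle>?L\<rangle> \<star> (t \<star> \<langle>?L'\<rangle>)) =
      (\<langle>p\<rangle> \<star> (cinv C (acounit e') \<star> \<langle>?L'\<rangle>)) \<bullet> (acounit e \<star> \<langle>p \<odot> ?L'\<rangle>)"
  proof -
    have "((s \<star> \<langle>?R'\<rangle>) \<bullet> (\<langle>?L\<rangle> \<star> t)) \<star> \<langle>?L'\<rangle> =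
      ((\<langle>p\<rangle> \<star> cinv C (acounit e')) \<bullet> (acounit e \<star> \<langle>p\<rangle>)) \<star> \<langle>?L'\<rangle>" using eq by simp
    then show ?thesis using E by simp
  qed
  have 2: "(acounit e \<star> \<langle>p \<odot> ?L'\<rangle>) \<bullet> (\<langle>?L \<odot> ?R\<rangle> \<star> s) = s \<bullet> (acounit e \<star> \<langle>?L \<odot> q\<rangle>)"
    using hcmp_slide[of s "acounit e"] E by simp
  have 3: "(acounit e \<star> \<langle>?L \<odot> q\<rangle>) \<bullet> (\<langle>?L\<rangle> \<star> (aunit e \<star> \<langle>q\<rangle>)) = \<langle>?L \<odot> q\<rangle>"
  proof -
    have "((acounit e \<star> \<langle>?L\<rangle>) \<bullet> (\<langle>?L\<rangle> \<star> aunit e)) \<star> \<langle>q\<rangle> = \<langle>?L \<odot> q\<rangle>"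
      unfolding adjoint_equivalenceD(13)[OF e] using E by simp
    then show ?thesis using E by simp
  qed
  have 4: "(\<langle>p \<odot> ?L'\<rangle> \<star> aunit e') \<bullet> s = (s \<star> \<langle>?R' \<odot> ?L'\<rangle>) \<bullet> (\<langle>?L \<odot> q\<rangle> \<star> aunit e')"
    using hcmp_slide[of "aunit e'" s] E by simp
  let ?x = "((t \<star> \<langle>?L'\<rangle>) \<bullet> (\<langle>?R\<rangle> \<star> s)) \<bullet> (aunit e \<star> \<langle>q\<rangle>)"
  have "(s \<star> \<langle>?R' \<odot> ?L'\<rangle>) \<bullet> (\<langle>?L\<rangle> \<star> ?x) = (s \<star> \<langle>?R' \<odot> ?L'\<rangle>) \<bullet> ((\<langle>?L\<rangle> \<star> (t \<star> \<langle>?L'\<rangle>)) \<bullet>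
      ((\<langle>?L \<odot> ?R\<rangle> \<star> s) \<bullet> (\<langle>?L\<rangle> \<star> (aunit e \<star> \<langle>q\<rangle>))))"
    using E by simp
  also have "\<dots> = (\<langle>p\<rangle> \<star> (cinv C (acounit e') \<star> \<langle>?L'\<rangle>)) \<bullet> ((acounit e \<star> \<langle>p \<odot> ?L'\<rangle>) \<bullet>
      ((\<langle>?L \<odot> ?R\<rangle> \<star> s) \<bullet> (\<langle>?L\<rangle> \<star> (aunit e \<star> \<langle>q\<rangle>))))"
    by (rule vcmp_prefix[OF 1]) (use E in simp_all)
  also have "(acounit e \<star> \<langle>p \<odot> ?L'\<rangle>) \<bullet> ((\<langle>?L \<odot> ?R\<rangle> \<star> s) \<bullet> (\<langle>?L\<rangle> \<star> (aunit e \<star> \<langle>q\<rangle>))) =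
      s \<bullet> ((acounit e \<star> \<langle>?L \<odot> q\<rangle>) \<bullet> (\<langle>?L\<rangle> \<star> (aunit e \<star> \<langle>q\<rangle>)))"
    by (rule vcmp_prefix[OF 2]) (use E in simp_all)
  also have "\<dots> = s" unfolding 3 using E by simp
  \<comment> \<open>The triangle identity for \<open>e'\<close> exchanges its inverse counit for its
    unit, which can then slide past \<open>s\<close>.\<close>
  also have "(\<langle>p\<rangle> \<star> (cinv C (acounit e') \<star> \<langle>?L'\<rangle>)) \<bullet> s = (\<langle>p \<odot> ?L'\<rangle> \<star> aunit e') \<bullet> s"
    unfolding triangle_inverse[OF e'] using E by simp
  also have "\<dots> = (s \<star> \<langle>?R' \<odot> ?L'\<rangle>) \<bullet> (\<langle>?L\<rangle> \<star> (\<langle>q\<rangle> \<star> aunit e'))" unfolding 4 using E by simp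
  finally have eq': "(s \<star> \<langle>?R' \<odot> ?L'\<rangle>) \<bullet> (\<langle>?L\<rangle> \<star> ?x) = (s \<star> \<langle>?R' \<odot> ?L'\<rangle>) \<bullet> (\<langle>?L\<rangle> \<star> (\<langle>q\<rangle> \<star> aunit e'))" .
  have eq'': "\<langle>?L\<rangle> \<star> ?x = \<langle>?L\<rangle> \<star> (\<langle>q\<rangle> \<star> aunit e')"
    by (rule iso_cancel_leftD[OF eq']) (use E in simp_all)
  show ?thesis
    by (rule equivalence_whisker_inj[OF e _ _ _ _ _ eq'']) (use E in simp_all)
qed

end

end

section \<open>Trimodifications\<close>

context gray_category
begin

text \<open>Interchangers are squares, and the axiom at a composite 2-cell is their vertical
  pasting. In this form it combines with \<open>hpaste_vpaste\<close> when trimodifications are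
  composed.\<close>

lemma ich_cmp_right_vpaste:
  assumes "\<alpha> \<in> mor B" "\<alpha>' \<in> mor B" "cd B \<alpha> = dm B \<alpha>'" "\<beta> \<in> mor B" "s0 B (dm B \<beta>) = t0 B (dm B \<alpha>)"
  shows "ich B \<beta> (\<alpha>' \<odot> \<alpha>) = vpaste (cd B \<beta> \<rhd> \<alpha>') (dm B \<beta> \<rhd> \<alpha>) (ich B \<beta> \<alpha>') (ich B \<beta> \<alpha>)"
  using ich_cmp_right[of \<alpha> "s0 B (dm B \<alpha>)" "t0 B (dm B \<alpha>)" "dm B \<alpha>" "cd B \<alpha>" \<alpha>' "cd B \<alpha>'" \<beta>
      "t0 B (dm B \<beta>)" "dm B \<beta>" "cd B \<beta>"] assms composable_ends[OF assms(1-3)]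
  by (simp add: vpaste_def mors_hom_iff)

lemma cinv_ich_cmp_left_vpaste:
  assumes "\<alpha> \<in> mor B" "\<beta> \<in> mor B" "\<beta>' \<in> mor B" "cd B \<beta> = dm B \<beta>'" "s0 B (dm B \<beta>) = t0 B (dm B \<alpha>)"
  shows "cinv B (ich B (\<beta>' \<odot> \<beta>) \<alpha>) =
    vpaste (\<beta>' \<lhd> cd B \<alpha>) (\<beta> \<lhd> dm B \<alpha>) (cinv B (ich B \<beta>' \<alpha>)) (cinv B (ich B \<beta> \<alpha>))"
  using ich_cmp_left[of \<alpha> "s0 B (dm B \<alpha>)" "t0 B (dm B \<alpha>)" "dm B \<alpha>" "cd B \<alpha>" \<beta>
      "t0 B (dm B \<beta>)" "dm B \<beta>" "cd B \<beta>" \<beta>' "cd B \<beta>'"] assms composable_ends[OF assms(2-4)]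
  by (simp add: vpaste_def mors_hom_iff)

lemma ich_cocyl_right:
  assumes "\<Gamma> \<in> cel B" "\<beta> \<in> mor B" "s0 B (dm B \<beta>) = t0 B (dm B (sr B \<Gamma>))"
  shows "cocyl (\<beta> \<lhd> dm B (sr B \<Gamma>)) (\<beta> \<lhd> cd B (sr B \<Gamma>)) (cd B \<beta> \<unrhd> \<Gamma>) (dm B \<beta> \<unrhd> \<Gamma>)
    (ich B \<beta> (sr B \<Gamma>)) (ich B \<beta> (tg B \<Gamma>))"
  using ich_natural_right[of "sr B \<Gamma>" "s0 B (dm B (sr B \<Gamma>))" "t0 B (dm B (sr B \<Gamma>))" "dm B (sr B \<Gamma>)"
      "cd B (sr B \<Gamma>)" \<Gamma> "tg B \<Gamma>" \<beta> "t0 B (dm B \<beta>)" "dm B \<beta>" "cd B \<beta>"] assms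
  by (simp add: cocyl_def mors_hom_iff cels_hom_iff)

text \<open>The trimodification law contains the interchanger at a 2-cell of \<sigma> inverted, so
  the naturality axiom is conjugated into a cocylinder of inverses.\<close>

lemma cinv_ich_cocyl_left:
  assumes "\<alpha> \<in> mor B" "\<Gamma> \<in> cel B" "s0 B (dm B (sr B \<Gamma>)) = t0 B (dm B \<alpha>)"
  shows "cocyl (dm B (sr B \<Gamma>) \<rhd> \<alpha>) (cd B (sr B \<Gamma>) \<rhd> \<alpha>) (\<Gamma> \<unlhd> cd B \<alpha>) (\<Gamma> \<unlhd> dm B \<alpha>)
    (cinv B (ich B (sr B \<Gamma>) \<alpha>)) (cinv B (ich B (tg B \<Gamma>) \<alpha>))"
proof -
  have "((\<Gamma> \<unlhd> cd B \<alpha>) \<star> \<langle>dm B (sr B \<Gamma>) \<rhd> \<alpha>\<rangle>) \<bullet> ich B (sr B \<Gamma>) \<alpha> =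
      ich B (tg B \<Gamma>) \<alpha> \<bullet> (\<langle>cd B (sr B \<Gamma>) \<rhd> \<alpha>\<rangle> \<star> (\<Gamma> \<unlhd> dm B \<alpha>))"
    using ich_natural_left[of \<alpha> "s0 B (dm B \<alpha>)" "t0 B (dm B \<alpha>)" "dm B \<alpha>" "cd B \<alpha>" "sr B \<Gamma>"
        "t0 B (dm B (sr B \<Gamma>))" "dm B (sr B \<Gamma>)" "cd B (sr B \<Gamma>)" \<Gamma> "tg B \<Gamma>"] assms
    by (simp add: mors_hom_iff cels_hom_iff)
  then have "(\<langle>cd B (sr B \<Gamma>) \<rhd> \<alpha>\<rangle> \<star> (\<Gamma> \<unlhd> dm B \<alpha>)) \<bullet> cinv B (ich B (sr B \<Gamma>) \<alpha>) =
      cinv B (ich B (tg B \<Gamma>) \<alpha>) \<bullet> ((\<Gamma> \<unlhd> cd B \<alpha>) \<star> \<langle>dm B (sr B \<Gamma>) \<rhd> \<alpha>\<rangle>)"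
    by (subst (asm) conjugate_iff) (use assms in simp_all)
  then show ?thesis by (simp add: cocyl_def)
qed

lemma lw3_vpaste:
  assumes "s \<in> square a P Q b" "t \<in> square a' Q R b'" "g \<in> ob B" "s0 B g = t0 B (dm B P)"
  shows "g \<unrhd> vpaste a' b t s = vpaste (g \<rhd> a') (g \<rhd> b) (g \<unrhd> t) (g \<unrhd> s)"
proof -
  obtain W X Y Z Y' Z' where k: "dm B a = X" "cd B a = Z" "dm B b = W" "cd B b = Y"
    and k': "dm B a' = Z" "cd B a' = Z'" "dm B b' = Y" "cd B b' = Y'"
    using square_corners_vpaste[OF assms(1,2)] .
  note sq = square_cornersD[OF assms(1) k] square_cornersD[OF assms(2) k'] assms(3,4)
  have "t0 B Z = t0 B W" "t0 B Y = t0 B W" "t0 B X = t0 B W"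
    using sq cd_ends(3)[of P] cd_ends(3)[of a] cd_ends(3)[of b] by simp_all
  with sq show ?thesis by (simp add: vpaste_def)
qed

lemma rw3_vpaste:
  assumes "s \<in> square a P Q b" "t \<in> square a' Q R b'" "f \<in> ob B" "s0 B (dm B P) = t0 B f"
  shows "vpaste a' b t s \<unlhd> f = vpaste (a' \<lhd> f) (b \<lhd> f) (t \<unlhd> f) (s \<unlhd> f)"
proof -
  obtain W X Y Z Y' Z' where k: "dm B a = X" "cd B a = Z" "dm B b = W" "cd B b = Y"
    and k': "dm B a' = Z" "cd B a' = Z'" "dm B b' = Y" "cd B b' = Y'"
    using square_corners_vpaste[OF assms(1,2)] .
  note sq = square_cornersD[OF assms(1) k] square_cornersD[OF assms(2) k'] assms(3,4)
  have "s0 B Z = s0 B W" "s0 B Y = s0 B W" "s0 B X = s0 B W"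
    using sq cd_ends(2)[of P] cd_ends(2)[of a] cd_ends(2)[of b] by simp_all
  with sq show ?thesis by (simp add: vpaste_def)
qed

end

section \<open>Trimodification laws as cylinder equations\<close>

locale pretrimodification = p: pretrinatural A B F G p + q: pretrinatural A B F G q
  for A :: "('a, 'b, 'c, 'o) gray" and B :: "('d, 'e, 'g, 'p) gray" (structure) and F G p q +
  fixes \<sigma> :: "('o, 'a, 'b, 'd, 'e, 'g) trimod"
  assumes src_tgt: "tm_src \<sigma> = p" "tm_tgt \<sigma> = q"
    and extensional: "tm0 \<sigma> \<in> extensional (pt A)" "tm1 \<sigma> \<in> extensional (ob A)"
    and tm0_simps [simp]: "X \<in> pt A \<Longrightarrow> tm0 \<sigma> X \<in> mor B" "X \<in> pt A \<Longrightarrow> dm B (tm0 \<sigma> X) = tn0 p X"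
      "X \<in> pt A \<Longrightarrow> cd B (tm0 \<sigma> X) = tn0 q X"
    and tm1_simps [simp]: "f \<in> ob A \<Longrightarrow> invertible B (tm1 \<sigma> f)"
      "f \<in> ob A \<Longrightarrow> sr B (tm1 \<sigma> f) = (map1 G f \<rhd> tm0 \<sigma> (s0 A f)) \<odot> tnl p f"
      "f \<in> ob A \<Longrightarrow> tg B (tm1 \<sigma> f) = tnl q f \<odot> (tm0 \<sigma> (t0 A f) \<lhd> map1 F f)"
begin

text \<open>The two squares compared by the law at a 2-cell: the 3-cell of \<sigma> at the codomain
  pasted with an inverse interchanger, and an interchanger pasted with the 3-cell at the domain.
  Both have the same sides \<open>a\<close> and \<open>b\<close>, so \<open>tn2 p\<close> and
  \<open>tn2 q\<close> span a cylinder between them.\<close>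

abbreviation "nat_src \<phi> \<equiv> p.F.B.hpaste (tnl q (cd A \<phi>)) (tn0 p (t0 A (dm A \<phi>)) \<rhd> map2 F \<phi>)
  (tm1 \<sigma> (cd A \<phi>)) (cinv B (ich B (tm0 \<sigma> (t0 A (dm A \<phi>))) (map2 F \<phi>)))"

abbreviation "nat_tgt \<phi> \<equiv> p.F.B.hpaste (map2 G \<phi> \<lhd> tn0 q (s0 A (dm A \<phi>))) (tnl p (dm A \<phi>))
  (ich B (map2 G \<phi>) (tm0 \<sigma> (s0 A (dm A \<phi>)))) (tm1 \<sigma> (dm A \<phi>))"

abbreviation "comp_src g f \<equiv> p.F.B.hpaste (map1 G g \<rhd> tnl q f) (tnl p g \<lhd> map1 F f)
  (map1 G g \<unrhd> tm1 \<sigma> f) (tm1 \<sigma> g \<unlhd> map1 F f)"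

abbreviation "nat_law \<phi> \<equiv> p.F.B.cyl (map1 G (cd A \<phi>) \<rhd> tm0 \<sigma> (s0 A (dm A \<phi>)))
  (tm0 \<sigma> (t0 A (dm A \<phi>)) \<lhd> map1 F (dm A \<phi>)) (tn2 p \<phi>) (tn2 q \<phi>) (nat_src \<phi>) (nat_tgt \<phi>)"

text \<open>One of the two squares is degenerate: an identity 3-cell, viewed as a square between the
  identity 2-cells of \<open>tn0 p X\<close> and \<open>tn0 q X\<close>.\<close>

abbreviation "unit_law X \<equiv> p.F.B.cyl (tm0 \<sigma> X) (tm0 \<sigma> X) (tnu p X) (tnu q X) \<langle>tm0 \<sigma> X\<rangle> (tm1 \<sigma> (one A X))"

abbreviation "comp_law g f \<equiv> p.F.B.cyl (map1 G g \<rhd> (map1 G f \<rhd> tm0 \<sigma> (s0 A f)))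
  (tm0 \<sigma> (t0 A g) \<lhd> (map1 F g \<cdot> map1 F f)) (tnc p (g, f)) (tnc q (g, f)) (comp_src g f) (tm1 \<sigma> (g \<cdot>\<^bsub>A\<^esub> f))"

lemma tm1_square: "f \<in> ob A \<Longrightarrow>
    tm1 \<sigma> f \<in> p.F.B.square (map1 G f \<rhd> tm0 \<sigma> (s0 A f)) (tnl p f) (tnl q f) (tm0 \<sigma> (t0 A f) \<lhd> map1 F f)"
  by (simp add: p.F.B.square_def)

lemma ich_square_src: "\<phi> \<in> mor A \<Longrightarrow>
  cinv B (ich B (tm0 \<sigma> (t0 A (dm A \<phi>))) (map2 F \<phi>)) \<in> p.F.B.square
    (tm0 \<sigma> (t0 A (dm A \<phi>)) \<lhd> map1 F (cd A \<phi>)) (tn0 p (t0 A (dm A \<phi>)) \<rhd> map2 F \<phi>)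
    (tn0 q (t0 A (dm A \<phi>)) \<rhd> map2 F \<phi>) (tm0 \<sigma> (t0 A (dm A \<phi>)) \<lhd> map1 F (dm A \<phi>))"
  by (simp add: p.F.B.square_def)

lemma ich_square_tgt: "\<phi> \<in> mor A \<Longrightarrow>
  ich B (map2 G \<phi>) (tm0 \<sigma> (s0 A (dm A \<phi>))) \<in> p.F.B.square
    (map1 G (cd A \<phi>) \<rhd> tm0 \<sigma> (s0 A (dm A \<phi>))) (map2 G \<phi> \<lhd> tn0 p (s0 A (dm A \<phi>)))
    (map2 G \<phi> \<lhd> tn0 q (s0 A (dm A \<phi>))) (map1 G (dm A \<phi>) \<rhd> tm0 \<sigma> (s0 A (dm A \<phi>)))"
  by (simp add: p.F.B.square_def)

lemma tm1_square_cd: "\<phi> \<in> mor A \<Longrightarrow>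
    tm1 \<sigma> (cd A \<phi>) \<in> p.F.B.square (map1 G (cd A \<phi>) \<rhd> tm0 \<sigma> (s0 A (dm A \<phi>))) (tnl p (cd A \<phi>))
      (tnl q (cd A \<phi>)) (tm0 \<sigma> (t0 A (dm A \<phi>)) \<lhd> map1 F (cd A \<phi>))"
  using tm1_square[of "cd A \<phi>"] by simp

lemma tm1_square_one: "X \<in> pt A \<Longrightarrow>
    tm1 \<sigma> (one A X) \<in> p.F.B.square (tm0 \<sigma> X) (tnl p (one A X)) (tnl q (one A X)) (tm0 \<sigma> X)"
  using tm1_square[of "one A X"] by simp

lemma tm0_square: "X \<in> pt A \<Longrightarrow>
    \<langle>tm0 \<sigma> X\<rangle> \<in> p.F.B.square (tm0 \<sigma> X) (idn B (tn0 p X)) (idn B (tn0 q X)) (tm0 \<sigma> X)"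
  by (simp add: p.F.B.square_def)

lemma comp_squares:
  assumes "f \<in> ob A" "g \<in> ob A" "s0 A g = t0 A f"
  shows "map1 G g \<unrhd> tm1 \<sigma> f \<in> p.F.B.square (map1 G g \<rhd> (map1 G f \<rhd> tm0 \<sigma> (s0 A f)))
      (map1 G g \<rhd> tnl p f) (map1 G g \<rhd> tnl q f) (map1 G g \<rhd> (tm0 \<sigma> (t0 A f) \<lhd> map1 F f))"
    and "tm1 \<sigma> g \<unlhd> map1 F f \<in> p.F.B.square (map1 G g \<rhd> (tm0 \<sigma> (t0 A f) \<lhd> map1 F f))
      (tnl p g \<lhd> map1 F f) (tnl q g \<lhd> map1 F f) (tm0 \<sigma> (t0 A g) \<lhd> (map1 F g \<cdot> map1 F f))"
    and "tm1 \<sigma> (g \<cdot>\<^bsub>A\<^esub> f) \<in> p.F.B.square (map1 G g \<rhd> (map1 G f \<rhd> tm0 \<sigma> (s0 A f)))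
      (tnl p (g \<cdot>\<^bsub>A\<^esub> f)) (tnl q (g \<cdot>\<^bsub>A\<^esub> f)) (tm0 \<sigma> (t0 A g) \<lhd> (map1 F g \<cdot> map1 F f))"
  using assms by (simp_all add: p.F.B.square_def)

text \<open>Each fact carries the hypotheses of both squares that it pastes, which explains the
  repeated arguments where it is instantiated.\<close>

lemmas nat_src_square = p.F.B.hpaste_square[OF tm1_square_cd ich_square_src]
  and nat_tgt_square = p.F.B.hpaste_square[OF ich_square_tgt tm1_square[of "dm A \<phi>" for \<phi>, OF p.F.A.mor_simps(1)]]
  and comp_src_square = p.F.B.hpaste_square[OF comp_squares(1,2)]

text \<open>Replaces the three laws by cylinders, so that composition, cancellation and transport
  reduce to the lemmas on squares.\<close>

lemma trimodification_iff:
  assumes "trinatural A B F G p" "trinatural A B F G q"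
  shows "trimodification A B F G p q \<sigma> \<longleftrightarrow>
    (\<forall>\<phi>\<in>mor A. nat_law \<phi>) \<and> (\<forall>X\<in>pt A. unit_law X) \<and>
    (\<forall>f\<in>ob A. \<forall>g\<in>ob A. s0 A g = t0 A f \<longrightarrow> comp_law g f)"
proof -
  have nat: "nat_law \<phi> \<longleftrightarrow> (tn2 q \<phi> \<star> \<langle>tm0 \<sigma> (t0 A (dm A \<phi>)) \<lhd> map1 F (dm A \<phi>)\<rangle>)
        \<bullet> (\<langle>tnl q (cd A \<phi>)\<rangle> \<star> cinv B (ich B (tm0 \<sigma> (t0 A (dm A \<phi>))) (map2 F \<phi>)))
        \<bullet> (tm1 \<sigma> (cd A \<phi>) \<star> \<langle>tn0 p (t0 A (dm A \<phi>)) \<rhd> map2 F \<phi>\<rangle>) =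
      (\<langle>map2 G \<phi> \<lhd> tn0 q (s0 A (dm A \<phi>))\<rangle> \<star> tm1 \<sigma> (dm A \<phi>))
        \<bullet> (ich B (map2 G \<phi>) (tm0 \<sigma> (s0 A (dm A \<phi>))) \<star> \<langle>tnl p (dm A \<phi>)\<rangle>)
        \<bullet> (\<langle>map1 G (cd A \<phi>) \<rhd> tm0 \<sigma> (s0 A (dm A \<phi>))\<rangle> \<star> tn2 p \<phi>)" if "\<phi> \<in> mor A" for \<phi>
    using that by (simp add: p.F.B.cyl_def p.F.B.hpaste_def)
  have unit: "unit_law X \<longleftrightarrow> tm1 \<sigma> (one A X) \<bullet> (\<langle>tm0 \<sigma> X\<rangle> \<star> tnu p X) = tnu q X \<star> \<langle>tm0 \<sigma> X\<rangle>"
    if "X \<in> pt A" for X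
    using that by (auto simp: p.F.B.cyl_def)
  have comp: "comp_law g f \<longleftrightarrow>
      tm1 \<sigma> (g \<cdot>\<^bsub>A\<^esub> f) \<bullet> (\<langle>(map1 G g \<cdot> map1 G f) \<rhd> tm0 \<sigma> (s0 A f)\<rangle> \<star> tnc p (g, f)) =
        (tnc q (g, f) \<star> \<langle>tm0 \<sigma> (t0 A g) \<lhd> (map1 F g \<cdot> map1 F f)\<rangle>)
        \<bullet> (\<langle>map1 G g \<rhd> tnl q f\<rangle> \<star> (tm1 \<sigma> g \<unlhd> map1 F f))
        \<bullet> ((map1 G g \<unrhd> tm1 \<sigma> f) \<star> \<langle>tnl p g \<lhd> map1 F f\<rangle>)"
    if "f \<in> ob A" "g \<in> ob A" "s0 A g = t0 A f" for f g
    using that by (auto simp: p.F.B.cyl_def p.F.B.hpaste_def)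
  show ?thesis
  proof (intro iffI conjI ballI impI)
    assume "trimodification A B F G p q \<sigma>"
    then interpret m: trimodification A B F G p q \<sigma> .
    show "nat_law \<phi>" if "\<phi> \<in> mor A" for \<phi>
      unfolding nat[OF that]
      by (rule m.natural[of \<phi> "s0 A (dm A \<phi>)" "t0 A (dm A \<phi>)"]) (simp add: mors_hom_iff that)
    show "unit_law X" if "X \<in> pt A" for X
      unfolding unit[OF that] by (rule m.unit[OF that])
    show "comp_law g f" if "f \<in> ob A" "g \<in> ob A" "s0 A g = t0 A f" for f g
      unfolding comp[OF that] by (rule m.composition[of f "s0 A f" "t0 A f"]) (use that in auto)
  next
    assume laws: "(\<forall>\<phi>\<in>mor A. nat_law \<phi>) \<and> (\<forall>X\<in>pt A. unit_law X) \<and>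
      (\<forall>f\<in>ob A. \<forall>g\<in>ob A. s0 A g = t0 A f \<longrightarrow> comp_law g f)"
    show "trimodification A B F G p q \<sigma>"
    proof (rule trimodification.intro)
      show "tm_src \<sigma> = p" "tm_tgt \<sigma> = q" "tm0 \<sigma> \<in> extensional (pt A)" "tm1 \<sigma> \<in> extensional (ob A)"
        by (fact src_tgt extensional)+
      show "trinatural A B F G p" "trinatural A B F G q" by (fact assms)+
    next
      fix X assume X: "X \<in> pt A"
      then show "tm0 \<sigma> X \<in> mors B (tn0 p X) (tn0 q X)" by (simp add: mors_def)
      show "tm1 \<sigma> (one A X) \<bullet> (\<langle>tm0 \<sigma> X\<rangle> \<star> tnu p X) = tnu q X \<star> \<langle>tm0 \<sigma> X\<rangle>"
        using laws X unfolding unit[OF X, symmetric] by blast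
    next
      fix f X Y assume "f \<in> cells1 A X Y"
      then show "tm1 \<sigma> f \<in> icels B ((map1 G f \<rhd> tm0 \<sigma> X) \<odot> tnl p f) (tnl q f \<odot> (tm0 \<sigma> Y \<lhd> map1 F f))"
        by (auto simp: icels_iff)
    next
      fix \<phi> X Y f g assume "\<phi> \<in> mors (hom A X Y) f g"
      then have m: "\<phi> \<in> mor A" "f = dm A \<phi>" "g = cd A \<phi>" "X = s0 A (dm A \<phi>)" "Y = t0 A (dm A \<phi>)"
        by (auto simp: mors_hom_iff)
      show "(tn2 q \<phi> \<star> \<langle>tm0 \<sigma> Y \<lhd> map1 F f\<rangle>)
        \<bullet> (\<langle>tnl q g\<rangle> \<star> cinv B (ich B (tm0 \<sigma> Y) (map2 F \<phi>)))
        \<bullet> (tm1 \<sigma> g \<star> \<langle>tn0 p Y \<rhd> map2 F \<phi>\<rangle>) =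
      (\<langle>map2 G \<phi> \<lhd> tn0 q X\<rangle> \<star> tm1 \<sigma> f)
        \<bullet> (ich B (map2 G \<phi>) (tm0 \<sigma> X) \<star> \<langle>tnl p f\<rangle>)
        \<bullet> (\<langle>map1 G g \<rhd> tm0 \<sigma> X\<rangle> \<star> tn2 p \<phi>)"
        using laws m(1) unfolding m(2-5) nat[OF m(1), symmetric] by blast
    next
      fix f X Y g Z assume "f \<in> cells1 A X Y" "g \<in> cells1 A Y Z"
      then have m: "f \<in> ob A" "g \<in> ob A" "s0 A g = t0 A f" "X = s0 A f" "Z = t0 A g" by auto
      show "tm1 \<sigma> (g \<cdot>\<^bsub>A\<^esub> f) \<bullet> (\<langle>(map1 G g \<cdot> map1 G f) \<rhd> tm0 \<sigma> X\<rangle> \<star> tnc p (g, f)) =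
        (tnc q (g, f) \<star> \<langle>tm0 \<sigma> Z \<lhd> (map1 F g \<cdot> map1 F f)\<rangle>)
        \<bullet> (\<langle>map1 G g \<rhd> tnl q f\<rangle> \<star> (tm1 \<sigma> g \<unlhd> map1 F f))
        \<bullet> ((map1 G g \<unrhd> tm1 \<sigma> f) \<star> \<langle>tnl p g \<lhd> map1 F f\<rangle>)"
        using laws m(1-3) unfolding m(4,5) comp[OF m(1-3), symmetric] by blast
    qed
  qed
qed

end

lemma ladj_adj_map [simp]: "ladj (adj_map m1 m2 e) = m1 (ladj e)"
  by (simp add: adj_map_def)

context gray_functors
begin

lemma pretrimodification_of_trimodification:
  assumes "trimodification A B F G p q \<sigma>"
  shows "pretrimodification A B F G p q \<sigma>"
proof -
  interpret m: trimodification A B F G p q \<sigma> by fact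
  interpret p: pretrinatural A B F G p by (rule pretrinatural_of_trinatural) (rule m.src_tgt)
  interpret q: pretrinatural A B F G q by (rule pretrinatural_of_trinatural) (rule m.src_tgt)
  show ?thesis
  proof
    show "tm_src \<sigma> = p" "tm_tgt \<sigma> = q" "tm0 \<sigma> \<in> extensional (pt A)" "tm1 \<sigma> \<in> extensional (ob A)"
      by (fact m.src_tgt m.extensional)+
  next
    fix X assume "X \<in> pt A"
    then show "tm0 \<sigma> X \<in> mor B" "dm B (tm0 \<sigma> X) = tn0 p X" "cd B (tm0 \<sigma> X) = tn0 q X"
      using m.tm0_in[of X] by (auto simp: mors_def)
  next
    fix f assume "f \<in> ob A"
    then show "invertible B (tm1 \<sigma> f)" "sr B (tm1 \<sigma> f) = (map1 G f \<rhd> tm0 \<sigma> (s0 A f)) \<odot> tnl p f"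
      "tg B (tm1 \<sigma> f) = tnl q f \<odot> (tm0 \<sigma> (t0 A f) \<lhd> map1 F f)"
      using m.tm1_in[of f "s0 A f" "t0 A f"] by (auto simp: icels_iff)
  qed
qed

end

section \<open>Composing trimodifications and cancelling an equivalence\<close>

locale pretrimodification_pair = s: pretrimodification A B F G p q \<sigma> + t: pretrimodification A B F G q r \<tau>
  for A :: "('a, 'b, 'c, 'o) gray" and B :: "('d, 'e, 'g, 'p) gray" (structure) and F G p q r \<sigma> \<tau>
begin

abbreviation "\<tau>\<sigma> \<equiv> tm_comp A B F G \<tau> \<sigma>"

lemma tm_comp_simps [simp]:
  "X \<in> pt A \<Longrightarrow> tm0 \<tau>\<sigma> X = tm0 \<tau> X \<odot> tm0 \<sigma> X"
  "f \<in> ob A \<Longrightarrow> tm1 \<tau>\<sigma> f = s.p.F.B.vpaste (map1 G f \<rhd> tm0 \<tau> (s0 A f)) (tm0 \<sigma> (t0 A f) \<lhd> map1 F f)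
     (tm1 \<tau> f) (tm1 \<sigma> f)"
  by (simp_all add: tm_comp_def s.p.F.B.vpaste_def)

sublocale c: pretrimodification A B F G p r "tm_comp A B F G \<tau> \<sigma>"
proof
  show "tm_src \<tau>\<sigma> = p" "tm_tgt \<tau>\<sigma> = r" "tm0 \<tau>\<sigma> \<in> extensional (pt A)" "tm1 \<tau>\<sigma> \<in> extensional (ob A)"
    using s.src_tgt t.src_tgt by (simp_all add: tm_comp_def)
next
  fix X assume "X \<in> pt A"
  then show "tm0 \<tau>\<sigma> X \<in> mor B" "dm B (tm0 \<tau>\<sigma> X) = tn0 p X" "cd B (tm0 \<tau>\<sigma> X) = tn0 r X" by simp_all
next
  fix f assume f: "f \<in> ob A"
  show "invertible B (tm1 \<tau>\<sigma> f)"
    using s.p.F.B.vpaste_iso[OF s.tm1_square[OF f] t.tm1_square[OF f]] f by simp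
  show "sr B (tm1 \<tau>\<sigma> f) = (map1 G f \<rhd> tm0 \<tau>\<sigma> (s0 A f)) \<odot> tnl p f"
    "tg B (tm1 \<tau>\<sigma> f) = tnl r f \<odot> (tm0 \<tau>\<sigma> (t0 A f) \<lhd> map1 F f)"
    using s.p.F.B.squareD[OF s.p.F.B.vpaste_square[OF s.tm1_square[OF f] t.tm1_square[OF f]]] f
    by simp_all
qed

text \<open>The interchanger at the composite 2-cell is itself a vertical pasting, so the
  interchange law for squares splits the boundary pasting of the composite into those of the
  factors. The two lemmas that follow have the same reason.\<close>

lemma nat_src_comp:
  assumes "\<phi> \<in> mor A"
  shows "c.nat_src \<phi> = s.p.F.B.vpaste (map1 G (cd A \<phi>) \<rhd> tm0 \<tau> (s0 A (dm A \<phi>)))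
    (tm0 \<sigma> (t0 A (dm A \<phi>)) \<lhd> map1 F (dm A \<phi>)) (t.nat_src \<phi>) (s.nat_src \<phi>)"
  using s.p.F.B.hpaste_vpaste[OF s.tm1_square_cd[OF assms] s.ich_square_src[OF assms]
      t.tm1_square_cd[OF assms] t.ich_square_src[OF assms]] assms
    s.p.F.B.cinv_ich_cmp_left_vpaste[of "map2 F \<phi>" "tm0 \<sigma> (t0 A (dm A \<phi>))" "tm0 \<tau> (t0 A (dm A \<phi>))"]
  by simp

lemma nat_tgt_comp:
  assumes "\<phi> \<in> mor A"
  shows "c.nat_tgt \<phi> = s.p.F.B.vpaste (map1 G (cd A \<phi>) \<rhd> tm0 \<tau> (s0 A (dm A \<phi>)))
    (tm0 \<sigma> (t0 A (dm A \<phi>)) \<lhd> map1 F (dm A \<phi>)) (t.nat_tgt \<phi>) (s.nat_tgt \<phi>)"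
  using s.p.F.B.hpaste_vpaste[OF s.ich_square_tgt[OF assms] s.tm1_square[OF s.p.F.A.mor_simps(1)[OF assms]]
      t.ich_square_tgt[OF assms] t.tm1_square[OF s.p.F.A.mor_simps(1)[OF assms]]] assms
    s.p.F.B.ich_cmp_right_vpaste[of "tm0 \<sigma> (s0 A (dm A \<phi>))" "tm0 \<tau> (s0 A (dm A \<phi>))" "map2 G \<phi>"]
  by simp

lemma comp_src_comp:
  assumes "f \<in> ob A" "g \<in> ob A" "s0 A g = t0 A f"
  shows "c.comp_src g f = s.p.F.B.vpaste (map1 G g \<rhd> (map1 G f \<rhd> tm0 \<tau> (s0 A f)))
    (tm0 \<sigma> (t0 A g) \<lhd> (map1 F g \<cdot> map1 F f)) (t.comp_src g f) (s.comp_src g f)"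
  using s.p.F.B.hpaste_vpaste[OF s.comp_squares(1,2)[OF assms] t.comp_squares(1,2)[OF assms]] assms
    s.p.F.B.lw3_vpaste[OF s.tm1_square t.tm1_square, of f "map1 G g"]
    s.p.F.B.rw3_vpaste[OF s.tm1_square t.tm1_square, of g "map1 F f"]
  by simp

lemma tn2_cels: "\<phi> \<in> mor A \<Longrightarrow> tn2 p \<phi> \<in> cels B (tnl p (cd A \<phi>) \<odot> (tn0 p (t0 A (dm A \<phi>)) \<rhd> map2 F \<phi>))
    ((map2 G \<phi> \<lhd> tn0 p (s0 A (dm A \<phi>))) \<odot> tnl p (dm A \<phi>))"
  "\<phi> \<in> mor A \<Longrightarrow> tn2 q \<phi> \<in> cels B (tnl q (cd A \<phi>) \<odot> (tn0 q (t0 A (dm A \<phi>)) \<rhd> map2 F \<phi>))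
    ((map2 G \<phi> \<lhd> tn0 q (s0 A (dm A \<phi>))) \<odot> tnl q (dm A \<phi>))"
  "\<phi> \<in> mor A \<Longrightarrow> tn2 r \<phi> \<in> cels B (tnl r (cd A \<phi>) \<odot> (tn0 r (t0 A (dm A \<phi>)) \<rhd> map2 F \<phi>))
    ((map2 G \<phi> \<lhd> tn0 r (s0 A (dm A \<phi>))) \<odot> tnl r (dm A \<phi>))"
  by (simp_all add: cels_def)

lemma tnu_cels: "X \<in> pt A \<Longrightarrow> tnu p X \<in> cels B (idn B (tn0 p X)) (tnl p (one A X))"
  "X \<in> pt A \<Longrightarrow> tnu q X \<in> cels B (idn B (tn0 q X)) (tnl q (one A X))"
  "X \<in> pt A \<Longrightarrow> tnu r X \<in> cels B (idn B (tn0 r X)) (tnl r (one A X))"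
  by (simp_all add: cels_def)

lemma tnc_cels:
  assumes "f \<in> ob A" "g \<in> ob A" "s0 A g = t0 A f"
  shows "tnc p (g, f) \<in> cels B ((map1 G g \<rhd> tnl p f) \<odot> (tnl p g \<lhd> map1 F f)) (tnl p (g \<cdot>\<^bsub>A\<^esub> f))"
  "tnc q (g, f) \<in> cels B ((map1 G g \<rhd> tnl q f) \<odot> (tnl q g \<lhd> map1 F f)) (tnl q (g \<cdot>\<^bsub>A\<^esub> f))"
  "tnc r (g, f) \<in> cels B ((map1 G g \<rhd> tnl r f) \<odot> (tnl r g \<lhd> map1 F f)) (tnl r (g \<cdot>\<^bsub>A\<^esub> f))"
  using assms by (simp_all add: cels_def)

text \<open>Given the law of \<tau>, the laws of \<sigma> and of the composite imply each other; the
  direction back to \<sigma> cancels \<tau> and needs its 2-cell to be an equivalence.\<close>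

lemma nat_law_comp:
  assumes "\<phi> \<in> mor A" "t.nat_law \<phi>"
  shows "s.nat_law \<phi> \<Longrightarrow> c.nat_law \<phi>"
    and "adjoint_equivalence B (tn0 q (s0 A (dm A \<phi>))) (tn0 r (s0 A (dm A \<phi>))) e \<Longrightarrow>
      ladj e = tm0 \<tau> (s0 A (dm A \<phi>)) \<Longrightarrow> c.nat_law \<phi> \<Longrightarrow> s.nat_law \<phi>"
proof -
  note sq = s.nat_src_square[OF assms(1,1)] s.nat_tgt_square[OF assms(1,1)]
    t.nat_src_square[OF assms(1,1)] t.nat_tgt_square[OF assms(1,1)]
  have iff: "c.nat_law \<phi> \<longleftrightarrow> s.p.F.B.cyl
      ((map1 G (cd A \<phi>) \<rhd> tm0 \<tau> (s0 A (dm A \<phi>))) \<odot> (map1 G (cd A \<phi>) \<rhd> tm0 \<sigma> (s0 A (dm A \<phi>))))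
      ((tm0 \<tau> (t0 A (dm A \<phi>)) \<lhd> map1 F (dm A \<phi>)) \<odot> (tm0 \<sigma> (t0 A (dm A \<phi>)) \<lhd> map1 F (dm A \<phi>)))
      (tn2 p \<phi>) (tn2 r \<phi>)
      (s.p.F.B.vpaste (map1 G (cd A \<phi>) \<rhd> tm0 \<tau> (s0 A (dm A \<phi>)))
        (tm0 \<sigma> (t0 A (dm A \<phi>)) \<lhd> map1 F (dm A \<phi>)) (t.nat_src \<phi>) (s.nat_src \<phi>))
      (s.p.F.B.vpaste (map1 G (cd A \<phi>) \<rhd> tm0 \<tau> (s0 A (dm A \<phi>)))
        (tm0 \<sigma> (t0 A (dm A \<phi>)) \<lhd> map1 F (dm A \<phi>)) (t.nat_tgt \<phi>) (s.nat_tgt \<phi>))"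
    unfolding nat_src_comp[OF assms(1), symmetric] nat_tgt_comp[OF assms(1), symmetric]
    using assms(1) by simp
  show "s.nat_law \<phi> \<Longrightarrow> c.nat_law \<phi>"
    unfolding iff by (rule s.p.F.B.cyl_vpaste[OF sq tn2_cels[OF assms(1)] _ assms(2)])
  assume e: "adjoint_equivalence B (tn0 q (s0 A (dm A \<phi>))) (tn0 r (s0 A (dm A \<phi>))) e"
    "ladj e = tm0 \<tau> (s0 A (dm A \<phi>))"
  have inv: "invertible B (t.nat_tgt \<phi>)"
    using assms(1) by (intro s.p.F.B.hpaste_iso[OF t.ich_square_tgt t.tm1_square]) simp_all
  \<comment> \<open>The side to be cancelled is not the 2-cell of \<tau> itself but its whiskering
    with \<open>map1 G (cd A \<phi>)\<close>, which is again a left adjoint.\<close>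
  have e': "adjoint_equivalence B (map1 G (cd A \<phi>) \<cdot> tn0 q (s0 A (dm A \<phi>)))
      (map1 G (cd A \<phi>) \<cdot> tn0 r (s0 A (dm A \<phi>)))
      (adj_map (lw2 B (map1 G (cd A \<phi>))) (lw3 B (map1 G (cd A \<phi>))) e)"
    by (rule s.p.F.B.adj_map_lw[OF e(1)]) (use assms(1) in simp_all)
  show "c.nat_law \<phi> \<Longrightarrow> s.nat_law \<phi>"
    unfolding iff
    by (rule s.p.F.B.cyl_vpaste_cancel[OF sq inv tn2_cels[OF assms(1)] e' _ assms(2)]) (simp_all add: e(2))
qed

lemma unit_law_comp:
  assumes "X \<in> pt A" "t.unit_law X"
  shows "s.unit_law X \<Longrightarrow> c.unit_law X"
    and "adjoint_equivalence B (tn0 q X) (tn0 r X) e \<Longrightarrow> ladj e = tm0 \<tau> X \<Longrightarrow>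
      c.unit_law X \<Longrightarrow> s.unit_law X"
proof -
  note sq = s.tm0_square[OF assms(1)] s.tm1_square_one[OF assms(1)]
    t.tm0_square[OF assms(1)] t.tm1_square_one[OF assms(1)]
  have iff: "c.unit_law X \<longleftrightarrow> s.p.F.B.cyl (tm0 \<tau> X \<odot> tm0 \<sigma> X) (tm0 \<tau> X \<odot> tm0 \<sigma> X) (tnu p X) (tnu r X)
      (s.p.F.B.vpaste (tm0 \<tau> X) (tm0 \<sigma> X) \<langle>tm0 \<tau> X\<rangle> \<langle>tm0 \<sigma> X\<rangle>)
      (s.p.F.B.vpaste (tm0 \<tau> X) (tm0 \<sigma> X) (tm1 \<tau> (one A X)) (tm1 \<sigma> (one A X)))"
    using assms(1) by (simp add: s.p.F.B.vpaste_def)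
  show "s.unit_law X \<Longrightarrow> c.unit_law X"
    unfolding iff by (rule s.p.F.B.cyl_vpaste[OF sq tnu_cels[OF assms(1)] _ assms(2)])
  have inv: "invertible B (tm1 \<tau> (one A X))" using assms(1) by simp
  assume e: "adjoint_equivalence B (tn0 q X) (tn0 r X) e" "ladj e = tm0 \<tau> X"
  show "c.unit_law X \<Longrightarrow> s.unit_law X"
    unfolding iff
    by (rule s.p.F.B.cyl_vpaste_cancel[OF sq inv tnu_cels[OF assms(1)] e assms(2)])
qed

lemma comp_law_comp:
  assumes fg: "f \<in> ob A" "g \<in> ob A" "s0 A g = t0 A f" and t: "t.comp_law g f"
  shows "s.comp_law g f \<Longrightarrow> c.comp_law g f"
    and "adjoint_equivalence B (tn0 q (s0 A f)) (tn0 r (s0 A f)) e \<Longrightarrow> ladj e = tm0 \<tau> (s0 A f) \<Longrightarrow>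
      c.comp_law g f \<Longrightarrow> s.comp_law g f"
proof -
  note sq = s.comp_src_square[OF fg fg] s.comp_squares(3)[OF fg]
    t.comp_src_square[OF fg fg] t.comp_squares(3)[OF fg]
  have iff: "c.comp_law g f \<longleftrightarrow> s.p.F.B.cyl
      ((map1 G g \<rhd> (map1 G f \<rhd> tm0 \<tau> (s0 A f))) \<odot> (map1 G g \<rhd> (map1 G f \<rhd> tm0 \<sigma> (s0 A f))))
      ((tm0 \<tau> (t0 A g) \<lhd> (map1 F g \<cdot> map1 F f)) \<odot> (tm0 \<sigma> (t0 A g) \<lhd> (map1 F g \<cdot> map1 F f)))
      (tnc p (g, f)) (tnc r (g, f))
      (s.p.F.B.vpaste (map1 G g \<rhd> (map1 G f \<rhd> tm0 \<tau> (s0 A f)))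
        (tm0 \<sigma> (t0 A g) \<lhd> (map1 F g \<cdot> map1 F f)) (t.comp_src g f) (s.comp_src g f))
      (s.p.F.B.vpaste (map1 G g \<rhd> (map1 G f \<rhd> tm0 \<tau> (s0 A f)))
        (tm0 \<sigma> (t0 A g) \<lhd> (map1 F g \<cdot> map1 F f)) (tm1 \<tau> (g \<cdot>\<^bsub>A\<^esub> f)) (tm1 \<sigma> (g \<cdot>\<^bsub>A\<^esub> f)))"
    unfolding comp_src_comp[OF fg, symmetric] using fg by simp
  show "s.comp_law g f \<Longrightarrow> c.comp_law g f"
    unfolding iff by (rule s.p.F.B.cyl_vpaste[OF sq tnc_cels[OF fg] _ t])
  have inv: "invertible B (tm1 \<tau> (g \<cdot>\<^bsub>A\<^esub> f))" using fg by simp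
  assume e: "adjoint_equivalence B (tn0 q (s0 A f)) (tn0 r (s0 A f)) e" "ladj e = tm0 \<tau> (s0 A f)"
  have e1: "adjoint_equivalence B (map1 G f \<cdot> tn0 q (s0 A f)) (map1 G f \<cdot> tn0 r (s0 A f))
      (adj_map (lw2 B (map1 G f)) (lw3 B (map1 G f)) e)"
    by (rule s.p.F.B.adj_map_lw[OF e(1)]) (use fg in simp_all)
  \<comment> \<open>Here the side carries two successive whiskerings, by \<open>map1 G f\<close> and
    by \<open>map1 G g\<close>.\<close>
  have e2: "adjoint_equivalence B (map1 G g \<cdot> (map1 G f \<cdot> tn0 q (s0 A f))) (map1 G g \<cdot> (map1 G f \<cdot> tn0 r (s0 A f)))
      (adj_map (lw2 B (map1 G g)) (lw3 B (map1 G g)) (adj_map (lw2 B (map1 G f)) (lw3 B (map1 G f)) e))"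
    by (rule s.p.F.B.adj_map_lw[OF e1]) (use fg in simp_all)
  show "c.comp_law g f \<Longrightarrow> s.comp_law g f"
    unfolding iff
    by (rule s.p.F.B.cyl_vpaste_cancel[OF sq inv tnc_cels[OF fg] e2 _ t]) (simp_all add: e(2))
qed

end

context gray_functors
begin

lemma trimodification_comp:
  assumes "trimodification A B F G p q \<sigma>" "trimodification A B F G q r \<tau>"
  shows "trimodification A B F G p r (tm_comp A B F G \<tau> \<sigma>)"
proof -
  interpret pair: pretrimodification_pair A B F G p q r \<sigma> \<tau>
    using assms by (intro pretrimodification_pair.intro pretrimodification_of_trimodification)
  have tr: "trinatural A B F G p" "trinatural A B F G q" "trinatural A B F G r"
    using assms by (auto dest: trimodification.src_tgt)
  show ?thesis
    using assms pair.nat_law_comp(1) pair.unit_law_comp(1) pair.comp_law_comp(1)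
    unfolding pair.c.trimodification_iff[OF tr(1,3)] pair.s.trimodification_iff[OF tr(1,2)]
      pair.t.trimodification_iff[OF tr(2,3)]
    by blast
qed

text \<open>Pointwise adjoint equivalences in \<open>B\<close> are enough for cancelling \<tau>; no
  inverse trimodification is presupposed, so this may be applied before one has been
  constructed.\<close>

lemma trimodification_comp_cancel:
  assumes \<sigma>: "pretrimodification A B F G p q \<sigma>" and \<tau>: "trimodification A B F G q r \<tau>"
    and e: "\<And>X. X \<in> pt A \<Longrightarrow> adjoint_equivalence B (tn0 q X) (tn0 r X) (e X)"
      "\<And>X. X \<in> pt A \<Longrightarrow> ladj (e X) = tm0 \<tau> X"
    and c: "trimodification A B F G p r (tm_comp A B F G \<tau> \<sigma>)"
  shows "trimodification A B F G p q \<sigma>"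
proof -
  interpret pair: pretrimodification_pair A B F G p q r \<sigma> \<tau>
    by (rule pretrimodification_pair.intro[OF \<sigma> pretrimodification_of_trimodification[OF \<tau>]])
  have tr: "trinatural A B F G p" "trinatural A B F G q" "trinatural A B F G r"
    using \<tau> c by (auto dest: trimodification.src_tgt)
  note laws = \<tau>[unfolded pair.t.trimodification_iff[OF tr(2,3)]] c[unfolded pair.c.trimodification_iff[OF tr(1,3)]]
  show ?thesis
    unfolding pair.s.trimodification_iff[OF tr(1,2)]
  proof (intro conjI ballI impI)
    fix \<phi> assume "\<phi> \<in> mor A"
    then show "pair.s.nat_law \<phi>"
      using laws e[of "s0 A (dm A \<phi>)"] by (intro pair.nat_law_comp(2)) auto
  next
    fix X assume "X \<in> pt A"
    then show "pair.s.unit_law X"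
      using laws e[of X] by (intro pair.unit_law_comp(2)) auto
  next
    fix f g assume "f \<in> ob A" "g \<in> ob A" "s0 A g = t0 A f"
    then show "pair.s.comp_law g f"
      using laws e[of "s0 A f"] by (intro pair.comp_law_comp(2)) auto
  qed
qed

lemma trimodification_id:
  assumes "trinatural A B F G p"
  shows "trimodification A B F G p p (tm_id A B p)"
proof -
  interpret p: pretrinatural A B F G p by (rule pretrinatural_of_trinatural[OF assms])
  interpret m: pretrimodification A B F G p p "tm_id A B p"
    by unfold_locales (simp_all add: tm_id_def)
  show ?thesis
    unfolding m.trimodification_iff[OF assms assms]
    by (auto simp: tm_id_def F.B.cyl_def F.B.hpaste_def)
qed

end

section \<open>Transport of trimodification laws along pointwise invertible 3-cells\<close>

locale preperturbation = s: pretrimodification A B F G p q \<sigma> + t: pretrimodification A B F G p q \<tau>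
  for A :: "('a, 'b, 'c, 'o) gray" and B :: "('d, 'e, 'g, 'p) gray" (structure) and F G p q \<sigma> \<tau> +
  fixes \<Omega> :: "'o \<Rightarrow> 'g"
  assumes inv [simp]: "X \<in> pt A \<Longrightarrow> invertible B (\<Omega> X)"
    and ends [simp]: "X \<in> pt A \<Longrightarrow> sr B (\<Omega> X) = tm0 \<sigma> X" "X \<in> pt A \<Longrightarrow> tg B (\<Omega> X) = tm0 \<tau> X"
    and law: "f \<in> ob A \<Longrightarrow> tm1 \<tau> f \<bullet> ((map1 G f \<unrhd> \<Omega> (s0 A f)) \<star> \<langle>tnl p f\<rangle>) =
        (\<langle>tnl q f\<rangle> \<star> (\<Omega> (t0 A f) \<unlhd> map1 F f)) \<bullet> tm1 \<sigma> f"
begin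

lemma tm1_cocyl:
  "f \<in> ob A \<Longrightarrow> s.p.F.B.cocyl (tnl p f) (tnl q f) (map1 G f \<unrhd> \<Omega> (s0 A f)) (\<Omega> (t0 A f) \<unlhd> map1 F f)
    (tm1 \<sigma> f) (tm1 \<tau> f)"
  using law by (simp add: s.p.F.B.cocyl_def)

lemma \<Omega>_cels:
  "X \<in> pt A \<Longrightarrow> \<Omega> X \<in> cels B (tm0 \<sigma> X) (tm0 \<tau> X)"
  "f \<in> ob A \<Longrightarrow> X \<in> pt A \<Longrightarrow> s0 A f = X \<Longrightarrow>
    map1 G f \<unrhd> \<Omega> X \<in> cels B (map1 G f \<rhd> tm0 \<sigma> X) (map1 G f \<rhd> tm0 \<tau> X)"
  "f \<in> ob A \<Longrightarrow> X \<in> pt A \<Longrightarrow> t0 A f = X \<Longrightarrow>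
    \<Omega> X \<unlhd> map1 F f \<in> cels B (tm0 \<sigma> X \<lhd> map1 F f) (tm0 \<tau> X \<lhd> map1 F f)"
  by (auto simp: cels_def)

text \<open>The identity is composed with \<sigma> only to have the typing facts on the cells of
  \<open>p\<close> and \<open>q\<close> available.\<close>

sublocale pair: pretrimodification_pair A B F G p q q \<sigma> "tm_id A B q"
  by unfold_locales (simp_all add: tm_id_def)

text \<open>Each boundary square of \<sigma> is related to that of \<tau> by a cocylinder, pasted
  from the perturbation law and naturality of an interchanger. With such a cocylinder for both
  squares, the cylinder law moves from \<sigma> to \<tau>.\<close>

lemma nat_law_transport:
  assumes \<phi>: "\<phi> \<in> mor A" and law: "s.nat_law \<phi>"
  shows "t.nat_law \<phi>"
proof -
  note src = s.tm1_square_cd[OF \<phi>] t.tm1_square_cd[OF \<phi>] s.ich_square_src[OF \<phi>] t.ich_square_src[OF \<phi>]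
  note tgt = s.ich_square_tgt[OF \<phi>] t.ich_square_tgt[OF \<phi>] s.tm1_square[of "dm A \<phi>"] t.tm1_square[of "dm A \<phi>"]
  let ?\<omega> = "map1 G (cd A \<phi>) \<unrhd> \<Omega> (s0 A (dm A \<phi>))" and ?\<omega>' = "\<Omega> (t0 A (dm A \<phi>)) \<unlhd> map1 F (dm A \<phi>)"
  have \<omega>: "?\<omega> \<in> cels B (map1 G (cd A \<phi>) \<rhd> tm0 \<sigma> (s0 A (dm A \<phi>))) (map1 G (cd A \<phi>) \<rhd> tm0 \<tau> (s0 A (dm A \<phi>)))"
    "invertible B ?\<omega>"
    "?\<omega>' \<in> cels B (tm0 \<sigma> (t0 A (dm A \<phi>)) \<lhd> map1 F (dm A \<phi>)) (tm0 \<tau> (t0 A (dm A \<phi>)) \<lhd> map1 F (dm A \<phi>))"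
    using \<phi> by (auto simp: cels_def)
  \<comment> \<open>The intermediate change is \<Omega> on the side shared by the 3-cell of the
    trimodification and the interchanger.\<close>
  have c1: "s.p.F.B.cocyl (tnl p (cd A \<phi>) \<odot> (tn0 p (t0 A (dm A \<phi>)) \<rhd> map2 F \<phi>))
      (tnl q (cd A \<phi>) \<odot> (tn0 q (t0 A (dm A \<phi>)) \<rhd> map2 F \<phi>)) ?\<omega> ?\<omega>' (s.nat_src \<phi>) (t.nat_src \<phi>)"
    by (rule s.p.F.B.cocyl_hpaste[OF src \<omega>(1) _ \<omega>(3), of "\<Omega> (t0 A (dm A \<phi>)) \<unlhd> map1 F (cd A \<phi>)"])
      (use \<phi> tm1_cocyl[of "cd A \<phi>"]
        s.p.F.B.cinv_ich_cocyl_left[of "map2 F \<phi>" "\<Omega> (t0 A (dm A \<phi>))"] in \<open>simp_all add: cels_def\<close>)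
  have c2: "s.p.F.B.cocyl ((map2 G \<phi> \<lhd> tn0 p (s0 A (dm A \<phi>))) \<odot> tnl p (dm A \<phi>))
      ((map2 G \<phi> \<lhd> tn0 q (s0 A (dm A \<phi>))) \<odot> tnl q (dm A \<phi>)) ?\<omega> ?\<omega>' (s.nat_tgt \<phi>) (t.nat_tgt \<phi>)"
    by (rule s.p.F.B.cocyl_hpaste[OF tgt \<omega>(1) _ \<omega>(3), of "map1 G (dm A \<phi>) \<unrhd> \<Omega> (s0 A (dm A \<phi>))"])
      (use \<phi> tm1_cocyl[of "dm A \<phi>"]
        s.p.F.B.ich_cocyl_right[of "\<Omega> (s0 A (dm A \<phi>))" "map2 G \<phi>"] in \<open>simp_all add: cels_def\<close>)
  show ?thesis
    by (rule s.p.F.B.cyl_transport[OF s.nat_src_square[OF \<phi> \<phi>] s.nat_tgt_square[OF \<phi> \<phi>]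
      t.nat_src_square[OF \<phi> \<phi>] t.nat_tgt_square[OF \<phi> \<phi>] pair.tn2_cels(1,2)[OF \<phi>] \<omega> law c1 c2])
qed

lemma unit_law_transport:
  assumes X: "X \<in> pt A" and law: "s.unit_law X"
  shows "t.unit_law X"
proof -
  have c1: "s.p.F.B.cocyl (idn B (tn0 p X)) (idn B (tn0 q X)) (\<Omega> X) (\<Omega> X) \<langle>tm0 \<sigma> X\<rangle> \<langle>tm0 \<tau> X\<rangle>"
    using X by (simp add: s.p.F.B.cocyl_def)
  have c2: "s.p.F.B.cocyl (tnl p (one A X)) (tnl q (one A X)) (\<Omega> X) (\<Omega> X) (tm1 \<sigma> (one A X)) (tm1 \<tau> (one A X))"
    using tm1_cocyl[of "one A X"] X by simp
  show ?thesis
    by (rule s.p.F.B.cyl_transport[OF s.tm0_square[OF X] s.tm1_square_one[OF X]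
      t.tm0_square[OF X] t.tm1_square_one[OF X] pair.tnu_cels(1,2)[OF X] \<Omega>_cels(1)[OF X] inv[OF X]
      \<Omega>_cels(1)[OF X] law c1 c2])
qed

lemma comp_law_transport:
  assumes fg: "f \<in> ob A" "g \<in> ob A" "s0 A g = t0 A f" and hyp: "s.comp_law g f"
  shows "t.comp_law g f"
proof -
  let ?\<omega> = "map1 G g \<unrhd> (map1 G f \<unrhd> \<Omega> (s0 A f))" and ?\<omega>' = "\<Omega> (t0 A g) \<unlhd> (map1 F g \<cdot> map1 F f)"
  note sq = s.comp_squares[OF fg] t.comp_squares[OF fg]
  have \<omega>: "?\<omega> \<in> cels B (map1 G g \<rhd> (map1 G f \<rhd> tm0 \<sigma> (s0 A f))) (map1 G g \<rhd> (map1 G f \<rhd> tm0 \<tau> (s0 A f)))"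
    "invertible B ?\<omega>"
    "?\<omega>' \<in> cels B (tm0 \<sigma> (t0 A g) \<lhd> (map1 F g \<cdot> map1 F f)) (tm0 \<tau> (t0 A g) \<lhd> (map1 F g \<cdot> map1 F f))"
    using fg by (auto simp: cels_def)
  \<comment> \<open>The perturbation law at \<open>f\<close> whiskered with \<open>map1 G g\<close>.
    Together with the law at \<open>g\<close> whiskered with \<open>map1 F f\<close> it agrees on
    the common middle side, so the two cocylinders paste.\<close>
  have f: "s.p.F.B.cocyl (map1 G g \<rhd> tnl p f) (map1 G g \<rhd> tnl q f) ?\<omega>
      (map1 G g \<unrhd> (\<Omega> (t0 A f) \<unlhd> map1 F f)) (map1 G g \<unrhd> tm1 \<sigma> f) (map1 G g \<unrhd> tm1 \<tau> f)"
  proof -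
    have "map1 G g \<unrhd> (tm1 \<tau> f \<bullet> ((map1 G f \<unrhd> \<Omega> (s0 A f)) \<star> \<langle>tnl p f\<rangle>)) =
        map1 G g \<unrhd> ((\<langle>tnl q f\<rangle> \<star> (\<Omega> (t0 A f) \<unlhd> map1 F f)) \<bullet> tm1 \<sigma> f)"
      by (rule arg_cong[OF law[OF fg(1)]])
    then show ?thesis using fg by (simp add: s.p.F.B.cocyl_def)
  qed
  have g: "s.p.F.B.cocyl (tnl p g \<lhd> map1 F f) (tnl q g \<lhd> map1 F f)
      (map1 G g \<unrhd> (\<Omega> (t0 A f) \<unlhd> map1 F f)) ?\<omega>' (tm1 \<sigma> g \<unlhd> map1 F f) (tm1 \<tau> g \<unlhd> map1 F f)"
  proof -
    have "(tm1 \<tau> g \<bullet> ((map1 G g \<unrhd> \<Omega> (s0 A g)) \<star> \<langle>tnl p g\<rangle>)) \<unlhd> map1 F f =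
        ((\<langle>tnl q g\<rangle> \<star> (\<Omega> (t0 A g) \<unlhd> map1 F g)) \<bullet> tm1 \<sigma> g) \<unlhd> map1 F f"
      by (rule arg_cong[OF law[OF fg(2)], of "\<lambda>x. x \<unlhd> map1 F f"])
    then show ?thesis using fg by (simp add: s.p.F.B.cocyl_def)
  qed
  have c1: "s.p.F.B.cocyl ((map1 G g \<rhd> tnl p f) \<odot> (tnl p g \<lhd> map1 F f))
      ((map1 G g \<rhd> tnl q f) \<odot> (tnl q g \<lhd> map1 F f)) ?\<omega> ?\<omega>' (s.comp_src g f) (t.comp_src g f)"
    by (rule s.p.F.B.cocyl_hpaste[OF sq(1,4,2,5) \<omega>(1) _ \<omega>(3) f g]) (use fg in \<open>simp add: cels_def\<close>)
  have c2: "s.p.F.B.cocyl (tnl p (g \<cdot>\<^bsub>A\<^esub> f)) (tnl q (g \<cdot>\<^bsub>A\<^esub> f)) ?\<omega> ?\<omega>' (tm1 \<sigma> (g \<cdot>\<^bsub>A\<^esub> f)) (tm1 \<tau> (g \<cdot>\<^bsub>A\<^esub> f))"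
    using tm1_cocyl[of "g \<cdot>\<^bsub>A\<^esub> f"] fg by simp
  show ?thesis
    by (rule s.p.F.B.cyl_transport[OF s.comp_src_square[OF fg fg] sq(3) t.comp_src_square[OF fg fg] sq(6)
      pair.tnc_cels(1,2)[OF fg] \<omega> hyp c1 c2])
qed

lemma trimodification_transport:
  assumes "trimodification A B F G p q \<sigma>"
  shows "trimodification A B F G p q \<tau>"
proof -
  have tr: "trinatural A B F G p" "trinatural A B F G q"
    using assms by (auto dest: trimodification.src_tgt)
  show ?thesis
    using assms nat_law_transport unit_law_transport comp_law_transport
    unfolding s.trimodification_iff[OF tr] t.trimodification_iff[OF tr] by blast
qed

end

section \<open>Adjoint equivalences of trimodifications\<close>

definition trimod_at :: "(('o, 'a, 'b, 'd, 'e, 'g) trimod, ('o, 'a, 'b, 'd, 'e, 'g) pert) adjeq \<Rightarrow>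
    'o \<Rightarrow> ('e, 'g) adjeq" where
  "trimod_at \<sigma> X = \<lparr>ladj = tm0 (ladj \<sigma>) X, radj = tm0 (radj \<sigma>) X,
     aunit = pb0 (aunit \<sigma>) X, acounit = pb0 (acounit \<sigma>) X\<rparr>"

lemma trimod_at_simps [simp]:
  "ladj (trimod_at \<sigma> X) = tm0 (ladj \<sigma>) X" "radj (trimod_at \<sigma> X) = tm0 (radj \<sigma>) X"
  "aunit (trimod_at \<sigma> X) = pb0 (aunit \<sigma>) X" "acounit (trimod_at \<sigma> X) = pb0 (acounit \<sigma>) X"
  by (simp_all add: trimod_at_def)

context gray_functors
begin

abbreviation "K \<equiv> trinat_twocat A B F G"

lemma trinat_twocat_simps [simp]:
  "idn K = tm_id A B" "cmp K = tm_comp A B F G" "sr K = pb_src" "tg K = pb_tgt" "dm K = tm_src" "cd K = tm_tgt"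
  "idc K \<sigma> = \<lparr>pb_src = \<sigma>, pb_tgt = \<sigma>, pb0 = \<lambda>X\<in>pt A. idc B (tm0 \<sigma> X)\<rparr>"
  "hcmp K \<Omega>' \<Omega> = \<lparr>pb_src = tm_comp A B F G (pb_src \<Omega>') (pb_src \<Omega>),
     pb_tgt = tm_comp A B F G (pb_tgt \<Omega>') (pb_tgt \<Omega>), pb0 = \<lambda>X\<in>pt A. pb0 \<Omega>' X \<star> pb0 \<Omega> X\<rparr>"
  "vcmp K \<Omega>' \<Omega> = \<lparr>pb_src = pb_src \<Omega>, pb_tgt = pb_tgt \<Omega>', pb0 = \<lambda>X\<in>pt A. pb0 \<Omega>' X \<bullet> pb0 \<Omega> X\<rparr>"
  by (simp_all add: trinat_twocat_def)

lemma mors_trinat_iff: "\<sigma> \<in> mors K p q \<longleftrightarrow> trimodification A B F G p q \<sigma>"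
  by (auto simp: mors_def trinat_twocat_def dest: trimodification.src_tgt)

lemma cels_trinat_iff:
  assumes "trimodification A B F G p q \<sigma>"
  shows "\<Omega> \<in> cels K \<sigma> \<tau> \<longleftrightarrow> perturbation A B F G p q \<sigma> \<tau> \<Omega>"
  using assms by (auto simp: cels_def trinat_twocat_def dest: perturbation.src_tgt)
    (metis perturbation.src_tgt trimodification.src_tgt(1,2))

lemma perturbation_cells:
  assumes "perturbation A B F G p q \<sigma> \<tau> \<Omega>" "X \<in> pt A"
  shows "pb0 \<Omega> X \<in> cel B" "sr B (pb0 \<Omega> X) = tm0 \<sigma> X" "tg B (pb0 \<Omega> X) = tm0 \<tau> X"
  using perturbation.pb0_in[OF assms] by (auto simp: cels_def)

text \<open>Conjugating the law of \<Omega> gives the law for the pointwise inverses, so nothing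
  beyond pointwise invertibility is required.\<close>

lemma perturbation_inverse:
  assumes \<Omega>: "perturbation A B F G p q \<sigma> \<tau> \<Omega>"
  shows "(\<exists>y. inverse_cells K \<Omega> y) \<longleftrightarrow> (\<forall>X\<in>pt A. invertible B (pb0 \<Omega> X))"
proof
  interpret \<Omega>: perturbation A B F G p q \<sigma> \<tau> \<Omega> by fact
  interpret s: pretrimodification A B F G p q \<sigma>
    by (rule pretrimodification_of_trimodification) (rule \<Omega>.src_tgt)
  interpret t: pretrimodification A B F G p q \<tau>
    by (rule pretrimodification_of_trimodification) (rule \<Omega>.src_tgt)
  note c = perturbation_cells[OF \<Omega>]
  {
    assume "\<exists>y. inverse_cells K \<Omega> y"
    then obtain y where y: "inverse_cells K \<Omega> y" ..
    then have y': "perturbation A B F G p q \<tau> \<sigma> y"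
      using cels_trinat_iff[OF \<Omega>.src_tgt(4)] \<Omega>.src_tgt by (simp add: inverse_cells_def)
    show "\<forall>X\<in>pt A. invertible B (pb0 \<Omega> X)"
    proof
      fix X assume X: "X \<in> pt A"
      have "vcmp K y \<Omega> = idc K \<sigma>" "vcmp K \<Omega> y = idc K \<tau>"
        using y \<Omega>.src_tgt(1,2) by (simp_all add: inverse_cells_def del: trinat_twocat_simps(7-9))
      from this[THEN arg_cong[of _ _ pb0], THEN fun_cong, of X] X
      have "pb0 y X \<bullet> pb0 \<Omega> X = \<langle>tm0 \<sigma> X\<rangle>" "pb0 \<Omega> X \<bullet> pb0 y X = \<langle>tm0 \<tau> X\<rangle>"
        by simp_all
      then show "invertible B (pb0 \<Omega> X)"
        by (intro F.B.isoI(1)[where y = "pb0 y X"])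
          (simp_all add: c[OF X] perturbation_cells[OF y' X])
    qed
  }
  assume inv: "\<forall>X\<in>pt A. invertible B (pb0 \<Omega> X)"
  define y where "y = \<lparr>pb_src = \<tau>, pb_tgt = \<sigma>, pb0 = \<lambda>X\<in>pt A. cinv B (pb0 \<Omega> X)\<rparr>"
  have y: "perturbation A B F G p q \<tau> \<sigma> y"
  proof (rule perturbation.intro)
    show "pb_src y = \<tau>" "pb_tgt y = \<sigma>" "pb0 y \<in> extensional (pt A)" by (simp_all add: y_def)
    show "trimodification A B F G p q \<tau>" "trimodification A B F G p q \<sigma>" by (fact \<Omega>.src_tgt)+
  next
    fix X assume "X \<in> pt A"
    then show "pb0 y X \<in> cels B (tm0 \<tau> X) (tm0 \<sigma> X)"
      using inv c[of X] by (simp add: y_def cels_def)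
  next
    fix f X Y assume "f \<in> cells1 A X Y"
    then have f: "f \<in> ob A" "X = s0 A f" "Y = t0 A f" by auto
    have nat: "tm1 \<tau> f \<bullet> ((map1 G f \<unrhd> pb0 \<Omega> X) \<star> \<langle>tnl p f\<rangle>) =
        (\<langle>tnl q f\<rangle> \<star> (pb0 \<Omega> Y \<unlhd> map1 F f)) \<bullet> tm1 \<sigma> f"
      using \<Omega>.natural[of f X Y] f by simp
    have "tm1 \<sigma> f \<bullet> cinv B ((map1 G f \<unrhd> pb0 \<Omega> X) \<star> \<langle>tnl p f\<rangle>) =
        cinv B (\<langle>tnl q f\<rangle> \<star> (pb0 \<Omega> Y \<unlhd> map1 F f)) \<bullet> tm1 \<tau> f"
      by (rule iffD1[OF F.B.conjugate_iff nat]) (use f inv c[of X] c[of Y] in simp_all)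
    then show "tm1 \<sigma> f \<bullet> ((map1 G f \<unrhd> pb0 y X) \<star> \<langle>tnl p f\<rangle>) =
        (\<langle>tnl q f\<rangle> \<star> (pb0 y Y \<unlhd> map1 F f)) \<bullet> tm1 \<tau> f"
      using f inv c[of X] c[of Y] by (simp add: y_def)
  qed
  have "inverse_cells K \<Omega> y"
    unfolding inverse_cells_def
    using y cels_trinat_iff[OF \<Omega>.src_tgt(4)] \<Omega>.src_tgt inv c
    by (auto simp: y_def restrict_def fun_eq_iff)
  then show "\<exists>y. inverse_cells K \<Omega> y" ..
qed

lemma icels_trinat_iff:
  assumes "trimodification A B F G p q \<sigma>"
  shows "\<Omega> \<in> icels K \<sigma> \<tau> \<longleftrightarrow>
    perturbation A B F G p q \<sigma> \<tau> \<Omega> \<and> (\<forall>X\<in>pt A. invertible B (pb0 \<Omega> X))"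
  unfolding icels_def using cels_trinat_iff[OF assms] perturbation_inverse by blast

lemma tm_comp_id:
  assumes "trimodification A B F G p q \<sigma>"
  shows "tm_comp A B F G \<sigma> (tm_id A B p) = \<sigma>" "tm_comp A B F G (tm_id A B q) \<sigma> = \<sigma>"
proof -
  interpret s: pretrimodification A B F G p q \<sigma> by (rule pretrimodification_of_trimodification[OF assms])
  have "(\<lambda>X\<in>pt A. tm0 \<sigma> X) = tm0 \<sigma>" "(\<lambda>f\<in>ob A. tm1 \<sigma> f) = tm1 \<sigma>"
    using s.extensional by (simp_all add: extensional_restrict)
  then show "tm_comp A B F G \<sigma> (tm_id A B p) = \<sigma>" "tm_comp A B F G (tm_id A B q) \<sigma> = \<sigma>"
    using s.src_tgt by (auto intro!: trimod.equality simp: tm_comp_def tm_id_def cong: restrict_cong)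
qed

text \<open>Composites and identities of perturbations are computed pointwise in \<open>B\<close>,
  so the triangle identities and invertibility hold exactly when they hold at every object. What is
  left over globally is that the four cells are trimodifications and perturbations.\<close>

lemma trimod_adjoint_equivalence_iff:
  "trimod_adjoint_equivalence A B F G p q \<sigma> \<longleftrightarrow>
    trimodification A B F G p q (ladj \<sigma>) \<and> trimodification A B F G q p (radj \<sigma>) \<and>
    perturbation A B F G p p (tm_id A B p) (tm_comp A B F G (radj \<sigma>) (ladj \<sigma>)) (aunit \<sigma>) \<and>
    perturbation A B F G q q (tm_comp A B F G (ladj \<sigma>) (radj \<sigma>)) (tm_id A B q) (acounit \<sigma>) \<and>
    (\<forall>X\<in>pt A. adjoint_equivalence B (tn0 p X) (tn0 q X) (trimod_at \<sigma> X))"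
    (is "_ \<longleftrightarrow> ?l \<and> ?r \<and> ?\<eta> \<and> ?\<epsilon> \<and> ?at")
proof (cases "?l \<and> ?r")
  case False
  then show ?thesis by (auto simp: adjoint_equivalence_def mors_trinat_iff)
next
  case True
  then have l: ?l and r: ?r by auto
  interpret l: pretrimodification A B F G p q "ladj \<sigma>" by (rule pretrimodification_of_trimodification[OF l])
  interpret r: pretrimodification A B F G q p "radj \<sigma>" by (rule pretrimodification_of_trimodification[OF r])
  have tr: "trinatural A B F G p" "trinatural A B F G q" using trimodification.src_tgt[OF l] by auto
  have \<eta>: "aunit \<sigma> \<in> icels K (idn K p) (cmp K (radj \<sigma>) (ladj \<sigma>)) \<longleftrightarrow>
      ?\<eta> \<and> (\<forall>X\<in>pt A. invertible B (pb0 (aunit \<sigma>) X))"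
    using icels_trinat_iff[OF trimodification_id[OF tr(1)]] by simp
  have \<epsilon>: "acounit \<sigma> \<in> icels K (cmp K (ladj \<sigma>) (radj \<sigma>)) (idn K q) \<longleftrightarrow>
      ?\<epsilon> \<and> (\<forall>X\<in>pt A. invertible B (pb0 (acounit \<sigma>) X))"
    using icels_trinat_iff[OF trimodification_comp[OF r l]] by simp
  show ?thesis
  \<comment> \<open>The triangle identities are equations of records that include sources and
    targets, so they can be made pointwise only after unit and counit have been typed.\<close>
  proof (cases "?\<eta> \<and> ?\<epsilon>")
    case False
    then show ?thesis
      unfolding adjoint_equivalence_def using \<eta> \<epsilon> by blast
  next
    case True
    then have p: ?\<eta> ?\<epsilon> by auto
    note s = perturbation.src_tgt(1,2)[OF p(1)] perturbation.src_tgt(1,2)[OF p(2)]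
    note c = perturbation_cells[OF p(1)] perturbation_cells[OF p(2)]
    have t1: "vcmp K (hcmp K (acounit \<sigma>) (idc K (ladj \<sigma>))) (hcmp K (idc K (ladj \<sigma>)) (aunit \<sigma>)) = idc K (ladj \<sigma>) \<longleftrightarrow>
      (\<forall>X\<in>pt A. (pb0 (acounit \<sigma>) X \<star> \<langle>tm0 (ladj \<sigma>) X\<rangle>) \<bullet> (\<langle>tm0 (ladj \<sigma>) X\<rangle> \<star> pb0 (aunit \<sigma>) X) =
        \<langle>tm0 (ladj \<sigma>) X\<rangle>)"
      by (auto simp: s tm_comp_id[OF l] restrict_def fun_eq_iff)
    have t2: "vcmp K (hcmp K (idc K (radj \<sigma>)) (acounit \<sigma>)) (hcmp K (aunit \<sigma>) (idc K (radj \<sigma>))) = idc K (radj \<sigma>) \<longleftrightarrow>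
      (\<forall>X\<in>pt A. (\<langle>tm0 (radj \<sigma>) X\<rangle> \<star> pb0 (acounit \<sigma>) X) \<bullet> (pb0 (aunit \<sigma>) X \<star> \<langle>tm0 (radj \<sigma>) X\<rangle>) =
        \<langle>tm0 (radj \<sigma>) X\<rangle>)"
      by (auto simp: s tm_comp_id[OF r] restrict_def fun_eq_iff)
    have at: "adjoint_equivalence B (tn0 p X) (tn0 q X) (trimod_at \<sigma> X) \<longleftrightarrow>
        invertible B (pb0 (aunit \<sigma>) X) \<and> invertible B (pb0 (acounit \<sigma>) X) \<and>
        (pb0 (acounit \<sigma>) X \<star> \<langle>tm0 (ladj \<sigma>) X\<rangle>) \<bullet> (\<langle>tm0 (ladj \<sigma>) X\<rangle> \<star> pb0 (aunit \<sigma>) X) =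
          \<langle>tm0 (ladj \<sigma>) X\<rangle> \<and>
        (\<langle>tm0 (radj \<sigma>) X\<rangle> \<star> pb0 (acounit \<sigma>) X) \<bullet> (pb0 (aunit \<sigma>) X \<star> \<langle>tm0 (radj \<sigma>) X\<rangle>) =
          \<langle>tm0 (radj \<sigma>) X\<rangle>" if "X \<in> pt A" for X
      using that by (simp add: F.B.adjoint_equivalence_iff c tm_id_def tm_comp_def)
    show ?thesis
      unfolding adjoint_equivalence_def[of K] mors_trinat_iff \<eta> \<epsilon> t1 t2 using l r p at by auto
  qed
qed

text \<open>The 3-cells of the left adjoint are the only data not already shared. The unit law fixes
  the 3-cells of the composite \<open>radj \<tau>\<close> after the left adjoint, and uniqueness of
  mates extracts them from there.\<close>

lemma trimod_adjoint_equivalence_eqI: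
  assumes \<sigma>: "trimod_adjoint_equivalence A B F G p q \<sigma>" and \<tau>: "trimod_adjoint_equivalence A B F G p q \<tau>"
    and r: "radj \<sigma> = radj \<tau>" and at: "\<And>X. X \<in> pt A \<Longrightarrow> trimod_at \<sigma> X = trimod_at \<tau> X"
  shows "\<sigma> = \<tau>"
proof -
  note s = \<sigma>[unfolded trimod_adjoint_equivalence_iff] and t = \<tau>[unfolded trimod_adjoint_equivalence_iff]
  interpret ls: pretrimodification A B F G p q "ladj \<sigma>"
    by (rule pretrimodification_of_trimodification) (use s in blast)
  interpret lt: pretrimodification A B F G p q "ladj \<tau>"
    by (rule pretrimodification_of_trimodification) (use t in blast)
  interpret r: pretrimodification A B F G q p "radj \<tau>"
    by (rule pretrimodification_of_trimodification) (use t in blast)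
  interpret cs: pretrimodification_pair A B F G p q p "ladj \<sigma>" "radj \<tau>" by unfold_locales
  interpret ct: pretrimodification_pair A B F G p q p "ladj \<tau>" "radj \<tau>" by unfold_locales
  have at': "tm0 (ladj \<sigma>) X = tm0 (ladj \<tau>) X" "pb0 (aunit \<sigma>) X = pb0 (aunit \<tau>) X"
    "pb0 (acounit \<sigma>) X = pb0 (acounit \<tau>) X" if "X \<in> pt A" for X
    using at[OF that] by (simp_all add: trimod_at_def)
  have tm1: "tm1 (ladj \<sigma>) f = tm1 (ladj \<tau>) f" if f: "f \<in> ob A" for f
  proof -
    let ?X = "s0 A f" and ?Y = "t0 A f"
    have XY: "?X \<in> pt A" "?Y \<in> pt A" using f by simp_all
    \<comment> \<open>Reversed, so that \<open>radj \<tau>\<close> is a left adjoint and its known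
      3-cells can play the part of \<open>s\<close> in the lemmas on mates.\<close>
    have eX: "adjoint_equivalence B (tn0 q ?X) (tn0 p ?X) (F.B.adj_opp (trimod_at \<tau> ?X))"
      and eY: "adjoint_equivalence B (tn0 q ?Y) (tn0 p ?Y) (F.B.adj_opp (trimod_at \<tau> ?Y))"
      using t XY by (auto intro: F.B.adj_opp_equivalence)
    let ?e = "adj_map (lw2 B (map1 G f)) (lw3 B (map1 G f)) (F.B.adj_opp (trimod_at \<tau> ?X))"
    let ?e' = "adj_map (\<lambda>\<phi>. \<phi> \<lhd> map1 F f) (\<lambda>\<Gamma>. \<Gamma> \<unlhd> map1 F f) (F.B.adj_opp (trimod_at \<tau> ?Y))"
    have e: "adjoint_equivalence B (map1 G f \<cdot> tn0 q ?X) (map1 G f \<cdot> tn0 p ?X) ?e"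
      by (rule F.B.adj_map_lw[OF eX]) (use f in simp_all)
    have e': "adjoint_equivalence B (tn0 q ?Y \<cdot> map1 F f) (tn0 p ?Y \<cdot> map1 F f) ?e'"
      by (rule F.B.adj_map_rw[OF eY]) (use f in simp_all)
    have sim: "ladj ?e = map1 G f \<rhd> tm0 (radj \<tau>) ?X" "radj ?e = map1 G f \<rhd> tm0 (ladj \<tau>) ?X"
      "ladj ?e' = tm0 (radj \<tau>) ?Y \<lhd> map1 F f" "radj ?e' = tm0 (ladj \<tau>) ?Y \<lhd> map1 F f"
      by (simp_all add: adj_map_def F.B.adj_opp_def)
    \<comment> \<open>Stated for an arbitrary \<rho> to cover \<sigma> and \<tau> alike. As the
      units agree pointwise, both composites satisfy this same equation, and the invertible unit can
      be cancelled.\<close>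
    have law: "tm1 (tm_comp A B F G (radj \<tau>) (ladj \<rho>)) f \<bullet> ((map1 G f \<unrhd> pb0 (aunit \<tau>) ?X) \<star> \<langle>tnl p f\<rangle>) =
        (\<langle>tnl p f\<rangle> \<star> (pb0 (aunit \<tau>) ?Y \<unlhd> map1 F f)) \<bullet> \<langle>tnl p f\<rangle>"
      if "perturbation A B F G p p (tm_id A B p) (tm_comp A B F G (radj \<tau>) (ladj \<rho>)) (aunit \<rho>)"
        "pb0 (aunit \<rho>) ?X = pb0 (aunit \<tau>) ?X" "pb0 (aunit \<rho>) ?Y = pb0 (aunit \<tau>) ?Y" for \<rho>
      using perturbation.natural[OF that(1), of f ?X ?Y] f that(2,3) by (simp add: tm_id_def)
    have "tm1 cs.\<tau>\<sigma> f \<bullet> ((map1 G f \<unrhd> pb0 (aunit \<tau>) ?X) \<star> \<langle>tnl p f\<rangle>) =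
        tm1 ct.\<tau>\<sigma> f \<bullet> ((map1 G f \<unrhd> pb0 (aunit \<tau>) ?X) \<star> \<langle>tnl p f\<rangle>)"
      using law[of \<sigma>] law[of \<tau>] s t r at' XY by simp
    then have "tm1 cs.\<tau>\<sigma> f = tm1 ct.\<tau>\<sigma> f"
      by (rule F.B.iso_cancel_rightD)
        (use f XY t F.B.adjoint_equivalenceD(7-9)[of "tn0 p ?X" "tn0 q ?X" "trimod_at \<tau> ?X"] at'
          in \<open>simp_all del: cs.tm_comp_simps(2) ct.tm_comp_simps(2)\<close>)
    then have eq: "(tm1 (radj \<tau>) f \<star> \<langle>radj ?e'\<rangle>) \<bullet> (\<langle>ladj ?e\<rangle> \<star> tm1 (ladj \<sigma>) f) =
        (tm1 (radj \<tau>) f \<star> \<langle>radj ?e'\<rangle>) \<bullet> (\<langle>ladj ?e\<rangle> \<star> tm1 (ladj \<tau>) f)"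
      unfolding sim using f at'[OF XY(2)] by (simp add: F.B.vpaste_def)
    show ?thesis
      by (rule F.B.mate_unique[OF e e' _ _ _ _ _ _ _ _ _ _ _ _ _ _ _ eq])
        (unfold sim, use f at'[OF XY(1)] at'[OF XY(2)] in simp_all)
  qed
  have "ladj \<sigma> = ladj \<tau>"
    using at' tm1 ls.src_tgt lt.src_tgt
    by (intro trimod.equality) (auto intro: extensionalityI[OF ls.extensional(1) lt.extensional(1)]
      extensionalityI[OF ls.extensional(2) lt.extensional(2)])
  moreover have "aunit \<sigma> = aunit \<tau>" "acounit \<sigma> = acounit \<tau>"
    if "ladj \<sigma> = ladj \<tau>"
  proof -
    have *: "\<Omega> = \<Omega>'" if "perturbation A B F G p' q' \<alpha> \<beta> \<Omega>" "perturbation A B F G p' q' \<alpha> \<beta> \<Omega>'"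
      "\<And>X. X \<in> pt A \<Longrightarrow> pb0 \<Omega> X = pb0 \<Omega>' X" for p' q' \<alpha> \<beta> \<Omega> \<Omega>'
      using perturbation.src_tgt(1,2)[OF that(1)] perturbation.src_tgt(1,2)[OF that(2)] that(3)
      by (intro pert.equality) (auto intro: extensionalityI[OF perturbation.extensional[OF that(1)]
        perturbation.extensional[OF that(2)]])
    show "aunit \<sigma> = aunit \<tau>" by (rule *) (use s t r that at' in auto)
    show "acounit \<sigma> = acounit \<tau>" by (rule *) (use s t r that at' in auto)
  qed
  ultimately show ?thesis using r by (intro adjeq.equality) auto
qed

text \<open>The trimodification \<open>s\<close> becomes the right adjoint, so the pointwise data
  are the reversals of \<open>E\<close>: the inverse counits of \<open>E\<close> form the unit and
  the inverse units form the counit.\<close>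

lemma trimod_adjoint_equivalence_exists:
  assumes s: "trimodification A B F G q p s"
    and E: "\<And>X. X \<in> pt A \<Longrightarrow> adjoint_equivalence B (tn0 q X) (tn0 p X) (E X)"
    and Es: "\<And>X. X \<in> pt A \<Longrightarrow> ladj (E X) = tm0 s X"
  obtains \<sigma> where "trimod_adjoint_equivalence A B F G p q \<sigma>" "radj \<sigma> = s"
    "\<And>X. X \<in> pt A \<Longrightarrow> trimod_at \<sigma> X = F.B.adj_opp (E X)"
proof -
  interpret s: pretrimodification A B F G q p s by (rule pretrimodification_of_trimodification[OF s])
  have tr: "trinatural A B F G p" "trinatural A B F G q" using trimodification.src_tgt[OF s] by auto
  let ?e = "\<lambda>f. adj_map (lw2 B (map1 G f)) (lw3 B (map1 G f)) (E (s0 A f))"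
  let ?e' = "\<lambda>f. adj_map (\<lambda>\<phi>. \<phi> \<lhd> map1 F f) (\<lambda>\<Gamma>. \<Gamma> \<unlhd> map1 F f) (E (t0 A f))"
  have e: "adjoint_equivalence B (map1 G f \<cdot> tn0 q (s0 A f)) (map1 G f \<cdot> tn0 p (s0 A f)) (?e f)"
    and e': "adjoint_equivalence B (tn0 q (t0 A f) \<cdot> map1 F f) (tn0 p (t0 A f) \<cdot> map1 F f) (?e' f)"
    if f: "f \<in> ob A" for f
    by (rule F.B.adj_map_lw[OF E], use f in simp_all, rule F.B.adj_map_rw[OF E], use f in simp_all)
  have sim: "ladj (?e f) = map1 G f \<rhd> tm0 s (s0 A f)" "radj (?e f) = map1 G f \<rhd> radj (E (s0 A f))"
      "ladj (?e' f) = tm0 s (t0 A f) \<lhd> map1 F f" "radj (?e' f) = radj (E (t0 A f)) \<lhd> map1 F f"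
      "aunit (?e f) = map1 G f \<unrhd> aunit (E (s0 A f))" "acounit (?e f) = map1 G f \<unrhd> acounit (E (s0 A f))"
      "aunit (?e' f) = aunit (E (t0 A f)) \<unlhd> map1 F f" "acounit (?e' f) = acounit (E (t0 A f)) \<unlhd> map1 F f"
    if "f \<in> ob A" for f
    using that Es by (simp_all add: adj_map_def)
  have EX: "radj (E X) \<in> mor B" "dm B (radj (E X)) = tn0 p X" "cd B (radj (E X)) = tn0 q X"
    "invertible B (aunit (E X))" "sr B (aunit (E X)) = idn B (tn0 q X)"
    "tg B (aunit (E X)) = radj (E X) \<odot> tm0 s X"
    "invertible B (acounit (E X))" "sr B (acounit (E X)) = tm0 s X \<odot> radj (E X)"
    "tg B (acounit (E X)) = idn B (tn0 p X)" if "X \<in> pt A" for X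
    using F.B.adjoint_equivalenceD(4-12)[OF E[OF that]] Es[OF that] by simp_all
  \<comment> \<open>The mate of the inverse of \<open>tm1 s f\<close>, taken with respect to
    \<open>E\<close> at the two ends of \<open>f\<close> whiskered by \<open>map1 G f\<close> and
    \<open>map1 F f\<close>.\<close>
  have "\<exists>t. invertible B t \<and> sr B t = radj (?e f) \<odot> tnl p f \<and> tg B t = tnl q f \<odot> radj (?e' f) \<and>
      (tm1 s f \<star> \<langle>radj (?e' f)\<rangle>) \<bullet> (\<langle>ladj (?e f)\<rangle> \<star> t) =
      (\<langle>tnl p f\<rangle> \<star> cinv B (acounit (?e' f))) \<bullet> (acounit (?e f) \<star> \<langle>tnl p f\<rangle>)" if f: "f \<in> ob A" for f
  proof -
    have m: "tnl p f \<in> mor B" "dm B (tnl p f) = tn0 p (t0 A f) \<cdot> map1 F f"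
      "cd B (tnl p f) = map1 G f \<cdot> tn0 p (s0 A f)"
      "tnl q f \<in> mor B" "dm B (tnl q f) = tn0 q (t0 A f) \<cdot> map1 F f"
      "cd B (tnl q f) = map1 G f \<cdot> tn0 q (s0 A f)"
      "invertible B (tm1 s f)" "sr B (tm1 s f) = ladj (?e f) \<odot> tnl q f"
      "tg B (tm1 s f) = tnl p f \<odot> ladj (?e' f)"
      using f by (simp_all add: Es)
    show ?thesis by (rule F.B.mate_exists[OF e[OF f] e'[OF f] m]) blast
  qed
  then obtain T where T: "\<And>f. f \<in> ob A \<Longrightarrow> invertible B (T f) \<and> sr B (T f) = radj (?e f) \<odot> tnl p f \<and>
      tg B (T f) = tnl q f \<odot> radj (?e' f) \<and>
      (tm1 s f \<star> \<langle>radj (?e' f)\<rangle>) \<bullet> (\<langle>ladj (?e f)\<rangle> \<star> T f) =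
      (\<langle>tnl p f\<rangle> \<star> cinv B (acounit (?e' f))) \<bullet> (acounit (?e f) \<star> \<langle>tnl p f\<rangle>)" by metis
  \<comment> \<open>So far only typed data: the 3-cells come from mates chosen separately for each
    1-cell, with no law relating different choices.\<close>
  define t where "t = \<lparr>tm_src = p, tm_tgt = q, tm0 = \<lambda>X\<in>pt A. radj (E X), tm1 = \<lambda>f\<in>ob A. T f\<rparr>"
  have t_cells: "X \<in> pt A \<Longrightarrow> tm0 t X = radj (E X)" "f \<in> ob A \<Longrightarrow> tm1 t f = T f" for X f
    by (simp_all add: t_def)
  interpret t: pretrimodification A B F G p q t
    by unfold_locales (use T in \<open>simp_all add: t_def EX sim\<close>)
  interpret st: pretrimodification_pair A B F G p q p t s by unfold_locales
  interpret i: pretrimodification A B F G p p "tm_id A B p"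
    by (rule pretrimodification_of_trimodification[OF trimodification_id[OF tr(1)]])
  \<comment> \<open>The defining counit equation of the mate, with the counit at the source moved to
    the other side as its inverse. It says that the inverse counits obey the perturbation law from
    the identity to \<open>s\<close> after \<open>t\<close>.\<close>
  have unit_law: "tm1 st.\<tau>\<sigma> f \<bullet> ((map1 G f \<unrhd> cinv B (acounit (E (s0 A f)))) \<star> \<langle>tnl p f\<rangle>) =
      \<langle>tnl p f\<rangle> \<star> (cinv B (acounit (E (t0 A f))) \<unlhd> map1 F f)" if f: "f \<in> ob A" for f
  proof -
    let ?x = "(map1 G f \<unrhd> acounit (E (s0 A f))) \<star> \<langle>tnl p f\<rangle>"
    let ?y = "\<langle>tnl p f\<rangle> \<star> (cinv B (acounit (E (t0 A f))) \<unlhd> map1 F f)"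
    have "tm1 st.\<tau>\<sigma> f = ?y \<bullet> ?x"
      using T[OF f] f EX by (simp add: F.B.vpaste_def t_cells sim Es)
    moreover have "(?y \<bullet> ?x) \<bullet> cinv B ?x = ?y \<bullet> (?x \<bullet> cinv B ?x)"
      by (rule F.B.vcmp_assoc_simp) (use f EX in simp_all)
    moreover have "?x \<bullet> cinv B ?x = \<langle>tg B ?x\<rangle>"
      by (rule F.B.cinv_simps) (use f EX in simp_all)
    moreover have "cinv B ?x = (map1 G f \<unrhd> cinv B (acounit (E (s0 A f)))) \<star> \<langle>tnl p f\<rangle>"
      using f EX by simp
    ultimately show ?thesis using f EX by simp
  qed
  \<comment> \<open>The inverse counits connect the identity to the composite without the latter
    being known as a trimodification; transport then supplies its laws.\<close>
  interpret \<eta>: preperturbation A B F G p p "tm_id A B p" "tm_comp A B F G s t" "\<lambda>X. cinv B (acounit (E X))"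
    by unfold_locales
      (simp_all add: tm_id_def t_cells EX unit_law del: st.tm_comp_simps(2))
  have st: "trimodification A B F G p p (tm_comp A B F G s t)"
    by (rule \<eta>.trimodification_transport[OF trimodification_id[OF tr(1)]])
  \<comment> \<open>Cancelling \<open>s\<close>, whose components are left adjoints in
    \<open>E\<close>, leaves the laws of \<open>t\<close>.\<close>
  have t: "trimodification A B F G p q t"
    by (rule trimodification_comp_cancel[OF _ s E Es st]) unfold_locales
  interpret ts: pretrimodification_pair A B F G q p q s t by unfold_locales
  have counit_law: "((map1 G f \<unrhd> cinv B (aunit (E (s0 A f)))) \<star> \<langle>tnl q f\<rangle>) =
      (\<langle>tnl q f\<rangle> \<star> (cinv B (aunit (E (t0 A f))) \<unlhd> map1 F f)) \<bullet> tm1 ts.\<tau>\<sigma> f" if f: "f \<in> ob A" for f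
  proof -
    let ?x = "(map1 G f \<unrhd> aunit (E (s0 A f))) \<star> \<langle>tnl q f\<rangle>"
    let ?y = "\<langle>tnl q f\<rangle> \<star> (aunit (E (t0 A f)) \<unlhd> map1 F f)"
    \<comment> \<open>Compatibility of the mate with units; conjugated, it becomes the perturbation
      law for the counit.\<close>
    have "((T f \<star> \<langle>ladj (?e' f)\<rangle>) \<bullet> (\<langle>radj (?e f)\<rangle> \<star> tm1 s f)) \<bullet> (aunit (?e f) \<star> \<langle>tnl q f\<rangle>) =
        \<langle>tnl q f\<rangle> \<star> aunit (?e' f)"
      by (rule F.B.mate_unit[OF e[OF f] e'[OF f], of "tnl p f" "tnl q f" "tm1 s f" "T f"])
        (use f T[OF f] in \<open>simp_all add: Es\<close>)
    then have "tm1 ts.\<tau>\<sigma> f \<bullet> ?x = ?y \<bullet> \<langle>tnl q f\<rangle>"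
      using f EX by (simp add: F.B.vpaste_def t_cells sim Es)
    then have "\<langle>tnl q f\<rangle> \<bullet> cinv B ?x = cinv B ?y \<bullet> tm1 ts.\<tau>\<sigma> f"
      by (rule iffD1[OF F.B.conjugate_iff, rotated -1])
        (simp_all add: f EX t_cells del: ts.tm_comp_simps(2))
    then show ?thesis using f EX by (simp del: ts.tm_comp_simps(2))
  qed
  define \<sigma> where "\<sigma> = \<lparr>ladj = t, radj = s,
    aunit = \<lparr>pb_src = tm_id A B p, pb_tgt = tm_comp A B F G s t, pb0 = \<lambda>X\<in>pt A. cinv B (acounit (E X))\<rparr>,
    acounit = \<lparr>pb_src = tm_comp A B F G t s, pb_tgt = tm_id A B q, pb0 = \<lambda>X\<in>pt A. cinv B (aunit (E X))\<rparr>\<rparr>"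
  have at: "trimod_at \<sigma> X = F.B.adj_opp (E X)" if "X \<in> pt A" for X
    using that Es by (simp add: trimod_at_def \<sigma>_def F.B.adj_opp_def t_def)
  have "perturbation A B F G p p (tm_id A B p) (tm_comp A B F G s t) (aunit \<sigma>)"
  proof (rule perturbation.intro)
    show "trimodification A B F G p p (tm_id A B p)" by (rule trimodification_id[OF tr(1)])
    show "trimodification A B F G p p (tm_comp A B F G s t)" by (rule st)
  next
    fix f X Y assume "f \<in> cells1 A X Y"
    then show "tm1 st.\<tau>\<sigma> f \<bullet> ((map1 G f \<unrhd> pb0 (aunit \<sigma>) X) \<star> \<langle>tnl p f\<rangle>) =
        (\<langle>tnl p f\<rangle> \<star> (pb0 (aunit \<sigma>) Y \<unlhd> map1 F f)) \<bullet> tm1 (tm_id A B p) f"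
      using \<eta>.law[of f] by (auto simp: \<sigma>_def)
  qed (use EX in \<open>simp_all add: \<sigma>_def cels_def tm_id_def tm_comp_def t_def\<close>)
  moreover have "perturbation A B F G q q (tm_comp A B F G t s) (tm_id A B q) (acounit \<sigma>)"
  proof (rule perturbation.intro)
    show "trimodification A B F G q q (tm_id A B q)" by (rule trimodification_id[OF tr(2)])
    show "trimodification A B F G q q (tm_comp A B F G t s)" by (rule trimodification_comp[OF s t])
  next
    fix f X Y assume "f \<in> cells1 A X Y"
    then have f: "f \<in> ob A" "X = s0 A f" "Y = t0 A f" by auto
    have "tm1 (tm_id A B q) f \<bullet> ((map1 G f \<unrhd> pb0 (acounit \<sigma>) X) \<star> \<langle>tnl q f\<rangle>) =
        (map1 G f \<unrhd> cinv B (aunit (E (s0 A f)))) \<star> \<langle>tnl q f\<rangle>"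
      using f EX by (simp add: \<sigma>_def tm_id_def)
    also have "\<dots> = (\<langle>tnl q f\<rangle> \<star> (cinv B (aunit (E (t0 A f))) \<unlhd> map1 F f)) \<bullet> tm1 ts.\<tau>\<sigma> f"
      by (rule counit_law[OF f(1)])
    finally show "tm1 (tm_id A B q) f \<bullet> ((map1 G f \<unrhd> pb0 (acounit \<sigma>) X) \<star> \<langle>tnl q f\<rangle>) =
        (\<langle>tnl q f\<rangle> \<star> (pb0 (acounit \<sigma>) Y \<unlhd> map1 F f)) \<bullet> tm1 ts.\<tau>\<sigma> f"
      using f by (simp add: \<sigma>_def del: ts.tm_comp_simps(2))
  qed (use EX in \<open>simp_all add: \<sigma>_def cels_def tm_id_def tm_comp_def t_def\<close>)
  ultimately have "trimod_adjoint_equivalence A B F G p q \<sigma>"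
    unfolding trimod_adjoint_equivalence_iff
    using s t at F.B.adj_opp_equivalence[OF E] by (simp add: \<sigma>_def)
  then show thesis using that at by (simp add: \<sigma>_def)
qed

end

section \<open>3-pseudonatural transformations into the path object\<close>

text \<open>The transformation \<open>\<theta>\<close> goes from the 3-pseudofunctor of \<open>p\<close> to that of \<open>q\<close>, in the direction
  opposite to the trimodification \<open>s : q \<Rightarrow> p\<close> made of its 3-cells.\<close>

locale path_transformation = s: pretrimodification A B F G q p s
  for A :: "('a, 'b, 'c, 'o) gray" and B :: "('d, 'e, 'g, 'p) gray" (structure) and F G p q s +
  fixes E :: "'o \<Rightarrow> ('e, 'g) adjeq"
  assumes E_equivalence: "X \<in> pt A \<Longrightarrow> adjoint_equivalence B (tn0 q X) (tn0 p X) (E X)"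
    and ladj_E [simp]: "X \<in> pt A \<Longrightarrow> ladj (E X) = tm0 s X"
begin

definition \<theta>0 where "\<theta>0 X = \<lparr>p1_src = tn0 p X, p1_tgt = tn0 q X, p1_eq = E X,
    p1_0 = one B (map0 F X), p1_1 = one B (map0 G X)\<rparr>"

definition \<theta>1 where "\<theta>1 f = \<lparr>p2_src = path_comp1 B (\<theta>0 (t0 A f)) (path1_of A F G p f),
    p2_tgt = path_comp1 B (path1_of A F G q f) (\<theta>0 (s0 A f)),
    p2_cell = tm1 s f, p2_0 = idn B (map1 F f), p2_1 = idn B (map1 G f)\<rparr>"

definition \<theta> where "\<theta> = \<lparr>ps0 = \<lambda>X\<in>pt A. \<theta>0 X, ps1 = \<lambda>f\<in>ob A. \<theta>1 f\<rparr>"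

lemma \<theta>0_simps [simp]:
  "p1_src (\<theta>0 X) = tn0 p X" "p1_tgt (\<theta>0 X) = tn0 q X" "p1_eq (\<theta>0 X) = E X"
  "p1_0 (\<theta>0 X) = one B (map0 F X)" "p1_1 (\<theta>0 X) = one B (map0 G X)"
  by (simp_all add: \<theta>0_def)

lemma \<theta>1_simps [simp]:
  "p2_src (\<theta>1 f) = path_comp1 B (\<theta>0 (t0 A f)) (path1_of A F G p f)"
  "p2_tgt (\<theta>1 f) = path_comp1 B (path1_of A F G q f) (\<theta>0 (s0 A f))"
  "p2_cell (\<theta>1 f) = tm1 s f" "p2_0 (\<theta>1 f) = idn B (map1 F f)" "p2_1 (\<theta>1 f) = idn B (map1 G f)"
  by (simp_all add: \<theta>1_def)

lemma \<theta>_simps [simp]: "X \<in> pt A \<Longrightarrow> ps0 \<theta> X = \<theta>0 X" "f \<in> ob A \<Longrightarrow> ps1 \<theta> f = \<theta>1 f"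
  by (simp_all add: \<theta>_def)

lemma \<theta>0_in [simp]: "X \<in> pt A \<Longrightarrow> \<theta>0 X \<in> path_cells1 B"
  using E_equivalence by (simp add: s.p.F.B.path_cells1_iff)

lemma \<theta>1_in [simp]: "f \<in> ob A \<Longrightarrow> \<theta>1 f \<in> path_cells2 B"
  by (simp add: s.p.F.B.path_cells2_iff)

text \<open>Whiskering with \<open>\<theta>0\<close> produces precisely the two interchangers of the
  trimodification law: left whiskering gives the inverted one at the 2-cell of \<open>s\<close>,
  right whiskering the one at \<open>map2 G \<phi>\<close>.\<close>

lemma natural2_iff:
  assumes "\<phi> \<in> mor A"
  shows "path_cmp B (\<theta>1 (cd A \<phi>)) (path_lw2 B (\<theta>0 (t0 A (dm A \<phi>))) (path2_of A F G p \<phi>)) =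
      path_cmp B (path_rw2 B (path2_of A F G q \<phi>) (\<theta>0 (s0 A (dm A \<phi>)))) (\<theta>1 (dm A \<phi>)) \<longleftrightarrow> s.nat_law \<phi>"
  using assms
  by (simp add: path_cmp_def s.p.F.B.p2_cell_path_lw2 s.p.F.B.p2_cell_path_rw2
      s.p.F.B.cyl_def s.p.F.B.hpaste_def)

text \<open>As \<open>s\<close> runs from \<open>q\<close> to \<open>p\<close>, the prefix
  \<open>s.q\<close> refers to \<open>p\<close> and \<open>s.p\<close> to \<open>q\<close>; so
  \<open>s.q.H\<close> is the source of \<open>\<theta>\<close> and \<open>s.p.H\<close> its target.
  The unitors occur inverted and are conjugated back.\<close>

lemma unit_iff:
  assumes X: "X \<in> pt A"
  shows "path_cmp B (\<theta>1 (one A X)) (path_lw2 B (\<theta>0 X) (iota s.q.H X)) =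
      path_rw2 B (iota s.p.H X) (\<theta>0 X) \<longleftrightarrow> s.unit_law X" (is "?l \<longleftrightarrow> _")
proof -
  let ?x = "\<langle>tm0 s X\<rangle> \<star> tnu q X" and ?y = "tnu p X \<star> \<langle>tm0 s X\<rangle>"
  have "?l \<longleftrightarrow> \<langle>tm0 s X\<rangle> \<bullet> cinv B ?x = cinv B ?y \<bullet> tm1 s (one A X)"
    using X by (auto simp: path_cmp_def path_rw2_def s.p.F.B.p2_cell_path_lw2)
  also have "\<dots> \<longleftrightarrow> tm1 s (one A X) \<bullet> ?x = ?y \<bullet> \<langle>tm0 s X\<rangle>"
    by (rule s.p.F.B.conjugate_iff[symmetric]) (use X in simp_all)
  finally show ?thesis by (auto simp: s.p.F.B.cyl_def)
qed

text \<open>The compositors are over identities, so their whiskerings contribute no interchanger;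
  the two 3-cells of \<open>s\<close> remain as a horizontal pasting, and conjugation restores the
  compositors.\<close>

lemma composition_iff:
  assumes fg: "f \<in> ob A" "g \<in> ob A" "s0 A g = t0 A f"
  shows "path_cmp B (\<theta>1 (g \<cdot>\<^bsub>A\<^esub> f)) (path_lw2 B (\<theta>0 (t0 A g)) (chi s.q.H (g, f))) =
      path_cmp B (path_cmp B (path_rw2 B (chi s.p.H (g, f)) (\<theta>0 (s0 A f)))
        (path_lw2 B (path1_of A F G q g) (\<theta>1 f))) (path_rw2 B (\<theta>1 g) (path1_of A F G p f)) \<longleftrightarrow>
    s.comp_law g f" (is "?l \<longleftrightarrow> _")
proof -
  let ?x = "\<langle>map1 G g \<rhd> (map1 G f \<rhd> tm0 s (s0 A f))\<rangle> \<star> tnc q (g, f)"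
  let ?y = "tnc p (g, f) \<star> \<langle>tm0 s (t0 A g) \<lhd> (map1 F g \<cdot> map1 F f)\<rangle>"
  have "?l \<longleftrightarrow> s.comp_src g f \<bullet> cinv B ?x = cinv B ?y \<bullet> tm1 s (g \<cdot>\<^bsub>A\<^esub> f)"
    using fg by (auto simp: path_cmp_def s.p.F.B.p2_cell_path_lw2 s.p.F.B.p2_cell_path_rw2 s.p.F.B.hpaste_def)
  also have "\<dots> \<longleftrightarrow> tm1 s (g \<cdot>\<^bsub>A\<^esub> f) \<bullet> ?x = ?y \<bullet> s.comp_src g f"
    using s.p.F.B.squareD[OF s.comp_src_square[OF fg fg]] fg
    by (intro s.p.F.B.conjugate_iff[symmetric]) simp_all
  finally show ?thesis by (auto simp: s.p.F.B.cyl_def)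
qed

lemma post_whisker_path_ends:
  "post_whisker A (path_s0 B) \<theta> = psnat_id A B F" "post_whisker A (path_t0 B) \<theta> = psnat_id A B G"
  by (auto simp: post_whisker_def psnat_id_def path_s0_def path_t0_def \<theta>_def compose_def fun_eq_iff)

text \<open>Invertibility and naturality in 3-cells come for free: the former because the 2-cells
  lie over identities, the latter because both sides have the same components and their boundaries
  agree by 2-naturality. The other axioms match the three laws one by one.\<close>

lemma pseudonatural3_iff:
  assumes "trinatural A B F G p" "trinatural A B F G q"
  shows "pseudonatural3 A (path B) s.q.H s.p.H \<theta> \<longleftrightarrow> trimodification A B F G q p s"
  unfolding s.trimodification_iff[OF assms(2,1)]
proof (intro iffI conjI ballI impI)
  assume "pseudonatural3 A (path B) s.q.H s.p.H \<theta>"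
  then interpret n: pseudonatural3 A "path B" s.q.H s.p.H \<theta> .
  show "s.nat_law \<phi>" if "\<phi> \<in> mor A" for \<phi>
    unfolding natural2_iff[OF that, symmetric]
    using n.natural2[of \<phi> "s0 A (dm A \<phi>)" "t0 A (dm A \<phi>)" "dm A \<phi>" "cd A \<phi>"] that
    by (simp add: mors_hom_iff)
  show "s.unit_law X" if "X \<in> pt A" for X
    unfolding unit_iff[OF that, symmetric] using n.unit[OF that] that by simp
  show "s.comp_law g f" if "f \<in> ob A" "g \<in> ob A" "s0 A g = t0 A f" for f g
    unfolding composition_iff[OF that, symmetric]
    using n.composition[of f "s0 A f" "t0 A f" g "t0 A g"] that by simp
next
  assume laws: "(\<forall>\<phi>\<in>mor A. s.nat_law \<phi>) \<and> (\<forall>X\<in>pt A. s.unit_law X) \<and>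
    (\<forall>f\<in>ob A. \<forall>g\<in>ob A. s0 A g = t0 A f \<longrightarrow> s.comp_law g f)"
  have nat: "path_cmp B (\<theta>1 (cd A \<phi>)) (path_lw2 B (\<theta>0 (t0 A (dm A \<phi>))) (path2_of A F G p \<phi>)) =
      path_cmp B (path_rw2 B (path2_of A F G q \<phi>) (\<theta>0 (s0 A (dm A \<phi>)))) (\<theta>1 (dm A \<phi>))"
    if "\<phi> \<in> mor A" for \<phi>
    unfolding natural2_iff[OF that] using laws that by blast
  show "pseudonatural3 A (path B) s.q.H s.p.H \<theta>"
  proof (rule pseudonatural3.intro)
    show "ps0 \<theta> \<in> extensional (pt A)" "ps1 \<theta> \<in> extensional (ob A)" by (simp_all add: \<theta>_def)
  next
    fix X assume X: "X \<in> pt A"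
    then show "ps0 \<theta> X \<in> cells1 (path B) (map0 s.q.H X) (map0 s.p.H X)" by simp
    have "path_cmp B (\<theta>1 (one A X)) (path_lw2 B (\<theta>0 X) (iota s.q.H X)) = path_rw2 B (iota s.p.H X) (\<theta>0 X)"
      unfolding unit_iff[OF X] using laws X by blast
    then show "ps1 \<theta> (one A X) \<odot>\<^bsub>path B\<^esub> (ps0 \<theta> X \<rhd>\<^bsub>path B\<^esub> iota s.q.H X) =
        iota s.p.H X \<lhd>\<^bsub>path B\<^esub> ps0 \<theta> X"
      using X by simp
  next
    fix f X Y assume "f \<in> cells1 A X Y"
    then show "ps1 \<theta> f \<in> imors (path B) (ps0 \<theta> Y \<cdot>\<^bsub>path B\<^esub> map1 s.q.H f) (map1 s.p.H f \<cdot>\<^bsub>path B\<^esub> ps0 \<theta> X)"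
      using s.p.F.B.path_inverse[of "\<theta>1 f" "map1 F f" "map1 G f"] by auto
  next
    fix \<phi> X Y f f' assume "\<phi> \<in> mors (hom A X Y) f f'"
    then show "ps1 \<theta> f' \<odot>\<^bsub>path B\<^esub> (ps0 \<theta> Y \<rhd>\<^bsub>path B\<^esub> map2 s.q.H \<phi>) =
        (map2 s.p.H \<phi> \<lhd>\<^bsub>path B\<^esub> ps0 \<theta> X) \<odot>\<^bsub>path B\<^esub> ps1 \<theta> f"
      using nat[of \<phi>] by (auto simp: mors_hom_iff)
  next
    fix \<phi> X Y f f' \<Gamma> \<phi>' assume "\<phi> \<in> mors (hom A X Y) f f'" "\<Gamma> \<in> cels (hom A X Y) \<phi> \<phi>'"
    then show "idc (path B) (ps1 \<theta> f') \<star>\<^bsub>path B\<^esub> (ps0 \<theta> Y \<unrhd>\<^bsub>path B\<^esub> map3 s.q.H \<Gamma>) =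
        (map3 s.p.H \<Gamma> \<unlhd>\<^bsub>path B\<^esub> ps0 \<theta> X) \<star>\<^bsub>path B\<^esub> idc (path B) (ps1 \<theta> f)"
      using nat[of \<phi>] nat[of \<phi>'] by (auto simp: mors_hom_iff cels_hom_iff s.p.path_ops)
  next
    fix f X Y g Z assume "f \<in> cells1 A X Y" "g \<in> cells1 A Y Z"
    then have fg: "f \<in> ob A" "g \<in> ob A" "s0 A g = t0 A f" "X = s0 A f" "Z = t0 A g" by auto
    have "path_cmp B (\<theta>1 (g \<cdot>\<^bsub>A\<^esub> f)) (path_lw2 B (\<theta>0 (t0 A g)) (chi s.q.H (g, f))) =
      path_cmp B (path_cmp B (path_rw2 B (chi s.p.H (g, f)) (\<theta>0 (s0 A f)))
        (path_lw2 B (path1_of A F G q g) (\<theta>1 f))) (path_rw2 B (\<theta>1 g) (path1_of A F G p f))"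
      unfolding composition_iff[OF fg(1-3)] using laws fg by blast
    then show "ps1 \<theta> (g \<cdot>\<^bsub>A\<^esub> f) \<odot>\<^bsub>path B\<^esub> (ps0 \<theta> Z \<rhd>\<^bsub>path B\<^esub> chi s.q.H (g, f)) =
        (chi s.p.H (g, f) \<lhd>\<^bsub>path B\<^esub> ps0 \<theta> X) \<odot>\<^bsub>path B\<^esub> (map1 s.p.H g \<rhd>\<^bsub>path B\<^esub> ps1 \<theta> f) \<odot>\<^bsub>path B\<^esub>
          (ps1 \<theta> g \<lhd>\<^bsub>path B\<^esub> map1 s.q.H f)"
      using fg by simp
  qed
qed

end

section \<open>The bijection for trimodificational adjoint equivalences\<close>

context gray_functors
begin

text \<open>Identifies \<open>adj_to_path\<close> with the transformation built from the right
  adjoint and the reversed pointwise data, which makes the law-by-law comparison available for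
  it.\<close>

lemma path_transformation_of_adjoint_equivalence:
  assumes "trimod_adjoint_equivalence A B F G p q \<sigma>"
  shows "path_transformation A B F G p q (radj \<sigma>) (\<lambda>X. F.B.adj_opp (trimod_at \<sigma> X))"
    and "path_transformation.\<theta> A B F G p q (radj \<sigma>) (\<lambda>X. F.B.adj_opp (trimod_at \<sigma> X)) =
      adj_to_path A B F G p q \<sigma>"
proof -
  note s = assms[unfolded trimod_adjoint_equivalence_iff]
  interpret s: pretrimodification A B F G q p "radj \<sigma>"
    by (rule pretrimodification_of_trimodification) (use s in blast)
  show "path_transformation A B F G p q (radj \<sigma>) (\<lambda>X. F.B.adj_opp (trimod_at \<sigma> X))"
  proof
    fix X assume "X \<in> pt A"
    then show "adjoint_equivalence B (tn0 q X) (tn0 p X) (F.B.adj_opp (trimod_at \<sigma> X))"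
      using s by (intro F.B.adj_opp_equivalence) blast
    show "ladj (F.B.adj_opp (trimod_at \<sigma> X)) = tm0 (radj \<sigma>) X" by (simp add: F.B.adj_opp_def)
  qed
  then interpret path_transformation A B F G p q "radj \<sigma>" "\<lambda>X. F.B.adj_opp (trimod_at \<sigma> X)" .
  have "\<theta>0 X = adj_to_path0 B F G p q \<sigma> X" for X
    unfolding \<theta>0_def adj_to_path0_def by (simp add: F.B.adj_opp_def)
  then show "\<theta> = adj_to_path A B F G p q \<sigma>"
    by (simp add: \<theta>_def adj_to_path_def \<theta>1_def)
qed

text \<open>The end conditions reduce the components of \<theta> to adjoint equivalences and
  3-cells, and the left adjoints of the former give the 2-cells of \<open>s\<close>. The laws of
  \<open>s\<close> are left to \<open>pseudonatural3_iff\<close>.\<close>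

lemma path_pseudonaturals_surj:
  assumes p: "trinatural A B F G p" and q: "trinatural A B F G q"
    and \<theta>: "\<theta> \<in> path_pseudonaturals A B F G (trinat_to_path A B F G p) (trinat_to_path A B F G q)"
  obtains s E where "path_transformation A B F G p q s E" "path_transformation.\<theta> A B F G p q s E = \<theta>"
proof -
  interpret p: pretrinatural A B F G p by (rule pretrinatural_of_trinatural[OF p])
  interpret q: pretrinatural A B F G q by (rule pretrinatural_of_trinatural[OF q])
  interpret n: pseudonatural3 A "path B" p.H q.H \<theta> using \<theta> by (simp add: path_pseudonaturals_def)
  have w: "post_whisker A (path_s0 B) \<theta> = psnat_id A B F" "post_whisker A (path_t0 B) \<theta> = psnat_id A B G"
    using \<theta> by (auto simp: path_pseudonaturals_def)
  have c0: "ps0 \<theta> X \<in> path_cells1 B" "p1_src (ps0 \<theta> X) = tn0 p X" "p1_tgt (ps0 \<theta> X) = tn0 q X"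
    if "X \<in> pt A" for X
    using n.ps0_in[OF that] that by auto
  have c0': "p1_0 (ps0 \<theta> X) = one B (map0 F X)" "p1_1 (ps0 \<theta> X) = one B (map0 G X)" if "X \<in> pt A" for X
    using w[THEN arg_cong[of _ _ ps0], THEN fun_cong, of X] that c0[OF that]
    by (simp_all add: post_whisker_def psnat_id_def compose_eq path_s0_def path_t0_def)
  have c1: "ps1 \<theta> f \<in> path_cells2 B" "p2_src (ps1 \<theta> f) = path_comp1 B (ps0 \<theta> (t0 A f)) (p.P1 f)"
    "p2_tgt (ps1 \<theta> f) = path_comp1 B (q.P1 f) (ps0 \<theta> (s0 A f))" if "f \<in> ob A" for f
    using n.ps1_in[of f "s0 A f" "t0 A f"] that by (auto simp: imors_def mors_def)
  have c1': "p2_0 (ps1 \<theta> f) = idn B (map1 F f)" "p2_1 (ps1 \<theta> f) = idn B (map1 G f)" if "f \<in> ob A" for f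
    using w[THEN arg_cong[of _ _ ps1], THEN fun_cong, of f] that c1[OF that]
    by (simp_all add: post_whisker_def psnat_id_def compose_eq path_s0_def path_t0_def)
  define E where "E X = p1_eq (ps0 \<theta> X)" for X
  define s where "s = \<lparr>tm_src = q, tm_tgt = p, tm0 = \<lambda>X\<in>pt A. ladj (E X), tm1 = \<lambda>f\<in>ob A. p2_cell (ps1 \<theta> f)\<rparr>"
  have E: "adjoint_equivalence B (tn0 q X) (tn0 p X) (E X)" if "X \<in> pt A" for X
    using F.B.path_cells1_equivalence[OF c0(1)[OF that]] that by (simp add: E_def c0 c0')
  note El = F.B.adjoint_equivalenceD(1-3)[OF E]
  have "path_transformation A B F G p q s E"
  proof
    show "tm_src s = q" "tm_tgt s = p" "tm0 s \<in> extensional (pt A)" "tm1 s \<in> extensional (ob A)"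
      by (simp_all add: s_def)
  next
    fix X assume X: "X \<in> pt A"
    then show "tm0 s X \<in> mor B" "dm B (tm0 s X) = tn0 q X" "cd B (tm0 s X) = tn0 p X"
      "ladj (E X) = tm0 s X" "adjoint_equivalence B (tn0 q X) (tn0 p X) (E X)"
      using El E by (simp_all add: s_def)
  next
    fix f assume f: "f \<in> ob A"
    then show "invertible B (tm1 s f)" "sr B (tm1 s f) = (map1 G f \<rhd> tm0 s (s0 A f)) \<odot> tnl q f"
      "tg B (tm1 s f) = tnl p f \<odot> (tm0 s (t0 A f) \<lhd> map1 F f)"
      using F.B.path_cells2_simps(11-13)[OF c1(1)[OF f]]
      by (simp_all add: s_def c0 c0' c1 c1' El E_def[symmetric])
  qed
  then interpret t: path_transformation A B F G p q s E .
  have tm1: "tm1 s f = p2_cell (ps1 \<theta> f)" if "f \<in> ob A" for f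
    using that by (simp add: s_def)
  have \<theta>0: "t.\<theta>0 X = ps0 \<theta> X" if "X \<in> pt A" for X
    using that by (intro path1.equality) (simp_all add: c0 c0' E_def)
  have \<theta>1: "t.\<theta>1 f = ps1 \<theta> f" if "f \<in> ob A" for f
    using that by (intro path2.equality) (simp_all add: c1 c1' \<theta>0 tm1)
  have "t.\<theta> = \<theta>"
    using \<theta>0 \<theta>1 by (intro psnat.equality) (auto simp: t.\<theta>_def intro!: extensionalityI[OF _ n.extensional(1)]
      extensionalityI[OF _ n.extensional(2)])
  with \<open>path_transformation A B F G p q s E\<close> show thesis using that by blast
qed

text \<open>A transformation over identities records the right adjoint and the pointwise data.
  Injectivity says that these determine the adjoint equivalence, surjectivity that they can be
  completed to one.\<close>

lemma adj_to_path_bij: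
  assumes p: "trinatural A B F G p" and q: "trinatural A B F G q"
  shows "bij_betw (adj_to_path A B F G p q) {\<sigma>. trimod_adjoint_equivalence A B F G p q \<sigma>}
    (path_pseudonaturals A B F G (trinat_to_path A B F G p) (trinat_to_path A B F G q))"
    (is "bij_betw _ ?S ?T")
proof (rule bij_betw_imageI)
  show "inj_on (adj_to_path A B F G p q) ?S"
  proof (rule inj_onI)
    fix \<sigma> \<tau> assume "\<sigma> \<in> ?S" "\<tau> \<in> ?S" and eq: "adj_to_path A B F G p q \<sigma> = adj_to_path A B F G p q \<tau>"
    then have \<sigma>: "trimod_adjoint_equivalence A B F G p q \<sigma>" and \<tau>: "trimod_adjoint_equivalence A B F G p q \<tau>"
      by auto
    interpret s: path_transformation A B F G p q "radj \<sigma>" "\<lambda>X. F.B.adj_opp (trimod_at \<sigma> X)"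
      by (rule path_transformation_of_adjoint_equivalence[OF \<sigma>])
    interpret t: path_transformation A B F G p q "radj \<tau>" "\<lambda>X. F.B.adj_opp (trimod_at \<tau> X)"
      by (rule path_transformation_of_adjoint_equivalence[OF \<tau>])
    have \<theta>: "s.\<theta> = t.\<theta>"
      using eq path_transformation_of_adjoint_equivalence(2)[OF \<sigma>]
        path_transformation_of_adjoint_equivalence(2)[OF \<tau>] by simp
    \<comment> \<open>The fields of the 1-cells give equality of the reversed data only; reversing a
      second time is the identity on adjoint equivalences.\<close>
    have opp: "F.B.adj_opp (trimod_at \<sigma> X) = F.B.adj_opp (trimod_at \<tau> X)" if "X \<in> pt A" for X
      using s.\<theta>_simps(1)[OF that] t.\<theta>_simps(1)[OF that] \<theta> by (metis s.\<theta>0_simps(3) t.\<theta>0_simps(3))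
    then have at: "trimod_at \<sigma> X = trimod_at \<tau> X" if "X \<in> pt A" for X
      using \<sigma> \<tau> that unfolding trimod_adjoint_equivalence_iff by (metis F.B.adj_opp_opp)
    have tm1: "tm1 (radj \<sigma>) f = tm1 (radj \<tau>) f" if "f \<in> ob A" for f
      using s.\<theta>_simps(2)[OF that] t.\<theta>_simps(2)[OF that] \<theta> by (metis s.\<theta>1_simps(3) t.\<theta>1_simps(3))
    have tm0: "tm0 (radj \<sigma>) X = tm0 (radj \<tau>) X" if "X \<in> pt A" for X
      using at[OF that] by (simp add: trimod_at_def)
    have "radj \<sigma> = radj \<tau>"
      using tm0 tm1 s.s.src_tgt t.s.src_tgt
      by (intro trimod.equality) (auto intro: extensionalityI[OF s.s.extensional(1) t.s.extensional(1)]
        extensionalityI[OF s.s.extensional(2) t.s.extensional(2)])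
    then show "\<sigma> = \<tau>" by (rule trimod_adjoint_equivalence_eqI[OF \<sigma> \<tau> _ at])
  qed
  show "adj_to_path A B F G p q ` ?S = ?T"
  proof
    show "adj_to_path A B F G p q ` ?S \<subseteq> ?T"
    proof (rule image_subsetI)
      fix \<sigma> assume "\<sigma> \<in> ?S"
      then have \<sigma>: "trimod_adjoint_equivalence A B F G p q \<sigma>" by simp
      interpret s: path_transformation A B F G p q "radj \<sigma>" "\<lambda>X. F.B.adj_opp (trimod_at \<sigma> X)"
        by (rule path_transformation_of_adjoint_equivalence[OF \<sigma>])
      have "trimodification A B F G q p (radj \<sigma>)" using \<sigma> by (simp add: trimod_adjoint_equivalence_iff)
      then show "adj_to_path A B F G p q \<sigma> \<in> ?T"
        using s.pseudonatural3_iff[OF p q] s.post_whisker_path_ends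
        unfolding path_transformation_of_adjoint_equivalence(2)[OF \<sigma>]
        by (simp add: path_pseudonaturals_def)
    qed
    show "?T \<subseteq> adj_to_path A B F G p q ` ?S"
    proof
      fix \<theta> assume \<theta>: "\<theta> \<in> ?T"
      obtain s E where "path_transformation A B F G p q s E" and t: "path_transformation.\<theta> A B F G p q s E = \<theta>"
        using path_pseudonaturals_surj[OF p q \<theta>] .
      then interpret t: path_transformation A B F G p q s E by simp
      have "trimodification A B F G q p s"
        using \<theta> t.pseudonatural3_iff[OF p q] t by (simp add: path_pseudonaturals_def)
      then obtain \<sigma> where \<sigma>: "trimod_adjoint_equivalence A B F G p q \<sigma>" "radj \<sigma> = s"
        "\<And>X. X \<in> pt A \<Longrightarrow> trimod_at \<sigma> X = F.B.adj_opp (E X)"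
        using trimod_adjoint_equivalence_exists[OF _ t.E_equivalence t.ladj_E] by blast
      interpret u: path_transformation A B F G p q s "\<lambda>X. F.B.adj_opp (trimod_at \<sigma> X)"
        using path_transformation_of_adjoint_equivalence(1)[OF \<sigma>(1)] \<sigma>(2) by simp
      \<comment> \<open>The reversal used in constructing \<sigma> is undone by the one in
        \<open>adj_to_path\<close>, so the original \<open>E\<close> reappears.\<close>
      have "u.\<theta>0 X = t.\<theta>0 X" if "X \<in> pt A" for X
        using F.B.adj_opp_opp[OF t.E_equivalence[OF that]] that
        by (simp add: u.\<theta>0_def t.\<theta>0_def \<sigma>(3))
      then have "u.\<theta> = t.\<theta>"
        by (auto simp: u.\<theta>_def t.\<theta>_def u.\<theta>1_def t.\<theta>1_def fun_eq_iff)
      then have "adj_to_path A B F G p q \<sigma> = \<theta>"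
        using path_transformation_of_adjoint_equivalence(2)[OF \<sigma>(1)] \<sigma>(2) t by simp
      then show "\<theta> \<in> adj_to_path A B F G p q ` ?S" using \<sigma>(1) by blast
    qed
  qed
qed

end

theorem proposition4p2p3:
  fixes A :: "('a, 'b, 'c, 'o) gray" and B :: "('d, 'e, 'g, 'p) gray"
    and F G :: "('o, 'a, 'b, 'c, 'p, 'd, 'e, 'g) gmap"
  assumes "gray_category A" and "gray_category B"
    and "gray_functor A B F" and "gray_functor A B G"
  shows "bij_betw (trinat_to_path A B F G)
           {p. trinatural A B F G p}
           (path_pseudofunctors A B F G)
       \<and> bij_betw (trinat_to_path A B F G)
           {p. trinatural A B F G p \<and> semi_strict A B F G p}
           {H \<in> path_pseudofunctors A B F G.
              \<exists>P. gray_functor A (path B) P \<and> H = strict_pmap A (path B) P}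
       \<and> (\<forall>p q. trinatural A B F G p \<longrightarrow> trinatural A B F G q \<longrightarrow>
           bij_betw (adj_to_path A B F G p q)
             {\<sigma>. trimod_adjoint_equivalence A B F G p q \<sigma>}
             (path_pseudonaturals A B F G
                (trinat_to_path A B F G p) (trinat_to_path A B F G q)))"
proof -
  interpret gray_functors A B F G
    using assms by (intro gray_functors.intro gray_functor_between.intro)
  show ?thesis
    using trinat_to_path_bij trinat_to_path_semi_strict_bij adj_to_path_bij by blast
qed

end
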